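(* Let $X_{\Sigma_A}$ be a smooth projective toric weak Fano variety with Landau–Ginzburg model $(W,q):S_1\to\mathbb C_t\times S_2$, and consider its restriction $(W,q):S_1^0\to\mathbb C_t\times S_2^0$ to the non-degenerate locus. Then there is an isomorphism of $\mathcal D_{\mathbb C_\tau\times S_2^0}$-modules $$\mathcal D_{\mathbb C_\tau\times S_2^0}[\tau^{-1}]/\widetilde{\mathcal I}\ \cong\ \overline{\mathrm{FL}}{}_t^{\tau}\big(\mathcal H^0((W,q)_+\mathcal O_{S_1^0})\big)[\tau^{-1}],$$ where $\widetilde{\mathcal I}$ is the left ideal generated, with $z=\tau^{-1}$, by the operators $$\widetilde\Box_{\underline l}=\prod_{a:p_a(\underline l)>0}q_a^{p_a(\underline l)}\prod_{i:l_i<0}\prod_{\nu=0}^{-l_i-1}\Big(\sum_{a=1}^r m_{ia}zq_a\partial_{q_a}-\nu z\Big)-\prod_{a:p_a(\underline l)<0}q_a^{-p_a(\underline l)}\prod_{i:l_i>0}\prod_{\nu=0}^{l_i-1}\Big(\sum_{a=1}^r m_{ia}zq_a\partial_{q_a}-\nu z\Big)$$ for all $\underline l\in\mathbb L$, and by $z\partial_z+\sum_{a=1}^r\rho(p_a^\vee)q_a\partial_{q_a}$.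
   Context: $\Sigma_A$ is a fan in $N\otimes\mathbb R$, $N\cong\mathbb Z^n$, defining $X_{\Sigma_A}$ (weak Fano: anticanonical divisor nef), with primitive ray generators $\underline a_1,\dots,\underline a_m$. $\mathbb L=\{\underline l\in\mathbb Z^m:\sum l_i\underline a_i=0\}$ has rank $r=m-n$; $\mathbb L^\vee\cong\mathrm{Pic}(X_{\Sigma_A})$; $[D_i]\in\mathbb L^\vee$ is the class of the torus invariant divisor of $\underline a_i$, and $\rho=\sum_i[D_i]$ the anticanonical class. Fix a basis $p_1,\dots,p_r$ of $\mathbb L^\vee$ consisting of nef classes such that $\rho$ lies in the cone generated by $p_1,\dots,p_r$; let $p_a^\vee$ be the dual basis of $\mathbb L$ and $m_{ia}$ the $i$-th coordinate of $p_a^\vee\in\mathbb Z^m$. $S_1=(\mathbb C^* )^m$ with coordinates $w_1,\dots,w_m$, $S_2=\mathrm{Spec}\,\mathbb C[\mathbb L]\cong(\mathbb C^* )^r$ with coordinates $q_1,\dots,q_r$ defined by the basis $p_a$. The Landau–Ginzburg model is $(W,q)$ with $W=w_1+\dots+w_m$ and $q(\underline w)=(\prod_iw_i^{m_{ia}})_{a=1,\dots,r}$. $S_1^0\subset S_1$ is the Zariski open set of $\underline\lambda$ for which $\sum_i\lambda_i\underline y^{\underline a_i}$ on $(\mathbb C^* )^n$ is non-degenerate, i.e. for every proper face $\sigma$ of $\mathrm{Conv}(\underline0,\underline a_1,\dots,\underline a_m)$ not containing $\underline 0$ the polynomial $\sum_{\underline a_i\in\sigma}\lambda_i\underline y^{\underline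 a_i}$ has no critical points in $(\mathbb C^* )^n$. Choose integers $g_{ia}\ge0$ with $\sum_ig_{ia}m_{ib}=\delta_{ab}$ such that $(g_{ia})_i\in\mathbb Z^m$ maps to $p_a$ under $\mathbb Z^m\to\mathbb L^\vee$, giving a section $g:S_2\to S_1$, $g(\underline q)_i=\prod_aq_a^{g_{ia}}$ of $q$; then $S_2^0=g^{-1}(S_1^0)$ (and $S_1^0=q^{-1}(S_2^0)$). Fourier–Laplace: $\overline{\mathrm{FL}}{}_t^{\tau}\mathcal M$ is $\mathcal M$ with $\tau$ acting as $-\partial_t$ and $\partial_\tau$ acting as $t$; $[\tau^{-1}]$ is localization along $\tau=0$. All $\mathcal D$-modules are algebraic; $\mathcal H^0(f_+)$ is the zeroth cohomology of the $\mathcal D$-module direct image. *)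

theory Defs
  imports
    "HOL-Analysis.Analysis"
    "HOL-Algebra.Free_Abelian_Groups"
    "HOL-Algebra.Ideal"
    "HOL-Algebra.Module"
begin

section \<open>Fans and toric data\<close>

definition lat :: "int ^ 'n \<Rightarrow> real ^ 'n" where
  "lat v = (\<chi> k. real_of_int (v $ k))"

definition fan :: "(real ^ 'n) set set \<Rightarrow> bool" where
  "fan \<Sigma> \<longleftrightarrow> finite \<Sigma> \<and> \<Sigma> \<noteq> {} \<and>
     (\<forall>\<sigma>\<in>\<Sigma>. (\<exists>F. finite F \<and> \<sigma> = convex_cone hull (lat ` F)) \<and> (\<forall>x. x \<in> \<sigma> \<and> - x \<in> \<sigma> \<longrightarrow> x = 0)) \<and>
     (\<forall>\<sigma>\<in>\<Sigma>. \<forall>\<tau>. \<tau> face_of \<sigma> \<and> \<tau> \<noteq> {} \<longrightarrow> \<tau> \<in> \<Sigma>) \<and>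
     (\<forall>\<sigma>\<in>\<Sigma>. \<forall>\<tau>\<in>\<Sigma>. (\<sigma> \<inter> \<tau>) face_of \<sigma> \<and> (\<sigma> \<inter> \<tau>) face_of \<tau>)"

definition lattice_basis :: "('n \<Rightarrow> int ^ 'n) \<Rightarrow> bool" where
  "lattice_basis b \<longleftrightarrow> (\<forall>v. \<exists>!c :: 'n \<Rightarrow> int. v = (\<Sum>j\<in>UNIV. c j *s b j))"

definition smooth_fan :: "(real ^ 'n) set set \<Rightarrow> bool" where
  "smooth_fan \<Sigma> \<longleftrightarrow>
     (\<forall>\<sigma>\<in>\<Sigma>. \<exists>b I. lattice_basis (b :: 'n \<Rightarrow> int ^ 'n) \<and> \<sigma> = convex_cone hull (lat ` b ` I))"

definition complete_fan :: "(real ^ 'n) set set \<Rightarrow> bool" where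
  "complete_fan \<Sigma> \<longleftrightarrow> \<Union>\<Sigma> = UNIV"

definition primitive_vector :: "int ^ 'n \<Rightarrow> bool" where
  "primitive_vector v \<longleftrightarrow> Gcd (range (\<lambda>k. v $ k)) = 1"

definition ray_generators :: "(real ^ 'n) set set \<Rightarrow> ('m::finite \<Rightarrow> int ^ 'n) \<Rightarrow> bool" where
  "ray_generators \<Sigma> A \<longleftrightarrow>
     inj A \<and> range A = {v. primitive_vector v \<and> convex_cone hull {lat v} \<in> \<Sigma>}"

text \<open>A vector \<^term>\<open>c\<close> stands for the torus invariant divisor \<open>\<Sum>i. c $ i D\<^sub>i\<close>. Its support function
  is normalised by \<open>\<phi>(a\<^sub>i) = c\<^sub>i\<close> (the opposite sign is also common), so that nef means convex and
  ample means strictly convex, in the usual sense of convexity.\<close>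

definition support_function ::
    "(real ^ 'n) set set \<Rightarrow> ('m::finite \<Rightarrow> int ^ 'n) \<Rightarrow> int ^ 'm \<Rightarrow> (real ^ 'n \<Rightarrow> real) \<Rightarrow> bool" where
  "support_function \<Sigma> A c \<phi> \<longleftrightarrow>
     (\<forall>\<sigma>\<in>\<Sigma>. \<exists>u. \<forall>x\<in>\<sigma>. \<phi> x = u \<bullet> x) \<and> (\<forall>i. \<phi> (lat (A i)) = real_of_int (c $ i))"

definition nef_divisor :: "(real ^ 'n) set set \<Rightarrow> ('m::finite \<Rightarrow> int ^ 'n) \<Rightarrow> int ^ 'm \<Rightarrow> bool" where
  "nef_divisor \<Sigma> A c \<longleftrightarrow> (\<exists>\<phi>. support_function \<Sigma> A c \<phi> \<and> convex_on UNIV \<phi>)"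

definition ample_divisor :: "(real ^ 'n) set set \<Rightarrow> ('m::finite \<Rightarrow> int ^ 'n) \<Rightarrow> int ^ 'm \<Rightarrow> bool" where
  "ample_divisor \<Sigma> A c \<longleftrightarrow> (\<exists>\<phi>. support_function \<Sigma> A c \<phi> \<and> convex_on UNIV \<phi> \<and>
     (\<forall>\<sigma>\<in>\<Sigma>. interior \<sigma> \<noteq> {} \<longrightarrow> (\<exists>u. \<forall>x. \<phi> x = u \<bullet> x \<longleftrightarrow> x \<in> \<sigma>)))"

text \<open>The fan defines a smooth projective toric variety, with the \<open>A i\<close> as its ray generators.\<close>

definition smooth_projective_toric :: "(real ^ 'n) set set \<Rightarrow> ('m::finite \<Rightarrow> int ^ 'n) \<Rightarrow> bool" where
  "smooth_projective_toric \<Sigma> A \<longleftrightarrow>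
     fan \<Sigma> \<and> smooth_fan \<Sigma> \<and> complete_fan \<Sigma> \<and> ray_generators \<Sigma> A \<and> (\<exists>c. ample_divisor \<Sigma> A c)"

definition weak_Fano :: "(real ^ 'n) set set \<Rightarrow> ('m::finite \<Rightarrow> int ^ 'n) \<Rightarrow> bool" where
  "weak_Fano \<Sigma> A \<longleftrightarrow> nef_divisor \<Sigma> A (\<chi> i. 1)"

definition relation_lattice :: "('m::finite \<Rightarrow> int ^ 'n) \<Rightarrow> (int ^ 'm) set" where
  "relation_lattice A = {l. (\<Sum>i\<in>UNIV. l $ i *s A i) = 0}"

text \<open>The dual lattice \<open>Hom(\<L>, \<int>)\<close>, identified with the Picard group.\<close>

definition dual_relation_lattice :: "('m::finite \<Rightarrow> int ^ 'n) \<Rightarrow> (int ^ 'm \<Rightarrow> int) set" where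
  "dual_relation_lattice A = {h \<in> extensional (relation_lattice A).
     \<forall>l\<in>relation_lattice A. \<forall>l'\<in>relation_lattice A. h (l + l') = h l + h l'}"

definition divisor_class :: "('m::finite \<Rightarrow> int ^ 'n) \<Rightarrow> int ^ 'm \<Rightarrow> (int ^ 'm \<Rightarrow> int)" where
  "divisor_class A c = restrict (\<lambda>l. \<Sum>i\<in>UNIV. c $ i * l $ i) (relation_lattice A)"

definition anticanonical_class :: "('m::finite \<Rightarrow> int ^ 'n) \<Rightarrow> (int ^ 'm \<Rightarrow> int)" where
  "anticanonical_class A =
     restrict (\<lambda>l. \<Sum>i\<in>UNIV. divisor_class A (axis i 1) l) (relation_lattice A)"

definition nef_class ::
    "(real ^ 'n) set set \<Rightarrow> ('m::finite \<Rightarrow> int ^ 'n) \<Rightarrow> (int ^ 'm \<Rightarrow> int) \<Rightarrow> bool" where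
  "nef_class \<Sigma> A h \<longleftrightarrow> (\<exists>c. nef_divisor \<Sigma> A c \<and> divisor_class A c = h)"

definition dual_lattice_basis ::
    "('m::finite \<Rightarrow> int ^ 'n) \<Rightarrow> ('r::finite \<Rightarrow> int ^ 'm \<Rightarrow> int) \<Rightarrow> bool" where
  "dual_lattice_basis A p \<longleftrightarrow> (\<forall>k. p k \<in> dual_relation_lattice A) \<and>
     (\<forall>h\<in>dual_relation_lattice A. \<exists>!c :: 'r \<Rightarrow> int.
        \<forall>l\<in>relation_lattice A. h l = (\<Sum>k\<in>UNIV. c k * p k l))"

definition dual_basis_of ::
    "('m::finite \<Rightarrow> int ^ 'n) \<Rightarrow> ('r \<Rightarrow> int ^ 'm \<Rightarrow> int) \<Rightarrow> ('r \<Rightarrow> int ^ 'm) \<Rightarrow> bool" where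
  "dual_basis_of A p d \<longleftrightarrow> (\<forall>k. d k \<in> relation_lattice A) \<and>
     (\<forall>j k. p j (d k) = (if j = k then 1 else 0))"

definition in_generated_cone ::
    "('m::finite \<Rightarrow> int ^ 'n) \<Rightarrow> ('r::finite \<Rightarrow> int ^ 'm \<Rightarrow> int) \<Rightarrow> (int ^ 'm \<Rightarrow> int) \<Rightarrow> bool" where
  "in_generated_cone A p h \<longleftrightarrow> (\<exists>c :: 'r \<Rightarrow> real. (\<forall>k. c k \<ge> 0) \<and>
     (\<forall>l\<in>relation_lattice A. real_of_int (h l) = (\<Sum>k\<in>UNIV. c k * real_of_int (p k l))))"


section \<open>Differential operators on open subvarieties of affine space\<close>

text \<open>Throughout, \<open>X\<close> is a Zariski open subset of affine space; functions on it are extended by zero.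
  All varieties to which the definitions are applied below are complements of hypersurfaces, hence
  affine, so (quasi-coherent) modules over the sheaf of differential operators are the same as modules
  over its ring of global sections.\<close>

inductive_set polynomial_fun :: "(complex ^ 'k \<Rightarrow> complex) set" where
  const: "(\<lambda>_. c) \<in> polynomial_fun"
| coord: "(\<lambda>x. x $ i) \<in> polynomial_fun"
| add: "f \<in> polynomial_fun \<Longrightarrow> g \<in> polynomial_fun \<Longrightarrow> (\<lambda>x. f x + g x) \<in> polynomial_fun"
| mult: "f \<in> polynomial_fun \<Longrightarrow> g \<in> polynomial_fun \<Longrightarrow> (\<lambda>x. f x * g x) \<in> polynomial_fun"

definition zero_outside :: "'x set \<Rightarrow> ('x \<Rightarrow> complex) \<Rightarrow> 'x \<Rightarrow> complex" where
  "zero_outside X f = (\<lambda>x. if x \<in> X then f x else 0)"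

definition regular_fun :: "(complex ^ 'k) set \<Rightarrow> (complex ^ 'k \<Rightarrow> complex) set" where
  "regular_fun X = {f. (\<forall>x. x \<notin> X \<longrightarrow> f x = 0) \<and>
     (\<forall>x\<in>X. \<exists>P\<in>polynomial_fun. \<exists>Q\<in>polynomial_fun. Q x \<noteq> 0 \<and>
        (\<forall>y\<in>X. Q y \<noteq> 0 \<longrightarrow> f y = P y / Q y))}"

type_synonym ('k, 'l) operator = "(complex ^ 'k \<Rightarrow> complex) \<Rightarrow> complex ^ 'l \<Rightarrow> complex"

text \<open>Operators are likewise set to zero off \<^const>\<open>regular_fun\<close>. Only the restriction of \<open>f\<close> to
  \<open>X\<close> matters in \<open>mult_op X f\<close>.\<close>

definition mult_op :: "(complex ^ 'k) set \<Rightarrow> (complex ^ 'k \<Rightarrow> complex) \<Rightarrow> ('k, 'k) operator" where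
  "mult_op X f = (\<lambda>h. if h \<in> regular_fun X then (\<lambda>x. f x * h x) else (\<lambda>_. 0))"

definition partial_op :: "(complex ^ 'k) set \<Rightarrow> 'k \<Rightarrow> ('k, 'k) operator" where
  "partial_op X i = (\<lambda>h. if h \<in> regular_fun X
     then zero_outside X (\<lambda>x. deriv (\<lambda>s. h (\<chi> j. if j = i then s else x $ j)) (x $ i))
     else (\<lambda>_. 0))"

inductive_set diff_op :: "(complex ^ 'k) set \<Rightarrow> ('k, 'k) operator set" for X where
  mult: "f \<in> regular_fun X \<Longrightarrow> mult_op X f \<in> diff_op X"
| partial: "partial_op X i \<in> diff_op X"
| add: "P \<in> diff_op X \<Longrightarrow> Q \<in> diff_op X \<Longrightarrow> (\<lambda>h x. P h x + Q h x) \<in> diff_op X"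
| comp: "P \<in> diff_op X \<Longrightarrow> Q \<in> diff_op X \<Longrightarrow> P \<circ> Q \<in> diff_op X"

definition D_ring :: "(complex ^ 'k) set \<Rightarrow> ('k, 'k) operator ring" where
  "D_ring X = \<lparr>carrier = diff_op X, mult = (\<circ>), one = mult_op X (\<lambda>_. 1),
     zero = (\<lambda>_ _. 0), add = (\<lambda>P Q h x. P h x + Q h x)\<rparr>"

text \<open>Formal adjoint: the anti-automorphism that fixes functions and changes the sign of the
  coordinate vector fields. It is the passage between left and right modules given by the volume form
  \<open>dx\<^sub>1 \<and> \<dots> \<and> dx\<^sub>k\<close>, which trivialises the canonical bundle.\<close>

definition adjoint_op :: "(complex ^ 'k) set \<Rightarrow> ('k, 'k) operator \<Rightarrow> ('k, 'k) operator" where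
  "adjoint_op X = (THE t. t \<in> extensional (diff_op X) \<and> t \<in> diff_op X \<rightarrow> diff_op X \<and>
     (\<forall>P\<in>diff_op X. \<forall>Q\<in>diff_op X.
        t (P \<oplus>\<^bsub>D_ring X\<^esub> Q) = t P \<oplus>\<^bsub>D_ring X\<^esub> t Q \<and>
        t (P \<otimes>\<^bsub>D_ring X\<^esub> Q) = t Q \<otimes>\<^bsub>D_ring X\<^esub> t P) \<and>
     (\<forall>f\<in>regular_fun X. t (mult_op X f) = mult_op X f) \<and>
     (\<forall>i. t (partial_op X i) = \<ominus>\<^bsub>D_ring X\<^esub> partial_op X i))"

text \<open>Restriction of differential operators to an open dense \<open>U \<subseteq> X\<close>.\<close>

definition restrict_op ::
    "(complex ^ 'k) set \<Rightarrow> (complex ^ 'k) set \<Rightarrow> ('k, 'k) operator \<Rightarrow> ('k, 'k) operator" where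
  "restrict_op X U P = (THE Q. Q \<in> diff_op U \<and>
     (\<forall>h\<in>regular_fun X. Q (zero_outside U h) = zero_outside U (P h)))"


section \<open>Left modules over noncommutative rings\<close>

text \<open>The record \<^typ>\<open>('r, 'a) module\<close> is reused; its ring multiplication and unit play no role.\<close>

definition left_module :: "('r, 'x) ring_scheme \<Rightarrow> ('r, 'a, 'y) module_scheme \<Rightarrow> bool" where
  "left_module R M \<longleftrightarrow> ring R \<and> abelian_group M \<and>
     (\<forall>r\<in>carrier R. \<forall>x\<in>carrier M. r \<odot>\<^bsub>M\<^esub> x \<in> carrier M) \<and>
     (\<forall>r\<in>carrier R. \<forall>s\<in>carrier R. \<forall>x\<in>carrier M.
        (r \<oplus>\<^bsub>R\<^esub> s) \<odot>\<^bsub>M\<^esub> x = r \<odot>\<^bsub>M\<^esub> x \<oplus>\<^bsub>M\<^esub> s \<odot>\<^bsub>M\<^esub> x \<and>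
        (r \<otimes>\<^bsub>R\<^esub> s) \<odot>\<^bsub>M\<^esub> x = r \<odot>\<^bsub>M\<^esub> (s \<odot>\<^bsub>M\<^esub> x)) \<and>
     (\<forall>r\<in>carrier R. \<forall>x\<in>carrier M. \<forall>y\<in>carrier M.
        r \<odot>\<^bsub>M\<^esub> (x \<oplus>\<^bsub>M\<^esub> y) = r \<odot>\<^bsub>M\<^esub> x \<oplus>\<^bsub>M\<^esub> r \<odot>\<^bsub>M\<^esub> y) \<and>
     (\<forall>x\<in>carrier M. \<one>\<^bsub>R\<^esub> \<odot>\<^bsub>M\<^esub> x = x)"

definition left_modules_isomorphic ::
    "('r, 'x) ring_scheme \<Rightarrow> ('r, 'a, 'y) module_scheme \<Rightarrow> ('r, 'b, 'z) module_scheme \<Rightarrow> bool" where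
  "left_modules_isomorphic R M N \<longleftrightarrow> left_module R M \<and> left_module R N \<and>
     (\<exists>\<phi>. bij_betw \<phi> (carrier M) (carrier N) \<and>
        (\<forall>x\<in>carrier M. \<forall>y\<in>carrier M. \<phi> (x \<oplus>\<^bsub>M\<^esub> y) = \<phi> x \<oplus>\<^bsub>N\<^esub> \<phi> y) \<and>
        (\<forall>r\<in>carrier R. \<forall>x\<in>carrier M. \<phi> (r \<odot>\<^bsub>M\<^esub> x) = r \<odot>\<^bsub>N\<^esub> \<phi> x))"

definition restrict_scalars :: "('s \<Rightarrow> 'r) \<Rightarrow> ('r, 'a, 'y) module_scheme \<Rightarrow> ('s, 'a) module" where
  "restrict_scalars h M = \<lparr>carrier = carrier M, mult = mult M, one = one M, zero = zero M,
     add = add M, smult = (\<lambda>s. smult M (h s))\<rparr>"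

definition left_ideal :: "('r, 'x) ring_scheme \<Rightarrow> 'r set \<Rightarrow> bool" where
  "left_ideal R I \<longleftrightarrow> additive_subgroup I R \<and> (\<forall>r\<in>carrier R. \<forall>x\<in>I. r \<otimes>\<^bsub>R\<^esub> x \<in> I)"

definition generated_left_ideal :: "('r, 'x) ring_scheme \<Rightarrow> 'r set \<Rightarrow> 'r set" where
  "generated_left_ideal R G = \<Inter>{I. left_ideal R I \<and> G \<subseteq> I}"

definition quotient_by_left_ideal :: "('r, 'x) ring_scheme \<Rightarrow> 'r set \<Rightarrow> ('r, 'r set) module" where
  "quotient_by_left_ideal R I = \<lparr>carrier = a_rcosets\<^bsub>R\<^esub> I, mult = undefined, one = undefined,
     zero = I, add = (<+>\<^bsub>R\<^esub>), smult = (\<lambda>r C. \<Union>x\<in>C. I +>\<^bsub>R\<^esub> (r \<otimes>\<^bsub>R\<^esub> x))\<rparr>"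

text \<open>Tensor product over \<open>R\<close> of a bimodule and a left module: \<open>M\<close> carries a left module structure
  over some further ring as part of the record and the right action \<open>\<rho>\<close> of \<open>R\<close>. It is the free
  abelian group on pairs modulo the usual relations.\<close>

definition tensor_relations ::
    "('r, 'x) ring_scheme \<Rightarrow> ('s, 'a) module \<Rightarrow> ('a \<Rightarrow> 'r \<Rightarrow> 'a) \<Rightarrow> ('r, 'b) module
      \<Rightarrow> ('a \<times> 'b \<Rightarrow>\<^sub>0 int) set" where
  "tensor_relations R M \<rho> N =
     {frag_of (x \<oplus>\<^bsub>M\<^esub> x', y) - frag_of (x, y) - frag_of (x', y) | x x' y.
        x \<in> carrier M \<and> x' \<in> carrier M \<and> y \<in> carrier N} \<union>
     {frag_of (x, y \<oplus>\<^bsub>N\<^esub> y') - frag_of (x, y) - frag_of (x, y') | x y y'.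
        x \<in> carrier M \<and> y \<in> carrier N \<and> y' \<in> carrier N} \<union>
     {frag_of (\<rho> x r, y) - frag_of (x, r \<odot>\<^bsub>N\<^esub> y) | x r y.
        x \<in> carrier M \<and> r \<in> carrier R \<and> y \<in> carrier N}"

definition tensor_product ::
    "('r, 'x) ring_scheme \<Rightarrow> ('s, 'a) module \<Rightarrow> ('a \<Rightarrow> 'r \<Rightarrow> 'a) \<Rightarrow> ('r, 'b) module
      \<Rightarrow> ('s, ('a \<times> 'b \<Rightarrow>\<^sub>0 int) set) module" where
  "tensor_product R M \<rho> N =
     (let F = free_Abelian_group (carrier M \<times> carrier N);
          H = generate F (tensor_relations R M \<rho> N)
      in \<lparr>carrier = carrier (F Mod H), mult = undefined, one = undefined,
          zero = \<one>\<^bsub>F Mod H\<^esub>, add = (\<otimes>\<^bsub>F Mod H\<^esub>),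
          smult = (\<lambda>s C. \<Union>u\<in>C. H #>\<^bsub>F\<^esub> frag_extend (\<lambda>(x, y). frag_of (s \<odot>\<^bsub>M\<^esub> x, y)) u)\<rparr>)"


section \<open>Direct images, localisation and Fourier--Laplace transformation\<close>

definition structure_module :: "(complex ^ 'k) set \<Rightarrow> (('k, 'k) operator, complex ^ 'k \<Rightarrow> complex) module" where
  "structure_module X = \<lparr>carrier = regular_fun X, mult = undefined, one = undefined,
     zero = (\<lambda>_. 0), add = (\<lambda>f g x. f x + g x), smult = (\<lambda>P. P)\<rparr>"

text \<open>The transfer bimodule \<open>D\<^bsub>X\<rightarrow>Y\<^esub> = \<O>\<^sub>X \<otimes> f\<^sup>* D\<^sub>Y\<close>, realised as differential operators
  from \<open>\<O>\<^sub>Y\<close> to \<open>\<O>\<^sub>X\<close> along \<open>f\<close> via \<open>\<phi> \<otimes> Q \<mapsto> (h \<mapsto> \<phi> \<cdot> (Q h \<circ> f))\<close>. This map is injective: the source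
  is free over \<open>\<O>\<^sub>X\<close> on the monomials \<open>\<partial>\<^sup>\<beta>\<close>, and the coefficients at a point are recovered by
  applying the operator to the polynomials \<open>(y - f x)\<^sup>\<beta>\<close>. The left action of \<open>D\<^sub>X\<close> is composition on
  the left, the right action of \<open>D\<^sub>Y\<close> is composition on the right.\<close>

inductive_set transfer_op ::
    "(complex ^ 'k) set \<Rightarrow> (complex ^ 'l) set \<Rightarrow> (complex ^ 'k \<Rightarrow> complex ^ 'l) \<Rightarrow> ('l, 'k) operator set"
  for X Y f where
  tensor: "\<phi> \<in> regular_fun X \<Longrightarrow> Q \<in> diff_op Y \<Longrightarrow> (\<lambda>h x. \<phi> x * Q h (f x)) \<in> transfer_op X Y f"
| add: "S \<in> transfer_op X Y f \<Longrightarrow> T \<in> transfer_op X Y f \<Longrightarrow> (\<lambda>h x. S h x + T h x) \<in> transfer_op X Y f"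

text \<open>\<open>D\<^bsub>Y\<leftarrow>X\<^esub> = \<omega>\<^sub>X \<otimes> D\<^bsub>X\<rightarrow>Y\<^esub> \<otimes> f\<^sup>* \<omega>\<^sub>Y\<^sup>-\<^sup>1\<close>, with both canonical bundles trivialised by the
  coordinate volume forms, is the same group with the two actions exchanged by the formal adjoint.\<close>

definition transfer_module ::
    "(complex ^ 'k) set \<Rightarrow> (complex ^ 'l) set \<Rightarrow> (complex ^ 'k \<Rightarrow> complex ^ 'l)
      \<Rightarrow> (('l, 'l) operator, ('l, 'k) operator) module" where
  "transfer_module X Y f = \<lparr>carrier = transfer_op X Y f, mult = undefined, one = undefined,
     zero = (\<lambda>_ _. 0), add = (\<lambda>S T h x. S h x + T h x), smult = (\<lambda>Q T. T \<circ> adjoint_op Y Q)\<rparr>"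

text \<open>For a morphism of affine varieties, global sections are exact, so the zeroth cohomology of
  \<open>f\<^sub>+ M = R f\<^sub>* (D\<^bsub>Y\<leftarrow>X\<^esub> \<otimes>\<^sup>L M)\<close> is the underived tensor product of the modules of global sections.\<close>

definition direct_image_H0 ::
    "(complex ^ 'k) set \<Rightarrow> (complex ^ 'l) set \<Rightarrow> (complex ^ 'k \<Rightarrow> complex ^ 'l)
      \<Rightarrow> (('k, 'k) operator, 'b) module
      \<Rightarrow> (('l, 'l) operator, (('l, 'k) operator \<times> 'b \<Rightarrow>\<^sub>0 int) set) module" where
  "direct_image_H0 X Y f M =
     tensor_product (D_ring X) (transfer_module X Y f) (\<lambda>T P. adjoint_op X P \<circ> T) M"

text \<open>Extension of scalars from \<open>D\<^sub>X\<close> to \<open>D\<^sub>U\<close>. If \<open>U\<close> is the complement of \<open>g = 0\<close> in the affine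
  variety \<open>X\<close>, then \<open>D\<^sub>U = D\<^sub>X[g\<^sup>-\<^sup>1]\<close> and this is the localisation \<open>M[g\<^sup>-\<^sup>1]\<close>.\<close>

definition localization ::
    "(complex ^ 'k) set \<Rightarrow> (complex ^ 'k) set \<Rightarrow> (('k, 'k) operator, 'b) module
      \<Rightarrow> (('k, 'k) operator, (('k, 'k) operator \<times> 'b \<Rightarrow>\<^sub>0 int) set) module" where
  "localization X U M =
     tensor_product (D_ring X)
       \<lparr>carrier = diff_op U, mult = undefined, one = undefined, zero = \<zero>\<^bsub>D_ring U\<^esub>,
        add = (\<oplus>\<^bsub>D_ring U\<^esub>), smult = (\<otimes>\<^bsub>D_ring U\<^esub>)\<rparr>
       (\<lambda>Q P. Q \<otimes>\<^bsub>D_ring U\<^esub> restrict_op X U P) M"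

text \<open>Points of \<open>\<complex> \<times> S\<close> have coordinate \<^const>\<open>None\<close> for the line (which is \<open>t\<close> or \<open>\<tau>\<close>, depending on
  the side of the Fourier--Laplace transformation) and \<open>Some k\<close> for the coordinate \<open>k\<close> on \<open>S\<close>.\<close>

definition line_times :: "(complex ^ 'r) set \<Rightarrow> (complex ^ 'r option) set" where
  "line_times S = {y. (\<chi> k. y $ Some k) \<in> S}"

definition punctured_line_times :: "(complex ^ 'r) set \<Rightarrow> (complex ^ 'r option) set" where
  "punctured_line_times S = {y \<in> line_times S. y $ None \<noteq> 0}"

definition FL_hom :: "(complex ^ 'r) set \<Rightarrow> ('r option, 'r option) operator \<Rightarrow> ('r option, 'r option) operator" where
  "FL_hom S = (let Y = line_times S; D = D_ring Y in
     THE \<Phi>. \<Phi> \<in> extensional (diff_op Y) \<and> \<Phi> \<in> ring_hom D D \<and>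
       \<Phi> (mult_op Y (\<lambda>y. y $ None)) = \<ominus>\<^bsub>D\<^esub> partial_op Y None \<and>
       \<Phi> (partial_op Y None) = mult_op Y (\<lambda>y. y $ None) \<and>
       (\<forall>h\<in>regular_fun S. \<Phi> (mult_op Y (\<lambda>y. h (\<chi> k. y $ Some k))) = mult_op Y (\<lambda>y. h (\<chi> k. y $ Some k))) \<and>
       (\<forall>k. \<Phi> (partial_op Y (Some k)) = partial_op Y (Some k)))"

definition fourier_laplace ::
    "(complex ^ 'r) set \<Rightarrow> (('r option, 'r option) operator, 'b) module
      \<Rightarrow> (('r option, 'r option) operator, 'b) module" where
  "fourier_laplace S M = restrict_scalars (FL_hom S) M"


section \<open>The Landau--Ginzburg model and the quantum differential operators\<close>

definition nondegenerate :: "('m::finite \<Rightarrow> int ^ 'n) \<Rightarrow> complex ^ 'm \<Rightarrow> bool" where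
  "nondegenerate A w \<longleftrightarrow>
     (let P = convex hull (insert 0 (range (\<lambda>i. lat (A i)))) in
      \<forall>\<sigma>. \<sigma> face_of P \<and> \<sigma> \<noteq> P \<and> \<sigma> \<noteq> {} \<and> 0 \<notin> \<sigma> \<longrightarrow>
        \<not> (\<exists>y. (\<forall>k. y $ k \<noteq> 0) \<and>
             ((\<lambda>y. \<Sum>i | lat (A i) \<in> \<sigma>. w $ i * (\<Prod>k\<in>UNIV. (y $ k) powi (A i $ k)))
                has_derivative (\<lambda>_. 0)) (at (y :: complex ^ 'n))))"

definition S1_nondeg :: "('m::finite \<Rightarrow> int ^ 'n) \<Rightarrow> (complex ^ 'm) set" where
  "S1_nondeg A = {w. (\<forall>i. w $ i \<noteq> 0) \<and> nondegenerate A w}"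

definition LG_section :: "('r::finite \<Rightarrow> int ^ 'm) \<Rightarrow> complex ^ 'r \<Rightarrow> complex ^ 'm" where
  "LG_section g q = (\<chi> i. \<Prod>k\<in>UNIV. (q $ k) powi (g k $ i))"

definition S2_nondeg :: "('m::finite \<Rightarrow> int ^ 'n) \<Rightarrow> ('r::finite \<Rightarrow> int ^ 'm) \<Rightarrow> (complex ^ 'r) set" where
  "S2_nondeg A g = {q. (\<forall>k. q $ k \<noteq> 0) \<and> LG_section g q \<in> S1_nondeg A}"

definition LG_map :: "('r::finite \<Rightarrow> int ^ 'm::finite) \<Rightarrow> complex ^ 'm \<Rightarrow> complex ^ 'r option" where
  "LG_map d w = (\<chi> j. case j of None \<Rightarrow> \<Sum>i\<in>UNIV. w $ i | Some k \<Rightarrow> \<Prod>i\<in>UNIV. (w $ i) powi (d k $ i))"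

text \<open>Operators on \<open>\<complex>\<^sup>*\<^sub>\<tau> \<times> S\<close>, with \<open>z = \<tau>\<^sup>-\<^sup>1\<close>; note \<open>z\<partial>\<^sub>z = - \<tau>\<partial>\<^sub>\<tau>\<close>. The factors of the products in
  \<open>box_half\<close> commute.\<close>

context
  fixes S :: "(complex ^ 'r::finite) set"
begin

definition Dtau :: "('r option, 'r option) operator ring" where
  "Dtau = D_ring (punctured_line_times S)"

abbreviation fn :: "(complex ^ 'r option \<Rightarrow> complex) \<Rightarrow> ('r option, 'r option) operator" where
  "fn f \<equiv> mult_op (punctured_line_times S) f"

abbreviation pd :: "'r option \<Rightarrow> ('r option, 'r option) operator" where
  "pd j \<equiv> partial_op (punctured_line_times S) j"

definition q_euler :: "'r \<Rightarrow> ('r option, 'r option) operator" where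
  "q_euler k = fn (\<lambda>y. y $ Some k) \<otimes>\<^bsub>Dtau\<^esub> pd (Some k)"

definition z_euler :: "('r option, 'r option) operator" where
  "z_euler = \<ominus>\<^bsub>Dtau\<^esub> (fn (\<lambda>y. y $ None) \<otimes>\<^bsub>Dtau\<^esub> pd None)"

definition box_factor :: "('r \<Rightarrow> int ^ 'm) \<Rightarrow> 'm \<Rightarrow> nat \<Rightarrow> ('r option, 'r option) operator" where
  "box_factor d i \<nu> =
     (\<Oplus>\<^bsub>Dtau\<^esub>k\<in>UNIV. fn (\<lambda>y. of_int (d k $ i) * inverse (y $ None)) \<otimes>\<^bsub>Dtau\<^esub> q_euler k)
       \<ominus>\<^bsub>Dtau\<^esub> fn (\<lambda>y. of_nat \<nu> * inverse (y $ None))"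

text \<open>The first summand of the box operator of \<open>l\<close>; the second is the one of \<open>- l\<close>.\<close>

definition box_half ::
    "('r \<Rightarrow> int ^ 'm \<Rightarrow> int) \<Rightarrow> ('r \<Rightarrow> int ^ 'm::finite) \<Rightarrow> int ^ 'm \<Rightarrow> ('r option, 'r option) operator" where
  "box_half p d l =
     fn (\<lambda>y. \<Prod>k | p k l > 0. (y $ Some k) ^ nat (p k l)) \<otimes>\<^bsub>Dtau\<^esub>
     (\<Otimes>\<^bsub>Dtau\<^esub>i\<in>{i. l $ i < 0}. \<Otimes>\<^bsub>Dtau\<^esub>\<nu>\<in>{..<nat (- (l $ i))}. box_factor d i \<nu>)"

definition box_op ::
    "('r \<Rightarrow> int ^ 'm \<Rightarrow> int) \<Rightarrow> ('r \<Rightarrow> int ^ 'm::finite) \<Rightarrow> int ^ 'm \<Rightarrow> ('r option, 'r option) operator" where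
  "box_op p d l = box_half p d l \<ominus>\<^bsub>Dtau\<^esub> box_half p d (- l)"

definition euler_op ::
    "('m::finite \<Rightarrow> int ^ 'n) \<Rightarrow> ('r \<Rightarrow> int ^ 'm) \<Rightarrow> ('r option, 'r option) operator" where
  "euler_op A d = z_euler \<oplus>\<^bsub>Dtau\<^esub>
     (\<Oplus>\<^bsub>Dtau\<^esub>k\<in>UNIV. fn (\<lambda>_. of_int (anticanonical_class A (d k))) \<otimes>\<^bsub>Dtau\<^esub> q_euler k)"

definition quantum_ideal ::
    "('m::finite \<Rightarrow> int ^ 'n) \<Rightarrow> ('r \<Rightarrow> int ^ 'm \<Rightarrow> int) \<Rightarrow> ('r \<Rightarrow> int ^ 'm)
      \<Rightarrow> ('r option, 'r option) operator set" where
  "quantum_ideal A p d =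
     generated_left_ideal Dtau (insert (euler_op A d) (box_op p d ` relation_lattice A))"

definition quantum_module ::
    "('m::finite \<Rightarrow> int ^ 'n) \<Rightarrow> ('r \<Rightarrow> int ^ 'm \<Rightarrow> int) \<Rightarrow> ('r \<Rightarrow> int ^ 'm)
      \<Rightarrow> (('r option, 'r option) operator, ('r option, 'r option) operator set) module" where
  "quantum_module A p d = quotient_by_left_ideal Dtau (quantum_ideal A p d)"

end

text \<open>Modules over \<open>D[\<tau>\<^sup>-\<^sup>1]\<close>, i.e. over the differential operators on \<open>\<complex>\<^sup>*\<^sub>\<tau> \<times> S\<close>, regarded as modules
  over the differential operators on \<open>\<complex>\<^sub>\<tau> \<times> S\<close>.\<close>

abbreviation as_D_module ::
    "(complex ^ 'r::finite) set \<Rightarrow> (('r option, 'r option) operator, 'b) module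
      \<Rightarrow> (('r option, 'r option) operator, 'b) module" where
  "as_D_module S \<equiv> restrict_scalars (restrict_op (line_times S) (punctured_line_times S))"

end

theory Submission
  imports Defs "HOL-Library.Function_Algebras" "HOL-Computational_Algebra.Fundamental_Theorem_Algebra"
begin

text \<open>The direct image is generated by the classes of functions on \<open>S\<^sub>1\<close>. After the Fourier--Laplace
  transformation, and with \<open>\<tau>\<close> inverted, the relation coming from the vector field \<open>\<partial>/\<partial>w\<^sub>i\<close> reads
  \<open>[w\<^sup>u\<^sup>+\<^sup>e\<^sup>i] = z (E\<^sub>i - u\<^sub>i) [w\<^sup>u]\<close> with \<open>E\<^sub>i = \<Sum>\<^sub>a m\<^sub>i\<^sub>a q\<^sub>a\<partial>\<^sub>q\<^sub>a\<close>, the exponents being shifted by a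
  fixed vector \<open>u\<^sub>0\<close>. The fan is complete and smooth, so its ray generators generate the lattice as a
  monoid; hence the functions on \<open>S\<^sub>1\<close> form a free module over those on the base, with a basis of
  monomials \<open>w\<^sup>u\<close>, \<open>u \<ge> 0\<close>, one for each character of the torus. It follows that one class generates the
  module. Two monomials that differ by a relation \<open>l\<close> give the box operator of \<open>l\<close>, and multiplication
  by \<open>W\<close> gives the Euler operator. Conversely, sending \<open>w\<^sup>u\<close> to the product of the operators
  \<open>z (E\<^sub>i - \<nu>)\<close>, \<open>\<nu> < u\<^sub>i\<close>, respects all relations of the direct image modulo the quantum ideal, so there
  are no further relations.\<close>

text \<open>Adjoint, restriction and Fourier-Laplace transformation are given by definite
  descriptions, so each needs existence and uniqueness. Both rest on one fact: operators along a
  morphism have a unique normal form, with coefficients in front of iterated partial derivatives.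
  Additive maps can therefore be prescribed on normal forms, and multiplicativity is checked on
  generators. Derivatives of regular functions require the non-degenerate locus to be open, which
  needs a compactness argument on degenerating critical points. The free basis comes from the
  splitting of the fibration: each point is the torus translate of the point of the section g above
  its image, and averaging over roots of unity splits a regular function into torus weights with
  regular coefficients. No choice of basis exponents is canonical, so the map to the quantum module
  is fixed on chosen exponents and is independent of them only modulo the ideal; it is kept as a map
  to operators, and its compatibilities are congruences. The shift satisfies w^(u_0) = \<Prod>q_a /
  \<Prod>w_i, the factor between the coordinate volume forms and the torus invariant ones.\<close>

lemma sum_fun_apply: "(\<Sum>i\<in>I. F i) x = (\<Sum>i\<in>I. F i x)"
  by (induction I rule: infinite_finite_induct) simp_all

section \<open>Regular functions on open sets\<close>

lemma polynomial_fun_line: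
  assumes "P \<in> polynomial_fun"
  shows "\<exists>p. \<forall>s. P (a + s *s b) = poly p s"
  using assms
proof (induction rule: polynomial_fun.induct)
  case (const c)
  show ?case by (rule exI[of _ "[:c:]"]) simp
next
  case (coord i)
  show ?case by (rule exI[of _ "[:a $ i, b $ i:]"]) (simp add: algebra_simps)
next
  case (add f g)
  then obtain p q where "\<forall>s. f (a + s *s b) = poly p s" "\<forall>s. g (a + s *s b) = poly q s"
    by blast
  then show ?case by (intro exI[of _ "p + q"]) simp
next
  case (mult f g)
  then obtain p q where "\<forall>s. f (a + s *s b) = poly p s" "\<forall>s. g (a + s *s b) = poly q s"
    by blast
  then show ?case by (intro exI[of _ "p * q"]) simp
qed

text \<open>On the complex line through \<open>x0\<close> and \<open>x\<close> the polynomial is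
  univariate, and it vanishes for the infinitely many parameters that stay in \<open>U\<close>;
  parameter 1 gives the value at \<open>x\<close>.\<close>

lemma polynomial_fun_eq_0_if_open:
  fixes P :: "complex ^ 'k::finite \<Rightarrow> complex"
  assumes P: "P \<in> polynomial_fun" and U: "open U" "x0 \<in> U" and zero: "\<And>x. x \<in> U \<Longrightarrow> P x = 0"
  shows "P x = 0"
proof -
  obtain p where p: "\<And>s. P (x0 + s *s (x - x0)) = poly p s"
    using polynomial_fun_line[OF P] by blast
  have "continuous_on UNIV (\<lambda>s::complex. x0 + s *s (x - x0))"
    by (intro continuous_on_add continuous_on_const)
       (auto simp: vector_scalar_mult_def intro!: continuous_on_vec_lambda continuous_intros)
  then have "open ((\<lambda>s::complex. x0 + s *s (x - x0)) -` U)"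
    using U(1) open_vimage by blast
  moreover have "0 \<in> (\<lambda>s::complex. x0 + s *s (x - x0)) -` U"
    using U(2) by simp
  ultimately have "infinite ((\<lambda>s::complex. x0 + s *s (x - x0)) -` U)"
    using finite_imp_not_open by blast
  moreover have "(\<lambda>s::complex. x0 + s *s (x - x0)) -` U \<subseteq> {s. poly p s = 0}"
    using zero p by force
  ultimately have "p = 0"
    using poly_roots_finite finite_subset by blast
  then show ?thesis using p[of 1] by simp
qed

text \<open>The pointwise half of \<open>regular_fun\<close>, split off so that closure properties
  can be proved at one point and for functions that have not been extended by zero.\<close>

definition rational_at :: "(complex ^ 'k) set \<Rightarrow> complex ^ 'k \<Rightarrow> (complex ^ 'k \<Rightarrow> complex) \<Rightarrow> bool" where
  "rational_at X x f \<longleftrightarrow> (\<exists>P\<in>polynomial_fun. \<exists>Q\<in>polynomial_fun. Q x \<noteq> 0 \<and>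
     (\<forall>y\<in>X. Q y \<noteq> 0 \<longrightarrow> f y = P y / Q y))"

lemma regular_fun_iff:
  "f \<in> regular_fun X \<longleftrightarrow> (\<forall>x. x \<notin> X \<longrightarrow> f x = 0) \<and> (\<forall>x\<in>X. rational_at X x f)"
  unfolding regular_fun_def rational_at_def by simp

lemma regular_fun_outside: "f \<in> regular_fun X \<Longrightarrow> x \<notin> X \<Longrightarrow> f x = 0"
  by (simp add: regular_fun_def)

lemma regular_fun_rational_at: "f \<in> regular_fun X \<Longrightarrow> x \<in> X \<Longrightarrow> rational_at X x f"
  by (simp add: regular_fun_iff)

lemma rational_at_cong:
  assumes "\<And>y. y \<in> X \<Longrightarrow> f y = g y"
  shows "rational_at X x f \<longleftrightarrow> rational_at X x g"
  unfolding rational_at_def using assms by simp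

lemma zero_outside_regular:
  assumes "\<And>x. x \<in> X \<Longrightarrow> rational_at X x f"
  shows "zero_outside X f \<in> regular_fun X"
  using assms rational_at_cong[of X "zero_outside X f" f]
  by (auto simp: regular_fun_iff zero_outside_def)

lemma zero_outside_apply: "x \<in> X \<Longrightarrow> zero_outside X f x = f x"
  by (simp add: zero_outside_def)

lemma rational_at_polynomial: "P \<in> polynomial_fun \<Longrightarrow> rational_at X x P"
  unfolding rational_at_def
  by (rule bexI[of _ P], rule bexI[of _ "\<lambda>_. 1"]) (auto intro: polynomial_fun.const)

lemma rational_at_add:
  assumes "rational_at X x f" "rational_at X x g"
  shows "rational_at X x (\<lambda>y. f y + g y)"
proof -
  obtain P Q P' Q' where PQ: "P \<in> polynomial_fun" "Q \<in> polynomial_fun" "Q x \<noteq> 0"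
      "\<forall>y\<in>X. Q y \<noteq> 0 \<longrightarrow> f y = P y / Q y"
    and PQ': "P' \<in> polynomial_fun" "Q' \<in> polynomial_fun" "Q' x \<noteq> 0"
      "\<forall>y\<in>X. Q' y \<noteq> 0 \<longrightarrow> g y = P' y / Q' y"
    using assms unfolding rational_at_def by blast
  show ?thesis unfolding rational_at_def
    by (rule bexI[of _ "\<lambda>y. P y * Q' y + P' y * Q y"], rule bexI[of _ "\<lambda>y. Q y * Q' y"])
       (use PQ PQ' in \<open>auto simp: field_simps intro!: polynomial_fun.intros\<close>)
qed

lemma rational_at_mult:
  assumes "rational_at X x f" "rational_at X x g"
  shows "rational_at X x (\<lambda>y. f y * g y)"
proof -
  obtain P Q P' Q' where PQ: "P \<in> polynomial_fun" "Q \<in> polynomial_fun" "Q x \<noteq> 0"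
      "\<forall>y\<in>X. Q y \<noteq> 0 \<longrightarrow> f y = P y / Q y"
    and PQ': "P' \<in> polynomial_fun" "Q' \<in> polynomial_fun" "Q' x \<noteq> 0"
      "\<forall>y\<in>X. Q' y \<noteq> 0 \<longrightarrow> g y = P' y / Q' y"
    using assms unfolding rational_at_def by blast
  show ?thesis unfolding rational_at_def
    by (rule bexI[of _ "\<lambda>y. P y * P' y"], rule bexI[of _ "\<lambda>y. Q y * Q' y"])
       (use PQ PQ' in \<open>auto intro!: polynomial_fun.intros\<close>)
qed

lemma rational_at_inverse:
  assumes "rational_at X x f" "x \<in> X" "f x \<noteq> 0"
  shows "rational_at X x (\<lambda>y. inverse (f y))"
proof -
  obtain P Q where PQ: "P \<in> polynomial_fun" "Q \<in> polynomial_fun" "Q x \<noteq> 0"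
      "\<forall>y\<in>X. Q y \<noteq> 0 \<longrightarrow> f y = P y / Q y"
    using assms unfolding rational_at_def by blast
  then have Px: "P x \<noteq> 0" using assms by auto
  \<comment> \<open>The factor \<open>Q\<close> stays in the denominator: where the denominator is
    nonzero, the formula for \<open>f\<close> applies and can be inverted.\<close>
  show ?thesis unfolding rational_at_def
    by (rule bexI[of _ "\<lambda>y. Q y * Q y"], rule bexI[of _ "\<lambda>y. P y * Q y"])
       (use PQ Px in \<open>auto intro!: polynomial_fun.intros\<close>)
qed

lemma rational_at_const: "rational_at X x (\<lambda>_. c)"
  by (rule rational_at_polynomial[OF polynomial_fun.const])

lemma rational_at_coord: "rational_at X x (\<lambda>y. y $ i)"
  by (rule rational_at_polynomial[OF polynomial_fun.coord])

lemma rational_at_uminus: "rational_at X x f \<Longrightarrow> rational_at X x (\<lambda>y. - f y)"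
  using rational_at_mult[OF rational_at_const[of X x "-1"]] by simp

lemma rational_at_divide:
  "rational_at X x f \<Longrightarrow> rational_at X x g \<Longrightarrow> x \<in> X \<Longrightarrow> g x \<noteq> 0 \<Longrightarrow> rational_at X x (\<lambda>y. f y / g y)"
  using rational_at_mult[OF _ rational_at_inverse] by (fastforce simp: divide_inverse)

lemma rational_at_sum:
  "(\<And>i. i \<in> I \<Longrightarrow> rational_at X x (f i)) \<Longrightarrow> rational_at X x (\<lambda>y. \<Sum>i\<in>I. f i y)"
  by (induction I rule: infinite_finite_induct) (auto intro: rational_at_const rational_at_add)

lemma rational_at_prod:
  "(\<And>i. i \<in> I \<Longrightarrow> rational_at X x (f i)) \<Longrightarrow> rational_at X x (\<lambda>y. \<Prod>i\<in>I. f i y)"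
  by (induction I rule: infinite_finite_induct) (auto intro: rational_at_const rational_at_mult)

lemma rational_at_power: "rational_at X x f \<Longrightarrow> rational_at X x (\<lambda>y. f y ^ n)"
  by (induction n) (auto intro: rational_at_const rational_at_mult)

lemma rational_at_powi:
  "rational_at X x f \<Longrightarrow> x \<in> X \<Longrightarrow> f x \<noteq> 0 \<Longrightarrow> rational_at X x (\<lambda>y. f y powi n)"
  by (cases "n \<ge> 0") (auto simp: power_int_def intro!: rational_at_power rational_at_inverse)

lemma rational_at_polynomial_compose:
  assumes "P \<in> polynomial_fun" "\<And>j. rational_at X x (\<lambda>y. F y $ j)"
  shows "rational_at X x (\<lambda>y. P (F y))"
  using assms(1)
  by (induction rule: polynomial_fun.induct)
     (auto intro: assms rational_at_const rational_at_add rational_at_mult)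

lemma rational_at_compose:
  assumes h: "rational_at Y (F x) h" and F: "\<And>j. rational_at X x (\<lambda>y. F y $ j)"
    and x: "x \<in> X" and FXY: "\<And>y. y \<in> X \<Longrightarrow> F y \<in> Y"
  shows "rational_at X x (\<lambda>y. h (F y))"
proof -
  obtain P Q where PQ: "P \<in> polynomial_fun" "Q \<in> polynomial_fun" "Q (F x) \<noteq> 0"
      "\<forall>y\<in>Y. Q y \<noteq> 0 \<longrightarrow> h y = P y / Q y"
    using h unfolding rational_at_def by blast
  obtain P1 Q1 P2 Q2 where 1: "P1 \<in> polynomial_fun" "Q1 \<in> polynomial_fun" "Q1 x \<noteq> 0"
      "\<forall>y\<in>X. Q1 y \<noteq> 0 \<longrightarrow> P (F y) = P1 y / Q1 y"
    and 2: "P2 \<in> polynomial_fun" "Q2 \<in> polynomial_fun" "Q2 x \<noteq> 0"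
      "\<forall>y\<in>X. Q2 y \<noteq> 0 \<longrightarrow> Q (F y) = P2 y / Q2 y"
    using rational_at_polynomial_compose[OF PQ(1) F] rational_at_polynomial_compose[OF PQ(2) F]
    unfolding rational_at_def by metis
  have Px: "P2 x \<noteq> 0" using 2 PQ(3) x by auto
  have eq: "h (F y) = (P1 y / Q1 y) / (P2 y / Q2 y)"
    if "y \<in> X" "Q1 y \<noteq> 0" "Q2 y \<noteq> 0" "P2 y \<noteq> 0" for y
    using that PQ(4) FXY 1(4) 2(4) by (metis divide_eq_0_iff)
  show ?thesis unfolding rational_at_def
    by (rule bexI[of _ "\<lambda>y. P1 y * (Q2 y * Q2 y)"], rule bexI[of _ "\<lambda>y. Q1 y * (P2 y * Q2 y)"])
       (use PQ Px 1 2 eq in \<open>auto intro!: polynomial_fun.intros\<close>)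
qed

lemma regular_fun_compose:
  assumes h: "h \<in> regular_fun Y" and F: "\<And>x j. x \<in> X \<Longrightarrow> rational_at X x (\<lambda>y. F y $ j)"
    and FXY: "\<And>y. y \<in> X \<Longrightarrow> F y \<in> Y"
  shows "zero_outside X (\<lambda>y. h (F y)) \<in> regular_fun X"
proof (rule zero_outside_regular)
  fix x assume "x \<in> X"
  then show "rational_at X x (\<lambda>y. h (F y))"
    using assms rational_at_compose[of Y F x h X] regular_fun_rational_at[OF h] by blast
qed

lemma regular_fun_restrict:
  "h \<in> regular_fun Y \<Longrightarrow> X \<subseteq> Y \<Longrightarrow> zero_outside X h \<in> regular_fun X"
  using regular_fun_compose[of h Y X "\<lambda>x. x"] by (auto intro: rational_at_coord)

lemma regular_fun_0 [simp]: "0 \<in> regular_fun X"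
  by (auto simp: regular_fun_iff zero_fun_def intro: rational_at_const)

lemma regular_fun_add: "f \<in> regular_fun X \<Longrightarrow> g \<in> regular_fun X \<Longrightarrow> f + g \<in> regular_fun X"
  by (auto simp: regular_fun_iff plus_fun_def intro: rational_at_add)

lemma regular_fun_uminus: "f \<in> regular_fun X \<Longrightarrow> - f \<in> regular_fun X"
  by (auto simp: regular_fun_iff fun_Compl_def intro: rational_at_uminus)

lemma regular_fun_diff: "f \<in> regular_fun X \<Longrightarrow> g \<in> regular_fun X \<Longrightarrow> f - g \<in> regular_fun X"
  using regular_fun_add[OF _ regular_fun_uminus] by fastforce

lemma regular_fun_sum: "(\<And>i. i \<in> I \<Longrightarrow> f i \<in> regular_fun X) \<Longrightarrow> sum f I \<in> regular_fun X"
  by (induction I rule: infinite_finite_induct) (simp_all add: regular_fun_add)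

lemma regular_fun_mult_rational:
  assumes "f \<in> regular_fun X" "\<And>x. x \<in> X \<Longrightarrow> rational_at X x g"
  shows "g * f \<in> regular_fun X" "f * g \<in> regular_fun X"
  using assms by (auto simp: regular_fun_iff times_fun_def intro: rational_at_mult)

lemma regular_fun_mult: "f \<in> regular_fun X \<Longrightarrow> g \<in> regular_fun X \<Longrightarrow> f * g \<in> regular_fun X"
  by (intro regular_fun_mult_rational) (auto simp: regular_fun_iff)

lemma regular_fun_const: "zero_outside X (\<lambda>_. c) \<in> regular_fun X"
  by (intro zero_outside_regular rational_at_const)

lemma polynomial_fun_continuous:
  fixes P :: "complex ^ 'k::finite \<Rightarrow> complex"
  assumes "P \<in> polynomial_fun" shows "continuous_on UNIV P"
  using assms by (induction rule: polynomial_fun.induct) (auto intro!: continuous_intros)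

lemma open_polynomial_nonzero:
  fixes Q :: "complex ^ 'k::finite \<Rightarrow> complex"
  assumes "Q \<in> polynomial_fun" shows "open {x. Q x \<noteq> 0}"
  using open_Collect_neq[OF polynomial_fun_continuous[OF assms] continuous_on_const] .

text \<open>Vanishing off a hypersurface suffices, even if \<open>X\<close> is disconnected: near
  any point \<open>f\<close> is a quotient whose numerator vanishes on a nonempty open set, hence on
  all of affine space.\<close>

lemma regular_fun_eq_0:
  assumes X: "open X" and f: "f \<in> regular_fun X" and Q: "Q \<in> polynomial_fun" "Q x0 \<noteq> 0"
    and zero: "\<And>x. x \<in> X \<Longrightarrow> Q x \<noteq> 0 \<Longrightarrow> f x = 0"
  shows "f = 0"
proof
  fix x
  show "f x = 0 x"
  proof (cases "x \<in> X")
    case True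
    then obtain P R where PR: "P \<in> polynomial_fun" "R \<in> polynomial_fun" "R x \<noteq> 0"
        "\<forall>y\<in>X. R y \<noteq> 0 \<longrightarrow> f y = P y / R y"
      using regular_fun_rational_at[OF f] unfolding rational_at_def by blast
    have o: "open (X \<inter> {y. R y \<noteq> 0})"
      using X PR by (intro open_Int open_polynomial_nonzero)
    have "\<exists>y\<in>X \<inter> {y. R y \<noteq> 0}. Q y \<noteq> 0"
      using polynomial_fun_eq_0_if_open[OF Q(1) o, of x x0] Q(2) True PR(3) by auto
    then obtain y where y: "y \<in> X \<inter> {y. R y \<noteq> 0} \<inter> {y. Q y \<noteq> 0}" by blast
    have "P x = 0"
    proof (rule polynomial_fun_eq_0_if_open[OF PR(1) _ y])
      show "open (X \<inter> {y. R y \<noteq> 0} \<inter> {y. Q y \<noteq> 0})"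
        by (intro open_Int o open_polynomial_nonzero Q)
      show "P z = 0" if "z \<in> X \<inter> {y. R y \<noteq> 0} \<inter> {y. Q y \<noteq> 0}" for z
        using that zero PR(4) by force
    qed
    then show ?thesis using PR True by simp
  next
    case False
    then show ?thesis using f by (simp add: regular_fun_outside)
  qed
qed

subsection \<open>Partial derivatives\<close>

text \<open>\<open>has_derivative\<close> on complex vectors is only real linear. Requiring the
  derivative to have this shape expresses holomorphy and names the complex partial
  derivatives.\<close>

definition has_gradient :: "(complex ^ 'k::finite \<Rightarrow> complex) \<Rightarrow> ('k \<Rightarrow> complex) \<Rightarrow> complex ^ 'k \<Rightarrow> bool" where
  "has_gradient h D x \<longleftrightarrow> (h has_derivative (\<lambda>v. \<Sum>j\<in>UNIV. D j * v $ j)) (at x)"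

lemma has_gradient_const: "has_gradient (\<lambda>_. c) (\<lambda>_. 0) x"
  unfolding has_gradient_def by simp

lemma has_gradient_coord: "has_gradient (\<lambda>y. y $ i) (\<lambda>j. if j = i then 1 else 0) x"
proof -
  have "(\<lambda>v. \<Sum>j\<in>UNIV. (if j = i then 1 else 0) * v $ j) = (\<lambda>v::complex ^ 'a. v $ i)"
    by (auto simp: if_distrib[of "\<lambda>x. x * _"] cong: if_cong)
  then show ?thesis unfolding has_gradient_def
    by (simp add: bounded_linear_vec_nth bounded_linear_imp_has_derivative)
qed

lemma has_gradient_add:
  assumes "has_gradient f D x" "has_gradient g E x"
  shows "has_gradient (\<lambda>y. f y + g y) (\<lambda>j. D j + E j) x"
  using has_derivative_add[OF assms[unfolded has_gradient_def]]
  unfolding has_gradient_def by (simp add: sum.distrib algebra_simps)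

lemma has_gradient_mult:
  assumes "has_gradient f D x" "has_gradient g E x"
  shows "has_gradient (\<lambda>y. f y * g y) (\<lambda>j. D j * g x + f x * E j) x"
proof -
  have "(\<lambda>v. \<Sum>j\<in>UNIV. (D j * g x + f x * E j) * v $ j) =
    (\<lambda>v. f x * (\<Sum>j\<in>UNIV. E j * v $ j) + (\<Sum>j\<in>UNIV. D j * v $ j) * g x)"
    by (simp add: sum_distrib_left sum_distrib_right sum.distrib algebra_simps)
  then show ?thesis
    using has_derivative_mult[OF assms[unfolded has_gradient_def]] unfolding has_gradient_def by simp
qed

lemma has_gradient_inverse:
  assumes "has_gradient f D x" "f x \<noteq> 0"
  shows "has_gradient (\<lambda>y. inverse (f y)) (\<lambda>j. - D j / (f x)\<^sup>2) x"
proof -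
  have "(\<lambda>v. \<Sum>j\<in>UNIV. (- D j / (f x)\<^sup>2) * v $ j) =
    (\<lambda>v. - (inverse (f x) * (\<Sum>j\<in>UNIV. D j * v $ j) * inverse (f x)))"
    by (auto simp: sum_distrib_left sum_distrib_right field_simps power2_eq_square simp flip: sum_negf)
  then show ?thesis
    using Deriv.has_derivative_inverse[OF assms(2) assms(1)[unfolded has_gradient_def]]
    unfolding has_gradient_def by simp
qed

lemma has_gradient_cong:
  assumes "has_gradient f D x" "open U" "x \<in> U" "\<And>y. y \<in> U \<Longrightarrow> f y = g y"
  shows "has_gradient g D x"
  using assms has_derivative_transform_within_open unfolding has_gradient_def by blast

lemma has_gradient_compose:
  assumes h: "has_gradient h E (F x)" and F: "\<And>j. has_gradient (\<lambda>y. F y $ j) (D j) x"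
  shows "has_gradient (\<lambda>y. h (F y)) (\<lambda>i. \<Sum>j\<in>UNIV. E j * D j i) x"
proof -
  have "(F has_derivative (\<lambda>v. \<chi> j. \<Sum>i\<in>UNIV. D j i * v $ i)) (at x)"
  proof (subst has_derivative_componentwise_within, rule ballI)
    fix b :: "complex ^ 'a" assume "b \<in> Basis"
    then obtain j u where b: "b = axis j u" "u \<in> Basis" by (auto simp: Basis_vec_def)
    have "((\<lambda>y. F y $ j \<bullet> u) has_derivative (\<lambda>v. (\<Sum>i\<in>UNIV. D j i * v $ i) \<bullet> u)) (at x)"
      using F[of j] unfolding has_gradient_def by (rule has_derivative_inner_left)
    then show "((\<lambda>y. F y \<bullet> b) has_derivative (\<lambda>v. (\<chi> j. \<Sum>i\<in>UNIV. D j i * v $ i) \<bullet> b)) (at x)"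
      by (simp add: b inner_axis)
  qed
  from diff_chain_at[OF this h[unfolded has_gradient_def]]
  have "((\<lambda>y. h (F y)) has_derivative (\<lambda>v. \<Sum>j\<in>UNIV. E j * (\<Sum>i\<in>UNIV. D j i * v $ i))) (at x)"
    by (simp add: o_def)
  moreover have "(\<lambda>v. \<Sum>j\<in>UNIV. E j * (\<Sum>i\<in>UNIV. D j i * v $ i)) =
      (\<lambda>v. \<Sum>i\<in>UNIV. (\<Sum>j\<in>UNIV. E j * D j i) * v $ i)"
    by (rule ext, simp add: sum_distrib_left sum_distrib_right mult.assoc, rule sum.swap)
  ultimately show ?thesis unfolding has_gradient_def by simp
qed

text \<open>Links the total derivative to the derivative along a coordinate axis, by which
  \<open>partial_op\<close> is defined.\<close>

lemma has_gradient_partial: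
  fixes x :: "complex ^ 'k::finite"
  assumes "has_gradient h D x"
  shows "((\<lambda>s. h (\<chi> j. if j = i then s else x $ j)) has_field_derivative D i) (at (x $ i))"
proof -
  have lin: "bounded_linear (axis i :: complex \<Rightarrow> complex ^ 'k)"
    by (simp add: linear_conv_bounded_linear[symmetric], rule linearI) (auto simp: axis_def vec_eq_iff)
  have eq: "(\<lambda>s. \<chi> j. if j = i then s else x $ j) = (\<lambda>s. x + axis i (s - x $ i))"
    by (auto simp: vec_eq_iff axis_def)
  have "((\<lambda>s. \<chi> j. if j = i then s else x $ j) has_derivative axis i) (at (x $ i))"
    unfolding eq
    by (rule derivative_eq_intros bounded_linear.has_derivative[OF lin] refl | simp)+
  moreover have "(\<chi> j. if j = i then x $ i else x $ j) = x" by (auto simp: vec_eq_iff)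
  ultimately have "((\<lambda>s. h (\<chi> j. if j = i then s else x $ j)) has_derivative
      (\<lambda>s. \<Sum>j\<in>UNIV. D j * axis i s $ j)) (at (x $ i))"
    using assms diff_chain_at[of "\<lambda>s. \<chi> j. if j = i then s else x $ j" "axis i" "x $ i" h]
    unfolding has_gradient_def by (simp add: o_def)
  moreover have "(\<lambda>s. \<Sum>j\<in>UNIV. D j * axis i s $ j) = (*) (D i)"
    by (auto simp: axis_def if_distrib[of "\<lambda>x. _ * x"] cong: if_cong)
  ultimately show ?thesis unfolding has_field_derivative_def by simp
qed

lemma polynomial_gradient:
  assumes "P \<in> polynomial_fun"
  shows "\<exists>D. (\<forall>j. D j \<in> polynomial_fun) \<and> (\<forall>x. has_gradient P (\<lambda>j. D j x) x)"
  using assms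
proof (induction rule: polynomial_fun.induct)
  case (const c)
  show ?case
    by (intro exI[of _ "\<lambda>_ _. 0"]) (auto intro: polynomial_fun.const has_gradient_const)
next
  case (coord i)
  show ?case
    by (intro exI[of _ "\<lambda>j _. if j = i then 1 else 0"]) (auto intro: polynomial_fun.const has_gradient_coord)
next
  case (add f g)
  then obtain D E where "\<forall>j. D j \<in> polynomial_fun" "\<forall>x. has_gradient f (\<lambda>j. D j x) x"
    "\<forall>j. E j \<in> polynomial_fun" "\<forall>x. has_gradient g (\<lambda>j. E j x) x" by blast
  then show ?case
    by (intro exI[of _ "\<lambda>j x. D j x + E j x"]) (auto intro: polynomial_fun.add has_gradient_add)
next
  case (mult f g)
  then obtain D E where "\<forall>j. D j \<in> polynomial_fun" "\<forall>x. has_gradient f (\<lambda>j. D j x) x"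
    "\<forall>j. E j \<in> polynomial_fun" "\<forall>x. has_gradient g (\<lambda>j. E j x) x" by blast
  with mult.hyps show ?case
    by (intro exI[of _ "\<lambda>j x. D j x * g x + f x * E j x"])
       (auto intro!: polynomial_fun.add polynomial_fun.mult has_gradient_mult)
qed

lemma partial_op_apply:
  assumes "h \<in> regular_fun X" "x \<in> X" "has_gradient h D x"
  shows "partial_op X i h x = D i"
  using DERIV_imp_deriv[OF has_gradient_partial[OF assms(3)]] assms(1,2)
  by (simp add: partial_op_def zero_outside_def)

text \<open>The quotient rule, valid where the denominator is nonzero, gives a gradient with
  rational entries. It must coincide with the partial derivatives, so these are rational as well and
  regular functions are stable under them.\<close>

lemma
  assumes X: "open X" and h: "h \<in> regular_fun X"
  shows regular_fun_gradient: "x \<in> X \<Longrightarrow> has_gradient h (\<lambda>j. partial_op X j h x) x"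
    and partial_op_regular: "partial_op X i h \<in> regular_fun X"
proof -
  have key: "\<exists>D. (\<forall>j. rational_at X x (D j)) \<and> (\<exists>Q\<in>polynomial_fun. Q x \<noteq> 0 \<and>
      (\<forall>y\<in>X. Q y \<noteq> 0 \<longrightarrow> has_gradient h (\<lambda>j. D j y) y))" if x: "x \<in> X" for x
  proof -
    obtain P Q where PQ: "P \<in> polynomial_fun" "Q \<in> polynomial_fun" "Q x \<noteq> 0"
        "\<forall>y\<in>X. Q y \<noteq> 0 \<longrightarrow> h y = P y / Q y"
      using regular_fun_rational_at[OF h x] unfolding rational_at_def by blast
    obtain D E where D: "\<And>j. D j \<in> polynomial_fun" "\<And>x. has_gradient P (\<lambda>j. D j x) x"
      and E: "\<And>j. E j \<in> polynomial_fun" "\<And>x. has_gradient Q (\<lambda>j. E j x) x"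
      using polynomial_gradient PQ(1,2) by metis
    define G where "G j y = D j y * inverse (Q y) + P y * (- E j y / (Q y)\<^sup>2)" for j y
    have "has_gradient h (\<lambda>j. G j y) y" if y: "y \<in> X" "Q y \<noteq> 0" for y
    proof (rule has_gradient_cong)
      show "has_gradient (\<lambda>y. P y * inverse (Q y)) (\<lambda>j. G j y) y"
        unfolding G_def by (intro has_gradient_mult has_gradient_inverse D E y)
      show "open (X \<inter> {y. Q y \<noteq> 0})" using X PQ by (intro open_Int open_polynomial_nonzero)
    qed (use y PQ in \<open>auto simp: divide_inverse\<close>)
    moreover have "rational_at X x (G j)" for j
      unfolding G_def using x PQ D E
      by (intro rational_at_add rational_at_mult rational_at_divide rational_at_uminus rational_at_power
          rational_at_inverse) (auto intro: rational_at_polynomial)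
    ultimately show ?thesis using PQ by blast
  qed
  show g: "has_gradient h (\<lambda>j. partial_op X j h x) x" if x: "x \<in> X" for x
  proof -
    obtain D where D: "has_gradient h (\<lambda>j. D j x) x" using key[OF x] x by blast
    then have "(\<lambda>j. partial_op X j h x) = (\<lambda>j. D j x)" using partial_op_apply[OF h x] by blast
    with D show ?thesis by simp
  qed
  show "partial_op X i h \<in> regular_fun X"
    unfolding regular_fun_iff
  proof (intro conjI allI impI ballI)
    show "x \<notin> X \<Longrightarrow> partial_op X i h x = 0" for x by (simp add: partial_op_def zero_outside_def)
    fix x assume x: "x \<in> X"
    then obtain D Q where D: "\<And>j. rational_at X x (D j)" and Q: "Q \<in> polynomial_fun" "Q x \<noteq> 0"
        "\<And>y. y \<in> X \<Longrightarrow> Q y \<noteq> 0 \<Longrightarrow> has_gradient h (\<lambda>j. D j y) y"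
      using key by blast
    obtain P R where PR: "P \<in> polynomial_fun" "R \<in> polynomial_fun" "R x \<noteq> 0"
        "\<forall>y\<in>X. R y \<noteq> 0 \<longrightarrow> D i y = P y / R y"
      using D unfolding rational_at_def by blast
    show "rational_at X x (partial_op X i h)" unfolding rational_at_def
      by (rule bexI[of _ "\<lambda>y. P y * Q y"], rule bexI[of _ "\<lambda>y. R y * Q y"])
         (use PR Q in \<open>auto simp: partial_op_apply[OF h _ Q(3)] intro!: polynomial_fun.mult\<close>)
  qed
qed

lemma partial_op_nonregular: "h \<notin> regular_fun X \<Longrightarrow> partial_op X i h = 0"
  by (simp add: partial_op_def zero_fun_def)

lemma partial_op_cong:
  assumes "open X" "open U" "h \<in> regular_fun X" "h' \<in> regular_fun U" "U \<subseteq> X"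
    "\<And>y. y \<in> U \<Longrightarrow> h y = h' y" "x \<in> U"
  shows "partial_op U i h' x = partial_op X i h x"
  using assms by (intro partial_op_apply[OF assms(4,7)] has_gradient_cong[OF regular_fun_gradient[of X h x] assms(2)]) auto

lemma partial_op_add:
  assumes "open X" "f \<in> regular_fun X" "g \<in> regular_fun X"
  shows "partial_op X i (f + g) = partial_op X i f + partial_op X i g"
proof
  fix x
  show "partial_op X i (f + g) x = (partial_op X i f + partial_op X i g) x"
  proof (cases "x \<in> X")
    case True
    have "has_gradient (f + g) (\<lambda>j. partial_op X j f x + partial_op X j g x) x"
      unfolding plus_fun_def using assms True by (intro has_gradient_add regular_fun_gradient)
    then show ?thesis
      using partial_op_apply[OF regular_fun_add[OF assms(2,3)] True] by simp
  qed (simp add: partial_op_def zero_outside_def assms)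
qed

lemma partial_op_mult:
  assumes "open X" "f \<in> regular_fun X" "g \<in> regular_fun X"
  shows "partial_op X i (f * g) = partial_op X i f * g + f * partial_op X i g"
proof
  fix x
  show "partial_op X i (f * g) x = (partial_op X i f * g + f * partial_op X i g) x"
  proof (cases "x \<in> X")
    case True
    have "has_gradient (f * g) (\<lambda>j. partial_op X j f x * g x + f x * partial_op X j g x) x"
      unfolding times_fun_def using assms True by (intro has_gradient_mult regular_fun_gradient)
    then show ?thesis
      using partial_op_apply[OF regular_fun_mult[OF assms(2,3)] True] by simp
  qed (simp add: partial_op_def zero_outside_def assms regular_fun_outside)
qed

lemma partial_op_const:
  assumes "open X" shows "partial_op X i (zero_outside X (\<lambda>_. c)) = 0"
proof
  fix x
  show "partial_op X i (zero_outside X (\<lambda>_. c)) x = 0 x"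
  proof (cases "x \<in> X")
    case True
    have "has_gradient (zero_outside X (\<lambda>_. c)) (\<lambda>_. 0) x"
      by (rule has_gradient_cong[OF has_gradient_const assms True]) (simp add: zero_outside_apply)
    then show ?thesis
      using partial_op_apply[OF regular_fun_const True] by simp
  qed (simp add: partial_op_def zero_outside_def)
qed

lemma regular_coord: "zero_outside X (\<lambda>y. y $ i) \<in> regular_fun X"
  by (intro zero_outside_regular rational_at_coord)

lemma partial_op_coord:
  assumes "open X"
  shows "partial_op X i (zero_outside X (\<lambda>y. y $ j)) = zero_outside X (\<lambda>_. if i = j then 1 else 0)"
proof
  fix x
  show "partial_op X i (zero_outside X (\<lambda>y. y $ j)) x = zero_outside X (\<lambda>_. if i = j then 1 else 0) x"
  proof (cases "x \<in> X")
    case True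
    have "has_gradient (zero_outside X (\<lambda>y. y $ j)) (\<lambda>i. if i = j then 1 else 0) x"
      by (rule has_gradient_cong[OF has_gradient_coord assms True]) (simp add: zero_outside_apply)
    then show ?thesis
      using partial_op_apply[OF regular_coord True] True by (simp add: zero_outside_apply)
  qed (simp_all add: partial_op_def zero_outside_def)
qed

lemma zero_outside_add: "zero_outside X (\<lambda>x. f x + g x) = zero_outside X f + zero_outside X g"
  and zero_outside_mult: "zero_outside X (\<lambda>x. f x * g x) = zero_outside X f * zero_outside X g"
  and zero_outside_sum: "zero_outside X (\<lambda>x. \<Sum>i\<in>I. F i x) = (\<Sum>i\<in>I. zero_outside X (F i))"
  by (auto simp: zero_outside_def fun_eq_iff sum_fun_apply)

notation comp (infixl "\<cdot>" 70)

lemmas pointwise_simps = o_apply plus_fun_apply minus_apply uminus_apply zero_fun_apply times_fun_apply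

section \<open>The ring of differential operators\<close>

lemma mult_op_apply: "h \<in> regular_fun X \<Longrightarrow> mult_op X f h = f * h"
  by (auto simp: mult_op_def)

lemma mult_op_nonregular: "h \<notin> regular_fun X \<Longrightarrow> mult_op X f h = 0"
  by (auto simp: mult_op_def)

lemma mult_op_cong: "(\<And>x. x \<in> X \<Longrightarrow> f x = g x) \<Longrightarrow> mult_op X f = mult_op X g"
  by (auto simp: mult_op_def fun_eq_iff regular_fun_outside)
     (metis mult_eq_0_iff regular_fun_outside)

lemma mult_op_zero_outside: "mult_op X (zero_outside X f) = mult_op X f"
  by (rule mult_op_cong) (simp add: zero_outside_apply)

lemma mult_op_diff_op:
  assumes "\<And>x. x \<in> X \<Longrightarrow> rational_at X x f" shows "mult_op X f \<in> diff_op X"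
  using diff_op.mult[OF zero_outside_regular[OF assms]] by (simp add: mult_op_zero_outside)

lemma one_diff_op: "mult_op X (\<lambda>_. 1) \<in> diff_op X"
  by (intro mult_op_diff_op rational_at_const)

lemma mult_op_0: "mult_op X 0 = 0"
  by (auto simp: mult_op_def fun_eq_iff)

lemma mult_op_add: "mult_op X (f + g) = mult_op X f + mult_op X g"
  by (auto simp: mult_op_def fun_eq_iff algebra_simps)

lemma zero_diff_op: "0 \<in> diff_op X"
  using diff_op.mult[OF regular_fun_0] by (simp add: mult_op_0)

lemma diff_op_plus: "P \<in> diff_op X \<Longrightarrow> Q \<in> diff_op X \<Longrightarrow> P + Q \<in> diff_op X"
  using diff_op.add[of P X Q] by (simp add: plus_fun_def)

lemma diff_op_induct [consumes 1, case_names mult partial add comp]: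
  assumes "P \<in> diff_op X"
    and "\<And>f. f \<in> regular_fun X \<Longrightarrow> C (mult_op X f)"
    and "\<And>i. C (partial_op X i)"
    and "\<And>P Q. P \<in> diff_op X \<Longrightarrow> Q \<in> diff_op X \<Longrightarrow> C P \<Longrightarrow> C Q \<Longrightarrow> C (P + Q)"
    and "\<And>P Q. P \<in> diff_op X \<Longrightarrow> Q \<in> diff_op X \<Longrightarrow> C P \<Longrightarrow> C Q \<Longrightarrow> C (P \<cdot> Q)"
  shows "C P"
  using assms(1)
proof (induction rule: diff_op.induct)
  case (add P Q)
  then show ?case using assms(4)[of P Q] by (simp add: plus_fun_def)
next
  case (comp P Q)
  then show ?case using assms(5)[of P Q] by (simp add: comp_def)
qed (use assms in auto)

lemma comp_plus_left: "(P + Q) \<cdot> R = P \<cdot> R + Q \<cdot> (R :: 'a \<Rightarrow> 'b)"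
  by (simp add: fun_eq_iff)

lemma comp_uminus_left: "(- P) \<cdot> R = - (P \<cdot> (R :: 'a \<Rightarrow> 'b))"
  by (simp add: fun_eq_iff)

lemma comp_diff_left: "(P - Q) \<cdot> R = P \<cdot> R - Q \<cdot> (R :: 'a \<Rightarrow> 'b)"
  by (simp add: fun_eq_iff)

lemma comp_sum_left: "(\<Sum>i\<in>I. P i) \<cdot> R = (\<Sum>i\<in>I. P i \<cdot> (R :: 'a \<Rightarrow> 'b))"
  by (simp add: fun_eq_iff sum_fun_apply)

lemma comp_zero_left: "0 \<cdot> R = (0 :: 'a \<Rightarrow> 'b::zero)"
  by (simp add: fun_eq_iff)

lemmas comp_left_simps = comp_plus_left comp_uminus_left comp_diff_left comp_sum_left comp_zero_left

locale open_set =
  fixes X :: "(complex ^ 'k::finite) set"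
  assumes open_X: "open X"
begin

abbreviation "M \<equiv> mult_op X"
abbreviation "D \<equiv> partial_op X"
abbreviation "I \<equiv> mult_op X (\<lambda>_. 1)"

lemma diff_op_regular: "P \<in> diff_op X \<Longrightarrow> h \<in> regular_fun X \<Longrightarrow> P h \<in> regular_fun X"
  by (induction arbitrary: h rule: diff_op_induct)
     (simp_all add: mult_op_apply regular_fun_mult regular_fun_add partial_op_regular open_X)

lemma diff_op_fun_add:
  assumes "P \<in> diff_op X" "f \<in> regular_fun X" "g \<in> regular_fun X"
  shows "P (f + g) = P f + P g"
  using assms
proof (induction arbitrary: f g rule: diff_op_induct)
  case (comp P Q)
  then show ?case by (simp add: diff_op_regular)
qed (simp_all add: mult_op_apply regular_fun_add partial_op_add open_X algebra_simps)

lemma diff_op_fun_0: "P \<in> diff_op X \<Longrightarrow> P 0 = 0"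
  using diff_op_fun_add[of P 0 0] by simp

lemma diff_op_nonregular: "P \<in> diff_op X \<Longrightarrow> h \<notin> regular_fun X \<Longrightarrow> P h = 0"
proof (induction rule: diff_op_induct)
  case (comp P Q)
  then show ?case using diff_op_fun_0[of P] by (simp del: zero_fun_apply)
qed (simp_all add: mult_op_nonregular partial_op_nonregular)

lemma diff_op_eqI:
  assumes "P \<in> diff_op X" "Q \<in> diff_op X" "\<And>h. h \<in> regular_fun X \<Longrightarrow> P h = Q h"
  shows "P = Q"
  using assms diff_op_nonregular by (metis ext)

lemma I_comp [simp]: "P \<in> diff_op X \<Longrightarrow> I \<cdot> P = P"
  and comp_I [simp]: "P \<in> diff_op X \<Longrightarrow> P \<cdot> I = P"
proof -
  have I: "I h = (if h \<in> regular_fun X then h else 0)" for h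
    by (auto simp: mult_op_def)
  assume P: "P \<in> diff_op X"
  show "I \<cdot> P = P"
  proof
    fix h show "(I \<cdot> P) h = P h"
      using P by (cases "h \<in> regular_fun X") (auto simp: I diff_op_regular diff_op_nonregular[OF P])
  qed
  show "P \<cdot> I = P"
    using P by (auto simp: fun_eq_iff I diff_op_nonregular[OF P] diff_op_fun_0[OF P])
qed

lemma diff_op_uminus:
  assumes "P \<in> diff_op X" shows "- P \<in> diff_op X"
proof -
  have "M (\<lambda>_. -1) \<cdot> P = - P"
  proof
    fix h show "(M (\<lambda>_. -1) \<cdot> P) h = (- P) h"
      using assms by (cases "h \<in> regular_fun X")
        (auto simp: mult_op_apply diff_op_regular diff_op_nonregular[OF assms] diff_op_fun_0[OF mult_op_diff_op[OF rational_at_const]] fun_eq_iff)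
  qed
  then show ?thesis
    using diff_op.comp[OF mult_op_diff_op[OF rational_at_const[of X _ "-1"]] assms] by metis
qed

lemma diff_op_minus: "P \<in> diff_op X \<Longrightarrow> Q \<in> diff_op X \<Longrightarrow> P - Q \<in> diff_op X"
  using diff_op_plus[OF _ diff_op_uminus] by fastforce

lemma diff_op_sum: "(\<And>i. i \<in> A \<Longrightarrow> P i \<in> diff_op X) \<Longrightarrow> sum P A \<in> diff_op X"
  by (induction A rule: infinite_finite_induct) (simp_all add: zero_diff_op diff_op_plus)

lemma comp_plus_right:
  assumes "R \<in> diff_op X" "P \<in> diff_op X" "Q \<in> diff_op X"
  shows "R \<cdot> (P + Q) = R \<cdot> P + R \<cdot> Q"
proof
  fix h show "(R \<cdot> (P + Q)) h = (R \<cdot> P + R \<cdot> Q) h"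
    using assms
    by (cases "h \<in> regular_fun X")
       (simp_all add: diff_op_fun_add[OF assms(1)] diff_op_regular diff_op_nonregular[OF assms(2)]
         diff_op_nonregular[OF assms(3)] diff_op_fun_0[OF assms(1)])
qed

lemma comp_zero_right: "R \<in> diff_op X \<Longrightarrow> R \<cdot> 0 = 0"
  by (simp add: fun_eq_iff diff_op_fun_0)

lemma comp_uminus_right:
  assumes "R \<in> diff_op X" "P \<in> diff_op X" shows "R \<cdot> (- P) = - (R \<cdot> P)"
  using comp_plus_right[OF assms diff_op_uminus[OF assms(2)]] comp_zero_right[OF assms(1)]
    minus_unique[of "R \<cdot> P" "R \<cdot> (- P)"] by (metis add.right_inverse)

lemma comp_diff_right:
  assumes "R \<in> diff_op X" "P \<in> diff_op X" "Q \<in> diff_op X"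
  shows "R \<cdot> (P - Q) = R \<cdot> P - R \<cdot> Q"
  using comp_plus_right[OF assms(1,2) diff_op_uminus[OF assms(3)]] comp_uminus_right[OF assms(1,3)] by simp

lemma comp_sum_right:
  assumes "R \<in> diff_op X" "\<And>i. i \<in> A \<Longrightarrow> P i \<in> diff_op X"
  shows "R \<cdot> sum P A = (\<Sum>i\<in>A. R \<cdot> P i)"
  using assms(2)
  by (induction A rule: infinite_finite_induct)
     (simp_all add: comp_zero_right assms(1) comp_plus_right diff_op_sum)

lemma M_comp:
  assumes "\<And>x. x \<in> X \<Longrightarrow> rational_at X x g"
  shows "M f \<cdot> M g = M (f * g)"
proof
  fix h
  have "M g h = g * h \<and> g * h \<in> regular_fun X" if "h \<in> regular_fun X"
    using assms that by (simp add: mult_op_apply regular_fun_mult_rational)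
  then show "(M f \<cdot> M g) h = M (f * g) h"
    by (cases "h \<in> regular_fun X") (auto simp: mult_op_apply mult_op_nonregular mult.assoc)
qed

lemma D_M:
  assumes "f \<in> regular_fun X"
  shows "D i \<cdot> M f = M (D i f) + M f \<cdot> D i"
proof
  fix h show "(D i \<cdot> M f) h = (M (D i f) + M f \<cdot> D i) h"
    using assms diff_op_fun_0[OF diff_op.partial]
    by (cases "h \<in> regular_fun X")
       (simp_all add: mult_op_apply mult_op_nonregular partial_op_mult open_X partial_op_regular partial_op_nonregular)
qed

text \<open>Proved algebraically: the commutator of two partial derivatives is a derivation that
  kills constants and coordinates, hence polynomials, hence their fractions. No second derivatives
  are computed.\<close>

lemma D_D: "D i \<cdot> D j = D j \<cdot> D i"
proof (rule diff_op_eqI)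
  have D0: "D k 0 = 0" for k by (rule diff_op_fun_0[OF diff_op.partial])
  define C where "C h = D i (D j h) - D j (D i h)" for h
  have C_mult: "C (f * g) = C f * g + f * C g" if "f \<in> regular_fun X" "g \<in> regular_fun X" for f g
    using that unfolding C_def
    by (simp add: partial_op_mult partial_op_add regular_fun_mult partial_op_regular open_X algebra_simps)
  have C_add: "C (f + g) = C f + C g" if "f \<in> regular_fun X" "g \<in> regular_fun X" for f g
    using that unfolding C_def by (simp add: partial_op_add partial_op_regular open_X)
  have C_poly: "C (zero_outside X P) = 0" if "P \<in> polynomial_fun" for P
    using that
  proof (induction rule: polynomial_fun.induct)
    case (const c)
    show ?case by (simp add: C_def partial_op_const open_X D0)
  next
    case (coord k)
    show ?case by (simp add: C_def partial_op_const partial_op_coord open_X D0)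
  next
    case (add f g)
    moreover have "zero_outside X f \<in> regular_fun X" "zero_outside X g \<in> regular_fun X"
      using add by (auto intro!: zero_outside_regular rational_at_polynomial)
    ultimately show ?case
      using zero_outside_add[of X f g] C_add by (simp del: pointwise_simps)
  next
    case (mult f g)
    moreover have "zero_outside X f \<in> regular_fun X" "zero_outside X g \<in> regular_fun X"
      using mult by (auto intro!: zero_outside_regular rational_at_polynomial)
    ultimately show ?case
      using zero_outside_mult[of X f g] C_mult by (simp del: pointwise_simps)
  qed
  fix h assume h: "h \<in> regular_fun X"
  have "C h x = 0" for x
  proof (cases "x \<in> X")
    case True
    then obtain P Q where PQ: "P \<in> polynomial_fun" "Q \<in> polynomial_fun" "Q x \<noteq> 0"
        "\<forall>y\<in>X. Q y \<noteq> 0 \<longrightarrow> h y = P y / Q y"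
      using regular_fun_rational_at[OF h] unfolding rational_at_def by blast
    have QQ: "(\<lambda>y. Q y * Q y) \<in> polynomial_fun" "(\<lambda>y. Q y * P y) \<in> polynomial_fun"
      using PQ by (auto intro: polynomial_fun.mult)
    \<comment> \<open>The extra factor \<open>Q\<close> makes both sides vanish where
      \<open>Q\<close> does; at such points nothing is known about \<open>P\<close>.\<close>
    have eq: "zero_outside X (\<lambda>y. Q y * Q y) * h = zero_outside X (\<lambda>y. Q y * P y)"
      using PQ(4) by (auto simp: fun_eq_iff zero_outside_def)
        (metis nonzero_mult_div_cancel_left times_divide_eq_right)
    have reg: "zero_outside X (\<lambda>y. Q y * Q y) \<in> regular_fun X"
      using QQ by (auto intro!: zero_outside_regular rational_at_polynomial)
    have "zero_outside X (\<lambda>y. Q y * Q y) * C h = 0"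
      using C_mult[OF reg h] C_poly[OF QQ(1)] C_poly[OF QQ(2)] eq by simp
    from fun_cong[OF this, of x] show ?thesis
      using PQ(3) True by (simp add: zero_outside_apply)
  next
    case False
    then show ?thesis by (simp add: C_def partial_op_def zero_outside_def)
  qed
  then have "C h = 0" by auto
  then show "(D i \<cdot> D j) h = (D j \<cdot> D i) h"
    by (simp add: C_def)
qed (auto intro: diff_op.comp diff_op.partial)

lemma carrier_D_ring [simp]: "carrier (D_ring X) = diff_op X"
  and mult_D_ring [simp]: "P \<otimes>\<^bsub>D_ring X\<^esub> Q = P \<cdot> Q"
  and one_D_ring [simp]: "\<one>\<^bsub>D_ring X\<^esub> = I"
  and add_D_ring [simp]: "P \<oplus>\<^bsub>D_ring X\<^esub> Q = P + Q"
  and zero_D_ring [simp]: "\<zero>\<^bsub>D_ring X\<^esub> = 0"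
  by (auto simp: D_ring_def fun_eq_iff)

lemma ring_D_ring: "ring (D_ring X)"
proof (rule ringI)
  show "abelian_group (D_ring X)"
  proof (rule abelian_groupI)
    fix P assume "P \<in> carrier (D_ring X)"
    then show "\<exists>Q\<in>carrier (D_ring X). Q \<oplus>\<^bsub>D_ring X\<^esub> P = \<zero>\<^bsub>D_ring X\<^esub>"
      by (intro bexI[of _ "- P"]) (auto intro: diff_op_uminus)
  qed (auto intro: diff_op_plus zero_diff_op simp: algebra_simps)
  show "Group.monoid (D_ring X)"
    by (rule monoidI) (auto intro: diff_op.comp one_diff_op simp: o_assoc)
qed (auto simp: comp_plus_left comp_plus_right)

sublocale DR: ring "D_ring X"
  by (rule ring_D_ring)

lemma uminus_D_ring [simp]: "P \<in> diff_op X \<Longrightarrow> \<ominus>\<^bsub>D_ring X\<^esub> P = - P"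
  by (rule DR.minus_equality) (auto intro: diff_op_uminus)

lemma minus_D_ring [simp]: "Q \<in> diff_op X \<Longrightarrow> P \<ominus>\<^bsub>D_ring X\<^esub> Q = P - Q"
  by (simp add: a_minus_def)

lemma finsum_D_ring:
  assumes "finite A" "\<And>i. i \<in> A \<Longrightarrow> P i \<in> diff_op X"
  shows "finsum (D_ring X) P A = sum P A"
  using assms
  by (induction A rule: finite_induct) (simp_all add: Pi_def)

subsection \<open>Normal form\<close>

text \<open>Multisets serve as multi-indices: this is the iterated partial derivative
  \<partial>^\<beta>. The fold is well behaved because partial derivatives commute.\<close>

definition dpow :: "'k multiset \<Rightarrow> ('k, 'k) operator" where
  "dpow \<beta> = fold_mset (\<lambda>i P. D i \<cdot> P) I \<beta>"

lemma dpow_empty [simp]: "dpow {#} = I"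
  by (simp add: dpow_def)

lemma dpow_add_mset: "dpow (add_mset i \<beta>) = D i \<cdot> dpow \<beta>"
proof -
  interpret comp_fun_commute "\<lambda>i (P :: ('k, 'k) operator). D i \<cdot> P"
  proof
    fix i j
    have "D i \<cdot> (D j \<cdot> P) = D j \<cdot> (D i \<cdot> P)" for P :: "('k, 'k) operator"
      by (metis D_D comp_assoc)
    then show "(\<lambda>P. D j \<cdot> P) \<cdot> (\<lambda>P. D i \<cdot> P) = (\<lambda>P. D i \<cdot> P) \<cdot> (\<lambda>P :: ('k, 'k) operator. D j \<cdot> P)"
      by (auto simp: fun_eq_iff)
  qed
  show ?thesis by (simp add: dpow_def)
qed

lemma dpow_diff_op: "dpow \<beta> \<in> diff_op X"
  by (induction \<beta>) (auto simp: dpow_add_mset simp del: o_apply intro: one_diff_op diff_op.comp diff_op.partial)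

lemma dpow_add_mset_right: "dpow (add_mset i \<beta>) = dpow \<beta> \<cdot> D i"
proof (induction \<beta>)
  case empty
  show ?case by (simp add: dpow_add_mset diff_op.partial)
next
  case (add j \<beta>)
  have "dpow (add_mset i (add_mset j \<beta>)) = dpow (add_mset j (add_mset i \<beta>))"
    by (simp add: add_mset_commute)
  then show ?case using add by (metis dpow_add_mset o_assoc)
qed

text \<open>The commutator of \<partial>^\<beta> with the coordinate \<open>i\<close> is \<beta>_i
  \<partial>^(\<beta> - e_i). If \<open>i\<close> does not occur in \<beta>, the truncated
  difference is multiplied by 0.\<close>

lemma dpow_coord:
  assumes "h \<in> regular_fun X"
  shows "dpow \<beta> (zero_outside X (\<lambda>y. y $ i) * h) =
    zero_outside X (\<lambda>y. y $ i) * dpow \<beta> h + of_nat (count \<beta> i) * dpow (\<beta> - {#i#}) h"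
proof (induction \<beta>)
  case empty
  have "I h = h" "I (zero_outside X (\<lambda>y. y $ i) * h) = zero_outside X (\<lambda>y. y $ i) * h"
    using assms by (simp_all add: mult_op_def regular_fun_mult regular_coord fun_eq_iff)
  then have "dpow {#} (zero_outside X (\<lambda>y. y $ i) * h) =
    zero_outside X (\<lambda>y. y $ i) * dpow {#} h + of_nat (count {#} i) * dpow ({#} - {#i#}) h"
    by simp
  then show ?case .
next
  case (add j \<beta>)
  have reg: "dpow \<gamma> h \<in> regular_fun X" for \<gamma>
    by (rule diff_op_regular[OF dpow_diff_op assms])
  have regn: "of_nat n * dpow \<gamma> h \<in> regular_fun X" for n \<gamma>
    using regular_fun_mult_rational(1)[OF reg rational_at_const] by (simp add: of_nat_fun)
  have Dn: "D j (of_nat n * f) = of_nat n * D j f" if "f \<in> regular_fun X" for n f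
  proof -
    have "of_nat n * f = zero_outside X (\<lambda>_. of_nat n) * f"
      using that by (auto simp: fun_eq_iff zero_outside_def regular_fun_outside)
    then have "D j (of_nat n * f) = zero_outside X (\<lambda>_. of_nat n) * D j f"
      using that by (simp add: partial_op_mult partial_op_const open_X regular_fun_const)
    then show ?thesis
      using regular_fun_outside[OF partial_op_regular[OF open_X that]]
      by (auto simp: fun_eq_iff zero_outside_def)
  qed
  have "dpow (add_mset j \<beta>) (zero_outside X (\<lambda>y. y $ i) * h) =
      D j (zero_outside X (\<lambda>y. y $ i)) * dpow \<beta> h + zero_outside X (\<lambda>y. y $ i) * dpow (add_mset j \<beta>) h
      + of_nat (count \<beta> i) * D j (dpow (\<beta> - {#i#}) h)"
    by (simp add: dpow_add_mset add partial_op_add partial_op_mult open_X reg regn regular_coord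
        regular_fun_mult Dn del: plus_fun_apply times_fun_apply of_nat_fun_apply)
  moreover have "D j (zero_outside X (\<lambda>y. y $ i)) * dpow \<beta> h = (if i = j then dpow \<beta> h else 0)"
    using regular_fun_outside[OF reg] unfolding partial_op_coord[OF open_X]
    by (auto simp: fun_eq_iff zero_outside_def)
  moreover have "of_nat (count \<beta> i) * D j (dpow (\<beta> - {#i#}) h) =
      of_nat (count \<beta> i) * dpow (add_mset j \<beta> - {#i#}) h" if "i \<noteq> j"
    using that by (simp add: dpow_add_mset[symmetric, THEN fun_cong, unfolded o_apply])
  moreover have "of_nat (count \<beta> i) * D j (dpow (\<beta> - {#i#}) h) = of_nat (count \<beta> i) * dpow \<beta> h" if "i = j"
  proof (cases "i \<in># \<beta>")
    case True
    then have "D j (dpow (\<beta> - {#i#}) h) = dpow \<beta> h"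
      using that dpow_add_mset[of i "\<beta> - {#i#}"] by (simp add: fun_eq_iff)
    then show ?thesis by simp
  qed (simp add: not_in_iff)
  ultimately show ?case by (auto simp: algebra_simps simp del: pointwise_simps of_nat_fun_apply)
qed

end

section \<open>Additive maps prescribed on a direct sum\<close>

text \<open>Only nonempty sums are formed. The generating sets used below contain 0 and negatives,
  so the result is the additive subgroup they generate, with fewer cases in inductions.\<close>

inductive_set add_span :: "'a::ab_group_add set \<Rightarrow> 'a set" for G where
  base: "x \<in> G \<Longrightarrow> x \<in> add_span G"
| add: "x \<in> add_span G \<Longrightarrow> y \<in> add_span G \<Longrightarrow> x + y \<in> add_span G"

definition additive_set :: "'c::ab_group_add set \<Rightarrow> bool" where
  "additive_set J \<longleftrightarrow> 0 \<in> J \<and> (\<forall>x\<in>J. \<forall>y\<in>J. x - y \<in> J)"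

lemma additive_setD:
  assumes "additive_set J"
  shows "0 \<in> J" "x \<in> J \<Longrightarrow> y \<in> J \<Longrightarrow> x - y \<in> J" "x \<in> J \<Longrightarrow> - x \<in> J" "x \<in> J \<Longrightarrow> y \<in> J \<Longrightarrow> x + y \<in> J"
proof -
  show 0: "0 \<in> J" and d: "\<And>x y. x \<in> J \<Longrightarrow> y \<in> J \<Longrightarrow> x - y \<in> J"
    using assms by (auto simp: additive_set_def)
  show u: "- x \<in> J" if "x \<in> J" for x using d[OF 0 that] by simp
  show "x + y \<in> J" if "x \<in> J" "y \<in> J" using d[OF that(1) u[OF that(2)]] by simp
qed

text \<open>The universal property of a direct sum of copies of \<open>R\<close>:
  \<open>unique\<close> says that the sum of the images of the \<open>e i\<close> is direct, so
  additive values on the summands extend to a well-defined additive \<open>L\<close>. It serves for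
  transfer operators, for functions on the line times the base and for functions on the torus
  fibration.\<close>

lemma additive_extend:
  fixes e :: "'i \<Rightarrow> 'r::ab_group_add \<Rightarrow> 'f::ab_group_add" and G :: "'i \<Rightarrow> 'r \<Rightarrow> 'n::ab_group_add"
  assumes R: "additive_set R"
    and e_add: "\<And>i a b. a \<in> R \<Longrightarrow> b \<in> R \<Longrightarrow> e i (a + b) = e i a + e i b"
    and G_add: "\<And>i a b. a \<in> R \<Longrightarrow> b \<in> R \<Longrightarrow> G i (a + b) = G i a + G i b"
    and unique: "\<And>B c i. finite B \<Longrightarrow> (\<And>i. c i \<in> R) \<Longrightarrow> (\<Sum>i\<in>B. e i (c i)) = 0 \<Longrightarrow> i \<in> B \<Longrightarrow> c i = 0"
  obtains L where "\<And>x y. x \<in> add_span {e i r | i r. r \<in> R} \<Longrightarrow> y \<in> add_span {e i r | i r. r \<in> R} \<Longrightarrow> L (x + y) = L x + L y"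
    and "\<And>i r. r \<in> R \<Longrightarrow> L (e i r) = G i r"
proof -
  \<comment> \<open>Coefficients are total and vanish off the support, so that two representations
    can be compared on the union of their supports.\<close>
  define nf where "nf B c \<longleftrightarrow> finite B \<and> (\<forall>i. c i \<in> R) \<and> (\<forall>i. i \<notin> B \<longrightarrow> c i = 0)" for B :: "'i set" and c
  define rel where "rel x N \<longleftrightarrow> (\<exists>B c. nf B c \<and> x = (\<Sum>i\<in>B. e i (c i)) \<and> N = (\<Sum>i\<in>B. G i (c i)))" for x N
  note RD = additive_setD[OF R]
  have e0: "e i 0 = 0" and G0: "G i 0 = 0" for i using e_add[of 0 0 i] G_add[of 0 0 i] RD(1) by simp_all
  have em: "e i (- r) = - e i r" and Gm: "G i (- r) = - G i r" if r: "r \<in> R" for i r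
    using e_add[OF r RD(3)[OF r], of i] G_add[OF r RD(3)[OF r], of i] e0 G0 by (simp_all add: add_eq_0_iff)
  have extend: "(\<Sum>i\<in>B'. h i (c i)) = (\<Sum>i\<in>B. h i (c i))" if "nf B c" "finite B'" "B \<subseteq> B'" "\<And>i. h i 0 = 0"
    for B B' c and h :: "'i \<Rightarrow> 'r \<Rightarrow> 'c::comm_monoid_add"
    using that by (intro sum.mono_neutral_right) (auto simp: nf_def)
  have add: "rel (x + y) (M + N)" if MN: "rel x M" "rel y N" for x y M N
  proof -
    obtain B c B' c' where 1: "nf B c" "x = (\<Sum>i\<in>B. e i (c i))" "M = (\<Sum>i\<in>B. G i (c i))"
      and 2: "nf B' c'" "y = (\<Sum>i\<in>B'. e i (c' i))" "N = (\<Sum>i\<in>B'. G i (c' i))"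
      using MN unfolding rel_def by blast
    have fin: "finite (B \<union> B')" using 1(1) 2(1) by (simp add: nf_def)
    have "x = (\<Sum>i\<in>B \<union> B'. e i (c i))" "y = (\<Sum>i\<in>B \<union> B'. e i (c' i))"
      "M = (\<Sum>i\<in>B \<union> B'. G i (c i))" "N = (\<Sum>i\<in>B \<union> B'. G i (c' i))"
      using extend[OF 1(1) fin, of e] extend[OF 2(1) fin, of e] extend[OF 1(1) fin, of G] extend[OF 2(1) fin, of G] 1 2
      by (simp_all add: e0 G0)
    moreover have "nf (B \<union> B') (\<lambda>i. c i + c' i)" using 1(1) 2(1) by (auto simp: nf_def RD)
    ultimately show ?thesis using 1(1) 2(1) unfolding rel_def
      by (intro exI[of _ "B \<union> B'"] exI[of _ "\<lambda>i. c i + c' i"]) (simp add: nf_def e_add G_add sum.distrib)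
  qed
  have uminus: "rel (- x) (- N)" if xN: "rel x N" for x N
  proof -
    obtain B c where 1: "nf B c" "x = (\<Sum>i\<in>B. e i (c i))" "N = (\<Sum>i\<in>B. G i (c i))"
      using xN unfolding rel_def by blast
    then show ?thesis unfolding rel_def
      by (intro exI[of _ B] exI[of _ "\<lambda>i. - c i"]) (simp add: nf_def RD em Gm sum_negf)
  qed
  have zero: "N = 0" if rN: "rel 0 N" for N
  proof -
    obtain B c where 1: "nf B c" "0 = (\<Sum>i\<in>B. e i (c i))" "N = (\<Sum>i\<in>B. G i (c i))"
      using rN unfolding rel_def by blast
    have "c i = 0" if "i \<in> B" for i
      by (rule unique[OF _ _ 1(2)[symmetric] that]) (use 1(1) in \<open>auto simp: nf_def\<close>)
    then show ?thesis by (simp add: 1(3) G0)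
  qed
  have base: "rel (e i r) (G i r)" if "r \<in> R" for i r
    unfolding rel_def using that RD(1)
    by (intro exI[of _ "{i}"] exI[of _ "\<lambda>j. if j = i then r else 0"]) (simp add: nf_def)
  have ex: "\<exists>N. rel x N" if "x \<in> add_span {e i r | i r. r \<in> R}" for x
    using that by (induction rule: add_span.induct) (use base add in blast)+
  have func: "M = N" if "rel x M" "rel x N" for x M N
    using zero[of "M - N"] add[OF that(1) uminus[OF that(2)]] by simp
  define L where "L x = (THE N. rel x N)" for x
  have L_eq: "L x = N" if "rel x N" for x N
    unfolding L_def using that func by (intro the_equality) auto
  show ?thesis
  proof
    fix x y assume "x \<in> add_span {e i r | i r. r \<in> R}" "y \<in> add_span {e i r | i r. r \<in> R}"
    then obtain M N where "rel x M" "rel y N" using ex by blast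
    then show "L (x + y) = L x + L y" using L_eq add by simp
  next
    show "L (e i r) = G i r" if "r \<in> R" for i r by (rule L_eq[OF base[OF that]])
  qed
qed

lemma additive_set_regular: "additive_set (regular_fun X)"
  by (simp add: additive_set_def regular_fun_diff)

context open_set
begin

text \<open>The span of normal forms is stable under left composition with every operator, by
  induction on that operator, and it contains the identity.\<close>

lemma diff_op_span:
  assumes "P \<in> diff_op X"
  shows "P \<in> add_span {M c \<cdot> dpow \<beta> | c \<beta>. c \<in> regular_fun X}" (is "P \<in> ?S")
proof -
  have S: "R \<in> diff_op X" if "R \<in> ?S" for R
    using that by (induction rule: add_span.induct)
      (auto intro: diff_op.comp diff_op.mult dpow_diff_op diff_op_plus simp del: pointwise_simps)
  have "P \<cdot> R \<in> ?S" if "R \<in> ?S" for R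
    using assms that
  proof (induction arbitrary: R rule: diff_op_induct)
    case (mult f)
    from mult(2,1) show ?case
    proof (induction rule: add_span.induct)
      case (base R)
      then obtain c \<beta> where "R = M c \<cdot> dpow \<beta>" "c \<in> regular_fun X" by blast
      then have "M f \<cdot> R = M (f * c) \<cdot> dpow \<beta>" "f * c \<in> regular_fun X"
        using base by (simp_all add: o_assoc M_comp regular_fun_rational_at regular_fun_mult)
      then show ?case by (auto intro: add_span.base)
    next
      case (add R R')
      then show ?case by (simp add: comp_plus_right S diff_op.mult add_span.add del: pointwise_simps)
    qed
  next
    case (partial i)
    then show ?case
    proof (induction rule: add_span.induct)
      case (base R)
      then obtain c \<beta> where c: "R = M c \<cdot> dpow \<beta>" "c \<in> regular_fun X" by blast
      from c have "D i \<cdot> R = M (D i c) \<cdot> dpow \<beta> + M c \<cdot> dpow (add_mset i \<beta>)"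
        by (simp add: o_assoc D_M comp_plus_left dpow_add_mset)
      moreover have "M (D i c) \<cdot> dpow \<beta> \<in> ?S" "M c \<cdot> dpow (add_mset i \<beta>) \<in> ?S"
        using c(2) partial_op_regular[OF open_X c(2)] by (blast intro: add_span.base)+
      ultimately have "D i \<cdot> R \<in> ?S" by (simp only: add_span.add)
      then show ?case .
    next
      case (add R R')
      then show ?case by (simp add: comp_plus_right S diff_op.partial add_span.add del: pointwise_simps)
    qed
  next
    case (add P Q)
    then show ?case by (simp add: comp_plus_left add_span.add del: pointwise_simps)
  next
    case (comp P Q)
    then show ?case by (simp add: comp_assoc del: pointwise_simps)
  qed
  moreover have "I \<in> ?S"
    using regular_fun_const[of X 1]
    by (intro add_span.base CollectI exI[of _ "zero_outside X (\<lambda>_. 1)"] exI[of _ "{#}"])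
       (simp add: mult_op_zero_outside one_diff_op)
  ultimately have "P \<cdot> I \<in> ?S" by blast
  then show ?thesis by (simp only: comp_I[OF assms])
qed

end

section \<open>Transfer operators along a regular map\<close>

text \<open>The elementary tensor \<phi> \<otimes> Q of the transfer bimodule, realised as an
  operator.\<close>

definition pull :: "('x \<Rightarrow> 'y) \<Rightarrow> ('x \<Rightarrow> complex) \<Rightarrow> ('h \<Rightarrow> 'y \<Rightarrow> complex) \<Rightarrow> 'h \<Rightarrow> 'x \<Rightarrow> complex" where
  "pull F \<phi> Q = (\<lambda>h x. \<phi> x * Q h (F x))"

lemma pull_apply: "pull F \<phi> Q h x = \<phi> x * Q h (F x)"
  by (simp add: pull_def)

lemma pull_add_left: "pull F (\<phi> + \<psi>) Q = pull F \<phi> Q + pull F \<psi> Q"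
  and pull_uminus_left: "pull F (- \<phi>) Q = - pull F \<phi> Q"
  and pull_zero_left: "pull F 0 Q = 0"
  and pull_add_right: "pull F \<phi> (Q + R) = pull F \<phi> Q + pull F \<phi> R"
  and pull_comp: "pull F \<phi> Q \<cdot> S = pull F \<phi> (Q \<cdot> S)"
  by (auto simp: pull_apply fun_eq_iff algebra_simps)

locale regular_map = X: open_set X + Y: open_set Y
  for X :: "(complex ^ 'k::finite) set" and Y :: "(complex ^ 'l::finite) set" +
  fixes F :: "complex ^ 'k \<Rightarrow> complex ^ 'l"
  assumes F_in: "x \<in> X \<Longrightarrow> F x \<in> Y"
    and F_rational: "x \<in> X \<Longrightarrow> rational_at X x (\<lambda>y. F y $ j)"
begin

lemma compose_regular:
  assumes "\<phi> \<in> regular_fun X" "h \<in> regular_fun Y"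
  shows "(\<lambda>x. \<phi> x * h (F x)) \<in> regular_fun X"
proof -
  have "\<phi> * zero_outside X (\<lambda>x. h (F x)) \<in> regular_fun X"
    using assms F_in F_rational by (intro regular_fun_mult regular_fun_compose[where Y = Y])
  moreover have "\<phi> * zero_outside X (\<lambda>x. h (F x)) = (\<lambda>x. \<phi> x * h (F x))"
    using assms by (auto simp: fun_eq_iff zero_outside_def regular_fun_outside)
  ultimately show ?thesis by simp
qed

lemma transfer_induct [consumes 1, case_names pull add]:
  assumes "T \<in> transfer_op X Y F"
    and "\<And>\<phi> Q. \<phi> \<in> regular_fun X \<Longrightarrow> Q \<in> diff_op Y \<Longrightarrow> C (pull F \<phi> Q)"
    and "\<And>S T. S \<in> transfer_op X Y F \<Longrightarrow> T \<in> transfer_op X Y F \<Longrightarrow> C S \<Longrightarrow> C T \<Longrightarrow> C (S + T)"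
  shows "C T"
  using assms(1) by induction (use assms(2-) in \<open>simp_all add: pull_def plus_fun_def\<close>)

lemma transfer_regular: "T \<in> transfer_op X Y F \<Longrightarrow> h \<in> regular_fun Y \<Longrightarrow> T h \<in> regular_fun X"
  by (induction rule: transfer_induct)
     (simp_all add: pull_def compose_regular Y.diff_op_regular regular_fun_add)

lemma transfer_nonregular: "T \<in> transfer_op X Y F \<Longrightarrow> h \<notin> regular_fun Y \<Longrightarrow> T h = 0"
  by (induction rule: transfer_induct) (auto simp: fun_eq_iff pull_apply Y.diff_op_nonregular[THEN fun_cong])

lemma transfer_plus: "S \<in> transfer_op X Y F \<Longrightarrow> T \<in> transfer_op X Y F \<Longrightarrow> S + T \<in> transfer_op X Y F"
  using transfer_op.add[of S X Y F T] by (simp add: plus_fun_def)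

lemma transfer_pull: "\<phi> \<in> regular_fun X \<Longrightarrow> Q \<in> diff_op Y \<Longrightarrow> pull F \<phi> Q \<in> transfer_op X Y F"
  unfolding pull_def by (rule transfer_op.tensor)

lemma transfer_fun_add:
  assumes "T \<in> transfer_op X Y F" "f \<in> regular_fun Y" "g \<in> regular_fun Y"
  shows "T (f + g) = T f + T g"
  using assms(1)
proof (induction rule: transfer_induct)
  case (pull \<phi> Q)
  have "pull F \<phi> Q (f + g) = pull F \<phi> Q f + pull F \<phi> Q g"
    using Y.diff_op_fun_add[OF pull(2) assms(2,3)] by (simp add: pull_def plus_fun_def distrib_left)
  then show ?case .
next
  case (add S T)
  then show ?case by (simp add: algebra_simps)
qed

lemma transfer_fun_0: "T \<in> transfer_op X Y F \<Longrightarrow> T 0 = 0"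
  using transfer_fun_add[of T 0 0] by simp

lemma transfer_comp_right:
  "T \<in> transfer_op X Y F \<Longrightarrow> Q \<in> diff_op Y \<Longrightarrow> T \<cdot> Q \<in> transfer_op X Y F"
  by (induction rule: transfer_induct)
     (auto simp: pull_comp comp_plus_left intro: transfer_pull diff_op.comp transfer_plus)

lemma transfer_comp_plus_right:
  assumes "T \<in> transfer_op X Y F" "P \<in> diff_op Y" "Q \<in> diff_op Y"
  shows "T \<cdot> (P + Q) = T \<cdot> P + T \<cdot> Q"
proof
  fix h show "(T \<cdot> (P + Q)) h = (T \<cdot> P + T \<cdot> Q) h"
    using assms by (cases "h \<in> regular_fun Y")
      (simp_all add: transfer_fun_add[OF assms(1)] transfer_fun_0[OF assms(1)] Y.diff_op_regular
        Y.diff_op_nonregular[OF assms(2)] Y.diff_op_nonregular[OF assms(3)])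
qed

lemma transfer_comp_I: "T \<in> transfer_op X Y F \<Longrightarrow> T \<cdot> Y.I = T"
  by (induction rule: transfer_induct) (simp_all add: pull_comp comp_plus_left del: pointwise_simps)

lemma M_pull:
  assumes "\<phi> \<in> regular_fun X" "Q \<in> diff_op Y"
  shows "X.M f \<cdot> pull F \<phi> Q = pull F (f * \<phi>) Q"
proof
  fix h
  have "pull F \<phi> Q h \<in> regular_fun X"
    using transfer_regular[OF transfer_pull[OF assms]] transfer_nonregular[OF transfer_pull[OF assms]]
    by (cases "h \<in> regular_fun Y") auto
  then show "(X.M f \<cdot> pull F \<phi> Q) h = pull F (f * \<phi>) Q h"
    by (simp add: mult_op_apply pull_apply fun_eq_iff)
qed

lemma pull_M:
  assumes "Q \<in> diff_op Y"
  shows "pull F \<phi> (Y.M f \<cdot> Q) = pull F (\<lambda>x. \<phi> x * f (F x)) Q"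
proof
  fix h
  have "Q h \<in> regular_fun Y"
    using Y.diff_op_regular[OF assms] Y.diff_op_nonregular[OF assms]
    by (cases "h \<in> regular_fun Y") auto
  then show "pull F \<phi> (Y.M f \<cdot> Q) h = pull F (\<lambda>x. \<phi> x * f (F x)) Q h"
    by (simp add: mult_op_apply pull_apply fun_eq_iff)
qed

lemma partial_compose:
  assumes "h \<in> regular_fun Y"
  shows "X.D i (zero_outside X (\<lambda>x. h (F x))) =
    (\<lambda>x. \<Sum>j\<in>UNIV. Y.D j h (F x) * X.D i (zero_outside X (\<lambda>x. F x $ j)) x)"
proof
  fix x
  show "X.D i (zero_outside X (\<lambda>x. h (F x))) x =
    (\<Sum>j\<in>UNIV. Y.D j h (F x) * X.D i (zero_outside X (\<lambda>x. F x $ j)) x)"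
  proof (cases "x \<in> X")
    case True
    have reg: "zero_outside X (\<lambda>x. F x $ j) \<in> regular_fun X" for j
      by (intro zero_outside_regular F_rational)
    have "has_gradient (\<lambda>x. F x $ j) (\<lambda>i. X.D i (zero_outside X (\<lambda>x. F x $ j)) x) x" for j
      by (rule has_gradient_cong[OF regular_fun_gradient[OF X.open_X reg True] X.open_X True])
         (simp add: zero_outside_apply)
    then have "has_gradient (\<lambda>x. h (F x))
        (\<lambda>i. \<Sum>j\<in>UNIV. Y.D j h (F x) * X.D i (zero_outside X (\<lambda>x. F x $ j)) x) x"
      using regular_fun_gradient[OF Y.open_X assms F_in[OF True]] by (rule has_gradient_compose[rotated])
    then have "has_gradient (zero_outside X (\<lambda>x. h (F x)))
        (\<lambda>i. \<Sum>j\<in>UNIV. Y.D j h (F x) * X.D i (zero_outside X (\<lambda>x. F x $ j)) x) x"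
      by (rule has_gradient_cong[OF _ X.open_X True]) (simp add: zero_outside_apply)
    moreover have "zero_outside X (\<lambda>x. h (F x)) \<in> regular_fun X"
      using assms F_in F_rational by (intro regular_fun_compose[where Y = Y])
    ultimately show ?thesis using True by (simp add: partial_op_apply)
  next
    case False
    then have "X.D i g x = 0" for g by (simp add: partial_op_def zero_outside_def)
    then show ?thesis by simp
  qed
qed

text \<open>The chain rule in operator form; it is the left action of a coordinate vector field on
  \<phi> \<otimes> Q in the transfer bimodule.\<close>

lemma D_pull:
  assumes "\<phi> \<in> regular_fun X" "Q \<in> diff_op Y"
  shows "X.D i \<cdot> pull F \<phi> Q = pull F (X.D i \<phi>) Q
    + (\<Sum>j\<in>UNIV. pull F (\<phi> * X.D i (zero_outside X (\<lambda>x. F x $ j))) (Y.D j \<cdot> Q))"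
proof
  fix h
  show "(X.D i \<cdot> pull F \<phi> Q) h = (pull F (X.D i \<phi>) Q
    + (\<Sum>j\<in>UNIV. pull F (\<phi> * X.D i (zero_outside X (\<lambda>x. F x $ j))) (Y.D j \<cdot> Q))) h"
  proof (cases "h \<in> regular_fun Y")
    case True
    define k where "k = Q h"
    have k: "k \<in> regular_fun Y" using Y.diff_op_regular[OF assms(2) True] by (simp add: k_def)
    have "zero_outside X (\<lambda>x. k (F x)) \<in> regular_fun X"
      using k F_in F_rational by (intro regular_fun_compose[where Y = Y])
    moreover have "pull F \<phi> Q h = \<phi> * zero_outside X (\<lambda>x. k (F x))"
      using assms by (auto simp: fun_eq_iff zero_outside_def regular_fun_outside pull_apply k_def)
    ultimately have "X.D i (pull F \<phi> Q h) = X.D i \<phi> * zero_outside X (\<lambda>x. k (F x)) +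
        \<phi> * (\<lambda>x. \<Sum>j\<in>UNIV. Y.D j k (F x) * X.D i (zero_outside X (\<lambda>x. F x $ j)) x)"
      using assms by (simp add: partial_op_mult X.open_X partial_compose[OF k])
    moreover have "X.D i \<phi> * zero_outside X (\<lambda>x. k (F x)) = (\<lambda>x. X.D i \<phi> x * k (F x))"
      using regular_fun_outside[OF partial_op_regular[OF X.open_X assms(1)]]
      by (auto simp: fun_eq_iff zero_outside_def)
    ultimately have "X.D i (pull F \<phi> Q h) = (\<lambda>x. X.D i \<phi> x * k (F x) +
        \<phi> x * (\<Sum>j\<in>UNIV. Y.D j k (F x) * X.D i (zero_outside X (\<lambda>x. F x $ j)) x))"
      by (simp add: fun_eq_iff)
    then show ?thesis
      by (simp add: fun_eq_iff pull_apply k_def sum_fun_apply sum_distrib_left mult.assoc mult.left_commute mult.commute)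
  next
    case False
    have z: "pull F \<psi> Q h = 0" for \<psi> by (simp add: pull_apply fun_eq_iff False Y.diff_op_nonregular[OF assms(2)])
    have "pull F \<psi> (Y.D j \<cdot> Q) h = 0" for \<psi> j
      by (simp add: pull_apply fun_eq_iff False Y.diff_op_nonregular[OF diff_op.comp[OF diff_op.partial assms(2)], simplified])
    then show ?thesis
      by (simp add: sum_fun_apply z X.diff_op_fun_0[OF diff_op.partial])
  qed
qed

lemma transfer_sum: 
  assumes "\<And>i. i \<in> A \<Longrightarrow> T i \<in> transfer_op X Y F" shows "sum T A \<in> transfer_op X Y F"
proof -
  have "0 \<in> transfer_op X Y F"
    using transfer_pull[OF regular_fun_0 zero_diff_op] by (simp add: pull_zero_left)
  with assms show ?thesis
    by (induction A rule: infinite_finite_induct) (simp_all add: transfer_plus)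
qed

lemma transfer_comp_left:
  assumes "P \<in> diff_op X" "T \<in> transfer_op X Y F"
  shows "P \<cdot> T \<in> transfer_op X Y F"
  using assms
proof (induction arbitrary: T rule: diff_op_induct)
  case (mult f)
  from mult(2,1) show ?case
  proof (induction rule: transfer_induct)
    case (pull \<phi> Q)
    then show ?case by (simp add: M_pull transfer_pull regular_fun_mult)
  next
    case (add S T)
    moreover have "X.M f \<cdot> (S + T) = X.M f \<cdot> S + X.M f \<cdot> T"
    proof
      fix h show "(X.M f \<cdot> (S + T)) h = (X.M f \<cdot> S + X.M f \<cdot> T) h"
        using add by (cases "h \<in> regular_fun Y")
         (simp_all add: X.diff_op_fun_add[OF diff_op.mult] transfer_regular transfer_nonregular[OF add(1)]
            transfer_nonregular[OF add(2)] X.diff_op_fun_0[OF diff_op.mult])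
    qed
    ultimately show ?case by (simp add: transfer_plus del: pointwise_simps)
  qed
next
  case (partial i)
  then show ?case
  proof (induction rule: transfer_induct)
    case (pull \<phi> Q)
    have "zero_outside X (\<lambda>x. F x $ j) \<in> regular_fun X" for j
      by (intro zero_outside_regular F_rational)
    with pull show ?case
      unfolding D_pull[OF pull] by (intro transfer_plus transfer_sum transfer_pull regular_fun_mult)
        (auto intro: partial_op_regular X.open_X diff_op.comp diff_op.partial)
  next
    case (add S T)
    moreover have "X.D i \<cdot> (S + T) = X.D i \<cdot> S + X.D i \<cdot> T"
    proof
      fix h show "(X.D i \<cdot> (S + T)) h = (X.D i \<cdot> S + X.D i \<cdot> T) h"
        using add by (cases "h \<in> regular_fun Y")
         (simp_all add: partial_op_add X.open_X transfer_regular transfer_nonregular[OF add(1)]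
            transfer_nonregular[OF add(2)] X.diff_op_fun_0[OF diff_op.partial])
    qed
    ultimately show ?case by (simp add: transfer_plus del: pointwise_simps)
  qed
next
  case (add P Q)
  then show ?case by (simp add: comp_plus_left transfer_plus del: pointwise_simps)
next
  case (comp P Q)
  then show ?case by (simp add: comp_assoc del: pointwise_simps)
qed

lemma comp_transfer_plus:
  assumes "P \<in> diff_op X" "S \<in> transfer_op X Y F" "T \<in> transfer_op X Y F"
  shows "P \<cdot> (S + T) = P \<cdot> S + P \<cdot> T"
proof
  fix h show "(P \<cdot> (S + T)) h = (P \<cdot> S + P \<cdot> T) h"
    using assms by (cases "h \<in> regular_fun Y")
      (simp_all add: X.diff_op_fun_add[OF assms(1)] X.diff_op_fun_0[OF assms(1)] transfer_regular
        transfer_nonregular[OF assms(2)] transfer_nonregular[OF assms(3)])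
qed

lemma transfer_span:
  assumes "T \<in> transfer_op X Y F"
  shows "T \<in> add_span {pull F \<phi> (Y.dpow \<beta>) | \<phi> \<beta>. \<phi> \<in> regular_fun X}"
  using assms
proof (induction rule: transfer_induct)
  case (pull \<phi> Q)
  from Y.diff_op_span[OF pull(2)] show ?case
  proof (induction rule: add_span.induct)
    case (base Q)
    then obtain c \<beta> where "Q = Y.M c \<cdot> Y.dpow \<beta>" "c \<in> regular_fun Y" by blast
    then show ?case using pull(1) compose_regular
      by (auto simp: pull_M Y.dpow_diff_op simp del: o_apply intro!: add_span.base)
  next
    case (add Q R)
    then show ?case by (simp add: pull_add_right add_span.add del: pointwise_simps)
  qed
qed (rule add_span.add)

lemma transfer_span_induct [consumes 1, case_names pull add]:
  assumes "T \<in> transfer_op X Y F"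
    and "\<And>\<phi> \<beta>. \<phi> \<in> regular_fun X \<Longrightarrow> C (pull F \<phi> (Y.dpow \<beta>))"
    and "\<And>S T. S \<in> transfer_op X Y F \<Longrightarrow> T \<in> transfer_op X Y F \<Longrightarrow> C S \<Longrightarrow> C T \<Longrightarrow> C (S + T)"
  shows "C T"
proof -
  from transfer_span[OF assms(1)] have "C T \<and> T \<in> transfer_op X Y F"
  proof (induction rule: add_span.induct)
    case (base x)
    then show ?case using assms(2) transfer_pull Y.dpow_diff_op by blast
  next
    case (add x y)
    then show ?case using assms(3) transfer_plus by blast
  qed
  then show ?thesis ..
qed

text \<open>The commutator with a coordinate function lowers the order, which gives an induction.\<close>

lemma normal_form_unique:
  assumes "finite B" "\<And>\<beta>. \<beta> \<in> B \<Longrightarrow> c \<beta> \<in> regular_fun X"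
    and "\<And>h. h \<in> regular_fun Y \<Longrightarrow> (\<Sum>\<beta>\<in>B. pull F (c \<beta>) (Y.dpow \<beta>)) h = 0"
    and "\<beta> \<in> B"
  shows "c \<beta> = 0"
proof -
  have "\<forall>B c. finite B \<longrightarrow> (\<forall>\<beta>\<in>B. size \<beta> < n) \<longrightarrow> (\<forall>\<beta>\<in>B. c \<beta> \<in> regular_fun X) \<longrightarrow>
     (\<forall>h\<in>regular_fun Y. (\<Sum>\<beta>\<in>B. pull F (c \<beta>) (Y.dpow \<beta>)) h = 0) \<longrightarrow> (\<forall>\<beta>\<in>B. c \<beta> = 0)" for n
  proof (induction n)
    case 0
    then show ?case by auto
  next
    case (Suc n)
    show ?case
    proof (intro allI impI)
      fix B :: "'l multiset set" and c
      assume fin: "finite B" and sz: "\<forall>\<beta>\<in>B. size \<beta> < Suc n" and c: "\<forall>\<beta>\<in>B. c \<beta> \<in> regular_fun X"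
        and z: "\<forall>h\<in>regular_fun Y. (\<Sum>\<beta>\<in>B. pull F (c \<beta>) (Y.dpow \<beta>)) h = 0"
      have c_in: "c \<beta> = 0" if \<beta>: "\<beta> \<in> B" "i \<in># \<beta>" for \<beta> i
      proof -
        define B' where "B' = {\<beta>\<in>B. i \<in># \<beta>}"
        \<comment> \<open>Coefficients of the commutator with the coordinate \<open>i\<close>: the
          term \<gamma> comes from \<gamma> + e_i, with the multiplicity of \<open>i\<close> in
          \<gamma> + e_i as factor.\<close>
        define c' where "c' \<gamma> = of_nat (Suc (count \<gamma> i)) * c (add_mset i \<gamma>)" for \<gamma>
        have inj: "inj_on (\<lambda>\<beta>. \<beta> - {#i#}) B'"
          by (rule inj_on_inverseI[where g = "add_mset i"]) (simp add: B'_def)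
        have "\<forall>\<gamma>\<in>(\<lambda>\<beta>. \<beta> - {#i#}) ` B'. c' \<gamma> = 0"
        proof (rule Suc.IH[rule_format, THEN ballI])
          show "finite ((\<lambda>\<beta>. \<beta> - {#i#}) ` B')" using fin by (simp add: B'_def)
          show "size \<gamma> < n" if \<gamma>: "\<gamma> \<in> (\<lambda>\<beta>. \<beta> - {#i#}) ` B'" for \<gamma>
          proof -
            obtain \<beta> where "\<beta> \<in> B" "i \<in># \<beta>" "\<gamma> = \<beta> - {#i#}" using \<gamma> unfolding B'_def by blast
            then show ?thesis using sz size_Suc_Diff1[of i \<beta>] by fastforce
          qed
          show "c' \<gamma> \<in> regular_fun X" if "\<gamma> \<in> (\<lambda>\<beta>. \<beta> - {#i#}) ` B'" for \<gamma>
          proof -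
            have "c (add_mset i \<gamma>) \<in> regular_fun X" using that c by (auto simp: B'_def)
            then show ?thesis unfolding c'_def
              using regular_fun_mult_rational(1)[OF _ rational_at_const] by (simp only: of_nat_fun)
          qed
          fix h assume h: "h \<in> regular_fun Y"
          let ?y = "zero_outside Y (\<lambda>y. y $ i)"
          have yh: "?y * h \<in> regular_fun Y" using h by (simp add: regular_fun_mult regular_coord)
          show "(\<Sum>\<gamma>\<in>(\<lambda>\<beta>. \<beta> - {#i#}) ` B'. pull F (c' \<gamma>) (Y.dpow \<gamma>)) h = 0"
          proof
            fix x
            have "(\<Sum>\<gamma>\<in>(\<lambda>\<beta>. \<beta> - {#i#}) ` B'. pull F (c' \<gamma>) (Y.dpow \<gamma>)) h x =
                (\<Sum>\<beta>\<in>B'. of_nat (count \<beta> i) * c \<beta> x * Y.dpow (\<beta> - {#i#}) h (F x))"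
              unfolding sum.reindex[OF inj]
              by (auto simp: sum_fun_apply pull_apply c'_def B'_def intro!: sum.cong)
            also have "\<dots> = (\<Sum>\<beta>\<in>B. of_nat (count \<beta> i) * c \<beta> x * Y.dpow (\<beta> - {#i#}) h (F x))"
              using fin by (intro sum.mono_neutral_left) (auto simp: B'_def not_in_iff)
            \<comment> \<open>The sum is the commutator with the coordinate, applied to
              \<open>h\<close>; both of its terms vanish by assumption.\<close>
            also have "\<dots> = (\<Sum>\<beta>\<in>B. pull F (c \<beta>) (Y.dpow \<beta>)) (?y * h) x
                - ?y (F x) * (\<Sum>\<beta>\<in>B. pull F (c \<beta>) (Y.dpow \<beta>)) h x"
              by (simp add: sum_fun_apply pull_apply Y.dpow_coord[OF h] sum_distrib_left
                  sum_subtractf[symmetric] distrib_left mult.assoc mult.left_commute)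
            also have "\<dots> = 0" using z h yh by simp
            finally show "(\<Sum>\<gamma>\<in>(\<lambda>\<beta>. \<beta> - {#i#}) ` B'. pull F (c' \<gamma>) (Y.dpow \<gamma>)) h x = 0 x" by simp
          qed
        qed
        then have "c' (\<beta> - {#i#}) = 0" using \<beta> by (auto simp: B'_def)
        then show ?thesis using \<beta>(2) by (simp add: c'_def fun_eq_iff count_eq_zero_iff del: of_nat_Suc)
      qed
      show "\<forall>\<beta>\<in>B. c \<beta> = 0"
      proof
        fix \<beta> assume \<beta>: "\<beta> \<in> B"
        show "c \<beta> = 0"
        proof (cases "\<beta> = {#}")
          case True
          \<comment> \<open>All other coefficients are already zero, so applying the operator to the
            constant 1 isolates the one of order zero.\<close>
          let ?one = "zero_outside Y (\<lambda>_. 1)"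
          have "c \<beta> x = 0" for x
          proof (cases "x \<in> X")
            case x: True
            have "0 = (\<Sum>\<beta>\<in>B. pull F (c \<beta>) (Y.dpow \<beta>)) ?one x"
              using z regular_fun_const[of Y 1] by simp
            also have "\<dots> = (\<Sum>\<gamma>\<in>{\<beta>}. pull F (c \<gamma>) (Y.dpow \<gamma>) ?one x)"
              unfolding sum_fun_apply
              by (rule sum.mono_neutral_right) (use fin \<beta> True c_in in \<open>auto simp: pull_apply multiset_nonemptyE\<close>)
            also have "\<dots> = c \<beta> x"
              using True F_in[OF x] by (simp add: pull_apply mult_op_apply regular_fun_const zero_outside_apply)
            finally show ?thesis by simp
          qed (use c \<beta> regular_fun_outside in blast)
          then show ?thesis by auto
        next
          case False
          then show ?thesis using c_in \<beta> multiset_nonemptyE by blast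
        qed
      qed
    qed
  qed
  note key = this[rule_format, OF assms(1) _ _ _ assms(4)]
  show ?thesis
    by (rule key[of "Suc (Max (size ` B))"]) (use assms in \<open>simp_all add: less_Suc_eq_le\<close>)
qed

definition normal_form :: "'l multiset set \<Rightarrow> ('l multiset \<Rightarrow> complex ^ 'k \<Rightarrow> complex) \<Rightarrow> bool" where
  "normal_form B c \<longleftrightarrow> finite B \<and> (\<forall>\<beta>. c \<beta> \<in> regular_fun X) \<and> (\<forall>\<beta>. \<beta> \<notin> B \<longrightarrow> c \<beta> = 0)"

lemma normal_form_sum:
  assumes "normal_form B c" "finite B'" "B \<subseteq> B'" "\<And>\<beta>. g \<beta> 0 = 0"
  shows "(\<Sum>\<beta>\<in>B'. g \<beta> (c \<beta>)) = (\<Sum>\<beta>\<in>B. g \<beta> (c \<beta>))"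
  using assms by (intro sum.mono_neutral_right) (auto simp: normal_form_def)

lemma normal_form_exists:
  assumes "T \<in> transfer_op X Y F"
  shows "\<exists>B c. normal_form B c \<and> T = (\<Sum>\<beta>\<in>B. pull F (c \<beta>) (Y.dpow \<beta>))"
  using assms
proof (induction rule: transfer_span_induct)
  case (pull \<phi> \<beta>)
  show ?case
    by (intro exI[of _ "{\<beta>}"] exI[of _ "\<lambda>\<gamma>. if \<gamma> = \<beta> then \<phi> else 0"]) (simp add: normal_form_def pull)
next
  case (add S T)
  then obtain B c B' c' where 1: "normal_form B c" "S = (\<Sum>\<beta>\<in>B. pull F (c \<beta>) (Y.dpow \<beta>))"
    and 2: "normal_form B' c'" "T = (\<Sum>\<beta>\<in>B'. pull F (c' \<beta>) (Y.dpow \<beta>))" by blast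
  have "S = (\<Sum>\<beta>\<in>B \<union> B'. pull F (c \<beta>) (Y.dpow \<beta>))" "T = (\<Sum>\<beta>\<in>B \<union> B'. pull F (c' \<beta>) (Y.dpow \<beta>))"
    using normal_form_sum[OF 1(1), of "B \<union> B'" "\<lambda>\<beta> \<phi>. pull F \<phi> (Y.dpow \<beta>)"]
      normal_form_sum[OF 2(1), of "B \<union> B'" "\<lambda>\<beta> \<phi>. pull F \<phi> (Y.dpow \<beta>)"] 1 2
    by (simp_all add: normal_form_def pull_zero_left)
  then show ?case using 1 2
    by (intro exI[of _ "B \<union> B'"] exI[of _ "\<lambda>\<beta>. c \<beta> + c' \<beta>"])
       (simp add: normal_form_def pull_add_left sum.distrib regular_fun_add del: pointwise_simps)
qed

text \<open>The transfer bimodule is free over the functions on \<open>X\<close> with basis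
  \<partial>^\<beta>, so an additive map may be prescribed on the \<phi> \<otimes>
  \<partial>^\<beta>, additively in \<phi>.\<close>

lemma transfer_extend:
  fixes G :: "'l multiset \<Rightarrow> (complex ^ 'k \<Rightarrow> complex) \<Rightarrow> 'n::ab_group_add"
  assumes G: "\<And>\<beta> \<phi> \<psi>. \<phi> \<in> regular_fun X \<Longrightarrow> \<psi> \<in> regular_fun X \<Longrightarrow> G \<beta> (\<phi> + \<psi>) = G \<beta> \<phi> + G \<beta> \<psi>"
  obtains L where "\<And>S T. S \<in> transfer_op X Y F \<Longrightarrow> T \<in> transfer_op X Y F \<Longrightarrow> L (S + T) = L S + L T"
    and "\<And>\<beta> \<phi>. \<phi> \<in> regular_fun X \<Longrightarrow> L (pull F \<phi> (Y.dpow \<beta>)) = G \<beta> \<phi>"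
proof (rule additive_extend[OF additive_set_regular, of X "\<lambda>\<beta> \<phi>. pull F \<phi> (Y.dpow \<beta>)" G])
  let ?S = "add_span {pull F \<phi> (Y.dpow \<beta>) | \<beta> \<phi>. \<phi> \<in> regular_fun X}"
  show "c \<beta> = 0"
    if c: "finite B" "\<And>\<beta>. c \<beta> \<in> regular_fun X" "(\<Sum>\<beta>\<in>B. pull F (c \<beta>) (Y.dpow \<beta>)) = 0" "\<beta> \<in> B" for B c \<beta>
    by (rule normal_form_unique[OF c(1,2) _ c(4)]) (simp add: c(3))
  fix L assume L: "\<And>S T. S \<in> ?S \<Longrightarrow> T \<in> ?S \<Longrightarrow> L (S + T) = L S + L T"
    "\<And>\<beta> \<phi>. \<phi> \<in> regular_fun X \<Longrightarrow> L (pull F \<phi> (Y.dpow \<beta>)) = G \<beta> \<phi>"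
  have "{pull F \<phi> (Y.dpow \<beta>) | \<beta> \<phi>. \<phi> \<in> regular_fun X} = {pull F \<phi> (Y.dpow \<beta>) | \<phi> \<beta>. \<phi> \<in> regular_fun X}" by blast
  then have "T \<in> ?S" if "T \<in> transfer_op X Y F" for T using transfer_span[OF that] by simp
  then show thesis by (intro that[of L] L)
qed (rule pull_add_left, rule G)

end

declare pointwise_simps [simp del] of_nat_fun_apply [simp del]

section \<open>Adjoints and restriction\<close>

context open_set
begin

text \<open>Operators on \<open>X\<close> are transfer operators along the identity, so they inherit
  the uniqueness of normal forms.\<close>

lemma regular_map_id: "regular_map X X (\<lambda>x. x)"
  by unfold_locales (auto simp: open_X intro: rational_at_coord)

lemma pull_id: "Q \<in> diff_op X \<Longrightarrow> pull (\<lambda>x. x) \<phi> Q = M \<phi> \<cdot> Q"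
  using diff_op_regular[of Q] diff_op_nonregular[of Q]
  by (auto simp: fun_eq_iff pull_apply mult_op_def pointwise_simps)

lemma diff_op_transfer: "P \<in> diff_op X \<Longrightarrow> P \<in> transfer_op X X (\<lambda>x. x)"
proof -
  interpret regular_map X X "\<lambda>x. x" by (rule regular_map_id)
  assume P: "P \<in> diff_op X"
  have "P = pull (\<lambda>x. x) (zero_outside X (\<lambda>_. 1)) P"
    by (simp add: pull_id P mult_op_zero_outside)
  then show ?thesis using transfer_pull[OF regular_fun_const[of X 1] P] by simp
qed

lemma diff_op_extend:
  fixes G :: "'k multiset \<Rightarrow> (complex ^ 'k \<Rightarrow> complex) \<Rightarrow> 'n::ab_group_add"
  assumes G: "\<And>\<beta> \<phi> \<psi>. \<phi> \<in> regular_fun X \<Longrightarrow> \<psi> \<in> regular_fun X \<Longrightarrow> G \<beta> (\<phi> + \<psi>) = G \<beta> \<phi> + G \<beta> \<psi>"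
  obtains L where "\<And>S T. S \<in> diff_op X \<Longrightarrow> T \<in> diff_op X \<Longrightarrow> L (S + T) = L S + L T"
    and "\<And>\<beta> \<phi>. \<phi> \<in> regular_fun X \<Longrightarrow> L (M \<phi> \<cdot> dpow \<beta>) = G \<beta> \<phi>"
proof -
  interpret regular_map X X "\<lambda>x. x" by (rule regular_map_id)
  obtain L where L: "\<And>S T. S \<in> transfer_op X X (\<lambda>x. x) \<Longrightarrow> T \<in> transfer_op X X (\<lambda>x. x) \<Longrightarrow> L (S + T) = L S + L T"
     "\<And>\<beta> \<phi>. \<phi> \<in> regular_fun X \<Longrightarrow> L (pull (\<lambda>x. x) \<phi> (dpow \<beta>)) = G \<beta> \<phi>"
    using transfer_extend[of G, OF G] by blast
  show ?thesis
    by (rule that[of L]) (auto simp: L diff_op_transfer L(2)[unfolded pull_id[OF dpow_diff_op]])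
qed

lemma diff_op_span_induct [consumes 1, case_names base add]:
  assumes "P \<in> diff_op X"
    and "\<And>c \<beta>. c \<in> regular_fun X \<Longrightarrow> C (M c \<cdot> dpow \<beta>)"
    and "\<And>P Q. P \<in> diff_op X \<Longrightarrow> Q \<in> diff_op X \<Longrightarrow> C P \<Longrightarrow> C Q \<Longrightarrow> C (P + Q)"
  shows "C P"
proof -
  from diff_op_span[OF assms(1)] have "C P \<and> P \<in> diff_op X"
  proof (induction rule: add_span.induct)
    case (base x)
    then show ?case using assms(2) diff_op.comp diff_op.mult dpow_diff_op by blast
  next
    case (add x y)
    then show ?case using assms(3) diff_op_plus by blast
  qed
  then show ?thesis ..
qed

definition is_adjoint :: "(('k, 'k) operator \<Rightarrow> ('k, 'k) operator) \<Rightarrow> bool" where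
  "is_adjoint t \<longleftrightarrow> t \<in> diff_op X \<rightarrow> diff_op X \<and>
     (\<forall>P\<in>diff_op X. \<forall>Q\<in>diff_op X. t (P + Q) = t P + t Q \<and> t (P \<cdot> Q) = t Q \<cdot> t P) \<and>
     (\<forall>f\<in>regular_fun X. t (M f) = M f) \<and> (\<forall>i. t (D i) = - D i)"

lemma adjoint_unique:
  assumes "is_adjoint s" "is_adjoint t" "P \<in> diff_op X"
  shows "s P = t P"
  using assms(3) by (induction rule: diff_op_induct) (use assms(1,2) in \<open>auto simp: is_adjoint_def\<close>)

text \<open>On normal forms the adjoint must send f \<partial>^\<beta> to (-\<partial>)^\<beta> f.
  Reversal of products is checked for a left factor that is a function or a partial derivative and
  extended by induction on the left factor.\<close>

lemma adjoint_exists: "\<exists>t. is_adjoint t"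
proof -
  define sd where "sd \<beta> = (if even (size \<beta>) then dpow \<beta> else - dpow \<beta>)" for \<beta>
  have sd: "sd \<beta> \<in> diff_op X" for \<beta> by (simp add: sd_def dpow_diff_op diff_op_uminus)
  have sd_add: "sd (add_mset i \<beta>) = - (sd \<beta> \<cdot> D i)" for i \<beta>
    by (simp add: sd_def dpow_add_mset_right comp_uminus_left)
  obtain L where L_add: "\<And>S T. S \<in> diff_op X \<Longrightarrow> T \<in> diff_op X \<Longrightarrow> L (S + T) = L S + L T"
    and L: "\<And>\<beta> \<phi>. \<phi> \<in> regular_fun X \<Longrightarrow> L (M \<phi> \<cdot> dpow \<beta>) = sd \<beta> \<cdot> M \<phi>"
    using diff_op_extend[of "\<lambda>\<beta> \<phi>. sd \<beta> \<cdot> M \<phi>"]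
    by (metis (mono_tags, lifting) mult_op_add comp_plus_right sd diff_op.mult)
  have L_closed: "L P \<in> diff_op X" if "P \<in> diff_op X" for P
    using that by (induction rule: diff_op_span_induct)
      (simp_all add: L L_add sd diff_op.mult diff_op.comp diff_op_plus)
  have base: "M c \<cdot> dpow \<beta> \<in> diff_op X" if "c \<in> regular_fun X" for c \<beta>
    using that by (intro diff_op.comp diff_op.mult dpow_diff_op)
  have L_M_comp: "L (M f \<cdot> Q) = L Q \<cdot> M f" if f: "f \<in> regular_fun X" and Q: "Q \<in> diff_op X" for f Q
    using Q
  proof (induction rule: diff_op_span_induct)
    case (base c \<beta>)
    have "M f \<cdot> (M c \<cdot> dpow \<beta>) = M (c * f) \<cdot> dpow \<beta>" "M c \<cdot> M f = M (c * f)"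
      using base f by (simp_all add: o_assoc M_comp regular_fun_rational_at mult.commute)
    then show ?case using base f by (simp add: L regular_fun_mult comp_assoc)
  next
    case (add P Q)
    then show ?case using f
      by (simp add: comp_plus_right comp_plus_left diff_op.mult L_add diff_op.comp)
  qed
  have L_D_comp: "L (D i \<cdot> Q) = L Q \<cdot> (- D i)" if Q: "Q \<in> diff_op X" for i Q
    using Q
  proof (induction rule: diff_op_span_induct)
    case (base c \<beta>)
    have Dc: "D i c \<in> regular_fun X" by (rule partial_op_regular[OF open_X base])
    have "D i \<cdot> (M c \<cdot> dpow \<beta>) = M (D i c) \<cdot> dpow \<beta> + M c \<cdot> dpow (add_mset i \<beta>)"
      using base by (simp add: o_assoc D_M comp_plus_left dpow_add_mset)
    then have "L (D i \<cdot> (M c \<cdot> dpow \<beta>)) = sd \<beta> \<cdot> M (D i c) - sd \<beta> \<cdot> (D i \<cdot> M c)"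
      using base Dc by (simp add: L_add diff_op.comp diff_op.mult dpow_diff_op L sd_add comp_uminus_left comp_assoc)
    also have "\<dots> = - (sd \<beta> \<cdot> (M c \<cdot> D i))"
      using base Dc by (simp add: D_M comp_plus_right sd diff_op.mult diff_op.comp diff_op.partial)
    finally show ?case using base
      by (simp add: L comp_assoc comp_uminus_right diff_op.mult diff_op.partial sd diff_op.comp)
  next
    case (add P Q)
    then show ?case
      by (simp add: comp_plus_right comp_plus_left diff_op.partial L_add diff_op.comp)
  qed
  have L_M: "L (M f) = M f" if "f \<in> regular_fun X" for f
    using L[OF that, of "{#}"] that by (simp add: sd_def diff_op.mult)
  have L_I: "L I = I"
    using L_M[OF regular_fun_const, of 1] by (simp add: mult_op_zero_outside)
  have L_D: "L (D i) = - D i" for i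
    using L_D_comp[OF one_diff_op, of i] by (simp add: L_I diff_op.partial diff_op_uminus)
  have L_comp: "L (P \<cdot> Q) = L Q \<cdot> L P" if "P \<in> diff_op X" "Q \<in> diff_op X" for P Q
    using that
  proof (induction arbitrary: Q rule: diff_op_induct)
    case (add P P')
    then show ?case
      by (simp add: comp_plus_left L_add diff_op.comp L_closed comp_plus_right)
  next
    case (comp P P')
    then show ?case by (simp add: comp_assoc diff_op.comp)
  qed (simp_all add: L_M_comp L_D_comp L_M L_D)
  show ?thesis
    by (rule exI[of _ L]) (auto simp: is_adjoint_def L_closed L_add L_comp L_M L_D)
qed

text \<open>Extensionality makes the definite description unique: an adjoint is determined by the
  generators on \<open>diff_op X\<close>, and elsewhere by convention.\<close>

lemma adjoint_op_is_adjoint: "is_adjoint (adjoint_op X)"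
proof -
  define spec where "spec t \<longleftrightarrow> t \<in> extensional (diff_op X) \<and> is_adjoint t" for t
  obtain t where t: "is_adjoint t" using adjoint_exists by blast
  have "is_adjoint (restrict t (diff_op X))"
    using t by (auto simp: is_adjoint_def diff_op.mult diff_op.partial diff_op_plus diff_op.comp)
  then have "spec (restrict t (diff_op X))" by (simp add: spec_def)
  moreover have "t = u" if "spec t" "spec u" for t u
    using that adjoint_unique by (auto simp: spec_def intro!: extensionalityI[of _ "diff_op X"])
  ultimately have "\<exists>!t. spec t" by blast
  then have "spec (THE t. spec t)" by (rule theI')
  moreover have "adjoint_op X = (THE t. spec t)"
    unfolding adjoint_op_def spec_def is_adjoint_def by (simp add: diff_op.partial)
  ultimately show ?thesis by (simp add: spec_def)
qed

lemma adjoint_closed: "P \<in> diff_op X \<Longrightarrow> adjoint_op X P \<in> diff_op X"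
  and adjoint_add: "P \<in> diff_op X \<Longrightarrow> Q \<in> diff_op X \<Longrightarrow> adjoint_op X (P + Q) = adjoint_op X P + adjoint_op X Q"
  and adjoint_comp: "P \<in> diff_op X \<Longrightarrow> Q \<in> diff_op X \<Longrightarrow> adjoint_op X (P \<cdot> Q) = adjoint_op X Q \<cdot> adjoint_op X P"
  and adjoint_D: "adjoint_op X (D i) = - D i"
  using adjoint_op_is_adjoint by (auto simp: is_adjoint_def)

lemma adjoint_M:
  assumes "\<And>x. x \<in> X \<Longrightarrow> rational_at X x f" shows "adjoint_op X (M f) = M f"
  using adjoint_op_is_adjoint zero_outside_regular[OF assms]
  by (metis is_adjoint_def mult_op_zero_outside)

lemma adjoint_uminus: "P \<in> diff_op X \<Longrightarrow> adjoint_op X (- P) = - adjoint_op X P"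
  using adjoint_add[of P "- P"] adjoint_add[OF zero_diff_op zero_diff_op]
  by (simp add: diff_op_uminus add_eq_0_iff)

end

section \<open>Restriction of operators to an open subset\<close>

lemma rational_at_subset:
  assumes "rational_at X x f" "U \<subseteq> X" shows "rational_at U x f"
proof -
  obtain P Q where "P \<in> polynomial_fun" "Q \<in> polynomial_fun" "Q x \<noteq> 0"
      "\<forall>y\<in>X. Q y \<noteq> 0 \<longrightarrow> f y = P y / Q y"
    using assms(1) unfolding rational_at_def by blast
  moreover from this(4) have "\<forall>y\<in>U. Q y \<noteq> 0 \<longrightarrow> f y = P y / Q y" using assms(2) by blast
  ultimately show ?thesis unfolding rational_at_def by blast
qed

locale open_subset = U: open_set U + X: open_set X
  for U X :: "(complex ^ 'k::finite) set" +
  assumes U_sub: "U \<subseteq> X"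
begin

lemma zero_outside_D:
  assumes "h \<in> regular_fun X"
  shows "U.D i (zero_outside U h) = zero_outside U (X.D i h)"
proof
  fix x
  show "U.D i (zero_outside U h) x = zero_outside U (X.D i h) x"
  proof (cases "x \<in> U")
    case True
    then show ?thesis
      using partial_op_cong[OF X.open_X U.open_X assms regular_fun_restrict[OF assms U_sub] U_sub]
      by (simp add: zero_outside_apply)
  qed (simp add: zero_outside_def partial_op_def)
qed

lemma zero_outside_dpow:
  assumes "h \<in> regular_fun X"
  shows "U.dpow \<beta> (zero_outside U h) = zero_outside U (X.dpow \<beta> h)"
proof (induction \<beta>)
  case empty
  show ?case using assms by (auto simp: mult_op_def regular_fun_restrict[OF _ U_sub])
next
  case (add i \<beta>)
  then show ?case
    by (simp add: U.dpow_add_mset X.dpow_add_mset pointwise_simps zero_outside_D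
        X.diff_op_regular[OF X.dpow_diff_op assms])
qed

text \<open>The defining property of \<open>restrict_op\<close>, kept as a relation so that sums and
  products can be treated before uniqueness is known.\<close>

definition restricts :: "('k, 'k) operator \<Rightarrow> ('k, 'k) operator \<Rightarrow> bool" where
  "restricts P Q \<longleftrightarrow> Q \<in> diff_op U \<and> (\<forall>h\<in>regular_fun X. Q (zero_outside U h) = zero_outside U (P h))"

lemma restricts_M:
  assumes "\<And>x. x \<in> X \<Longrightarrow> rational_at X x f"
  shows "restricts (X.M f) (U.M f)"
proof -
  have "\<And>x. x \<in> U \<Longrightarrow> rational_at U x f"
    using assms U_sub rational_at_subset by blast
  then have "U.M f \<in> diff_op U" by (rule mult_op_diff_op)
  moreover have "U.M f (zero_outside U h) = zero_outside U (X.M f h)" if "h \<in> regular_fun X" for h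
    using that unfolding mult_op_apply[OF regular_fun_restrict[OF that U_sub]] mult_op_apply[OF that]
    by (simp add: zero_outside_def times_fun_def fun_eq_iff)
  ultimately show ?thesis by (simp add: restricts_def)
qed

lemma restricts_D: "restricts (X.D i) (U.D i)"
  by (simp add: restricts_def zero_outside_D diff_op.partial)

lemma restricts_add:
  assumes "restricts P P'" "restricts Q Q'" shows "restricts (P + Q) (P' + Q')"
  using assms unfolding restricts_def by (auto simp: plus_fun_def zero_outside_def fun_eq_iff diff_op.add)

lemma restricts_comp:
  assumes "restricts P P'" "restricts Q Q'" "Q \<in> diff_op X" shows "restricts (P \<cdot> Q) (P' \<cdot> Q')"
  using assms X.diff_op_regular[OF assms(3)] unfolding restricts_def
  by (auto simp: pointwise_simps diff_op.comp)

lemma restricts_exists: "P \<in> diff_op X \<Longrightarrow> \<exists>Q. restricts P Q"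
proof (induction rule: diff_op_induct)
  case (mult f)
  then show ?case using restricts_M regular_fun_rational_at by blast
next
  case (partial i)
  then show ?case using restricts_D by blast
next
  case (add P Q)
  then show ?case using restricts_add by blast
next
  case (comp P Q)
  then show ?case using restricts_comp by blast
qed

text \<open>The difference of two restrictions is read as an operator along the inclusion of
  \<open>U\<close> in \<open>X\<close>. Uniqueness of normal forms along that map tests only against
  functions on \<open>X\<close>, where the difference vanishes.\<close>

lemma restricts_unique:
  assumes "restricts P Q" "restricts P Q'"
  shows "Q = Q'"
proof -
  interpret UU: regular_map U U "\<lambda>x. x" by (rule U.regular_map_id)
  interpret UX: regular_map U X "\<lambda>x. x"
    by unfold_locales (use U_sub in \<open>auto intro: rational_at_coord\<close>)
  have R: "Q - Q' \<in> diff_op U" using assms by (simp add: restricts_def U.diff_op_minus)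
  obtain B c where nf: "UU.normal_form B c" "Q - Q' = (\<Sum>\<beta>\<in>B. pull (\<lambda>x. x) (c \<beta>) (U.dpow \<beta>))"
    using UU.normal_form_exists[OF U.diff_op_transfer[OF R]] by blast
  have "c \<beta> = 0" if "\<beta> \<in> B" for \<beta>
  proof (rule UX.normal_form_unique[OF _ _ _ that])
    show "finite B" "\<And>\<beta>. c \<beta> \<in> regular_fun U" using nf(1) by (auto simp: UU.normal_form_def)
    then have c: "c \<beta> x * zero_outside U k x = c \<beta> x * k x" for \<beta> x k
      using regular_fun_outside[of "c \<beta>" U x] by (cases "x \<in> U") (auto simp: zero_outside_def)
    fix h assume h: "h \<in> regular_fun X"
    have "(\<Sum>\<beta>\<in>B. pull (\<lambda>x. x) (c \<beta>) (X.dpow \<beta>)) h = (Q - Q') (zero_outside U h)"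
      unfolding nf(2) by (simp add: fun_eq_iff sum_fun_apply pull_apply zero_outside_dpow[OF h] c)
    also have "\<dots> = 0" using assms h by (simp add: restricts_def pointwise_simps)
    finally show "(\<Sum>\<beta>\<in>B. pull (\<lambda>x. x) (c \<beta>) (X.dpow \<beta>)) h = 0" .
  qed
  then have "Q - Q' = 0" using nf(2) by (simp add: pull_zero_left)
  then show ?thesis by simp
qed

lemma restrict_op_eq: "restricts P Q \<Longrightarrow> restrict_op X U P = Q"
  unfolding restrict_op_def using restricts_unique
  by (intro the_equality) (auto simp: restricts_def)

lemma restricts_restrict_op: "P \<in> diff_op X \<Longrightarrow> restricts P (restrict_op X U P)"
  using restricts_exists restrict_op_eq by blast

lemma restrict_closed: "P \<in> diff_op X \<Longrightarrow> restrict_op X U P \<in> diff_op U"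
  using restricts_restrict_op by (simp add: restricts_def)

lemma restrict_add:
  "P \<in> diff_op X \<Longrightarrow> Q \<in> diff_op X \<Longrightarrow> restrict_op X U (P + Q) = restrict_op X U P + restrict_op X U Q"
  by (intro restrict_op_eq restricts_add restricts_restrict_op)

lemma restrict_comp:
  "P \<in> diff_op X \<Longrightarrow> Q \<in> diff_op X \<Longrightarrow> restrict_op X U (P \<cdot> Q) = restrict_op X U P \<cdot> restrict_op X U Q"
  by (intro restrict_op_eq restricts_comp restricts_restrict_op)

lemma restrict_M:
  "(\<And>x. x \<in> X \<Longrightarrow> rational_at X x f) \<Longrightarrow> restrict_op X U (X.M f) = U.M f"
  by (intro restrict_op_eq restricts_M)

lemma restrict_D: "restrict_op X U (X.D i) = U.D i"
  by (intro restrict_op_eq restricts_D)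

lemma restrict_ring_hom: "restrict_op X U \<in> ring_hom (D_ring X) (D_ring U)"
  by (rule ring_hom_memI) (auto simp: restrict_closed restrict_add restrict_comp restrict_M rational_at_const)

end

section \<open>Torus weights\<close>

text \<open>On the punctured plane \<open>g\<close> is a Laurent polynomial with exponents between
  -N and N.\<close>

definition laurent_bounded :: "nat \<Rightarrow> (complex \<Rightarrow> complex) \<Rightarrow> bool" where
  "laurent_bounded N g \<longleftrightarrow> (\<exists>p. degree p \<le> 2 * N \<and> (\<forall>s. s \<noteq> 0 \<longrightarrow> g s * s ^ N = poly p s))"

lemma laurent_bounded_mono:
  assumes "laurent_bounded N g" "N \<le> K" shows "laurent_bounded K g"
proof -
  obtain p where p: "degree p \<le> 2 * N" "\<forall>s. s \<noteq> 0 \<longrightarrow> g s * s ^ N = poly p s"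
    using assms(1) unfolding laurent_bounded_def by blast
  have "degree (monom 1 (K - N) * p) \<le> (K - N) + degree p"
    by (rule order.trans[OF degree_mult_le]) (simp add: degree_monom_eq)
  then have "degree (monom 1 (K - N) * p) \<le> 2 * K" using p(1) assms(2) by linarith
  moreover have "g s * s ^ K = poly (monom 1 (K - N) * p) s" if "s \<noteq> 0" for s
  proof -
    have "g s * s ^ K = s ^ (K - N) * (g s * s ^ N)"
      using assms(2) by (simp add: power_add[symmetric] mult.left_commute)
    then show ?thesis using p(2) that by (simp add: poly_monom)
  qed
  ultimately show ?thesis unfolding laurent_bounded_def by blast
qed

lemma laurent_bounded_add:
  assumes "laurent_bounded N g" "laurent_bounded N h" shows "laurent_bounded N (\<lambda>s. g s + h s)"
proof -
  obtain p q where "degree p \<le> 2 * N" "\<forall>s. s \<noteq> 0 \<longrightarrow> g s * s ^ N = poly p s"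
    "degree q \<le> 2 * N" "\<forall>s. s \<noteq> 0 \<longrightarrow> h s * s ^ N = poly q s"
    using assms unfolding laurent_bounded_def by blast
  then show ?thesis unfolding laurent_bounded_def
    by (intro exI[of _ "p + q"]) (auto simp: degree_add_le distrib_right)
qed

lemma laurent_bounded_mult:
  assumes "laurent_bounded N g" "laurent_bounded K h" shows "laurent_bounded (N + K) (\<lambda>s. g s * h s)"
proof -
  obtain p q where pq: "degree p \<le> 2 * N" "\<forall>s. s \<noteq> 0 \<longrightarrow> g s * s ^ N = poly p s"
    "degree q \<le> 2 * K" "\<forall>s. s \<noteq> 0 \<longrightarrow> h s * s ^ K = poly q s"
    using assms unfolding laurent_bounded_def by blast
  have "g s * h s * s ^ (N + K) = poly (p * q) s" if "s \<noteq> 0" for s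
    using pq that by (simp add: power_add) (metis mult.assoc mult.left_commute)
  moreover have "degree (p * q) \<le> 2 * (N + K)"
    using order.trans[OF degree_mult_le[of p q] add_mono[OF pq(1,3)]] by simp
  ultimately show ?thesis unfolding laurent_bounded_def by blast
qed

lemma continuous_cancel_root:
  fixes g :: "complex \<Rightarrow> complex"
  assumes "isCont g a" "\<And>s. s \<noteq> 0 \<Longrightarrow> s \<noteq> a \<Longrightarrow> g s * poly q s = poly p s"
  shows "g a * poly q a = poly p a"
proof -
  have "((\<lambda>s. g s * poly q s - poly p s) \<longlongrightarrow> g a * poly q a - poly p a) (at a)"
    using assms(1) by (intro tendsto_intros) (auto simp: isCont_def poly_isCont[unfolded isCont_def])
  moreover have "((\<lambda>s. g s * poly q s - poly p s) \<longlongrightarrow> 0) (at a)"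
  proof (rule tendsto_eventually)
    have "eventually (\<lambda>s. s \<noteq> 0) (at a)"
      by (cases "a = 0") (auto simp: eventually_at_filter intro: t1_space_nhds eventually_mono[OF t1_space_nhds])
    moreover have "eventually (\<lambda>s. s \<noteq> a) (at a)" by (simp add: eventually_at_filter)
    ultimately show "eventually (\<lambda>s. g s * poly q s - poly p s = 0) (at a)"
      by eventually_elim (simp add: assms(2))
  qed
  ultimately have "g a * poly q a - poly p a = 0" by (rule LIM_unique)
  then show ?thesis by simp
qed

text \<open>A rational function that is continuous off 0 has at most a pole at 0. Roots of
  \<open>q\<close> are removed one by one: a root 0 raises the power of \<open>s\<close>, any other
  root is also a root of \<open>p\<close> and cancels. The degree bounds make the later estimates
  uniform in a parameter.\<close>

lemma rational_laurent:
  fixes g :: "complex \<Rightarrow> complex"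
  assumes "q \<noteq> 0" "\<And>s. s \<noteq> 0 \<Longrightarrow> isCont g s" "\<And>s. s \<noteq> 0 \<Longrightarrow> g s * poly q s = poly p s"
  shows "\<exists>N p'. N \<le> degree q \<and> degree p' \<le> degree p \<and> (\<forall>s. s \<noteq> 0 \<longrightarrow> g s * s ^ N = poly p' s)"
  using assms
proof (induction "degree q" arbitrary: q p g)
  case 0
  then obtain c where c: "q = [:c:]" "c \<noteq> 0" by (metis degree_eq_zeroE pCons_0_0)
  show ?case
    by (intro exI[of _ 0] exI[of _ "Polynomial.smult (inverse c) p"])
       (use c 0 in \<open>auto simp: field_simps\<close>)
next
  case (Suc n)
  then obtain a where a: "poly q a = 0"
    using fundamental_theorem_of_algebra[of q] constant_degree[of q] by auto
  then obtain q1 where q1: "q = [:-a, 1:] * q1" by (auto simp: poly_eq_0_iff_dvd)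
  then have "q1 \<noteq> 0" using Suc.prems(1) by auto
  then have deg: "degree q = Suc (degree q1)" by (simp only: q1, subst degree_mult_eq) auto
  then have n: "n = degree q1" using Suc.hyps(2) by simp
  show ?case
  proof (cases "a = 0")
    case True
    have "\<exists>N p'. N \<le> degree q1 \<and> degree p' \<le> degree p \<and> (\<forall>s. s \<noteq> 0 \<longrightarrow> (g s * s) * s ^ N = poly p' s)"
      using Suc.prems q1 True \<open>q1 \<noteq> 0\<close> by (intro Suc.hyps(1) n) (auto simp: mult.assoc intro!: continuous_intros)
    then obtain N p' where "N \<le> degree q1" "degree p' \<le> degree p" "\<forall>s. s \<noteq> 0 \<longrightarrow> (g s * s) * s ^ N = poly p' s"
      by blast
    then show ?thesis using deg by (intro exI[of _ "Suc N"] exI[of _ p']) (simp add: mult.assoc)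
  next
    case False
    have "poly p a = 0" using Suc.prems(3)[OF False] a by simp
    then obtain p1 where p1: "p = [:-a, 1:] * p1" by (auto simp: poly_eq_0_iff_dvd)
    have eq: "g s * poly q1 s = poly p1 s" if s: "s \<noteq> 0" "s \<noteq> a" for s
    proof -
      have "(s - a) * (g s * poly q1 s) = (s - a) * poly p1 s"
        using Suc.prems(3)[OF s(1)] by (simp add: q1 p1 algebra_simps)
      then show ?thesis using s by simp
    qed
    then have "g s * poly q1 s = poly p1 s" if "s \<noteq> 0" for s
      using continuous_cancel_root[where g = g and a = a and q = q1 and p = p1] Suc.prems(2)[OF False] that by (cases "s = a") auto
    then obtain N p' where "N \<le> degree q1" "degree p' \<le> degree p1" "\<forall>s. s \<noteq> 0 \<longrightarrow> g s * s ^ N = poly p' s"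
      using Suc.hyps(1)[OF n \<open>q1 \<noteq> 0\<close> Suc.prems(2)] by blast
    moreover have "degree p1 \<le> degree p"
      by (cases "p1 = 0") (simp_all add: p1 degree_mult_eq del: mult_pCons_left)
    ultimately show ?thesis using deg by (intro exI[of _ N] exI[of _ p']) auto
  qed
qed

lemma sum_root_unity_powers:
  fixes M :: nat and d :: int
  assumes "M > 0" "\<bar>d\<bar> < int M"
  shows "(\<Sum>k<M. (cis (2 * pi / M) ^ k) powi d) = (if d = 0 then of_nat M else 0)"
proof (cases "d = 0")
  case False
  define z where "z = cis (2 * pi * d / M)"
  have pow: "(cis (2 * pi / M) ^ k) powi d = z ^ k" for k
    by (simp add: z_def Complex.DeMoivre Complex.cis_power_int mult_ac)
  have "z \<noteq> 1"
  proof
    assume "z = 1"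
    then obtain n :: int where "2 * pi * d / M = 2 * pi * n"
      by (auto simp: z_def cis_conv_exp exp_eq_1 mult.commute mult.left_commute)
    then have "real_of_int d = of_int n * real M" using assms(1) by (simp add: field_simps)
    then have "d = n * int M" by (metis of_int_eq_iff of_int_mult of_int_of_nat_eq)
    then show False using assms(2) False
      by (metis abs_mult abs_of_nat less_le_not_le mult_le_cancel_right1 mult_zero_left zero_less_abs_iff int_one_le_iff_zero_less)
  qed
  moreover have "z ^ M = 1"
  proof -
    have "z ^ M = cis (2 * pi * of_int d)" using assms(1) by (simp add: z_def Complex.DeMoivre)
    also have "\<dots> = 1" by (simp add: cis_multiple_2pi)
    finally show ?thesis .
  qed
  ultimately show ?thesis using False by (simp add: pow geometric_sum)
qed simp

section \<open>Laurent expansion along a one-parameter group\<close>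

definition weight_act :: "('k \<Rightarrow> int) \<Rightarrow> complex \<Rightarrow> complex ^ 'k \<Rightarrow> complex ^ 'k::finite" where
  "weight_act a s w = (\<chi> i. s powi a i * w $ i)"

text \<open>The bound does not depend on the point \<open>w\<close>. This uniformity allows one
  finite set of roots of unity to extract the coefficients at all points.\<close>

lemma polynomial_laurent_bounded:
  assumes "P \<in> polynomial_fun"
  shows "\<exists>N. \<forall>w. laurent_bounded N (\<lambda>s. P (weight_act a s w))"
  using assms
proof (induction rule: polynomial_fun.induct)
  case (const c)
  show ?case by (intro exI[of _ 0]) (auto simp: laurent_bounded_def intro: exI[of _ "[:c:]"])
next
  case (coord i)
  let ?N = "nat \<bar>a i\<bar>"
  have "laurent_bounded ?N (\<lambda>s. weight_act a s w $ i)" for w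
    unfolding laurent_bounded_def
  proof (intro exI conjI allI impI)
    show "degree (monom (w $ i) (nat (a i + \<bar>a i\<bar>))) \<le> 2 * ?N"
      using degree_monom_le[of "w $ i" "nat (a i + \<bar>a i\<bar>)"] by linarith
    fix s :: complex assume s: "s \<noteq> 0"
    obtain n k where n: "\<bar>a i\<bar> = int n" and k: "a i + \<bar>a i\<bar> = int k"
      by (metis zero_le_imp_eq_int abs_ge_zero abs_ge_minus_self add.commute diff_ge_0_iff_ge diff_minus_eq_add)
    have "s powi a i * s ^ n = s ^ k"
      using s power_int_add[of s "a i" "int n"] n k by simp
    then show "weight_act a s w $ i * s ^ ?N = poly (monom (w $ i) (nat (a i + \<bar>a i\<bar>))) s"
      using n k by (simp add: weight_act_def poly_monom mult_ac)
  qed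
  then show ?case by blast
next
  case (add f g)
  then obtain N K where "\<forall>w. laurent_bounded N (\<lambda>s. f (weight_act a s w))"
    "\<forall>w. laurent_bounded K (\<lambda>s. g (weight_act a s w))" by blast
  then show ?case
    by (intro exI[of _ "max N K"] allI laurent_bounded_add) (auto intro: laurent_bounded_mono)
next
  case (mult f g)
  then show ?case using laurent_bounded_mult by blast
qed

lemma regular_fun_isCont: "open X \<Longrightarrow> f \<in> regular_fun X \<Longrightarrow> x \<in> X \<Longrightarrow> isCont f x"
  using regular_fun_gradient has_derivative_continuous unfolding has_gradient_def by blast

text \<open>Along the orbit of a generic point \<open>f\<close> is a Laurent polynomial in
  \<open>s\<close> of uniformly bounded degree. Averaging over roots of unity expresses its
  coefficients by translates of \<open>f\<close>, which makes them regular functions; the expansion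
  then extends from generic points to all of \<open>X\<close>.\<close>

lemma regular_laurent:
  fixes X :: "(complex ^ 'k::finite) set"
  assumes X: "open X" and stable: "\<And>s w. s \<noteq> 0 \<Longrightarrow> w \<in> X \<Longrightarrow> weight_act a s w \<in> X" and f: "f \<in> regular_fun X"
  obtains K e where "\<And>i. e i \<in> regular_fun X"
    "\<And>w s. w \<in> X \<Longrightarrow> s \<noteq> 0 \<Longrightarrow> f (weight_act a s w) * s ^ K = (\<Sum>i\<le>2*K. e i w * s ^ i)"
proof (cases "X = {}")
  case True
  then show ?thesis using that[of "\<lambda>_. 0"] by auto
next
  case False
  then obtain x0 where "x0 \<in> X" by blast
  then obtain P Q where PQ: "P \<in> polynomial_fun" "Q \<in> polynomial_fun" "Q x0 \<noteq> 0"
      "\<forall>y\<in>X. Q y \<noteq> 0 \<longrightarrow> f y = P y / Q y"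
    using regular_fun_rational_at[OF f] unfolding rational_at_def by blast
  have act_one: "weight_act a 1 w = w" for w by (simp add: weight_act_def)
  \<comment> \<open>The fraction is cleared globally: f Q = P holds on \<open>X\<close> also where
    \<open>Q\<close> vanishes.\<close>
  have fQP: "f * zero_outside X Q - zero_outside X P = 0"
  proof (rule regular_fun_eq_0[OF X _ PQ(2,3)])
    show "f * zero_outside X Q - zero_outside X P \<in> regular_fun X"
      using PQ by (intro regular_fun_diff regular_fun_mult f zero_outside_regular rational_at_polynomial)
  qed (use PQ in \<open>auto simp: pointwise_simps zero_outside_apply\<close>)
  have fQ: "f x * Q x = P x" if "x \<in> X" for x
    using fun_cong[OF fQP, of x] that by (simp add: pointwise_simps zero_outside_apply)
  obtain N1 where "\<forall>w. laurent_bounded N1 (\<lambda>s. P (weight_act a s w))"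
    using polynomial_laurent_bounded[OF PQ(1)] by blast
  moreover obtain N2 where "\<forall>w. laurent_bounded N2 (\<lambda>s. Q (weight_act a s w))"
    using polynomial_laurent_bounded[OF PQ(2)] by blast
  ultimately obtain N where N: "\<And>w. laurent_bounded N (\<lambda>s. P (weight_act a s w))"
    "\<And>w. laurent_bounded N (\<lambda>s. Q (weight_act a s w))"
    using laurent_bounded_mono[of _ _ "max N1 N2"] by (meson max.cobounded1 max.cobounded2)
  \<comment> \<open>Numerator and denominator along an orbit have degree at most 2N. This bounds the
    order of the pole at 0 and the degree after clearing it.\<close>
  define K where "K = 2 * N"
  have generic: "laurent_bounded K (\<lambda>s. f (weight_act a s w))" if w: "w \<in> X" "Q w \<noteq> 0" for w
  proof -
    obtain p q where p: "degree p \<le> 2 * N" "\<forall>s. s \<noteq> 0 \<longrightarrow> P (weight_act a s w) * s ^ N = poly p s"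
      and q: "degree q \<le> 2 * N" "\<forall>s. s \<noteq> 0 \<longrightarrow> Q (weight_act a s w) * s ^ N = poly q s"
      using N[of w] unfolding laurent_bounded_def by blast
    have "poly q 1 \<noteq> 0" using q(2)[rule_format, of 1] w by (simp add: act_one)
    then have "q \<noteq> 0" by auto
    moreover have "isCont (\<lambda>s. f (weight_act a s w)) s" if s: "s \<noteq> 0" for s
    proof -
      have "isCont (\<lambda>s. weight_act a s w) s"
        unfolding weight_act_def continuous_at
        using s by (intro vec_tendstoI) (auto intro!: tendsto_intros)
      then show ?thesis
        using regular_fun_isCont[OF X f stable[OF s w(1)]] by (rule isCont_o2)
    qed
    moreover have "f (weight_act a s w) * poly q s = poly p s" if "s \<noteq> 0" for s
      using p(2) q(2) that fQ[OF stable[OF that w(1)]] by (metis mult.assoc)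
    ultimately obtain L p' where L: "L \<le> degree q" "degree p' \<le> degree p"
        "\<forall>s. s \<noteq> 0 \<longrightarrow> f (weight_act a s w) * s ^ L = poly p' s"
      using rational_laurent[of q "\<lambda>s. f (weight_act a s w)" p] by blast
    have "degree (monom 1 (K - L) * p') \<le> (K - L) + degree p'"
      by (rule order.trans[OF degree_mult_le]) (simp add: degree_monom_eq)
    then have "degree (monom 1 (K - L) * p') \<le> 2 * K" using L p q by (simp add: K_def)
    moreover have "f (weight_act a s w) * s ^ K = poly (monom 1 (K - L) * p') s" if "s \<noteq> 0" for s
    proof -
      have "s ^ K = s ^ (K - L) * s ^ L" using L q by (simp add: K_def power_add[symmetric])
      then show ?thesis using L(3) that by (simp add: poly_monom mult.left_commute)
    qed
    ultimately show ?thesis unfolding laurent_bounded_def by blast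
  qed
  \<comment> \<open>After multiplication by s^K the exponents lie between 0 and 2K, so 2K + 1 roots
    of unity separate them.\<close>
  define m where "m = Suc (2 * K)"
  define \<zeta> where "\<zeta> = cis (2 * pi / m)"
  have \<zeta>: "\<zeta> \<noteq> 0" by (simp add: \<zeta>_def)
  define F where "F s = zero_outside X (\<lambda>w. f (weight_act a s w))" for s
  have F: "F s \<in> regular_fun X" if "s \<noteq> 0" for s
    unfolding F_def
    by (rule regular_fun_compose[OF f _ stable[OF that]])
       (simp_all add: weight_act_def rational_at_mult rational_at_const rational_at_coord)
  \<comment> \<open>The inverse discrete Fourier transform; the \<open>K\<close> in the exponent
    accounts for the factor s^K.\<close>
  define e where "e i = (\<Sum>k<m. (\<lambda>_. inverse (of_nat m) * (\<zeta> ^ k) powi (int K - int i)) * F (\<zeta> ^ k))" for i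
  have e: "e i \<in> regular_fun X" for i
    unfolding e_def using \<zeta> by (intro regular_fun_sum regular_fun_mult_rational F rational_at_const) auto
  have eq: "f (weight_act a s w) * s ^ K = (\<Sum>i\<le>2*K. e i w * s ^ i)"
    if w: "w \<in> X" "Q w \<noteq> 0" and s: "s \<noteq> 0" for w s
  proof -
    obtain p where p: "degree p \<le> 2 * K" "\<forall>s. s \<noteq> 0 \<longrightarrow> f (weight_act a s w) * s ^ K = poly p s"
      using generic[OF w] unfolding laurent_bounded_def by blast
    have poly: "poly p s = (\<Sum>i\<le>2*K. coeff p i * s ^ i)" for s
      unfolding poly_altdef using p(1) by (intro sum.mono_neutral_left) (auto simp: coeff_eq_0)
    have "e i w = coeff p i" if i: "i \<le> 2 * K" for i
    proof -
      have "e i w = (\<Sum>k<m. inverse (of_nat m) * ((\<zeta> ^ k) powi (- int i) * poly p (\<zeta> ^ k)))"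
        unfolding e_def sum_fun_apply
      proof (rule sum.cong)
        fix k
        have "(\<zeta> ^ k) powi (int K - int i) = (\<zeta> ^ k) powi (- int i) * (\<zeta> ^ k) ^ K"
          using \<zeta> power_int_add[of "\<zeta> ^ k" "- int i" "int K"] by simp
        then show "((\<lambda>_. inverse (of_nat m) * (\<zeta> ^ k) powi (int K - int i)) * F (\<zeta> ^ k)) w =
            inverse (of_nat m) * ((\<zeta> ^ k) powi (- int i) * poly p (\<zeta> ^ k))"
          using p(2)[rule_format, of "\<zeta> ^ k"] \<zeta> w(1)
          by (simp add: pointwise_simps F_def zero_outside_apply mult_ac)
      qed simp
      also have "\<dots> = (\<Sum>k<m. \<Sum>j\<le>2*K. inverse (of_nat m) * (coeff p j * (\<zeta> ^ k) powi (int j - int i)))"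
      proof (rule sum.cong)
        fix k
        have "(\<zeta> ^ k) powi (- int i) * (coeff p j * (\<zeta> ^ k) ^ j) = coeff p j * (\<zeta> ^ k) powi (int j - int i)" for j
          using \<zeta> power_int_add[of "\<zeta> ^ k" "int j" "- int i"] by (auto simp: mult_ac)
        then show "inverse (of_nat m) * ((\<zeta> ^ k) powi (- int i) * poly p (\<zeta> ^ k)) =
            (\<Sum>j\<le>2*K. inverse (of_nat m) * (coeff p j * (\<zeta> ^ k) powi (int j - int i)))"
          by (simp only: poly sum_distrib_left)
      qed simp
      also have "\<dots> = (\<Sum>j\<le>2*K. inverse (of_nat m) * coeff p j * (\<Sum>k<m. (\<zeta> ^ k) powi (int j - int i)))"
        by (subst sum.swap) (simp add: sum_distrib_left mult.assoc)
      also have "\<dots> = (\<Sum>j\<le>2*K. if j = i then coeff p j else 0)"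
      proof (rule sum.cong)
        fix j assume "j \<in> {..2*K}"
        then have "\<bar>int j - int i\<bar> < int m" using i by (auto simp: m_def)
        then show "inverse (of_nat m) * coeff p j * (\<Sum>k<m. (\<zeta> ^ k) powi (int j - int i)) =
            (if j = i then coeff p j else 0)"
          using sum_root_unity_powers[of m "int j - int i"] by (auto simp: \<zeta>_def m_def simp del: of_nat_Suc)
      qed simp
      also have "\<dots> = coeff p i" using i by simp
      finally show ?thesis .
    qed
    then show ?thesis using p(2) s poly by simp
  qed
  have "f (weight_act a s w) * s ^ K = (\<Sum>i\<le>2*K. e i w * s ^ i)" if w: "w \<in> X" and s: "s \<noteq> 0" for w s
  proof -
    \<comment> \<open>The difference of both sides is regular in \<open>w\<close>, so its vanishing
      on the locus where \<open>Q\<close> is nonzero is enough.\<close>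
    define h where "h = F s * (\<lambda>_. s ^ K) - (\<Sum>i\<le>2*K. e i * (\<lambda>_. s ^ i))"
    have h_apply: "h w = f (weight_act a s w) * s ^ K - (\<Sum>i\<le>2*K. e i w * s ^ i)" if "w \<in> X" for w
      using that by (simp add: h_def pointwise_simps sum_fun_apply F_def zero_outside_apply)
    have "h = 0"
    proof (rule regular_fun_eq_0[OF X _ PQ(2,3)])
      show "h \<in> regular_fun X" unfolding h_def
        by (intro regular_fun_diff regular_fun_sum regular_fun_mult_rational F[OF s] e rational_at_const)
      show "h x = 0" if "x \<in> X" "Q x \<noteq> 0" for x
        using eq[OF that s] h_apply[OF that(1)] by simp
    qed
    then show ?thesis using h_apply[OF w] by (simp add: pointwise_simps)
  qed
  then show ?thesis using that[of e K] e by blast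
qed

section \<open>The Fourier--Laplace automorphism\<close>

definition base_pt :: "complex ^ 'r option \<Rightarrow> complex ^ 'r" where
  "base_pt y = (\<chi> k. y $ Some k)"

definition line_pt :: "complex \<Rightarrow> complex ^ 'r \<Rightarrow> complex ^ 'r::finite option" where
  "line_pt t x = (\<chi> j. case j of None \<Rightarrow> t | Some k \<Rightarrow> x $ k)"

lemma line_pt_simps [simp]:
  "base_pt (line_pt t x) = x" "line_pt t x $ None = t" "line_pt t x $ Some k = x $ k"
  "line_pt (y $ None) (base_pt y) = y"
  by (auto simp: base_pt_def line_pt_def vec_eq_iff split: option.split)

lemma base_pt_nth [simp]: "base_pt y $ k = y $ Some k"
  by (simp add: base_pt_def)

lemma line_times_iff: "y \<in> line_times S \<longleftrightarrow> base_pt y \<in> S"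
  by (simp add: line_times_def base_pt_def)

lemma punctured_iff: "y \<in> punctured_line_times S \<longleftrightarrow> base_pt y \<in> S \<and> y $ None \<noteq> 0"
  by (simp add: punctured_line_times_def line_times_iff)

lemma continuous_base_pt: "continuous_on UNIV base_pt"
  unfolding base_pt_def by (intro continuous_on_vec_lambda continuous_intros)

lemma open_line_times: "open S \<Longrightarrow> open (line_times S)"
proof -
  have "line_times S = base_pt -` S" by (auto simp: line_times_iff)
  then show "open S \<Longrightarrow> ?thesis" using open_vimage[OF _ continuous_base_pt, of S] by simp
qed

lemma open_punctured_line_times: "open S \<Longrightarrow> open (punctured_line_times S)"
proof -
  assume "open S"
  then have "open (line_times S \<inter> {y. y $ None \<noteq> 0})"
    by (intro open_Int open_line_times open_polynomial_nonzero polynomial_fun.coord)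
  moreover have "line_times S \<inter> {y. y $ None \<noteq> 0} = punctured_line_times S"
    by (auto simp: punctured_line_times_def)
  ultimately show ?thesis by simp
qed

text \<open>Continuity at 0 forces 0 to be a root of \<open>p\<close> as long as a factor
  \<open>s\<close> is left; hence \<open>p\<close> is divisible by s^K, and
  \<open>poly_shift\<close> is the quotient.\<close>

lemma polynomial_divisible_monom:
  fixes g :: "complex \<Rightarrow> complex"
  assumes "isCont g 0" "\<And>s. s \<noteq> 0 \<Longrightarrow> g s * s ^ K = poly p s"
  shows "g s = poly (poly_shift K p) s"
  using assms(2)
proof (induction K arbitrary: p s)
  case 0
  then show ?case using continuous_cancel_root[OF assms(1), of 1 p]
    by (cases "s = 0") auto
next
  case (Suc K)
  have "g 0 * poly (monom 1 (Suc K)) 0 = poly p 0"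
    by (rule continuous_cancel_root[OF assms(1)]) (simp add: Suc.prems poly_monom del: power_Suc)
  then have "poly p 0 = 0" by (simp add: poly_monom)
  then obtain p' where p': "p = [:0, 1:] * p'" by (auto simp: poly_eq_0_iff_dvd)
  have "g s * s ^ K = poly p' s" if "s \<noteq> 0" for s
    using Suc.prems[OF that] that by (simp add: p')
  from Suc.IH[OF this] have "g s = poly (poly_shift K p') s" for s .
  moreover have "poly_shift (Suc K) p = poly_shift K p'"
    by (simp add: poly_eq_iff coeff_poly_shift p')
  ultimately show ?case by simp
qed

locale line = S: open_set S for S :: "(complex ^ 'r::finite) set"
begin

sublocale Y: open_set "line_times S"
  by unfold_locales (rule open_line_times[OF S.open_X])

sublocale U: open_set "punctured_line_times S"
  by unfold_locales (rule open_punctured_line_times[OF S.open_X])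

sublocale UY: open_subset "punctured_line_times S" "line_times S"
  by unfold_locales (auto simp: punctured_line_times_def)

abbreviation "Y \<equiv> line_times S"

definition lift :: "(complex ^ 'r \<Rightarrow> complex) \<Rightarrow> complex ^ 'r option \<Rightarrow> complex" where
  "lift r = (\<lambda>y. r (base_pt y))"

definition mono :: "(complex ^ 'r \<Rightarrow> complex) \<Rightarrow> nat \<Rightarrow> complex ^ 'r option \<Rightarrow> complex" where
  "mono r j = (\<lambda>y. r (base_pt y) * (y $ None) ^ j)"

lemma lift_rational: "r \<in> regular_fun S \<Longrightarrow> y \<in> Y \<Longrightarrow> rational_at Y y (lift r)"
  unfolding lift_def
  by (rule rational_at_compose[where Y = S])
     (auto simp: regular_fun_rational_at line_times_iff intro: rational_at_coord)

lemma mono_regular: "r \<in> regular_fun S \<Longrightarrow> mono r j \<in> regular_fun Y"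
  unfolding regular_fun_iff[of "mono r j"]
proof (intro conjI allI impI ballI)
  assume r: "r \<in> regular_fun S"
  show "mono r j y = 0" if "y \<notin> Y" for y
    using that r by (simp add: mono_def line_times_iff regular_fun_outside)
  show "rational_at Y y (mono r j)" if "y \<in> Y" for y
    unfolding mono_def
    by (rule rational_at_mult[OF lift_rational[OF r that, unfolded lift_def] rational_at_power[OF rational_at_coord]])
qed

lemma mono_0: "mono r 0 = lift r"
  by (simp add: mono_def lift_def)

lemma lift_regular: "r \<in> regular_fun S \<Longrightarrow> lift r \<in> regular_fun Y"
  using mono_regular[of r 0] by (simp add: mono_0)

lemma mono_zero [simp]: "mono 0 j = 0"
  by (simp add: mono_def fun_eq_iff pointwise_simps)

lemma mono_add: "mono (r + r') j = mono r j + mono r' j"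
  by (simp add: mono_def fun_eq_iff pointwise_simps distrib_right)

lemma mono_mult: "mono r i * mono r' j = mono (r * r') (i + j)"
  by (simp add: mono_def fun_eq_iff pointwise_simps power_add mult_ac)

lemma M_mono_1: "Y.M (mono (zero_outside S (\<lambda>_. 1)) j) = Y.M (\<lambda>y. (y $ None) ^ j)"
  by (rule mult_op_cong) (simp add: mono_def zero_outside_apply line_times_iff)

text \<open>Functions on the line times \<open>S\<close> are polynomials in the line coordinate over
  the functions on \<open>S\<close>: scaling that coordinate gives a Laurent expansion, and
  continuity at its zero excludes negative powers.\<close>

lemma regular_line_expand:
  assumes f: "f \<in> regular_fun Y"
  obtains N c where "\<And>j. c j \<in> regular_fun S" "f = (\<Sum>j\<le>N. mono (c j) j)"
proof -
  let ?a = "case_option (1::int) (\<lambda>_::'r. 0)"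
  have act: "weight_act ?a s y = line_pt (s * y $ None) (base_pt y)" for s y
    by (auto simp: weight_act_def line_pt_def vec_eq_iff split: option.split)
  have stable: "weight_act ?a s y \<in> Y" if "s \<noteq> 0" "y \<in> Y" for s y
    using that by (simp add: act line_times_iff)
  obtain K e where e: "\<And>i. e i \<in> regular_fun Y"
    "\<And>w s. w \<in> Y \<Longrightarrow> s \<noteq> 0 \<Longrightarrow> f (weight_act ?a s w) * s ^ K = (\<Sum>i\<le>2*K. e i w * s ^ i)"
    by (rule regular_laurent[OF Y.open_X stable f]) (assumption | blast)+
  \<comment> \<open>The coefficient of the \<open>j\<close>-th power is the homogeneous part of
    index \<open>j + K\<close>, restricted to the slice where the line coordinate is 1.\<close>
  define c where "c j = (if j \<le> K then zero_outside S (\<lambda>x. e (j + K) (line_pt 1 x)) else 0)" for j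
  have c: "c j \<in> regular_fun S" for j
  proof -
    have "zero_outside S (\<lambda>x. e (j + K) (line_pt 1 x)) \<in> regular_fun S"
    proof (rule regular_fun_compose[OF e(1)])
      show "rational_at S x (\<lambda>y. line_pt 1 y $ i)" for x i
        by (cases i) (auto intro: rational_at_const rational_at_coord)
    qed (simp add: line_times_iff)
    then show ?thesis by (simp add: c_def)
  qed
  have "f y = (\<Sum>j\<le>K. mono (c j) j) y" for y
  proof (cases "y \<in> Y")
    case True
    define x where "x = base_pt y"
    have x: "x \<in> S" using True by (simp add: x_def line_times_iff)
    define p where "p = (\<Sum>i\<le>2*K. monom (e i (line_pt 1 x)) i)"
    have "isCont (\<lambda>s. f (line_pt s x)) 0"
    proof (rule isCont_o2[OF _ regular_fun_isCont[OF Y.open_X f]])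
      have "continuous_on UNIV (\<lambda>s. line_pt s x)"
        unfolding line_pt_def
      proof (rule continuous_on_vec_lambda)
        show "continuous_on UNIV (\<lambda>s. case j of None \<Rightarrow> s | Some k \<Rightarrow> x $ k)" for j
          by (cases j) (auto intro: continuous_intros)
      qed
      then show "isCont (\<lambda>s. line_pt s x) 0" by (simp add: continuous_on_eq_continuous_at)
    qed (simp add: line_times_iff x)
    moreover have "f (line_pt s x) * s ^ K = poly p s" if "s \<noteq> 0" for s
      using e(2)[of "line_pt 1 x", OF _ that] x by (simp add: act line_times_iff p_def poly_sum poly_monom)
    ultimately have "f (line_pt s x) = poly (poly_shift K p) s" for s
      by (rule polynomial_divisible_monom)
    moreover have "poly (poly_shift K p) s = (\<Sum>j\<le>K. c j x * s ^ j)" for s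
    proof -
      have cp: "coeff (poly_shift K p) j = c j x" for j
        using x by (simp add: coeff_poly_shift p_def coeff_sum c_def zero_outside_apply pointwise_simps)
      then have "degree (poly_shift K p) \<le> K"
        by (intro degree_le) (simp add: c_def pointwise_simps)
      then show ?thesis unfolding poly_altdef cp[symmetric]
        by (intro sum.mono_neutral_left) (auto simp: coeff_eq_0)
    qed
    ultimately have "f (line_pt (y $ None) x) = (\<Sum>j\<le>K. c j x * (y $ None) ^ j)" by simp
    then show ?thesis by (simp add: sum_fun_apply mono_def x_def)
  next
    case False
    then show ?thesis
      by (simp add: regular_fun_outside[OF f] sum_fun_apply mono_def line_times_iff regular_fun_outside[OF c])
  qed
  then show ?thesis using that[of c K] c by blast
qed

lemma mono_sum_eq_0:
  assumes "\<And>j. c j \<in> regular_fun S" "(\<Sum>j\<le>N. mono (c j) j) = 0" "j \<le> N"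
  shows "c j = 0"
proof
  fix x
  show "c j x = 0 x"
  proof -
    have "poly (\<Sum>j\<le>N. monom (c j x) j) s = 0" for s
      using fun_cong[OF assms(2), of "line_pt s x"]
      by (simp add: sum_fun_apply mono_def poly_sum poly_monom pointwise_simps)
    then have "(\<Sum>j\<le>N. monom (c j x) j) = 0" using poly_all_0_iff_0 by blast
    from arg_cong[OF this, of "\<lambda>p. coeff p j"] assms(3) show ?thesis
      by (simp add: coeff_sum pointwise_simps)
  qed
qed

lemma D_None_mono:
  assumes "r \<in> regular_fun S"
  shows "Y.D None (mono r j) = mono ((\<lambda>_. of_nat j) * r) (j - 1)"
proof
  fix y
  have "((\<lambda>s. r (base_pt y) * s ^ j) has_field_derivative r (base_pt y) * (of_nat j * y $ None ^ (j - 1))) (at (y $ None))"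
    by (auto intro!: derivative_eq_intros)
  then have "deriv (\<lambda>s. r (base_pt y) * s ^ j) (y $ None) = r (base_pt y) * (of_nat j * y $ None ^ (j - 1))"
    by (rule DERIV_imp_deriv)
  then show "Y.D None (mono r j) y = mono ((\<lambda>_. of_nat j) * r) (j - 1) y"
    using mono_regular[OF assms] regular_fun_outside[OF assms]
    by (simp add: partial_op_def zero_outside_def mono_def base_pt_def line_times_def pointwise_simps mult_ac)
qed

lemma D_Some_mono:
  assumes "r \<in> regular_fun S"
  shows "Y.D (Some k) (mono r j) = mono (S.D k r) j"
proof
  fix y
  show "Y.D (Some k) (mono r j) y = mono (S.D k r) j y"
  proof (cases "y \<in> Y")
    case True
    then have "((\<lambda>s. r (\<chi> i. if i = k then s else base_pt y $ i) * y $ None ^ j)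
        has_field_derivative S.D k r (base_pt y) * y $ None ^ j) (at (base_pt y $ k))"
      by (intro DERIV_cmult_right has_gradient_partial regular_fun_gradient S.open_X assms) (simp add: line_times_iff)
    then have "deriv (\<lambda>s. r (\<chi> i. if i = k then s else base_pt y $ i) * y $ None ^ j) (y $ Some k) =
        S.D k r (base_pt y) * y $ None ^ j"
      by (intro DERIV_imp_deriv) simp
    moreover have "base_pt (\<chi> j. if j = Some k then s else y $ j) = (\<chi> i. if i = k then s else base_pt y $ i)" for s
      by (simp add: vec_eq_iff)
    ultimately show ?thesis
      using mono_regular[OF assms] True
      by (simp add: partial_op_def[of Y] zero_outside_def mono_def)
  next
    case False
    then show ?thesis
      using regular_fun_outside[OF partial_op_regular[OF S.open_X assms]]
      by (simp add: mono_def line_times_iff partial_op_def[of Y] zero_outside_def)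
  qed
qed

section \<open>Construction of the Fourier-Laplace automorphism\<close>

text \<open>(-\<partial>_t)^j, the prospective image of t^j.\<close>

primrec ndt :: "nat \<Rightarrow> ('r option, 'r option) operator" where
  "ndt 0 = Y.I"
| "ndt (Suc j) = - Y.D None \<cdot> ndt j"

lemma ndt_diff_op: "ndt j \<in> diff_op Y"
  by (induction j) (auto intro: one_diff_op diff_op.comp Y.diff_op_uminus diff_op.partial)

lemma ndt_add: "ndt (i + j) = ndt i \<cdot> ndt j"
  by (induction i) (simp_all add: ndt_diff_op comp_assoc)

lemma ndt_commute:
  assumes "P \<in> diff_op Y" "Y.D None \<cdot> P = P \<cdot> Y.D None"
  shows "ndt j \<cdot> P = P \<cdot> ndt j"
proof (induction j)
  case (Suc j)
  have "ndt (Suc j) \<cdot> P = - Y.D None \<cdot> (P \<cdot> ndt j)" using Suc by (simp add: comp_assoc)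
  also have "\<dots> = - (Y.D None \<cdot> P) \<cdot> ndt j" by (simp add: comp_uminus_left comp_assoc)
  also have "\<dots> = P \<cdot> ndt (Suc j)"
    using assms by (simp add: comp_uminus_left comp_assoc Y.comp_uminus_right diff_op.comp diff_op.partial ndt_diff_op)
  finally show ?case .
qed (simp add: assms)

lemma D_None_lift:
  assumes "r \<in> regular_fun S" shows "Y.D None \<cdot> Y.M (lift r) = Y.M (lift r) \<cdot> Y.D None"
proof -
  have "Y.D None (lift r) = 0"
    using D_None_mono[OF assms, of 0] by (simp add: mono_def lift_def fun_eq_iff pointwise_simps)
  then show ?thesis using Y.D_M[OF lift_regular[OF assms], of None] by (simp add: mult_op_0)
qed

lemma M_t_diff_op: "Y.M (\<lambda>y. y $ None) \<in> diff_op Y"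
  by (intro mult_op_diff_op rational_at_coord)

lemma D_None_t: "Y.D None \<cdot> Y.M (\<lambda>y. y $ None) = Y.I + Y.M (\<lambda>y. y $ None) \<cdot> Y.D None"
  using Y.D_M[OF regular_coord, of None None] by (simp add: partial_op_coord Y.open_X mult_op_zero_outside)

text \<open>The commutator of t with (-\<partial>_t)^j is j (-\<partial>_t)^(j-1). It is the image
  of the rule \<partial>_t t^j = j t^(j-1) + t^j \<partial>_t; for j = 0 the factor covers the
  truncated subtraction.\<close>

lemma M_t_ndt:
  "Y.M (\<lambda>y. y $ None) \<cdot> ndt j = Y.M (\<lambda>_. of_nat j) \<cdot> ndt (j - 1) + ndt j \<cdot> Y.M (\<lambda>y. y $ None)"
proof (induction j)
  case 0
  have "Y.M (\<lambda>_. of_nat 0) = 0" using mult_op_0[of Y] by (simp add: zero_fun_def)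
  then show ?case by (simp add: M_t_diff_op comp_zero_left)
next
  case (Suc j)
  let ?t = "Y.M (\<lambda>y. y $ None)" and ?c = "Y.M (\<lambda>_. of_nat j)"
  have c: "?c \<in> diff_op Y" by (intro mult_op_diff_op rational_at_const)
  note cl = diff_op.comp[where X = Y] diff_op.partial[where X = Y] Y.diff_op_uminus ndt_diff_op c M_t_diff_op one_diff_op[of Y]
  have Dc: "Y.D None \<cdot> ?c = ?c \<cdot> Y.D None"
    using Y.D_M[OF regular_fun_const, of None "of_nat j"]
    by (simp add: partial_op_const Y.open_X mult_op_zero_outside mult_op_0)
  have "?t \<cdot> Y.D None = Y.D None \<cdot> ?t - Y.I" using D_None_t by simp
  then have "?t \<cdot> ndt (Suc j) = ndt j - Y.D None \<cdot> (?t \<cdot> ndt j)"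
    by (simp add: Y.comp_uminus_right comp_uminus_left cl o_assoc comp_diff_left)
  also have "\<dots> = ndt j - Y.D None \<cdot> (?c \<cdot> ndt (j - 1)) + ndt (Suc j) \<cdot> ?t"
    unfolding Suc by (simp add: Y.comp_plus_right cl comp_uminus_left comp_assoc)
  also have "Y.D None \<cdot> (?c \<cdot> ndt (j - 1)) = ?c \<cdot> (Y.D None \<cdot> ndt (j - 1))"
    by (simp only: o_assoc Dc)
  also have "?c \<cdot> (Y.D None \<cdot> ndt (j - 1)) = - (?c \<cdot> ndt j)"
  proof (cases j)
    case 0
    have "?c = 0" using 0 mult_op_0[of Y] by (simp add: zero_fun_def)
    then show ?thesis by (simp add: comp_zero_left)
  next
    case (Suc i)
    then have "ndt j = - (Y.D None \<cdot> ndt (j - 1))" by (simp add: comp_uminus_left)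
    then show ?thesis by (simp only: Y.comp_uminus_right cl minus_minus)
  qed
  also have "ndt j - - (?c \<cdot> ndt j) = Y.M (\<lambda>_. of_nat (Suc j)) \<cdot> ndt (Suc j - 1)"
  proof -
    have "Y.M (\<lambda>_. of_nat (Suc j)) = Y.I + ?c"
      unfolding mult_op_add[symmetric] by (simp add: plus_fun_def)
    then show ?thesis by (simp add: comp_plus_left ndt_diff_op)
  qed
  finally show ?case .
qed

lemma regular_line_induct [consumes 1, case_names mono add]:
  assumes "f \<in> regular_fun Y" "\<And>r j. r \<in> regular_fun S \<Longrightarrow> C (mono r j)"
    "\<And>f g. f \<in> regular_fun Y \<Longrightarrow> g \<in> regular_fun Y \<Longrightarrow> C f \<Longrightarrow> C g \<Longrightarrow> C (f + g)"
  shows "C f"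
proof -
  obtain N c where c: "\<And>j. c j \<in> regular_fun S" "f = (\<Sum>j\<le>N. mono (c j) j)"
    using regular_line_expand[OF assms(1)] by blast
  have "C (\<Sum>j\<le>n. mono (c j) j) \<and> (\<Sum>j\<le>n. mono (c j) j) \<in> regular_fun Y" for n
  proof (induction n)
    case (Suc n)
    then show ?case using assms(2,3) c(1) mono_regular by (simp add: regular_fun_add)
  qed (simp add: assms(2) c mono_regular)
  then show ?thesis using c(2) by simp
qed

text \<open>The transformation on functions. It is well defined because the powers of t are
  independent over the functions on \<open>S\<close>.\<close>

lemma theta_exists:
  obtains \<theta> where "\<And>f g. f \<in> regular_fun Y \<Longrightarrow> g \<in> regular_fun Y \<Longrightarrow> \<theta> (f + g) = \<theta> f + \<theta> g"
    and "\<And>r j. r \<in> regular_fun S \<Longrightarrow> \<theta> (mono r j) = Y.M (lift r) \<cdot> ndt j"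
proof (rule additive_extend[OF additive_set_regular, of S "\<lambda>j r. mono r j" "\<lambda>j r. Y.M (lift r) \<cdot> ndt j"])
  let ?S = "add_span {mono r j | j r. r \<in> regular_fun S}"
  show "mono (r + r') j = mono r j + mono r' j" for r r' j by (rule mono_add)
  show "Y.M (lift (r + r')) \<cdot> ndt j = Y.M (lift r) \<cdot> ndt j + Y.M (lift r') \<cdot> ndt j" for r r' j
  proof -
    have "lift (r + r') = lift r + lift r'" by (simp add: lift_def fun_eq_iff pointwise_simps)
    then show ?thesis by (simp add: mult_op_add comp_plus_left)
  qed
  show "c j = 0" if c: "finite B" "\<And>j. c j \<in> regular_fun S" "(\<Sum>j\<in>B. mono (c j) j) = 0" "j \<in> B" for B c j
  proof -
    let ?c = "\<lambda>j. if j \<in> B then c j else 0"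
    have "B \<subseteq> {..Max B}" using c(1) by auto
    then have "(\<Sum>j\<le>Max B. mono (?c j) j) = (\<Sum>j\<in>B. mono (c j) j)"
      by (intro sum.mono_neutral_cong_right) auto
    then have "?c j = 0" using mono_sum_eq_0[of ?c "Max B" j] c by simp
    then show ?thesis using c(4) by simp
  qed
  fix L assume L: "\<And>f g. f \<in> ?S \<Longrightarrow> g \<in> ?S \<Longrightarrow> L (f + g) = L f + L g"
    "\<And>j r. r \<in> regular_fun S \<Longrightarrow> L (mono r j) = Y.M (lift r) \<cdot> ndt j"
  have "f \<in> ?S" if "f \<in> regular_fun Y" for f
    using that by (induction rule: regular_line_induct) (auto intro: add_span.intros)
  then show thesis by (intro that[of L] L)
qed

text \<open>Functions are polynomial in the line coordinate, so t and the functions of the base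
  generate all multiplication operators.\<close>

lemma line_diff_op_induct [consumes 1, case_names t lift D_None D_Some add comp]:
  assumes "P \<in> diff_op Y"
    and "C (Y.M (\<lambda>y. y $ None))" "\<And>r. r \<in> regular_fun S \<Longrightarrow> C (Y.M (lift r))"
    and "C (Y.D None)" "\<And>k. C (Y.D (Some k))"
    and "\<And>P Q. P \<in> diff_op Y \<Longrightarrow> Q \<in> diff_op Y \<Longrightarrow> C P \<Longrightarrow> C Q \<Longrightarrow> C (P + Q)"
    and "\<And>P Q. P \<in> diff_op Y \<Longrightarrow> Q \<in> diff_op Y \<Longrightarrow> C P \<Longrightarrow> C Q \<Longrightarrow> C (P \<cdot> Q)"
  shows "C P"
  using assms(1)
proof (induction rule: diff_op_induct)
  case (mult f)
  then show ?case
  proof (induction rule: regular_line_induct)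
    case (mono r j)
    show ?case
    proof (induction j)
      case 0
      show ?case using assms(3) mono by (simp add: mono_0)
    next
      case (Suc j)
      have "Y.M (mono r (Suc j)) = Y.M (\<lambda>y. y $ None) \<cdot> Y.M (mono r j)"
        using mono_regular[OF mono]
        by (simp add: Y.M_comp regular_fun_rational_at) (simp add: mono_def times_fun_def mult_ac)
      then show ?case
        using assms(7)[OF M_t_diff_op diff_op.mult[OF mono_regular[OF mono]] assms(2) Suc] by simp
    qed
  next
    case (add f g)
    then show ?case using assms(6)[OF diff_op.mult diff_op.mult] by (simp add: mult_op_add)
  qed
next
  case (partial i)
  then show ?case using assms(4,5) by (cases i) auto
qed (use assms(6,7) in auto)

definition is_FL :: "(('r option, 'r option) operator \<Rightarrow> ('r option, 'r option) operator) \<Rightarrow> bool" where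
  "is_FL \<Phi> \<longleftrightarrow> \<Phi> \<in> diff_op Y \<rightarrow> diff_op Y \<and>
     (\<forall>P\<in>diff_op Y. \<forall>Q\<in>diff_op Y. \<Phi> (P \<cdot> Q) = \<Phi> P \<cdot> \<Phi> Q \<and> \<Phi> (P + Q) = \<Phi> P + \<Phi> Q) \<and> \<Phi> Y.I = Y.I \<and>
     \<Phi> (Y.M (\<lambda>y. y $ None)) = - Y.D None \<and> \<Phi> (Y.D None) = Y.M (\<lambda>y. y $ None) \<and>
     (\<forall>r\<in>regular_fun S. \<Phi> (Y.M (lift r)) = Y.M (lift r)) \<and> (\<forall>k. \<Phi> (Y.D (Some k)) = Y.D (Some k))"

lemma FL_unique:
  assumes "is_FL \<Phi>" "is_FL \<Psi>" "P \<in> diff_op Y" shows "\<Phi> P = \<Psi> P"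
  using assms(3) by (induction rule: line_diff_op_induct) (use assms(1,2) in \<open>auto simp: is_FL_def\<close>)

text \<open>On normal forms the map takes c \<partial>^\<beta> to \<theta>(c) \<eta>^\<beta>, where
  \<eta> replaces \<partial>_t by t and keeps the other derivatives. Multiplicativity rests on two
  facts: \<theta> is multiplicative, and \<eta>_i commutes with \<theta>(f) up to
  \<theta>(\<partial>_i f).\<close>

lemma FL_exists: "\<exists>\<Phi>. is_FL \<Phi>"
proof -
  let ?t = "Y.M (\<lambda>y. y $ None)"
  obtain \<theta> where \<theta>_add: "\<And>f g. f \<in> regular_fun Y \<Longrightarrow> g \<in> regular_fun Y \<Longrightarrow> \<theta> (f + g) = \<theta> f + \<theta> g"
    and \<theta>: "\<And>r j. r \<in> regular_fun S \<Longrightarrow> \<theta> (mono r j) = Y.M (lift r) \<cdot> ndt j"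
    using theta_exists by blast
  have lift_op: "Y.M (lift r) \<in> diff_op Y" if "r \<in> regular_fun S" for r
    using that by (intro diff_op.mult lift_regular)
  have \<theta>_closed: "\<theta> f \<in> diff_op Y" if "f \<in> regular_fun Y" for f
    using that by (induction rule: regular_line_induct)
      (simp_all add: \<theta> \<theta>_add lift_op ndt_diff_op diff_op.comp diff_op_plus)
  define \<eta> where "\<eta> i = (case i of None \<Rightarrow> ?t | Some k \<Rightarrow> Y.D (Some k))" for i
  have \<eta>: "\<eta> i \<in> diff_op Y" for i
    by (cases i) (auto simp: \<eta>_def M_t_diff_op diff_op.partial)
  \<comment> \<open>Multiplication by t commutes with the derivatives along the base, so the image
    of \<partial>^\<beta> can be written with all powers of t in front.\<close>
  define \<eta>pow where "\<eta>pow \<beta> = Y.M (\<lambda>y. (y $ None) ^ count \<beta> None) \<cdot> Y.dpow (filter_mset (\<lambda>i. i \<noteq> None) \<beta>)" for \<beta>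
  have t_pow: "Y.M (\<lambda>y. (y $ None) ^ n) \<in> diff_op Y" for n
    by (intro mult_op_diff_op rational_at_power rational_at_coord)
  have \<eta>pow: "\<eta>pow \<beta> \<in> diff_op Y" for \<beta>
    unfolding \<eta>pow_def by (intro diff_op.comp t_pow Y.dpow_diff_op)
  have one_S: "zero_outside S (\<lambda>_. 1) \<in> regular_fun S" by (rule regular_fun_const)
  have D_t_pow: "Y.D (Some k) \<cdot> Y.M (\<lambda>y. (y $ None) ^ n) = Y.M (\<lambda>y. (y $ None) ^ n) \<cdot> Y.D (Some k)" for k n
    using Y.D_M[OF mono_regular[OF one_S], of "Some k" n]
    by (simp add: M_mono_1 D_Some_mono one_S partial_op_const S.open_X mult_op_0)
  have \<eta>pow_add: "\<eta>pow (add_mset i \<beta>) = \<eta> i \<cdot> \<eta>pow \<beta>" for i \<beta>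
  proof (cases i)
    case None
    have "Y.M (\<lambda>y. (y $ None) ^ Suc (count \<beta> None)) = ?t \<cdot> Y.M (\<lambda>y. (y $ None) ^ count \<beta> None)"
      by (subst Y.M_comp) (auto simp: times_fun_def intro: rational_at_power rational_at_coord)
    then show ?thesis using None by (simp add: \<eta>pow_def \<eta>_def comp_assoc del: power_Suc)
  next
    case (Some k)
    then show ?thesis by (simp add: \<eta>pow_def \<eta>_def Y.dpow_add_mset o_assoc D_t_pow)
  qed
  have \<eta>_empty: "\<eta>pow {#} = Y.I" by (simp add: \<eta>pow_def one_diff_op)
  have \<theta>_I: "\<theta> (lift r) = Y.M (lift r)" if "r \<in> regular_fun S" for r
    using \<theta>[OF that, of 0] that by (simp add: mono_0 lift_op)
  have lift_mult: "Y.M (lift r) \<cdot> Y.M (lift r') = Y.M (lift (r * r'))" if "r' \<in> regular_fun S" for r r'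
    using Y.M_comp[OF lift_rational[OF that], of "lift r"] by (simp add: lift_def times_fun_def)
  have \<theta>_mult: "\<theta> (f * g) = \<theta> f \<cdot> \<theta> g" if f: "f \<in> regular_fun Y" and g: "g \<in> regular_fun Y" for f g
    using f
  proof (induction rule: regular_line_induct)
    case (mono r i)
    from g show ?case
    proof (induction rule: regular_line_induct)
      case (mono r' j)
      have "Y.M (lift r) \<cdot> ndt i \<cdot> (Y.M (lift r') \<cdot> ndt j) = Y.M (lift r) \<cdot> (ndt i \<cdot> Y.M (lift r')) \<cdot> ndt j"
        by (simp add: comp_assoc)
      also have "\<dots> = Y.M (lift (r * r')) \<cdot> ndt (i + j)"
        using mono by (simp add: ndt_commute[OF lift_op D_None_lift] o_assoc lift_mult ndt_add)
      finally show ?case using mono \<open>r \<in> regular_fun S\<close> by (simp add: mono_mult \<theta> regular_fun_mult)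
    next
      case (add f g)
      have "mono r i * (f + g) = mono r i * f + mono r i * g" by (simp add: distrib_left)
      then show ?case using add mono
        by (simp add: \<theta>_add regular_fun_mult mono_regular Y.comp_plus_right \<theta>_closed)
    qed
  next
    case (add f f')
    have "(f + f') * g = f * g + f' * g" by (simp add: distrib_right)
    then show ?case using add g by (simp add: \<theta>_add regular_fun_mult comp_plus_left)
  qed
  have \<theta>_comm: "\<eta> i \<cdot> \<theta> f = \<theta> (Y.D i f) + \<theta> f \<cdot> \<eta> i" if f: "f \<in> regular_fun Y" for i f
    using f
  proof (induction rule: regular_line_induct)
    case (mono r j)
    have j: "(\<lambda>_. of_nat j) * r \<in> regular_fun S"
      using mono by (intro regular_fun_mult_rational rational_at_const)
    show ?case
    proof (cases i)
      case None
      have tr: "?t \<cdot> Y.M (lift r) = Y.M (lift r) \<cdot> ?t"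
        using Y.M_comp[OF lift_rational[OF mono], of "\<lambda>y. y $ None"] Y.M_comp[OF rational_at_coord, of "lift r" None]
        by (simp add: mult.commute)
      have cr: "Y.M (lift ((\<lambda>_. of_nat j) * r)) = Y.M (lift r) \<cdot> Y.M (\<lambda>_. of_nat j)"
        by (subst Y.M_comp) (auto simp: lift_def times_fun_def mult.commute intro: rational_at_const)
      have c: "Y.M (\<lambda>_. of_nat j) \<in> diff_op Y" by (intro mult_op_diff_op rational_at_const)
      have "?t \<cdot> (Y.M (lift r) \<cdot> ndt j) = Y.M (lift r) \<cdot> (?t \<cdot> ndt j)"
        by (simp only: o_assoc tr)
      also have "\<dots> = Y.M (lift ((\<lambda>_. of_nat j) * r)) \<cdot> ndt (j - 1) + Y.M (lift r) \<cdot> ndt j \<cdot> ?t"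
        unfolding M_t_ndt cr
        by (simp add: Y.comp_plus_right lift_op mono diff_op.comp c ndt_diff_op M_t_diff_op comp_assoc)
      finally show ?thesis using None mono j by (simp add: \<eta>_def \<theta> D_None_mono)
    next
      case (Some k)
      have Dr: "S.D k r \<in> regular_fun S" by (rule partial_op_regular[OF S.open_X mono])
      have DD: "Y.D None \<cdot> Y.D (Some k) = Y.D (Some k) \<cdot> Y.D None" by (rule Y.D_D)
      have "Y.D (Some k) \<cdot> Y.M (lift r) = Y.M (lift (S.D k r)) + Y.M (lift r) \<cdot> Y.D (Some k)"
        using Y.D_M[OF lift_regular[OF mono], of "Some k"] D_Some_mono[OF mono, of k 0] by (simp add: mono_0)
      then have "Y.D (Some k) \<cdot> (Y.M (lift r) \<cdot> ndt j) =
          Y.M (lift (S.D k r)) \<cdot> ndt j + Y.M (lift r) \<cdot> (Y.D (Some k) \<cdot> ndt j)"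
        by (simp add: o_assoc comp_plus_left)
      also have "Y.D (Some k) \<cdot> ndt j = ndt j \<cdot> Y.D (Some k)"
        by (rule ndt_commute[OF diff_op.partial DD, symmetric])
      finally show ?thesis using Some mono Dr by (simp add: \<eta>_def \<theta> D_Some_mono o_assoc)
    qed
  next
    case (add f g)
    then show ?case
      by (simp add: \<theta>_add Y.comp_plus_right \<eta> \<theta>_closed partial_op_add Y.open_X partial_op_regular comp_plus_left)
  qed
  obtain L where L_add: "\<And>P Q. P \<in> diff_op Y \<Longrightarrow> Q \<in> diff_op Y \<Longrightarrow> L (P + Q) = L P + L Q"
    and L: "\<And>\<beta> c. c \<in> regular_fun Y \<Longrightarrow> L (Y.M c \<cdot> Y.dpow \<beta>) = \<theta> c \<cdot> \<eta>pow \<beta>"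
  proof (rule Y.diff_op_extend[of "\<lambda>\<beta> c. \<theta> c \<cdot> \<eta>pow \<beta>"])
    show "\<theta> (\<phi> + \<psi>) \<cdot> \<eta>pow \<beta> = \<theta> \<phi> \<cdot> \<eta>pow \<beta> + \<theta> \<psi> \<cdot> \<eta>pow \<beta>"
      if "\<phi> \<in> regular_fun Y" "\<psi> \<in> regular_fun Y" for \<beta> \<phi> \<psi>
      using that by (simp add: \<theta>_add comp_plus_left)
  qed blast
  have L_closed: "L P \<in> diff_op Y" if "P \<in> diff_op Y" for P
    using that by (induction rule: Y.diff_op_span_induct)
      (simp_all add: L L_add diff_op.comp diff_op_plus \<theta>_closed \<eta>pow)
  have L_M: "L (Y.M f) = \<theta> f" if "f \<in> regular_fun Y" for f
    using L[OF that, of "{#}"] that by (simp add: \<eta>_empty diff_op.mult \<theta>_closed)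
  have L_lift: "L (Y.M (lift r)) = Y.M (lift r)" if "r \<in> regular_fun S" for r
    using that by (simp add: L_M lift_regular \<theta>_I)
  have lift_1: "Y.M (lift (zero_outside S (\<lambda>_. 1))) = Y.I"
    using M_mono_1[of 0] by (simp add: mono_0)
  have L_I: "L Y.I = Y.I" using L_lift[OF one_S] by (simp add: lift_1)
  have L_t: "L ?t = - Y.D None"
    using L_M[OF mono_regular[OF one_S], of 1] M_mono_1[of 1] \<theta>[OF one_S, of 1]
    by (simp add: lift_1 Y.diff_op_uminus diff_op.partial)
  have L_D: "L (Y.D i) = \<eta> i" for i
    using L[OF lift_regular[OF one_S], of "{#i#}"] \<theta>_I[OF one_S]
    by (simp add: lift_1 Y.dpow_add_mset diff_op.partial \<eta>pow_add \<eta>_empty \<eta>)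
  have L_M_comp: "L (Y.M f \<cdot> Q) = L (Y.M f) \<cdot> L Q" if f: "f \<in> regular_fun Y" and Q: "Q \<in> diff_op Y" for f Q
    using Q
  proof (induction rule: Y.diff_op_span_induct)
    case (base c \<beta>)
    have "Y.M f \<cdot> (Y.M c \<cdot> Y.dpow \<beta>) = Y.M (f * c) \<cdot> Y.dpow \<beta>"
      using base by (simp add: o_assoc Y.M_comp regular_fun_rational_at)
    then show ?case using base f by (simp add: L L_M regular_fun_mult \<theta>_mult comp_assoc)
  next
    case (add P Q)
    then show ?case using f
      by (simp add: Y.comp_plus_right diff_op.mult L_add diff_op.comp L_closed)
  qed
  have L_D_comp: "L (Y.D i \<cdot> Q) = L (Y.D i) \<cdot> L Q" if Q: "Q \<in> diff_op Y" for i Q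
    using Q
  proof (induction rule: Y.diff_op_span_induct)
    case (base c \<beta>)
    have Dc: "Y.D i c \<in> regular_fun Y" by (rule partial_op_regular[OF Y.open_X base])
    have "Y.D i \<cdot> (Y.M c \<cdot> Y.dpow \<beta>) = Y.M (Y.D i c) \<cdot> Y.dpow \<beta> + Y.M c \<cdot> Y.dpow (add_mset i \<beta>)"
      using base by (simp add: o_assoc Y.D_M comp_plus_left Y.dpow_add_mset)
    then have "L (Y.D i \<cdot> (Y.M c \<cdot> Y.dpow \<beta>)) = (\<theta> (Y.D i c) + \<theta> c \<cdot> \<eta> i) \<cdot> \<eta>pow \<beta>"
      using base Dc by (simp add: L_add diff_op.comp diff_op.mult Y.dpow_diff_op L \<eta>pow_add comp_plus_left comp_assoc)
    then show ?case using base by (simp add: L L_D \<theta>_comm[symmetric] comp_assoc)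
  next
    case (add P Q)
    then show ?case
      by (simp add: Y.comp_plus_right diff_op.partial L_add diff_op.comp L_closed)
  qed
  have L_comp: "L (P \<cdot> Q) = L P \<cdot> L Q" if "P \<in> diff_op Y" "Q \<in> diff_op Y" for P Q
    using that
  proof (induction arbitrary: Q rule: diff_op_induct)
    case (add P P')
    then show ?case by (simp add: comp_plus_left L_add diff_op.comp)
  next
    case (comp P P')
    then show ?case by (simp add: comp_assoc diff_op.comp)
  qed (simp_all add: L_M_comp L_D_comp)
  show ?thesis
    by (rule exI[of _ L])
       (auto simp: is_FL_def L_closed L_add L_comp L_lift L_D L_t L_I \<eta>_def)
qed

lemma FL_hom_is_FL: "is_FL (FL_hom S)"
proof -
  define spec where "spec \<Phi> \<longleftrightarrow> \<Phi> \<in> extensional (diff_op Y) \<and> is_FL \<Phi>" for \<Phi>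
  have ops: "Y.M (lift r) \<in> diff_op Y" if "r \<in> regular_fun S" for r
    using that by (intro diff_op.mult lift_regular)
  obtain \<Phi> where \<Phi>: "is_FL \<Phi>" using FL_exists by blast
  have "is_FL (restrict \<Phi> (diff_op Y))"
    using \<Phi> by (auto simp: is_FL_def ops M_t_diff_op one_diff_op diff_op.partial diff_op_plus diff_op.comp)
  then have "spec (restrict \<Phi> (diff_op Y))" by (simp add: spec_def)
  moreover have "t = u" if "spec t" "spec u" for t u
    using that FL_unique by (auto simp: spec_def intro!: extensionalityI[of _ "diff_op Y"])
  ultimately have "\<exists>!t. spec t" by blast
  then have "spec (THE t. spec t)" by (rule theI')
  moreover have "FL_hom S = (THE t. spec t)"
    unfolding FL_hom_def Let_def spec_def is_FL_def ring_hom_def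
    by (rule arg_cong[where f = The])
       (auto simp: fun_eq_iff diff_op.partial lift_def base_pt_def)
  ultimately show ?thesis by (simp add: spec_def)
qed

lemma FL_closed: "P \<in> diff_op Y \<Longrightarrow> FL_hom S P \<in> diff_op Y"
  and FL_comp: "P \<in> diff_op Y \<Longrightarrow> Q \<in> diff_op Y \<Longrightarrow> FL_hom S (P \<cdot> Q) = FL_hom S P \<cdot> FL_hom S Q"
  and FL_add: "P \<in> diff_op Y \<Longrightarrow> Q \<in> diff_op Y \<Longrightarrow> FL_hom S (P + Q) = FL_hom S P + FL_hom S Q"
  and FL_t: "FL_hom S (Y.M (\<lambda>y. y $ None)) = - Y.D None"
  and FL_D_None: "FL_hom S (Y.D None) = Y.M (\<lambda>y. y $ None)"
  and FL_lift: "r \<in> regular_fun S \<Longrightarrow> FL_hom S (Y.M (lift r)) = Y.M (lift r)"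
  and FL_D_Some: "FL_hom S (Y.D (Some k)) = Y.D (Some k)"
  and FL_I: "FL_hom S Y.I = Y.I"
  using FL_hom_is_FL by (auto simp: is_FL_def)

lemma FL_ring_hom: "FL_hom S \<in> ring_hom (D_ring Y) (D_ring Y)"
  by (rule ring_hom_memI) (auto simp: FL_closed FL_comp FL_add FL_I)

end

section \<open>Tensor products of modules\<close>

text \<open>Extends \<open>b\<close> to the free abelian group. The \<open>ring_1\<close> structure
  supplies integer multiples only; on operators it is the pointwise one, unrelated to
  composition.\<close>

definition frag_eval :: "('x \<Rightarrow> 'c::ring_1) \<Rightarrow> ('x \<Rightarrow>\<^sub>0 int) \<Rightarrow> 'c" where
  "frag_eval b u = (\<Sum>i\<in>Poly_Mapping.keys u. of_int (Poly_Mapping.lookup u i) * b i)"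

lemma frag_eval_superset:
  assumes "finite K" "Poly_Mapping.keys u \<subseteq> K"
  shows "frag_eval b u = (\<Sum>i\<in>K. of_int (Poly_Mapping.lookup u i) * b i)"
  unfolding frag_eval_def using assms by (intro sum.mono_neutral_left) (auto simp: in_keys_iff)

lemma frag_eval_diff: "frag_eval b (u - v) = frag_eval b u - frag_eval b v"
proof -
  let ?K = "Poly_Mapping.keys u \<union> Poly_Mapping.keys v"
  have "frag_eval b (u - v) = (\<Sum>i\<in>?K. of_int (Poly_Mapping.lookup (u - v) i) * b i)"
    by (rule frag_eval_superset) (simp_all add: keys_diff)
  also have "\<dots> = frag_eval b u - frag_eval b v"
    by (simp add: frag_eval_superset[of ?K] lookup_minus left_diff_distrib sum_subtractf)
  finally show ?thesis .
qed

lemma frag_eval_0 [simp]: "frag_eval b 0 = 0"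
  by (simp add: frag_eval_def)

lemma frag_eval_uminus: "frag_eval b (- u) = - frag_eval b u"
  using frag_eval_diff[of b 0 u] by simp

lemma frag_eval_add: "frag_eval b (u + v) = frag_eval b u + frag_eval b v"
  using frag_eval_diff[of b u "- v"] by (simp add: frag_eval_uminus)

lemma frag_eval_of [simp]: "frag_eval b (frag_of x) = b x"
  by (simp add: frag_eval_def)

locale tensor =
  fixes R :: "('r, 'x) ring_scheme" and M :: "('s, 'a) module" and \<rho> :: "'a \<Rightarrow> 'r \<Rightarrow> 'a"
    and N :: "('r, 'b) module"
  assumes M_group: "abelian_group M" and N_group: "abelian_group N"
    and act_closed: "x \<in> carrier M \<Longrightarrow> r \<in> carrier R \<Longrightarrow> \<rho> x r \<in> carrier M"
    and smult_closed_N: "r \<in> carrier R \<Longrightarrow> y \<in> carrier N \<Longrightarrow> r \<odot>\<^bsub>N\<^esub> y \<in> carrier N"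
begin

sublocale MG: abelian_group M by (rule M_group)
sublocale NG: abelian_group N by (rule N_group)

abbreviation "T \<equiv> tensor_product R M \<rho> N"
abbreviation "F \<equiv> free_Abelian_group (carrier M \<times> carrier N)"

definition rels :: "('a \<times> 'b \<Rightarrow>\<^sub>0 int) set" where
  "rels = generate F (tensor_relations R M \<rho> N)"

definition cls :: "('a \<times> 'b \<Rightarrow>\<^sub>0 int) \<Rightarrow> ('a \<times> 'b \<Rightarrow>\<^sub>0 int) set" where
  "cls u = {v. v - u \<in> rels}"

definition tensor_cls :: "'a \<Rightarrow> 'b \<Rightarrow> ('a \<times> 'b \<Rightarrow>\<^sub>0 int) set" where
  "tensor_cls x y = cls (frag_of (x, y))"

lemma relations_in: "tensor_relations R M \<rho> N \<subseteq> carrier F"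
proof
  fix u assume u: "u \<in> tensor_relations R M \<rho> N"
  have F: "w \<in> carrier F \<and> v \<in> carrier F \<Longrightarrow> w - v \<in> carrier F" for w v
    using keys_diff[of w v] by auto
  from u show "u \<in> carrier F" unfolding tensor_relations_def
    by (elim UnE; clarify; intro F conjI) (simp_all add: act_closed smult_closed_N)
qed

lemma rels_sub: "rels \<subseteq> carrier F"
  unfolding rels_def by (rule group.generate_incl[OF group_free_Abelian_group relations_in])

lemma rels_induct [consumes 1, case_names zero rel uminus add]:
  assumes "u \<in> rels" "C 0" "\<And>u. u \<in> tensor_relations R M \<rho> N \<Longrightarrow> C u"
    "\<And>u. u \<in> tensor_relations R M \<rho> N \<Longrightarrow> C (- u)"
    "\<And>u v. u \<in> rels \<Longrightarrow> v \<in> rels \<Longrightarrow> C u \<Longrightarrow> C v \<Longrightarrow> C (u + v)"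
  shows "C u"
  using assms(1) unfolding rels_def
proof (induction rule: generate.induct)
  case (inv h)
  then have "h \<in> carrier F" using relations_in by blast
  then have "inv\<^bsub>F\<^esub> h = - h" by simp
  then show ?case using assms(4) inv by simp
qed (use assms(2,3,5) in \<open>auto simp: rels_def\<close>)

lemma rels_additive: "additive_set rels"
proof -
  have sub: "subgroup rels F"
    unfolding rels_def by (rule group.generate_is_subgroup[OF group_free_Abelian_group relations_in])
  have "- v \<in> rels" if "v \<in> rels" for v
  proof -
    have "v \<in> carrier F" using rels_sub that by blast
    then show ?thesis using subgroup.m_inv_closed[OF sub that] by simp
  qed
  then show ?thesis
    using subgroup.one_closed[OF sub] subgroup.m_closed[OF sub]
    unfolding additive_set_def by (auto simp: diff_conv_add_uminus simp del: add_uminus_conv_diff)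
qed

lemmas rels_closed = additive_setD[OF rels_additive]

lemma rcoset_cls: "rels #>\<^bsub>F\<^esub> u = cls u"
  unfolding r_coset_def cls_def by (auto simp: algebra_simps intro: bexI[of _ "_ - u"])

lemma self_in_cls: "u \<in> cls u"
  by (simp add: cls_def rels_closed)

lemma cls_eq_iff: "cls u = cls v \<longleftrightarrow> u - v \<in> rels"
proof
  show "cls u = cls v \<Longrightarrow> u - v \<in> rels" using self_in_cls[of u] by (simp add: cls_def)
  assume uv: "u - v \<in> rels"
  have "x - v = (x - u) + (u - v)" "x - u = (x - v) - (u - v)" for x by simp_all
  then have "x - u \<in> rels \<longleftrightarrow> x - v \<in> rels" for x
    using uv rels_closed(2,4) by metis
  then show "cls u = cls v" by (simp add: cls_def)
qed

lemma carrier_T: "carrier T = cls ` carrier F"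
  by (auto simp: tensor_product_def Let_def FactGroup_def RCOSETS_def rcoset_cls rels_def[symmetric])

lemma zero_T: "\<zero>\<^bsub>T\<^esub> = cls 0"
  by (simp add: tensor_product_def Let_def FactGroup_def rels_def[symmetric] cls_def)

lemma cls_add: "cls u \<oplus>\<^bsub>T\<^esub> cls v = cls (u + v)"
proof -
  have "cls u <#>\<^bsub>F\<^esub> cls v = cls (u + v)"
  proof (intro equalityI subsetI)
    fix x assume "x \<in> cls u <#>\<^bsub>F\<^esub> cls v"
    then obtain a b where ab: "a - u \<in> rels" "b - v \<in> rels" "x = a + b"
      by (auto simp: set_mult_def cls_def)
    then show "x \<in> cls (u + v)"
      using rels_closed(4)[OF ab(1,2)] by (simp add: cls_def algebra_simps)
  next
    fix x assume "x \<in> cls (u + v)"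
    then have "x - v \<in> cls u" by (simp add: cls_def algebra_simps)
    moreover have "x = (x - v) + v" by simp
    ultimately show "x \<in> cls u <#>\<^bsub>F\<^esub> cls v"
      using self_in_cls[of v] unfolding set_mult_def by (metis (no_types) UN_iff insertI1 mult_free_Abelian_group)
  qed
  then show ?thesis by (simp add: tensor_product_def Let_def FactGroup_def rels_def[symmetric])
qed

lemma abelian_group_T: "abelian_group T"
proof (rule abelian_groupI)
  have F: "u + v \<in> carrier F" "- u \<in> carrier F" if "u \<in> carrier F" "v \<in> carrier F" for u v
    using that keys_add[of u v] by auto
  show "C \<oplus>\<^bsub>T\<^esub> C' \<in> carrier T" if "C \<in> carrier T" "C' \<in> carrier T" for C C'
    using that F unfolding carrier_T by (auto simp: cls_add simp del: carrier_free_Abelian_group_iff)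
  show "\<exists>C'\<in>carrier T. C' \<oplus>\<^bsub>T\<^esub> C = \<zero>\<^bsub>T\<^esub>" if C: "C \<in> carrier T" for C
  proof -
    obtain u where "u \<in> carrier F" "C = cls u" using C unfolding carrier_T by blast
    then show ?thesis using F unfolding carrier_T by (intro bexI[of _ "cls (- u)"]) (auto simp: cls_add zero_T)
  qed
qed (auto simp: carrier_T cls_add zero_T add_ac)

sublocale TG: abelian_group T by (rule abelian_group_T)

lemma tensor_cls_closed: "x \<in> carrier M \<Longrightarrow> y \<in> carrier N \<Longrightarrow> tensor_cls x y \<in> carrier T"
  by (simp add: tensor_cls_def carrier_T)

lemma rel_in: "u \<in> tensor_relations R M \<rho> N \<Longrightarrow> u \<in> rels"
  unfolding rels_def by (rule generate.incl)

lemma tensor_cls_add_left: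
  assumes "x \<in> carrier M" "x' \<in> carrier M" "y \<in> carrier N"
  shows "tensor_cls (x \<oplus>\<^bsub>M\<^esub> x') y = tensor_cls x y \<oplus>\<^bsub>T\<^esub> tensor_cls x' y"
  unfolding tensor_cls_def cls_add cls_eq_iff diff_diff_eq[symmetric]
  by (rule rel_in) (use assms in \<open>auto simp: tensor_relations_def\<close>)

lemma tensor_cls_add_right:
  assumes "x \<in> carrier M" "y \<in> carrier N" "y' \<in> carrier N"
  shows "tensor_cls x (y \<oplus>\<^bsub>N\<^esub> y') = tensor_cls x y \<oplus>\<^bsub>T\<^esub> tensor_cls x y'"
  unfolding tensor_cls_def cls_add cls_eq_iff diff_diff_eq[symmetric]
  by (rule rel_in) (use assms in \<open>auto simp: tensor_relations_def\<close>)

lemma tensor_cls_balanced: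
  assumes "x \<in> carrier M" "r \<in> carrier R" "y \<in> carrier N"
  shows "tensor_cls (\<rho> x r) y = tensor_cls x (r \<odot>\<^bsub>N\<^esub> y)"
  unfolding tensor_cls_def cls_eq_iff
  by (rule rel_in) (use assms in \<open>auto simp: tensor_relations_def\<close>)

lemma tensor_cls_zero_left:
  assumes "y \<in> carrier N" shows "tensor_cls \<zero>\<^bsub>M\<^esub> y = \<zero>\<^bsub>T\<^esub>"
  using tensor_cls_add_left[of "\<zero>\<^bsub>M\<^esub>" "\<zero>\<^bsub>M\<^esub>" y] tensor_cls_closed[of "\<zero>\<^bsub>M\<^esub>" y] assms
  by (metis MG.l_zero MG.zero_closed TG.add.r_cancel_one)

text \<open>Negatives of elementary tensors are elementary tensors, so sums of these exhaust the
  product. Induction on the free abelian group proceeds by differences; hence the invariant speaks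
  of \<open>u\<close> and \<open>- u\<close> together.\<close>

lemma tensor_induct [consumes 1, case_names tensor add]:
  assumes C: "C \<in> carrier T" and base: "\<And>x y. x \<in> carrier M \<Longrightarrow> y \<in> carrier N \<Longrightarrow> P (tensor_cls x y)"
    and add: "\<And>C C'. C \<in> carrier T \<Longrightarrow> C' \<in> carrier T \<Longrightarrow> P C \<Longrightarrow> P C' \<Longrightarrow> P (C \<oplus>\<^bsub>T\<^esub> C')"
  shows "P C"
proof -
  have "P (cls u) \<and> P (cls (- u)) \<and> u \<in> carrier F" if "Poly_Mapping.keys u \<subseteq> carrier M \<times> carrier N" for u
    using that
  proof (rule free_Abelian_group_induct[where P = "\<lambda>u. P (cls u) \<and> P (cls (- u)) \<and> u \<in> carrier F"])
    show "P (cls 0) \<and> P (cls (- 0)) \<and> 0 \<in> carrier F"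
      using base[of "\<zero>\<^bsub>M\<^esub>" "\<zero>\<^bsub>N\<^esub>"] tensor_cls_zero_left[of "\<zero>\<^bsub>N\<^esub>"] by (simp add: zero_T)
  next
    fix u v
    assume u: "P (cls u) \<and> P (cls (- u)) \<and> u \<in> carrier F" and v: "P (cls v) \<and> P (cls (- v)) \<and> v \<in> carrier F"
    then have "cls u \<in> carrier T" "cls v \<in> carrier T" "cls (- u) \<in> carrier T" "cls (- v) \<in> carrier T"
      by (auto simp: carrier_T intro!: imageI)
    then have "P (cls u \<oplus>\<^bsub>T\<^esub> cls (- v))" "P (cls v \<oplus>\<^bsub>T\<^esub> cls (- u))"
      using u v by (auto intro: add)
    moreover have "u - v \<in> carrier F" using u v keys_diff[of u v] by auto
    ultimately show "P (cls (u - v)) \<and> P (cls (- (u - v))) \<and> u - v \<in> carrier F" by (simp add: cls_add)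
  next
    fix a assume "a \<in> carrier M \<times> carrier N"
    then obtain x y where a: "a = (x, y)" "x \<in> carrier M" "y \<in> carrier N" by auto
    have "tensor_cls (\<ominus>\<^bsub>M\<^esub> x) y \<oplus>\<^bsub>T\<^esub> tensor_cls x y = \<zero>\<^bsub>T\<^esub>"
      using a tensor_cls_add_left[of "\<ominus>\<^bsub>M\<^esub> x" x y] by (simp add: MG.l_neg tensor_cls_zero_left)
    then have "frag_of (\<ominus>\<^bsub>M\<^esub> x, y) + frag_of (x, y) \<in> rels"
      by (simp add: tensor_cls_def cls_add zero_T cls_eq_iff)
    then have "- (frag_of (\<ominus>\<^bsub>M\<^esub> x, y) + frag_of (x, y)) \<in> rels" by (rule rels_closed)
    then have "cls (- frag_of a) = tensor_cls (\<ominus>\<^bsub>M\<^esub> x) y"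
      by (simp add: tensor_cls_def a cls_eq_iff algebra_simps)
    moreover have "cls (frag_of a) = tensor_cls x y" by (simp add: tensor_cls_def a)
    ultimately show "P (cls (frag_of a)) \<and> P (cls (- frag_of a)) \<and> frag_of a \<in> carrier F" using a base by simp
  qed
  then show ?thesis using C unfolding carrier_T by auto
qed

text \<open>A map that is biadditive and balanced only modulo a subgroup \<open>J\<close> descends
  to the tensor product modulo \<open>J\<close>. The quotient by \<open>J\<close> is never formed:
  \<open>E\<close> evaluates a chosen representative, and its properties hold up to
  \<open>J\<close>.\<close>

lemma tensor_eval:
  fixes b :: "'a \<Rightarrow> 'b \<Rightarrow> 'c::ring_1"
  assumes J: "additive_set J" and V: "additive_set V" and JV: "J \<subseteq> V"
    and bV: "\<And>x y. x \<in> carrier M \<Longrightarrow> y \<in> carrier N \<Longrightarrow> b x y \<in> V"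
    and b1: "\<And>x x' y. x \<in> carrier M \<Longrightarrow> x' \<in> carrier M \<Longrightarrow> y \<in> carrier N \<Longrightarrow>
      b (x \<oplus>\<^bsub>M\<^esub> x') y - b x y - b x' y \<in> J"
    and b2: "\<And>x y y'. x \<in> carrier M \<Longrightarrow> y \<in> carrier N \<Longrightarrow> y' \<in> carrier N \<Longrightarrow>
      b x (y \<oplus>\<^bsub>N\<^esub> y') - b x y - b x y' \<in> J"
    and b3: "\<And>x r y. x \<in> carrier M \<Longrightarrow> r \<in> carrier R \<Longrightarrow> y \<in> carrier N \<Longrightarrow>
      b (\<rho> x r) y - b x (r \<odot>\<^bsub>N\<^esub> y) \<in> J"
  obtains E where "\<And>C. C \<in> carrier T \<Longrightarrow> E C \<in> V"
    "\<And>x y. x \<in> carrier M \<Longrightarrow> y \<in> carrier N \<Longrightarrow> E (tensor_cls x y) - b x y \<in> J"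
    "\<And>C C'. C \<in> carrier T \<Longrightarrow> C' \<in> carrier T \<Longrightarrow> E (C \<oplus>\<^bsub>T\<^esub> C') - (E C + E C') \<in> J"
    "E \<zero>\<^bsub>T\<^esub> \<in> J"
proof -
  let ?ev = "frag_eval (\<lambda>(x, y). b x y)"
  have rel: "?ev u \<in> J" if "u \<in> tensor_relations R M \<rho> N" for u
    using that unfolding tensor_relations_def by (auto simp: frag_eval_diff b1 b2 b3)
  have relsJ: "?ev u \<in> J" if "u \<in> rels" for u
    using that by (induction rule: rels_induct) (auto simp: frag_eval_uminus frag_eval_add additive_setD[OF J] rel)
  have evV: "?ev u \<in> V" if "u \<in> carrier F" for u
    using that unfolding carrier_free_Abelian_group_iff
    by (rule free_Abelian_group_induct) (auto simp: frag_eval_diff additive_setD[OF V] bV)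
  define E where "E C = ?ev (SOME u. u \<in> C)" for C
  have E: "E (cls u) - ?ev u \<in> J" for u
  proof -
    have "(SOME v. v \<in> cls u) \<in> cls u" using self_in_cls by (rule someI)
    then have "?ev ((SOME v. v \<in> cls u) - u) \<in> J" by (intro relsJ) (simp add: cls_def)
    then show ?thesis by (simp add: E_def frag_eval_diff)
  qed
  show ?thesis
  proof
    show "E C \<in> V" if "C \<in> carrier T" for C
    proof -
      obtain u where u: "u \<in> carrier F" "C = cls u" using \<open>C \<in> carrier T\<close> unfolding carrier_T by blast
      then show ?thesis using E[of u] JV evV[OF u(1)] additive_setD(4)[OF V, of "E C - ?ev u" "?ev u"] by auto
    qed
    show "E (tensor_cls x y) - b x y \<in> J" for x y
      using E[of "frag_of (x, y)"] by (simp add: tensor_cls_def)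
    show "E (C \<oplus>\<^bsub>T\<^esub> C') - (E C + E C') \<in> J" if CC': "C \<in> carrier T" "C' \<in> carrier T" for C C'
    proof -
      obtain u u' where u: "C = cls u" "C' = cls u'" using CC' unfolding carrier_T by blast
      have "E (cls (u + u')) - (E C + E C') =
        (E (cls (u + u')) - ?ev (u + u')) - ((E (cls u) - ?ev u) + (E (cls u') - ?ev u'))"
        by (simp add: u frag_eval_add)
      also have "\<dots> \<in> J" by (intro additive_setD(2)[OF J] additive_setD(4)[OF J] E)
      finally show ?thesis by (simp add: u cls_add)
    qed
    show "E \<zero>\<^bsub>T\<^esub> \<in> J" using E[of 0] by (simp add: zero_T)
  qed
qed

end

locale tensor_bimodule = tensor R M \<rho> N
  for R :: "('r, 'x) ring_scheme" and M :: "('s, 'a) module" and \<rho> :: "'a \<Rightarrow> 'r \<Rightarrow> 'a" and N :: "('r, 'b) module" +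
  fixes S :: "('s, 'z) ring_scheme"
  assumes M_module: "left_module S M"
    and act_commute: "s \<in> carrier S \<Longrightarrow> x \<in> carrier M \<Longrightarrow> r \<in> carrier R \<Longrightarrow> s \<odot>\<^bsub>M\<^esub> \<rho> x r = \<rho> (s \<odot>\<^bsub>M\<^esub> x) r"
begin

lemma M_smult:
  "s \<in> carrier S \<Longrightarrow> x \<in> carrier M \<Longrightarrow> s \<odot>\<^bsub>M\<^esub> x \<in> carrier M"
  "s \<in> carrier S \<Longrightarrow> x \<in> carrier M \<Longrightarrow> x' \<in> carrier M \<Longrightarrow> s \<odot>\<^bsub>M\<^esub> (x \<oplus>\<^bsub>M\<^esub> x') = s \<odot>\<^bsub>M\<^esub> x \<oplus>\<^bsub>M\<^esub> s \<odot>\<^bsub>M\<^esub> x'"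
  "s \<in> carrier S \<Longrightarrow> s' \<in> carrier S \<Longrightarrow> x \<in> carrier M \<Longrightarrow> (s \<oplus>\<^bsub>S\<^esub> s') \<odot>\<^bsub>M\<^esub> x = s \<odot>\<^bsub>M\<^esub> x \<oplus>\<^bsub>M\<^esub> s' \<odot>\<^bsub>M\<^esub> x"
  "s \<in> carrier S \<Longrightarrow> s' \<in> carrier S \<Longrightarrow> x \<in> carrier M \<Longrightarrow> (s \<otimes>\<^bsub>S\<^esub> s') \<odot>\<^bsub>M\<^esub> x = s \<odot>\<^bsub>M\<^esub> (s' \<odot>\<^bsub>M\<^esub> x)"
  "x \<in> carrier M \<Longrightarrow> \<one>\<^bsub>S\<^esub> \<odot>\<^bsub>M\<^esub> x = x"
  using M_module by (auto simp: left_module_def)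

abbreviation "\<phi> s \<equiv> frag_extend (\<lambda>(x, y). frag_of (s \<odot>\<^bsub>M\<^esub> x, y))"

lemma \<phi>_rels: "s \<in> carrier S \<Longrightarrow> u \<in> rels \<Longrightarrow> \<phi> s u \<in> rels"
proof -
  assume s: "s \<in> carrier S"
  have "\<phi> s u \<in> tensor_relations R M \<rho> N" if "u \<in> tensor_relations R M \<rho> N" for u
    using that s unfolding tensor_relations_def
    by (elim UnE; clarsimp simp: frag_extend_diff M_smult act_commute) (blast intro: M_smult)+
  then have base: "\<phi> s u \<in> rels" if "u \<in> tensor_relations R M \<rho> N" for u using that rel_in by blast
  show "u \<in> rels \<Longrightarrow> \<phi> s u \<in> rels"
    by (induction rule: rels_induct) (auto simp: frag_extend_add frag_extend_minus rels_closed base)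
qed

lemma smult_cls: "s \<in> carrier S \<Longrightarrow> s \<odot>\<^bsub>T\<^esub> cls u = cls (\<phi> s u)"
proof -
  assume s: "s \<in> carrier S"
  have eq: "cls (\<phi> s v) = cls (\<phi> s u)" if "v \<in> cls u" for v
    using \<phi>_rels[OF s, of "v - u"] that by (simp add: cls_def[of u] cls_eq_iff frag_extend_diff)
  have "s \<odot>\<^bsub>T\<^esub> cls u = (\<Union>v\<in>cls u. cls (\<phi> s v))"
    by (simp add: tensor_product_def Let_def rels_def[symmetric] rcoset_cls)
  also have "\<dots> = (\<Union>v\<in>cls u. cls (\<phi> s u))" by (rule SUP_cong[OF refl eq])
  also have "\<dots> = cls (\<phi> s u)" using self_in_cls[of u] by blast
  finally show ?thesis .
qed

lemma smult_tensor_cls: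
  "s \<in> carrier S \<Longrightarrow> s \<odot>\<^bsub>T\<^esub> tensor_cls x y = tensor_cls (s \<odot>\<^bsub>M\<^esub> x) y"
  by (simp add: tensor_cls_def smult_cls)

lemma smult_T_add:
  "s \<in> carrier S \<Longrightarrow> C \<in> carrier T \<Longrightarrow> C' \<in> carrier T \<Longrightarrow>
    s \<odot>\<^bsub>T\<^esub> (C \<oplus>\<^bsub>T\<^esub> C') = s \<odot>\<^bsub>T\<^esub> C \<oplus>\<^bsub>T\<^esub> s \<odot>\<^bsub>T\<^esub> C'"
  unfolding carrier_T by (auto simp: cls_add smult_cls frag_extend_add)

lemma smult_T_closed: "s \<in> carrier S \<Longrightarrow> C \<in> carrier T \<Longrightarrow> s \<odot>\<^bsub>T\<^esub> C \<in> carrier T"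
proof -
  assume s: "s \<in> carrier S"
  show "C \<in> carrier T \<Longrightarrow> ?thesis"
    by (induction rule: tensor_induct) (simp_all add: s smult_tensor_cls tensor_cls_closed M_smult smult_T_add)
qed

lemma left_module_T: "left_module S T"
  unfolding left_module_def
proof (intro conjI ballI)
  show "ring S" using M_module by (simp add: left_module_def)
  interpret SR: ring S by fact
  show "abelian_group T" by (rule abelian_group_T)
  fix s assume s: "s \<in> carrier S"
  show "s \<odot>\<^bsub>T\<^esub> C \<in> carrier T" if "C \<in> carrier T" for C by (rule smult_T_closed[OF s that])
  show "s \<odot>\<^bsub>T\<^esub> (C \<oplus>\<^bsub>T\<^esub> C') = s \<odot>\<^bsub>T\<^esub> C \<oplus>\<^bsub>T\<^esub> s \<odot>\<^bsub>T\<^esub> C'"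
    if "C \<in> carrier T" "C' \<in> carrier T" for C C' by (rule smult_T_add[OF s that])
  fix s' assume s': "s' \<in> carrier S"
  fix C assume C: "C \<in> carrier T"
  show "(s \<oplus>\<^bsub>S\<^esub> s') \<odot>\<^bsub>T\<^esub> C = s \<odot>\<^bsub>T\<^esub> C \<oplus>\<^bsub>T\<^esub> s' \<odot>\<^bsub>T\<^esub> C"
    using C
  proof (induction rule: tensor_induct)
    case (tensor x y)
    then show ?case using s s' by (simp add: smult_tensor_cls M_smult tensor_cls_add_left)
  next
    case (add C C')
    then show ?case using s s'
      by (simp add: smult_T_add smult_T_closed TG.add.m_ac)
  qed
  show "(s \<otimes>\<^bsub>S\<^esub> s') \<odot>\<^bsub>T\<^esub> C = s \<odot>\<^bsub>T\<^esub> (s' \<odot>\<^bsub>T\<^esub> C)"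
    using C
    by (induction rule: tensor_induct) (use s s' in \<open>simp_all add: smult_tensor_cls M_smult smult_T_add smult_T_closed\<close>)
next
  interpret SR: ring S using M_module by (simp add: left_module_def)
  fix C assume "C \<in> carrier T"
  then show "\<one>\<^bsub>S\<^esub> \<odot>\<^bsub>T\<^esub> C = C"
    by (induction rule: tensor_induct) (simp_all add: smult_tensor_cls M_smult smult_T_add)
qed

end

section \<open>Cyclic modules\<close>

lemma left_module_restrict_scalars:
  assumes "left_module R M" "ring D" "h \<in> ring_hom D R"
  shows "left_module D (restrict_scalars h M)"
proof -
  have "abelian_group (restrict_scalars h M)"
  proof -
    interpret M: abelian_group M using assms(1) by (simp add: left_module_def)
    show ?thesis
    proof (rule abelian_groupI)
      fix x assume "x \<in> carrier (restrict_scalars h M)"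
      then show "\<exists>y\<in>carrier (restrict_scalars h M). y \<oplus>\<^bsub>restrict_scalars h M\<^esub> x = \<zero>\<^bsub>restrict_scalars h M\<^esub>"
        by (intro bexI[of _ "\<ominus>\<^bsub>M\<^esub> x"]) (simp_all add: restrict_scalars_def M.l_neg)
    qed (simp_all add: restrict_scalars_def M.add.m_ac)
  qed
  then show ?thesis
    using assms ring_hom_closed[OF assms(3)] ring_hom_add[OF assms(3)] ring_hom_mult[OF assms(3)] ring_hom_one[OF assms(3)]
    by (auto simp: left_module_def restrict_scalars_def)
qed

lemma generated_left_ideal_is_left_ideal:
  assumes "ring R" "G \<subseteq> carrier R"
  shows "left_ideal R (generated_left_ideal R G)"
proof -
  interpret ring R by fact
  let ?A = "{I. left_ideal R I \<and> G \<subseteq> I}"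
  have "left_ideal R (carrier R)"
    unfolding left_ideal_def by (auto intro!: additive_subgroup.intro subgroup.intro simp: add.inv_closed)
  then have ne: "carrier R \<in> ?A" using assms(2) by simp
  have "subgroup (\<Inter>?A) (add_monoid R)"
    by (rule add.subgroups_Inter) (use ne in \<open>auto simp: left_ideal_def additive_subgroup_def\<close>)
  then show ?thesis
    by (auto simp: left_ideal_def generated_left_ideal_def intro: additive_subgroup.intro)
qed

lemma generated_left_ideal_least:
  "left_ideal R I \<Longrightarrow> G \<subseteq> I \<Longrightarrow> generated_left_ideal R G \<subseteq> I"
  by (auto simp: generated_left_ideal_def)

lemma generated_left_ideal_incl: "x \<in> G \<Longrightarrow> x \<in> generated_left_ideal R G"
  by (auto simp: generated_left_ideal_def)

text \<open>The remaining axioms are identities, so they can be pulled back along an injective map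
  that preserves the structure. Here it spares verifying them on cosets.\<close>

lemma left_module_transport:
  assumes N: "left_module R N" and inj: "inj_on f (carrier Q)"
    and f: "\<And>x. x \<in> carrier Q \<Longrightarrow> f x \<in> carrier N"
    and add: "\<And>x y. x \<in> carrier Q \<Longrightarrow> y \<in> carrier Q \<Longrightarrow> x \<oplus>\<^bsub>Q\<^esub> y \<in> carrier Q \<and> f (x \<oplus>\<^bsub>Q\<^esub> y) = f x \<oplus>\<^bsub>N\<^esub> f y"
    and zero: "\<zero>\<^bsub>Q\<^esub> \<in> carrier Q" "f \<zero>\<^bsub>Q\<^esub> = \<zero>\<^bsub>N\<^esub>"
    and smult: "\<And>r x. r \<in> carrier R \<Longrightarrow> x \<in> carrier Q \<Longrightarrow> r \<odot>\<^bsub>Q\<^esub> x \<in> carrier Q \<and> f (r \<odot>\<^bsub>Q\<^esub> x) = r \<odot>\<^bsub>N\<^esub> f x"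
    and neg: "\<And>x. x \<in> carrier Q \<Longrightarrow> \<exists>y\<in>carrier Q. f y = \<ominus>\<^bsub>N\<^esub> f x"
  shows "left_module R Q"
proof -
  interpret N: abelian_group N using N by (simp add: left_module_def)
  interpret R: ring R using N by (simp add: left_module_def)
  note eqI = inj_onD[OF inj]
  have "abelian_group Q"
  proof (rule abelian_groupI)
    fix x assume x: "x \<in> carrier Q"
    then obtain y where "y \<in> carrier Q" "f y = \<ominus>\<^bsub>N\<^esub> f x" using neg by blast
    then show "\<exists>y\<in>carrier Q. y \<oplus>\<^bsub>Q\<^esub> x = \<zero>\<^bsub>Q\<^esub>"
      using x add zero f by (intro bexI[of _ y] eqI) (auto simp: N.l_neg)
  qed (use add zero f in \<open>auto intro!: eqI simp: N.add.m_ac\<close>)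
  then show ?thesis
    using N add smult f unfolding left_module_def by (auto intro!: eqI)
qed

text \<open>The orbit map r to r m is surjective with kernel \<open>I\<close> and induces the
  isomorphism from the quotient; scalars are restricted along \<open>h\<close> on both sides
  afterwards.\<close>

lemma cyclic_module_isomorphic:
  assumes N: "left_module R N" and m: "m \<in> carrier N"
    and span: "\<And>n. n \<in> carrier N \<Longrightarrow> \<exists>r\<in>carrier R. n = r \<odot>\<^bsub>N\<^esub> m"
    and I: "left_ideal R I"
    and ann: "\<And>r. r \<in> carrier R \<Longrightarrow> r \<odot>\<^bsub>N\<^esub> m = \<zero>\<^bsub>N\<^esub> \<longleftrightarrow> r \<in> I"
    and D: "ring D" and h: "h \<in> ring_hom D R"
  shows "left_modules_isomorphic D (restrict_scalars h (quotient_by_left_ideal R I)) (restrict_scalars h N)"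
proof -
  let ?Q = "quotient_by_left_ideal R I"
  interpret N: abelian_group N using N by (simp add: left_module_def)
  interpret R: ring R using N by (simp add: left_module_def)
  interpret I: abelian_subgroup I R
    using I by (intro abelian_subgroupI3) (auto simp: left_ideal_def R.is_abelian_group)
  have sm: "r \<odot>\<^bsub>N\<^esub> m \<in> carrier N" if "r \<in> carrier R" for r
    using N m that by (simp add: left_module_def)
  have sm_add: "(r \<oplus>\<^bsub>R\<^esub> s) \<odot>\<^bsub>N\<^esub> m = r \<odot>\<^bsub>N\<^esub> m \<oplus>\<^bsub>N\<^esub> s \<odot>\<^bsub>N\<^esub> m" if "r \<in> carrier R" "s \<in> carrier R" for r s
    using N m that by (simp add: left_module_def)
  have sm_mult: "(r \<otimes>\<^bsub>R\<^esub> s) \<odot>\<^bsub>N\<^esub> m = r \<odot>\<^bsub>N\<^esub> (s \<odot>\<^bsub>N\<^esub> m)" if "r \<in> carrier R" "s \<in> carrier R" for r s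
    using N m that by (simp add: left_module_def)
  have sm_zero: "\<zero>\<^bsub>R\<^esub> \<odot>\<^bsub>N\<^esub> m = \<zero>\<^bsub>N\<^esub>"
    using sm_add[of "\<zero>\<^bsub>R\<^esub>" "\<zero>\<^bsub>R\<^esub>"] sm[of "\<zero>\<^bsub>R\<^esub>"] by simp
  have sm_neg: "(\<ominus>\<^bsub>R\<^esub> r) \<odot>\<^bsub>N\<^esub> m = \<ominus>\<^bsub>N\<^esub> (r \<odot>\<^bsub>N\<^esub> m)" if r: "r \<in> carrier R" for r
    using sm_add[of "\<ominus>\<^bsub>R\<^esub> r" r] sm_zero sm r by (intro N.minus_equality[symmetric]) (auto simp: R.l_neg)
  have coset: "I +>\<^bsub>R\<^esub> r = I +>\<^bsub>R\<^esub> s \<longleftrightarrow> r \<odot>\<^bsub>N\<^esub> m = s \<odot>\<^bsub>N\<^esub> m" if rs: "r \<in> carrier R" "s \<in> carrier R" for r s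
  proof -
    have "I +>\<^bsub>R\<^esub> r = I +>\<^bsub>R\<^esub> s \<longleftrightarrow> r \<ominus>\<^bsub>R\<^esub> s \<in> I"
      using rs I.a_rcos_module[of s r] I.a_rcos_self[of r] I.a_repr_independence'[of r s]
      by (auto simp: a_minus_def)
    also have "\<dots> \<longleftrightarrow> r \<odot>\<^bsub>N\<^esub> m \<ominus>\<^bsub>N\<^esub> s \<odot>\<^bsub>N\<^esub> m = \<zero>\<^bsub>N\<^esub>"
      using ann[of "r \<ominus>\<^bsub>R\<^esub> s"] rs by (simp add: a_minus_def sm_add sm_neg)
    also have "\<dots> \<longleftrightarrow> r \<odot>\<^bsub>N\<^esub> m = s \<odot>\<^bsub>N\<^esub> m"
      using sm[OF rs(1)] sm[OF rs(2)] by (metis N.minus_eq N.r_neg N.r_neg2 N.a_comm N.a_inv_closed N.minus_minus N.minus_equality)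
    finally show ?thesis .
  qed
  \<comment> \<open>The value does not depend on the chosen representative, by
    \<open>coset\<close>.\<close>
  define f where "f C = (SOME r. r \<in> carrier R \<and> C = I +>\<^bsub>R\<^esub> r) \<odot>\<^bsub>N\<^esub> m" for C
  have f: "f (I +>\<^bsub>R\<^esub> r) = r \<odot>\<^bsub>N\<^esub> m" if r: "r \<in> carrier R" for r
  proof -
    have "\<exists>s. s \<in> carrier R \<and> I +>\<^bsub>R\<^esub> r = I +>\<^bsub>R\<^esub> s" using r by blast
    from someI_ex[OF this] show ?thesis unfolding f_def using coset r by metis
  qed
  have Q: "carrier ?Q = {I +>\<^bsub>R\<^esub> r | r. r \<in> carrier R}"
    by (auto simp: quotient_by_left_ideal_def A_RCOSETS_def' a_r_coset_def')
  have Q_add: "(I +>\<^bsub>R\<^esub> r) \<oplus>\<^bsub>?Q\<^esub> (I +>\<^bsub>R\<^esub> s) = I +>\<^bsub>R\<^esub> (r \<oplus>\<^bsub>R\<^esub> s)" if "r \<in> carrier R" "s \<in> carrier R" for r s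
    using I.a_rcos_sum[OF that] by (simp add: quotient_by_left_ideal_def)
  have Q_zero: "\<zero>\<^bsub>?Q\<^esub> = I +>\<^bsub>R\<^esub> \<zero>\<^bsub>R\<^esub>"
    by (simp add: quotient_by_left_ideal_def R.a_coset_add_zero I.a_subset)
  have Q_smult: "r \<odot>\<^bsub>?Q\<^esub> (I +>\<^bsub>R\<^esub> s) = I +>\<^bsub>R\<^esub> (r \<otimes>\<^bsub>R\<^esub> s)" if rs: "r \<in> carrier R" "s \<in> carrier R" for r s
  proof -
    have eq: "I +>\<^bsub>R\<^esub> (r \<otimes>\<^bsub>R\<^esub> x) = I +>\<^bsub>R\<^esub> (r \<otimes>\<^bsub>R\<^esub> s)" if x: "x \<in> I +>\<^bsub>R\<^esub> s" for x
    proof -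
      have xR: "x \<in> carrier R" using x I.a_elemrcos_carrier[OF rs(2)] by blast
      have "I +>\<^bsub>R\<^esub> x = I +>\<^bsub>R\<^esub> s" using I.a_repr_independence'[OF x rs(2)] by simp
      then show ?thesis using coset[OF xR rs(2)] coset[of "r \<otimes>\<^bsub>R\<^esub> x" "r \<otimes>\<^bsub>R\<^esub> s"] rs xR by (simp add: sm_mult)
    qed
    have "r \<odot>\<^bsub>?Q\<^esub> (I +>\<^bsub>R\<^esub> s) = (\<Union>x\<in>I +>\<^bsub>R\<^esub> s. I +>\<^bsub>R\<^esub> (r \<otimes>\<^bsub>R\<^esub> x))"
      by (simp add: quotient_by_left_ideal_def)
    also have "\<dots> = (\<Union>x\<in>I +>\<^bsub>R\<^esub> s. I +>\<^bsub>R\<^esub> (r \<otimes>\<^bsub>R\<^esub> s))" by (rule SUP_cong[OF refl eq])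
    also have "\<dots> = I +>\<^bsub>R\<^esub> (r \<otimes>\<^bsub>R\<^esub> s)" using I.a_rcos_self[OF rs(2)] by blast
    finally show ?thesis .
  qed
  have inj: "inj_on f (carrier ?Q)"
  proof (rule inj_onI)
    fix x y assume "x \<in> carrier ?Q" "y \<in> carrier ?Q" "f x = f y"
    then obtain r s where "r \<in> carrier R" "s \<in> carrier R" "x = I +>\<^bsub>R\<^esub> r" "y = I +>\<^bsub>R\<^esub> s"
      "f x = f y" by (auto simp: Q)
    then show "x = y" by (simp add: f coset)
  qed
  have f_add: "x \<oplus>\<^bsub>?Q\<^esub> y \<in> carrier ?Q \<and> f (x \<oplus>\<^bsub>?Q\<^esub> y) = f x \<oplus>\<^bsub>N\<^esub> f y" if "x \<in> carrier ?Q" "y \<in> carrier ?Q" for x y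
    using that by (auto simp: Q Q_add f sm_add)
  have f_smult: "r \<odot>\<^bsub>?Q\<^esub> x \<in> carrier ?Q \<and> f (r \<odot>\<^bsub>?Q\<^esub> x) = r \<odot>\<^bsub>N\<^esub> f x" if "r \<in> carrier R" "x \<in> carrier ?Q" for r x
    using that by (auto simp: Q Q_smult f sm_mult)
  have QM: "left_module R ?Q"
  proof (rule left_module_transport[OF N inj _ f_add])
    fix x assume "x \<in> carrier ?Q"
    then obtain r where r: "r \<in> carrier R" "x = I +>\<^bsub>R\<^esub> r" by (auto simp: Q)
    then show "\<exists>y\<in>carrier ?Q. f y = \<ominus>\<^bsub>N\<^esub> f x"
      by (intro bexI[of _ "I +>\<^bsub>R\<^esub> (\<ominus>\<^bsub>R\<^esub> r)"]) (auto simp: Q f sm_neg)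
  qed (use f_smult in \<open>auto simp: Q Q_zero f sm sm_zero\<close>)
  have bij: "bij_betw f (carrier ?Q) (carrier N)"
  proof (rule bij_betw_imageI[OF inj])
    show "f ` carrier ?Q = carrier N"
    proof (intro equalityI subsetI)
      fix n assume "n \<in> carrier N"
      then obtain r where "r \<in> carrier R" "n = r \<odot>\<^bsub>N\<^esub> m" using span by blast
      then show "n \<in> f ` carrier ?Q" by (auto simp: Q f intro!: image_eqI[of _ _ "I +>\<^bsub>R\<^esub> r"])
    qed (auto simp: Q f sm)
  qed
  show ?thesis
    unfolding left_modules_isomorphic_def
  proof (intro conjI exI[of _ f])
    show "left_module D (restrict_scalars h ?Q)" "left_module D (restrict_scalars h N)"
      by (rule left_module_restrict_scalars[OF _ D h]; fact)+
  qed (use bij f_add f_smult ring_hom_closed[OF h] in \<open>auto simp: restrict_scalars_def\<close>)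
qed

section \<open>Lattices and fans\<close>

lemma lat_nth [simp]: "lat v $ k = real_of_int (v $ k)"
  by (simp add: lat_def)

text \<open>\<open>C\<close> is the inverse of the matrix with rows \<open>b i\<close>; its columns
  are the dual basis.\<close>

lemma lattice_basis_coordinates:
  fixes b :: "'n::finite \<Rightarrow> int ^ 'n"
  assumes b: "lattice_basis b"
  obtains C :: "'n \<Rightarrow> 'n \<Rightarrow> int" where "\<And>v. v = (\<Sum>j\<in>UNIV. (\<Sum>k\<in>UNIV. v $ k * C k j) *s b j)"
    "\<And>i j. (\<Sum>k\<in>UNIV. b i $ k * C k j) = (if i = j then 1 else 0)"
proof -
  have "\<exists>c. axis k 1 = (\<Sum>j\<in>UNIV. c j *s b j)" for k
    using b unfolding lattice_basis_def by blast
  then obtain C where C: "\<And>k. axis k 1 = (\<Sum>j\<in>UNIV. C k j *s b j)" by metis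
  have expand: "v = (\<Sum>j\<in>UNIV. (\<Sum>k\<in>UNIV. v $ k * C k j) *s b j)" for v
  proof -
    have "v = (\<Sum>k\<in>UNIV. v $ k *s axis k 1)" by (simp add: basis_expansion)
    also have "\<dots> = (\<Sum>k\<in>UNIV. \<Sum>j\<in>UNIV. (v $ k * C k j) *s b j)"
      unfolding C by (simp add: vec_eq_iff sum_component sum_distrib_left mult.assoc)
    also have "\<dots> = (\<Sum>j\<in>UNIV. (\<Sum>k\<in>UNIV. v $ k * C k j) *s b j)"
      by (subst sum.swap) (simp add: vec_eq_iff sum_component sum_distrib_right)
    finally show ?thesis .
  qed
  have "(\<lambda>j. \<Sum>k\<in>UNIV. b i $ k * C k j) = (\<lambda>j. if i = j then 1 else 0)" for i
  proof -
    have "b i = (\<Sum>j\<in>UNIV. (if i = j then 1 else 0) *s b j)"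
      by (simp add: vec_eq_iff sum_component if_distrib[of "\<lambda>x. x * _"] cong: if_cong)
    moreover have "\<exists>!c. b i = (\<Sum>j\<in>UNIV. c j *s b j)" using b unfolding lattice_basis_def by blast
    then obtain c0 where c0: "\<And>c. b i = (\<Sum>j\<in>UNIV. c j *s b j) \<Longrightarrow> c = c0" by blast
    ultimately have "(\<lambda>j. if i = j then 1 else 0) = c0" using c0[of "\<lambda>j. if i = j then 1 else 0"] by simp
    with c0[of "\<lambda>j. \<Sum>k\<in>UNIV. b i $ k * C k j", OF expand] show ?thesis by simp
  qed
  then show ?thesis using that[OF expand] by meson
qed

text \<open>\<open>lat v\<close> lies in some cone, which by smoothness is spanned by part of a
  lattice basis; so \<open>v\<close> is a combination of these basis vectors with nonnegative
  integer coefficients. Each of them is primitive and spans a face of the cone, hence occurs among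
  the \<open>A i\<close>.\<close>

lemma complete_smooth_fan_generates:
  fixes \<Sigma> :: "(real ^ 'n::finite) set set" and A :: "'m::finite \<Rightarrow> int ^ 'n"
  assumes fan: "fan \<Sigma>" "smooth_fan \<Sigma>" "complete_fan \<Sigma>" and rays: "ray_generators \<Sigma> A"
  obtains u :: "int ^ 'm" where "\<And>i. u $ i \<ge> 0" "(\<Sum>i\<in>UNIV. u $ i *s A i) = v"
proof -
  obtain \<sigma> where \<sigma>: "\<sigma> \<in> \<Sigma>" "lat v \<in> \<sigma>" using fan(3) unfolding complete_fan_def by blast
  obtain b I where b: "lattice_basis (b :: 'n \<Rightarrow> int ^ 'n)" and \<sigma>_eq: "\<sigma> = convex_cone hull (lat ` b ` I)"
    using fan(2) \<sigma>(1) unfolding smooth_fan_def by blast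
  obtain C where C: "\<And>v. v = (\<Sum>j\<in>UNIV. (\<Sum>k\<in>UNIV. v $ k * C k j) *s b j)"
    "\<And>i j. (\<Sum>k\<in>UNIV. b i $ k * C k j) = (if i = j then 1 else 0)"
    using lattice_basis_coordinates[OF b] by blast
  \<comment> \<open>The dual basis as linear forms on the real space.\<close>
  define \<phi> where "\<phi> j x = (\<Sum>k\<in>UNIV. x $ k * real_of_int (C k j))" for j and x :: "real ^ 'n"
  have \<phi>_lat: "\<phi> j (lat w) = of_int (\<Sum>k\<in>UNIV. w $ k * C k j)" for j w
    by (simp add: \<phi>_def)
  have \<phi>_b: "\<phi> j (lat (b i)) = (if i = j then 1 else 0)" for i j
    using C(2)[of i j] by (simp add: \<phi>_lat)
  have \<phi>_add: "\<phi> j (x + y) = \<phi> j x + \<phi> j y" and \<phi>_scale: "\<phi> j (c *\<^sub>R x) = c * \<phi> j x" for j c x y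
    by (simp_all add: \<phi>_def sum.distrib distrib_right sum_distrib_left mult.assoc)
  have expand: "x = (\<Sum>j\<in>UNIV. \<phi> j x *\<^sub>R lat (b j))" for x
  proof -
    have "(\<Sum>j\<in>UNIV. \<phi> j x * real_of_int (b j $ l)) = x $ l" for l
    proof -
      have "(\<Sum>j\<in>UNIV. C k j * b j $ l) = (if k = l then 1 else 0)" for k
      proof -
        have "axis k 1 $ l = (\<Sum>j\<in>UNIV. (\<Sum>i\<in>UNIV. axis k 1 $ i * C i j) * b j $ l)"
          using arg_cong[OF C(1)[of "axis k 1"], of "\<lambda>v. v $ l"] by (simp add: sum_component)
        moreover have "(\<Sum>i\<in>UNIV. axis k 1 $ i * C i j) = C k j" for j
          by (simp add: axis_def if_distrib[of "\<lambda>x. x * _"] cong: if_cong)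
        ultimately show ?thesis by (simp add: axis_def eq_commute)
      qed
      then have "(\<Sum>j\<in>UNIV. real_of_int (C k j) * real_of_int (b j $ l)) = (if k = l then 1 else 0)" for k
        by (metis (mono_tags, lifting) of_int_0 of_int_1 of_int_mult of_int_sum sum.cong)
      then have "(\<Sum>k\<in>UNIV. x $ k * (\<Sum>j\<in>UNIV. real_of_int (C k j) * real_of_int (b j $ l))) = x $ l"
        by (simp add: if_distrib[of "\<lambda>x. _ * x"] cong: if_cong)
      then show ?thesis
        unfolding \<phi>_def sum_distrib_left sum_distrib_right mult.assoc by (subst sum.swap)
    qed
    then show ?thesis by (simp add: vec_eq_iff sum_component)
  qed
  have cone: "convex_cone {x. \<forall>j. 0 \<le> \<phi> j x \<and> (j \<notin> K \<longrightarrow> \<phi> j x = 0)}" for K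
  proof -
    have "\<phi> j 0 = 0" for j by (simp add: \<phi>_def)
    then show ?thesis unfolding convex_cone_iff by (auto simp: \<phi>_add \<phi>_scale)
  qed
  have in_cone: "convex_cone hull (lat ` b ` K) \<subseteq> {x. \<forall>j. 0 \<le> \<phi> j x \<and> (j \<notin> K \<longrightarrow> \<phi> j x = 0)}" for K
    by (rule hull_minimal[where S = convex_cone, OF _ cone]) (auto simp: \<phi>_b)
  define n where "n j = (\<Sum>k\<in>UNIV. v $ k * C k j)" for j
  have n: "n j \<ge> 0" "j \<notin> I \<Longrightarrow> n j = 0" for j
    using in_cone[of I] \<sigma>(2) unfolding \<sigma>_eq by (auto simp: \<phi>_lat n_def[symmetric])
  have v: "v = (\<Sum>j\<in>UNIV. n j *s b j)" using C(1)[of v] by (simp add: n_def)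
  have "b j \<in> range A" if j: "j \<in> I" for j
  proof -
    have "primitive_vector (b j)"
    proof -
      \<comment> \<open>A common divisor of the entries of \<open>b j\<close> divides the value 1 of
        its dual form.\<close>
      let ?g = "Gcd (range (\<lambda>k. b j $ k))"
      have "?g dvd b j $ k" for k by (intro Gcd_dvd) auto
      then have "?g dvd (\<Sum>k\<in>UNIV. b j $ k * C k j)" by (intro dvd_sum dvd_mult2) auto
      then have "?g dvd 1" using C(2)[of j j] by simp
      moreover have "?g \<ge> 0" by (rule Gcd_int_greater_eq_0)
      ultimately show ?thesis unfolding primitive_vector_def by (simp add: zdvd1_eq)
    qed
    moreover have "convex_cone hull {lat (b j)} \<in> \<Sigma>"
    proof -
      let ?T = "convex_cone hull {lat (b j)}"
      have T: "x \<in> ?T" if "x \<in> \<sigma>" "\<forall>i. i \<noteq> j \<longrightarrow> \<phi> i x = 0" for x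
      proof -
        have "x = (\<Sum>i\<in>UNIV. if i = j then \<phi> j x *\<^sub>R lat (b j) else 0)"
          by (subst expand[of x]) (rule sum.cong, use that in auto)
        then have "x = \<phi> j x *\<^sub>R lat (b j)" by simp
        moreover have "0 \<le> \<phi> j x" using in_cone[of I] that(1) unfolding \<sigma>_eq by auto
        ultimately show ?thesis
          using convex_cone_hull_mul[of "lat (b j)" "{lat (b j)}" "\<phi> j x"] hull_inc[of "lat (b j)" "{lat (b j)}"] by simp
      qed
      have T': "x \<in> \<sigma> \<and> (\<forall>i. i \<noteq> j \<longrightarrow> \<phi> i x = 0)" if "x \<in> ?T" for x
        using in_cone[of "{j}"] hull_mono[of "{lat (b j)}" "lat ` b ` I" convex_cone] that j
        unfolding \<sigma>_eq by auto
      have nonneg: "0 \<le> \<phi> i x" if "x \<in> \<sigma>" for i x using in_cone[of I] that unfolding \<sigma>_eq by auto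
      have "?T face_of \<sigma>"
        unfolding face_of_def
      proof (intro conjI ballI impI)
        show "?T \<subseteq> \<sigma>" using T' by blast
        show "convex ?T" by (rule convex_convex_cone_hull)
        fix a c x assume ac: "a \<in> \<sigma>" "c \<in> \<sigma>" and x: "x \<in> ?T" "x \<in> open_segment a c"
        obtain s where s: "0 < s" "s < 1" "x = (1 - s) *\<^sub>R a + s *\<^sub>R c" using x(2) by (auto simp: in_segment)
        \<comment> \<open>The dual forms are nonnegative on the cone, so a combination with positive
          weights vanishes only if both terms do.\<close>
        have "\<phi> i a = 0 \<and> \<phi> i c = 0" if "i \<noteq> j" for i
        proof -
          have "(1 - s) * \<phi> i a + s * \<phi> i c = 0"
            using T'[OF x(1)] that s(3) by (metis \<phi>_add \<phi>_scale)
          moreover have "(1 - s) * \<phi> i a \<ge> 0" "s * \<phi> i c \<ge> 0" using nonneg ac s by simp_all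
          ultimately show ?thesis using s by (simp add: add_nonneg_eq_0_iff)
        qed
        then show "a \<in> ?T" "c \<in> ?T" using T ac by blast+
      qed
      moreover have "?T \<noteq> {}" by (rule convex_cone_hull_nonempty)
      ultimately show ?thesis using fan(1) \<sigma>(1) unfolding fan_def by blast
    qed
    ultimately show ?thesis using rays unfolding ray_generators_def by blast
  qed
  then have "\<forall>j. \<exists>l. j \<in> I \<longrightarrow> A l = b j" by fastforce
  from choice[OF this] obtain i where i: "\<And>j. j \<in> I \<Longrightarrow> A (i j) = b j" by blast
  have inj: "inj A" using rays unfolding ray_generators_def by blast
  define u :: "int ^ 'm" where "u = (\<chi> l. \<Sum>j\<in>I. if l = i j then n j else 0)"
  have "u $ l \<ge> 0" for l by (auto simp: u_def n intro!: sum_nonneg)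
  moreover have "(\<Sum>l\<in>UNIV. u $ l *s A l) = v"
  proof -
    have "(\<Sum>l\<in>UNIV. u $ l *s A l) = (\<Sum>j\<in>I. \<Sum>l\<in>UNIV. (if l = i j then n j else 0) *s A l)"
      by (subst sum.swap) (simp add: u_def vec_eq_iff sum_component sum_distrib_right)
    also have "\<dots> = (\<Sum>j\<in>I. n j *s A (i j))"
    proof (rule sum.cong)
      fix j
      have "(\<Sum>l\<in>UNIV. (if l = i j then n j else 0) *s A l) = (\<Sum>l\<in>UNIV. if l = i j then n j *s A l else 0)"
        by (rule sum.cong) auto
      then show "(\<Sum>l\<in>UNIV. (if l = i j then n j else 0) *s A l) = n j *s A (i j)" by simp
    qed simp
    also have "\<dots> = (\<Sum>j\<in>I. n j *s b j)" by (simp add: i)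
    also have "\<dots> = (\<Sum>j\<in>UNIV. n j *s b j)" by (rule sum.mono_neutral_left) (auto simp: n)
    finally show ?thesis using v by simp
  qed
  ultimately show ?thesis using that by blast
qed

section \<open>Laurent monomials\<close>

definition mpow :: "complex ^ 'a::finite \<Rightarrow> int ^ 'a \<Rightarrow> complex" where
  "mpow x e = (\<Prod>i\<in>UNIV. (x $ i) powi (e $ i))"

definition torus :: "(complex ^ 'a::finite) set" where
  "torus = {x. \<forall>i. x $ i \<noteq> 0}"

lemma torus_nth: "x \<in> torus \<Longrightarrow> x $ i \<noteq> 0"
  by (simp add: torus_def)

lemma mpow_nonzero: "x \<in> torus \<Longrightarrow> mpow x e \<noteq> 0"
  by (simp add: mpow_def torus_nth)

lemma mpow_0 [simp]: "mpow x 0 = 1"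
  by (simp add: mpow_def)

lemma mpow_add: "x \<in> torus \<Longrightarrow> mpow x (e + f) = mpow x e * mpow x f"
  by (simp add: mpow_def torus_nth power_int_add prod.distrib)

lemma mpow_scale: "mpow x (c *s e) = mpow x e powi c"
proof -
  have "(\<Prod>i\<in>I. f i) powi c = (\<Prod>i\<in>I. f i powi c)" for I and f :: "'a \<Rightarrow> complex"
    by (induction I rule: infinite_finite_induct) (simp_all add: power_int_mult_distrib)
  then show ?thesis by (simp add: mpow_def power_int_mult mult.commute[of c] del: power_int_mult_distrib)
qed

lemma mpow_sum: "x \<in> torus \<Longrightarrow> mpow x (\<Sum>k\<in>K. e k) = (\<Prod>k\<in>K. mpow x (e k))"
  by (induction K rule: infinite_finite_induct) (simp_all add: mpow_add)

lemma mpow_mult: "mpow (\<chi> i. x $ i * y $ i) e = mpow x e * mpow y e"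
  by (simp add: mpow_def power_int_mult_distrib prod.distrib)

lemma mpow_compose:
  assumes "y \<in> torus" shows "mpow (\<chi> i. mpow y (B i)) e = mpow y (\<Sum>i\<in>UNIV. e $ i *s B i)"
  using assms by (simp add: mpow_sum mpow_scale) (simp add: mpow_def)

lemma mpow_uminus: "x \<in> torus \<Longrightarrow> mpow x (- e) = inverse (mpow x e)"
  by (simp add: mpow_def power_int_minus prod_inversef[unfolded o_def])

lemma mpow_axis: "mpow x (axis i 1) = x $ i"
proof -
  have "mpow x (axis i 1) = (\<Prod>j\<in>UNIV. if j = i then x $ j else 1)"
    unfolding mpow_def by (rule prod.cong) (auto simp: axis_def)
  then show ?thesis by simp
qed

lemma open_torus: "open torus"
proof -
  have eq: "torus = (\<Inter>i\<in>UNIV. {x. x $ i \<noteq> 0})" by (auto simp: torus_def)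
  show ?thesis unfolding eq by (intro open_INT ballI open_polynomial_nonzero polynomial_fun.coord) simp
qed

lemma has_gradient_sum:
  assumes "\<And>i. i \<in> I \<Longrightarrow> has_gradient (f i) (D i) x"
  shows "has_gradient (\<lambda>y. \<Sum>i\<in>I. f i y) (\<lambda>k. \<Sum>i\<in>I. D i k) x"
  using assms
proof (induction I rule: infinite_finite_induct)
  case (insert i I)
  then show ?case using has_gradient_add[of "f i" "D i" x] by simp
qed (auto simp: has_gradient_const)

lemma has_gradient_mpow:
  assumes y: "y \<in> torus"
  shows "has_gradient (\<lambda>y. mpow y e) (\<lambda>k. of_int (e $ k) * mpow y e / y $ k) y"
proof -
  have powi: "has_gradient (\<lambda>y. y $ k powi n) (\<lambda>j. if j = k then of_int n * y $ k powi n / y $ k else 0) y" for k n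
  proof -
    have "((\<lambda>y. y $ k powi n) has_derivative (\<lambda>h. h $ k * (of_int n * y $ k powi (n - 1)))) (at y)"
      using torus_nth[OF y] by (intro has_derivative_power_int bounded_linear_imp_has_derivative bounded_linear_vec_nth)
    moreover have "(\<lambda>h. h $ k * (of_int n * y $ k powi (n - 1))) =
        (\<lambda>v. \<Sum>j\<in>UNIV. (if j = k then of_int n * y $ k powi n / y $ k else 0) * v $ j)"
      using torus_nth[OF y, of k]
      by (auto simp: if_distrib[of "\<lambda>x. x * _"] power_int_diff cong: if_cong)
    ultimately show ?thesis unfolding has_gradient_def by simp
  qed
  have "has_gradient (\<lambda>y. \<Prod>k\<in>K. y $ k powi e $ k)
      (\<lambda>j. if j \<in> K then of_int (e $ j) * (\<Prod>k\<in>K. y $ k powi e $ k) / y $ j else 0) y" if "finite K" for K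
    using that
  proof (induction K rule: finite_induct)
    case empty
    then show ?case by (simp add: has_gradient_const)
  next
    case (insert k K)
    have "(\<lambda>j. if j \<in> insert k K then of_int (e $ j) * (\<Prod>k\<in>insert k K. y $ k powi e $ k) / y $ j else 0) =
      (\<lambda>j. (if j = k then of_int (e $ k) * y $ k powi (e $ k) / y $ k else 0) * (\<Prod>k\<in>K. y $ k powi e $ k) +
        y $ k powi (e $ k) * (if j \<in> K then of_int (e $ j) * (\<Prod>k\<in>K. y $ k powi e $ k) / y $ j else 0))"
      using insert.hyps by (auto simp: fun_eq_iff)
    then show ?case using has_gradient_mult[OF powi insert.IH, of k "e $ k"] insert.hyps by simp
  qed
  from this[of UNIV] show ?thesis by (simp add: mpow_def)
qed

lemma rational_at_mpow:
  assumes "X \<subseteq> torus" "x \<in> X" shows "rational_at X x (\<lambda>w. mpow w e)"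
  unfolding mpow_def
  by (intro rational_at_prod rational_at_powi rational_at_coord assms torus_nth) (use assms in auto)

section \<open>Non-degeneracy\<close>

text \<open>Written with the logarithmic derivatives y_k \<partial>/\<partial>y_k, whose vanishing
  on the torus is equivalent to that of the derivative and which keep the monomials
  unchanged.\<close>

definition critical :: "('m::finite \<Rightarrow> int ^ 'n::finite) \<Rightarrow> 'm set \<Rightarrow> complex ^ 'm \<Rightarrow> bool" where
  "critical A I w \<longleftrightarrow> (\<exists>y\<in>torus. \<forall>k. (\<Sum>i\<in>I. w $ i * mpow y (A i) * of_int (A i $ k)) = 0)"

definition newton_faces :: "('m::finite \<Rightarrow> int ^ 'n::finite) \<Rightarrow> (real ^ 'n) set set" where
  "newton_faces A = {\<sigma>. \<sigma> face_of convex hull (insert 0 (range (\<lambda>i. lat (A i)))) \<and> \<sigma> \<noteq> {} \<and> 0 \<notin> \<sigma>}"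

lemma nondegenerate_iff:
  "nondegenerate A w \<longleftrightarrow> (\<forall>\<sigma>\<in>newton_faces A. \<not> critical A {i. lat (A i) \<in> \<sigma>} w)"
proof -
  have crit: "(\<exists>y. (\<forall>k. y $ k \<noteq> 0) \<and>
      ((\<lambda>y. \<Sum>i\<in>I. w $ i * (\<Prod>k\<in>UNIV. (y $ k) powi (A i $ k))) has_derivative (\<lambda>_. 0)) (at y))
      \<longleftrightarrow> critical A I w" for I
  proof -
    have "((\<lambda>y. \<Sum>i\<in>I. w $ i * (\<Prod>k\<in>UNIV. (y $ k) powi (A i $ k))) has_derivative (\<lambda>_. 0)) (at y)
      \<longleftrightarrow> (\<forall>k. (\<Sum>i\<in>I. w $ i * mpow y (A i) * of_int (A i $ k)) = 0)" if y: "y \<in> torus" for y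
    proof -
      let ?f = "\<lambda>y. \<Sum>i\<in>I. w $ i * mpow y (A i)"
      define D where "D k = (\<Sum>i\<in>I. w $ i * mpow y (A i) * of_int (A i $ k)) / y $ k" for k
      have "has_gradient ?f (\<lambda>k. \<Sum>i\<in>I. 0 * mpow y (A i) + w $ i * (of_int (A i $ k) * mpow y (A i) / y $ k)) y"
        by (intro has_gradient_sum has_gradient_mult has_gradient_const has_gradient_mpow y)
      moreover have "(\<lambda>k. \<Sum>i\<in>I. 0 * mpow y (A i) + w $ i * (of_int (A i $ k) * mpow y (A i) / y $ k)) = D"
        by (simp add: D_def fun_eq_iff sum_divide_distrib mult_ac)
      ultimately have f: "(?f has_derivative (\<lambda>v. \<Sum>j\<in>UNIV. D j * v $ j)) (at y)"
        by (simp only: has_gradient_def[symmetric])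
      have "(?f has_derivative (\<lambda>_. 0)) (at y) \<longleftrightarrow> (\<forall>k. D k = 0)"
      proof
        assume "(?f has_derivative (\<lambda>_. 0)) (at y)"
        then have eq: "(\<lambda>v. \<Sum>j\<in>UNIV. D j * v $ j) = (\<lambda>_. 0)" by (rule has_derivative_unique[OF f])
        show "\<forall>k. D k = 0"
        proof
          fix k
          have "(\<Sum>j\<in>UNIV. D j * axis k 1 $ j) = D k"
            by (simp add: axis_def if_distrib[of "\<lambda>x. _ * x"] cong: if_cong)
          then show "D k = 0" using fun_cong[OF eq, of "axis k 1"] by simp
        qed
      qed (use f in simp)
      then show ?thesis using torus_nth[OF y] by (simp add: D_def mpow_def)
    qed
    then show ?thesis by (auto simp: critical_def torus_def)
  qed
  have "convex hull (insert 0 (range (\<lambda>i. lat (A i)))) \<noteq> \<sigma>" if "0 \<notin> \<sigma>" for \<sigma>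
    using that hull_inc[of 0 "insert 0 (range (\<lambda>i. lat (A i)))" convex] by auto
  then show ?thesis unfolding nondegenerate_def Let_def newton_faces_def crit by auto
qed

text \<open>Rescaling the variables of \<Sum>w_i y^(a_i) by a point of the torus changes the
  coefficient vector in this way; this is why non-degeneracy is invariant under it.\<close>

definition torus_act :: "('m \<Rightarrow> int ^ 'n::finite) \<Rightarrow> complex ^ 'n \<Rightarrow> complex ^ 'm \<Rightarrow> complex ^ 'm::finite" where
  "torus_act A y w = (\<chi> i. mpow y (A i) * w $ i)"

lemma S1_nondeg_torus: "S1_nondeg A \<subseteq> torus"
  by (auto simp: S1_nondeg_def torus_def)

lemma torus_mult: "x \<in> torus \<Longrightarrow> y \<in> torus \<Longrightarrow> (\<chi> k. x $ k * y $ k) \<in> torus"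
  by (simp add: torus_def)

lemma torus_act_S1:
  assumes "y \<in> torus" "w \<in> S1_nondeg A" shows "torus_act A y w \<in> S1_nondeg A"
proof -
  have "critical A I w" if "critical A I (torus_act A y w)" for I
  proof -
    obtain x where x: "x \<in> torus" "\<And>k. (\<Sum>i\<in>I. mpow y (A i) * w $ i * mpow x (A i) * of_int (A i $ k)) = 0"
      using \<open>critical A I (torus_act A y w)\<close> by (auto simp: critical_def torus_act_def)
    then show ?thesis unfolding critical_def
      by (intro bexI[of _ "\<chi> k. x $ k * y $ k"] torus_mult assms x) (simp add: mpow_mult mult_ac)
  qed
  then show ?thesis
    using assms S1_nondeg_torus[of A] mpow_nonzero[OF assms(1)]
    by (auto simp: S1_nondeg_def nondegenerate_iff torus_act_def)
qed

text \<open>A face of a convex hull is the hull of some of the generators, and the generator 0 does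
  not lie in the face.\<close>

lemma newton_face_hull:
  assumes "\<sigma> \<in> newton_faces A"
  shows "\<sigma> = convex hull ((\<lambda>i. lat (A i)) ` {i. lat (A i) \<in> \<sigma>})"
proof -
  have \<sigma>: "\<sigma> face_of convex hull (insert 0 (range (\<lambda>i. lat (A i))))" "0 \<notin> \<sigma>"
    using assms by (auto simp: newton_faces_def)
  have compact: "compact (insert 0 (range (\<lambda>i. lat (A i))))" by (rule finite_imp_compact) simp
  obtain S where S: "S \<subseteq> insert 0 (range (\<lambda>i. lat (A i)))" "\<sigma> = convex hull S"
    by (rule face_of_convex_hull_subset[OF compact \<sigma>(1)])
  have "S \<subseteq> \<sigma>" unfolding S(2) by (rule hull_subset)
  then have "S \<subseteq> (\<lambda>i. lat (A i)) ` {i. lat (A i) \<in> \<sigma>}" using S(1) \<sigma>(2) by auto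
  then have "\<sigma> \<subseteq> convex hull ((\<lambda>i. lat (A i)) ` {i. lat (A i) \<in> \<sigma>})" unfolding S(2) by (rule hull_mono)
  moreover have "convex hull ((\<lambda>i. lat (A i)) ` {i. lat (A i) \<in> \<sigma>}) \<subseteq> \<sigma>"
    using \<sigma>(1) by (intro hull_minimal) (auto simp: face_of_imp_convex)
  ultimately show ?thesis by blast
qed

text \<open>Along a degenerating sequence of critical points, the monomials of maximal growth
  single out a smaller face, on which a rescaled limit is again critical.\<close>

lemma critical_limit:
  fixes A :: "'m::finite \<Rightarrow> int ^ 'n::finite"
  assumes \<sigma>: "\<sigma> \<in> newton_faces A" and crit: "\<And>j. critical A {i. lat (A i) \<in> \<sigma>} (ws j)" and lim: "ws \<longlonglongrightarrow> w"
  shows "\<exists>\<tau>\<in>newton_faces A. critical A {i. lat (A i) \<in> \<tau>} w"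
proof -
  define I where "I = {i. lat (A i) \<in> \<sigma>}"
  have \<sigma>_hull: "\<sigma> = convex hull ((\<lambda>i. lat (A i)) ` I)" unfolding I_def by (rule newton_face_hull[OF \<sigma>])
  have I_ne: "I \<noteq> {}" using \<sigma> \<sigma>_hull by (auto simp: newton_faces_def)
  obtain y where y: "\<And>j. y j \<in> torus" "\<And>j k. (\<Sum>i\<in>I. ws j $ i * mpow (y j) (A i) * of_int (A i $ k)) = 0"
  proof -
    have "\<forall>j. \<exists>y. y \<in> torus \<and> (\<forall>k. (\<Sum>i\<in>I. ws j $ i * mpow y (A i) * of_int (A i $ k)) = 0)"
      using crit unfolding critical_def I_def by blast
    from choice[OF this] show ?thesis using that by blast
  qed
  \<comment> \<open>\<open>x\<close> collects the logarithms of the absolute values, and exp M is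
    the largest absolute value of a monomial of the face.\<close>
  define x :: "nat \<Rightarrow> real ^ 'n" where "x j = (\<chi> k. ln (norm (y j $ k)))" for j
  define M where "M j = Max ((\<lambda>i. x j \<bullet> lat (A i)) ` I)" for j
  have L_le: "x j \<bullet> lat (A i) \<le> M j" if "i \<in> I" for i j
    unfolding M_def using that by (intro Max_ge) auto
  \<comment> \<open>Phases \<open>u\<close> and relative sizes \<open>c\<close> of the monomials.
    Both are bounded, so they converge along a subsequence, although the points themselves may
    diverge.\<close>
  define u where "u j = (\<chi> k. y j $ k / of_real (norm (y j $ k)))" for j
  define c where "c j i = (if i \<in> I then exp (x j \<bullet> lat (A i) - M j) else 0)" for j i
  have norm_mpow: "of_real (exp (z \<bullet> lat e)) = mpow (\<chi> k. of_real (exp (z $ k))) e" for z :: "real ^ 'n" and e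
  proof -
    have "exp (z $ k * of_int (e $ k)) = exp (z $ k) powi (e $ k)" for k
      by (simp add: exp_power_int mult.commute)
    then show ?thesis by (simp add: mpow_def inner_vec_def exp_sum)
  qed
  have y_mpow: "mpow (y j) (A i) = mpow (u j) (A i) * of_real (c j i) * of_real (exp (M j))" if "i \<in> I" for i j
  proof -
    have "(\<chi> k. u j $ k * (\<chi> k. of_real (exp (x j $ k))) $ k) = y j"
      using torus_nth[OF y(1), of j] by (simp add: vec_eq_iff u_def x_def)
    then have "mpow (y j) (A i) = mpow (u j) (A i) * of_real (exp (x j \<bullet> lat (A i)))"
      using mpow_mult[of "u j" "\<chi> k. of_real (exp (x j $ k))" "A i"] by (simp add: norm_mpow)
    also have "exp (x j \<bullet> lat (A i)) = c j i * exp (M j)"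
      using that by (simp add: c_def exp_diff)
    finally show ?thesis by simp
  qed
  define cv where "cv j = (\<chi> i. c j i)" for j
  have norm_u: "norm (u j $ k) = 1" for j k using torus_nth[OF y(1), of j k] by (simp add: u_def norm_divide)
  then have "norm (u j) \<le> real CARD('n)" for j
    unfolding norm_vec_def using L2_set_le_sum[of UNIV "\<lambda>k. norm (u j $ k)"] by simp
  moreover have c01: "0 \<le> c j i" "c j i \<le> 1" for j i
    using L_le by (auto simp: c_def)
  then have "norm (cv j) \<le> real CARD('m)" for j
  proof -
    have "norm (cv j) \<le> (\<Sum>i\<in>UNIV. norm (cv j $ i))"
      unfolding norm_vec_def by (rule L2_set_le_sum) simp
    also have "\<dots> \<le> (\<Sum>i\<in>(UNIV :: 'm set). 1)" using c01 by (intro sum_mono) (simp add: cv_def)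
    finally show ?thesis by simp
  qed
  ultimately have "norm (u j, cv j) \<le> real CARD('n) + real CARD('m)" for j
    using norm_Pair_le[of "u j" "cv j"] by (meson add_mono order_trans)
  then have "bounded (range (\<lambda>j. (u j, cv j)))" unfolding bounded_iff by blast
  then obtain l r where r: "strict_mono (r :: nat \<Rightarrow> nat)" and l: "((\<lambda>j. (u j, cv j)) \<circ> r) \<longlonglongrightarrow> l"
    using bounded_imp_convergent_subsequence by blast
  obtain u' cv' where l_eq: "l = (u', cv')" by (cases l)
  have u_lim: "(\<lambda>j. u (r j)) \<longlonglongrightarrow> u'" and cv_lim: "(\<lambda>j. cv (r j)) \<longlonglongrightarrow> cv'"
    using tendsto_fst[OF l] tendsto_snd[OF l] by (simp_all add: l_eq o_def)
  define c' where "c' i = cv' $ i" for i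
  have c_lim: "(\<lambda>j. c (r j) i) \<longlonglongrightarrow> c' i" for i
    using tendsto_vec_nth[OF cv_lim, of i] by (simp add: cv_def c'_def)
  have c'_nonneg: "c' i \<ge> 0" for i
    by (rule LIMSEQ_le_const[OF c_lim]) (use c01(1) in blast)
  have norm_u': "norm (u' $ k) = 1" for k
    using tendsto_norm[OF tendsto_vec_nth[OF u_lim, of k]] by (simp add: norm_u LIMSEQ_const_iff)
  have "u' $ k \<noteq> 0" for k using norm_u'[of k] by auto
  then have u'_torus: "u' \<in> torus" by (simp add: torus_def)
  define J where "J = {i\<in>I. c' i > 0}"
  \<comment> \<open>In each member of the sequence some relative size is 1, so the limits cannot all
    vanish.\<close>
  have "J \<noteq> {}"
  proof
    assume "J = {}"
    then have "c' i = 0" if "i \<in> I" for i using that c'_nonneg[of i] by (auto simp: J_def)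
    then have "(\<Sum>i\<in>I. c' i) = 0" by simp
    moreover have "(\<lambda>j. \<Sum>i\<in>I. c (r j) i) \<longlonglongrightarrow> (\<Sum>i\<in>I. c' i)" by (intro tendsto_sum c_lim)
    ultimately have "(\<lambda>j. \<Sum>i\<in>I. c (r j) i) \<longlonglongrightarrow> 0" by simp
    moreover have "1 \<le> (\<Sum>i\<in>I. c (r j) i)" for j
    proof -
      have "M (r j) \<in> (\<lambda>i. x (r j) \<bullet> lat (A i)) ` I" unfolding M_def using I_ne by (intro Max_in) auto
      then obtain i where i: "i \<in> I" "c (r j) i = 1" by (auto simp: c_def)
      then show ?thesis using member_le_sum[of i I "c (r j)"] c01 by simp
    qed
    ultimately have "(1::real) \<le> 0" by (intro LIMSEQ_le_const[of _ 0]) blast+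
    then show False by simp
  qed
  \<comment> \<open>The points of the face where the growth stays within bounded distance of the
    maximum. They form a face, and the \<open>A i\<close> in it are those whose monomials survive in
    the limit.\<close>
  define G where "G = {v\<in>\<sigma>. \<exists>B. \<forall>j. x (r j) \<bullet> v - M (r j) \<ge> B}"
  have v_le: "x j \<bullet> v \<le> M j" if "v \<in> \<sigma>" for v j
  proof -
    have "\<sigma> \<subseteq> {v. x j \<bullet> v \<le> M j}" unfolding \<sigma>_hull
      by (rule hull_minimal) (auto simp: L_le convex_halfspace_le)
    then show ?thesis using that by blast
  qed
  have "G face_of \<sigma>"
    unfolding face_of_def
  proof (intro conjI ballI impI)
    show "G \<subseteq> \<sigma>" by (auto simp: G_def)
    have conv_\<sigma>: "convex \<sigma>" unfolding \<sigma>_hull by (rule convex_convex_hull)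
    show "convex G"
      unfolding convex_def
    proof (intro ballI allI impI)
      fix a b and s t :: real assume ab: "a \<in> G" "b \<in> G" and st: "0 \<le> s" "0 \<le> t" "s + t = 1"
      obtain B B' where B: "\<And>j. x (r j) \<bullet> a - M (r j) \<ge> B" "\<And>j. x (r j) \<bullet> b - M (r j) \<ge> B'"
        using ab unfolding G_def by blast
      have "x (r j) \<bullet> (s *\<^sub>R a + t *\<^sub>R b) - M (r j) \<ge> s * B + t * B'" for j
      proof -
        have "x (r j) \<bullet> (s *\<^sub>R a + t *\<^sub>R b) - M (r j) = x (r j) \<bullet> (s *\<^sub>R a + t *\<^sub>R b) - (s + t) * M (r j)"
          using st by simp
        also have "\<dots> = s * (x (r j) \<bullet> a - M (r j)) + t * (x (r j) \<bullet> b - M (r j))"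
          by (simp add: inner_add_right algebra_simps)
        finally show ?thesis using B st by (simp add: add_mono mult_left_mono)
      qed
      moreover have "s *\<^sub>R a + t *\<^sub>R b \<in> \<sigma>"
        using ab st conv_\<sigma> unfolding convex_def G_def by blast
      ultimately show "s *\<^sub>R a + t *\<^sub>R b \<in> G" unfolding G_def by blast
    qed
    fix a b v assume ab: "a \<in> \<sigma>" "b \<in> \<sigma>" and v: "v \<in> G" "v \<in> open_segment a b"
    obtain s where s: "0 < s" "s < 1" "v = (1 - s) *\<^sub>R a + s *\<^sub>R b" using v(2) by (auto simp: in_segment)
    obtain B where B: "\<And>j. x (r j) \<bullet> v - M (r j) \<ge> B" using v(1) by (auto simp: G_def)
    have split: "(1 - s) * (x (r j) \<bullet> a - M (r j)) + s * (x (r j) \<bullet> b - M (r j)) \<ge> B" for j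
      using B[of j] by (simp add: s(3) inner_add_right algebra_simps)
    have neg: "x (r j) \<bullet> a - M (r j) \<le> 0" "x (r j) \<bullet> b - M (r j) \<le> 0" for j using v_le ab by auto
    have "B \<le> (1 - s) * (x (r j) \<bullet> a - M (r j))" "B \<le> s * (x (r j) \<bullet> b - M (r j))" for j
      using split[of j] neg[of j] s mult_nonneg_nonpos[of s "x (r j) \<bullet> b - M (r j)"]
        mult_nonneg_nonpos[of "1 - s" "x (r j) \<bullet> a - M (r j)"] by linarith+
    then have "B / (1 - s) \<le> x (r j) \<bullet> a - M (r j)" "B / s \<le> x (r j) \<bullet> b - M (r j)" for j
      using s by (simp_all add: pos_divide_le_eq mult.commute)
    then show "a \<in> G" "b \<in> G" using ab unfolding G_def by blast+
  qed
  then have "G face_of convex hull (insert 0 (range (\<lambda>i. lat (A i))))"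
    using \<sigma> by (auto simp: newton_faces_def intro: face_of_trans)
  moreover have G_J: "{i. lat (A i) \<in> G} = J"
  proof (intro equalityI subsetI)
    fix i assume "i \<in> {i. lat (A i) \<in> G}"
    then obtain B where i: "i \<in> I" and B: "\<And>j. x (r j) \<bullet> lat (A i) - M (r j) \<ge> B"
      by (auto simp: G_def I_def)
    have "exp B \<le> c (r j) i" for j using B i by (simp add: c_def)
    then have "exp B \<le> c' i" by (intro LIMSEQ_le_const[OF c_lim]) blast
    then have "c' i > 0" using exp_gt_zero less_le_trans by blast
    then show "i \<in> J" using i by (simp add: J_def)
  next
    fix i assume i: "i \<in> J"
    then have "c' i \<noteq> 0" "i \<in> I" by (auto simp: J_def)
    then have "(\<lambda>j. inverse (c (r j) i)) \<longlonglongrightarrow> inverse (c' i)" by (intro tendsto_inverse c_lim)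
    then have "Bseq (\<lambda>j. inverse (c (r j) i))" using convergent_imp_Bseq convergentI by blast
    then obtain K where K: "K > 0" "\<And>j. norm (inverse (c (r j) i)) \<le> K" by (auto elim: BseqE)
    have "x (r j) \<bullet> lat (A i) - M (r j) \<ge> - ln K" for j
    proof -
      have "exp (- (x (r j) \<bullet> lat (A i) - M (r j))) \<le> K"
        unfolding exp_minus using K(2)[of j] \<open>i \<in> I\<close> by (simp add: c_def)
      then have "- (x (r j) \<bullet> lat (A i) - M (r j)) \<le> ln K" using K(1) by (simp add: ln_ge_iff)
      then show ?thesis by simp
    qed
    then show "i \<in> {i. lat (A i) \<in> G}" using \<open>i \<in> I\<close> unfolding G_def I_def by blast
  qed
  moreover have "0 \<notin> G" using \<sigma> by (auto simp: G_def newton_faces_def)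
  ultimately have G: "G \<in> newton_faces A" using \<open>J \<noteq> {}\<close> by (auto simp: newton_faces_def)
  \<comment> \<open>The limiting sizes must come from an actual point of the torus, although
    \<open>x\<close> may diverge. Their logarithms are limits of points in the image of a linear
    map, and such an image is closed.\<close>
  define lin :: "(real ^ 'n) \<times> real \<Rightarrow> real ^ 'm" where
    "lin p = (\<chi> i. if i \<in> J then fst p \<bullet> lat (A i) - snd p else 0)" for p
  have "linear lin"
    by (rule linearI) (auto simp: lin_def vec_eq_iff inner_add_left algebra_simps)
  then have closed: "closed (range lin)"
    by (intro closed_subspace linear_subspace_image subspace_UNIV)
  have lin_lim: "(\<lambda>j. lin (x (r j), M (r j))) \<longlonglongrightarrow> (\<chi> i. if i \<in> J then ln (c' i) else 0)"
  proof (rule vec_tendstoI)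
    fix i
    show "(\<lambda>j. lin (x (r j), M (r j)) $ i) \<longlonglongrightarrow> (\<chi> i. if i \<in> J then ln (c' i) else 0) $ i"
    proof (cases "i \<in> J")
      case True
      then have "(\<lambda>j. ln (c (r j) i)) \<longlonglongrightarrow> ln (c' i)" by (intro tendsto_ln c_lim) (auto simp: J_def)
      then show ?thesis using True by (simp add: lin_def c_def J_def)
    qed (simp add: lin_def)
  qed
  have "(\<chi> i. if i \<in> J then ln (c' i) else 0) \<in> range lin"
    by (rule closed_sequentially[OF closed _ lin_lim]) simp
  then obtain p where p: "(\<chi> i. if i \<in> J then ln (c' i) else 0) = lin p" by blast
  obtain x' M' where "p = (x', M')" by (cases p)
  with p have x': "(\<chi> i. if i \<in> J then ln (c' i) else 0) = lin (x', M')" by simp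
  have c'_eq: "exp (x' \<bullet> lat (A i)) = c' i * exp M'" if "i \<in> J" for i
  proof -
    have "ln (c' i) = x' \<bullet> lat (A i) - M'" using arg_cong[OF x', of "\<lambda>v. v $ i"] that by (simp add: lin_def)
    then have "c' i = exp (x' \<bullet> lat (A i) - M')" using that by (metis (no_types, lifting) J_def exp_ln mem_Collect_eq)
    then show ?thesis by (simp add: exp_diff)
  qed
  define y' where "y' = (\<chi> k. u' $ k * of_real (exp (x' $ k)))"
  have y'_mpow: "mpow y' (A i) = mpow u' (A i) * of_real (c' i) * of_real (exp M')" if "i \<in> J" for i
    using mpow_mult[of u' "\<chi> k. of_real (exp (x' $ k))" "A i"] c'_eq[OF that]
    by (simp add: y'_def norm_mpow[symmetric])
  have "(\<Sum>i\<in>J. w $ i * mpow y' (A i) * of_int (A i $ k)) = 0" for k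
  proof -
    \<comment> \<open>The critical equations divided by exp M; in the limit only the terms in
      \<open>J\<close> remain.\<close>
    have "(\<Sum>i\<in>I. ws (r j) $ i * (mpow (u (r j)) (A i) * of_real (c (r j) i)) * of_int (A i $ k)) = 0" for j
    proof -
      have "(\<Sum>i\<in>I. ws (r j) $ i * (mpow (u (r j)) (A i) * of_real (c (r j) i)) * of_int (A i $ k)) * of_real (exp (M (r j))) = 0"
        unfolding sum_distrib_right y(2)[of "r j" k, symmetric]
        by (intro sum.cong refl) (simp add: y_mpow mult_ac)
      then show ?thesis by simp
    qed
    moreover have "(\<lambda>j. \<Sum>i\<in>I. ws (r j) $ i * (mpow (u (r j)) (A i) * of_real (c (r j) i)) * of_int (A i $ k)) \<longlonglongrightarrow>
        (\<Sum>i\<in>I. w $ i * (mpow u' (A i) * of_real (c' i)) * of_int (A i $ k))"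
      using LIMSEQ_subseq_LIMSEQ[OF lim r] torus_nth[OF u'_torus] unfolding mpow_def o_def
      by (intro tendsto_intros c_lim u_lim) auto
    ultimately have "(\<Sum>i\<in>I. w $ i * (mpow u' (A i) * of_real (c' i)) * of_int (A i $ k)) = 0"
      using LIMSEQ_unique[OF tendsto_const] by force
    moreover have "(\<Sum>i\<in>I. w $ i * (mpow u' (A i) * of_real (c' i)) * of_int (A i $ k)) =
        (\<Sum>i\<in>J. w $ i * (mpow u' (A i) * of_real (c' i)) * of_int (A i $ k))"
      by (rule sum.mono_neutral_right) (use c'_nonneg in \<open>auto simp: J_def not_less order_antisym\<close>)
    ultimately have "(\<Sum>i\<in>J. w $ i * (mpow u' (A i) * of_real (c' i)) * of_int (A i $ k)) * of_real (exp M') = 0"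
      by simp
    moreover have "(\<Sum>i\<in>J. w $ i * (mpow u' (A i) * of_real (c' i)) * of_int (A i $ k)) * of_real (exp M') =
        (\<Sum>i\<in>J. w $ i * mpow y' (A i) * of_int (A i $ k))"
      unfolding sum_distrib_right by (intro sum.cong refl) (simp add: y'_mpow mult_ac)
    ultimately show ?thesis by simp
  qed
  moreover have "y' \<in> torus" using torus_nth[OF u'_torus] by (simp add: torus_def y'_def)
  ultimately have "critical A J w" unfolding critical_def by blast
  then show ?thesis using G G_J by auto
qed

text \<open>There are finitely many index sets, so a limit of degenerate points is a limit for one
  fixed face. By \<open>critical_limit\<close> it is degenerate again, for a possibly smaller face,
  so the degenerate locus is closed.\<close>

lemma open_S1_nondeg: "open (S1_nondeg A)"
proof -
  let ?E = "\<lambda>I. {w. critical A I w}"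
  define Is where "Is = (\<lambda>\<sigma>. {i. lat (A i) \<in> \<sigma>}) ` newton_faces A"
  have fin: "finite Is" by (rule finite_subset[of _ UNIV]) auto
  have closure_Un: "closure (\<Union>(?E ` K)) = (\<Union>I\<in>K. closure (?E I))" if "finite K" for K
    using that by (induction K rule: finite_induct) (simp_all add: closure_Un)
  have "w \<in> \<Union>(?E ` Is)" if w: "w \<in> closure (\<Union>(?E ` Is))" for w
  proof -
    have "w \<in> (\<Union>I\<in>Is. closure (?E I))" using w closure_Un[OF fin] by simp
    then obtain \<sigma> where \<sigma>: "\<sigma> \<in> newton_faces A" "w \<in> closure (?E {i. lat (A i) \<in> \<sigma>})"
      unfolding Is_def by blast
    from \<sigma>(2) obtain ws where ws: "\<And>j. critical A {i. lat (A i) \<in> \<sigma>} (ws j)" "ws \<longlonglongrightarrow> w"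
      unfolding closure_sequential by auto
    show ?thesis using critical_limit[OF \<sigma>(1) ws] unfolding Is_def by blast
  qed
  then have "closure (\<Union>(?E ` Is)) \<subseteq> \<Union>(?E ` Is)" by (rule subsetI)
  then have "closed (\<Union>(?E ` Is))" by (simp only: closure_subset_eq)
  then have "open (torus - \<Union>(?E ` Is))" by (intro open_Diff open_torus)
  moreover have "torus - \<Union>(?E ` Is) = S1_nondeg A"
    by (auto simp: S1_nondeg_def torus_def nondegenerate_iff Is_def)
  ultimately show ?thesis by simp
qed

section \<open>Functions on the torus fibration\<close>

lemma add_span_sum:
  assumes "I \<noteq> {}" "finite I" "\<And>i. i \<in> I \<Longrightarrow> f i \<in> add_span G" shows "sum f I \<in> add_span G"
  using assms(2,1,3) by (induction rule: finite_ne_induct) (auto intro: add_span.add)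

lemma add_span_mono: "x \<in> add_span G \<Longrightarrow> (\<And>g. g \<in> G \<Longrightarrow> g \<in> add_span H) \<Longrightarrow> x \<in> add_span H"
  by (induction rule: add_span.induct) (auto intro: add_span.add)

lemma power_sum_eq_0:
  fixes a :: "nat \<Rightarrow> complex"
  assumes "\<And>s. s \<noteq> 0 \<Longrightarrow> (\<Sum>i\<le>n. a i * s ^ i) = 0" "i \<le> n"
  shows "a i = 0"
proof -
  define p where "p = (\<Sum>i\<le>n. monom (a i) i)"
  have p: "poly p s = (\<Sum>i\<le>n. a i * s ^ i)" for s by (simp add: p_def poly_sum poly_monom)
  have "UNIV - {0} \<subseteq> {s. poly p s = 0}" using assms(1) p by auto
  moreover have "infinite (UNIV - {0 :: complex})" by (simp add: infinite_UNIV_char_0)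
  ultimately have "p = 0" using poly_roots_finite finite_subset by blast
  then have "coeff p i = 0" by simp
  then show ?thesis using assms(2) by (simp add: p_def coeff_sum)
qed

text \<open>Independence of characters: the relations at y and at its translate by \<open>s\<close>
  are combined so that \<open>v0\<close> cancels, and \<open>s\<close> is chosen to separate
  \<open>v0\<close> from the given \<open>v\<close>. The coefficient of \<open>v0\<close> itself is
  then found at y = 1.\<close>

lemma mpow_independent:
  assumes "finite V" "\<And>y. y \<in> torus \<Longrightarrow> (\<Sum>v\<in>V. a v * mpow y v) = 0" "v \<in> V"
  shows "a v = 0"
  using assms
proof (induction V arbitrary: a v rule: finite_induct)
  case empty
  then show ?case by simp
next
  case (insert v0 V)
  have zero: "a v = 0" if v: "v \<in> V" for v
  proof -
    obtain k where k: "v $ k \<noteq> v0 $ k" using v insert.hyps(2) by (metis vec_eq_iff)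
    define s :: "complex ^ 'a" where "s = (\<chi> j. if j = k then 2 else 1)"
    have s: "s \<in> torus" by (simp add: s_def torus_def)
    have s_pow: "mpow s e = 2 powi (e $ k)" for e
    proof -
      have "mpow s e = (\<Prod>j\<in>UNIV. if j = k then 2 powi (e $ k) else 1)"
        unfolding mpow_def by (rule prod.cong) (auto simp: s_def)
      then show ?thesis by simp
    qed
    have "(a v * (2 powi (v $ k) - 2 powi (v0 $ k))) = 0"
    proof (rule insert.IH[OF _ v])
      fix y :: "complex ^ 'a" assume y: "y \<in> torus"
      have "0 = (\<Sum>v\<in>insert v0 V. a v * mpow (\<chi> i. s $ i * y $ i) v) - 2 powi (v0 $ k) * (\<Sum>v\<in>insert v0 V. a v * mpow y v)"
        using insert.prems(1) torus_mult[OF s y] y by simp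
      also have "\<dots> = (\<Sum>v\<in>insert v0 V. a v * (2 powi (v $ k) - 2 powi (v0 $ k)) * mpow y v)"
        by (simp only: mpow_mult s_pow sum_distrib_left sum_subtractf[symmetric]) (simp add: algebra_simps)
      also have "\<dots> = (\<Sum>v\<in>V. a v * (2 powi (v $ k) - 2 powi (v0 $ k)) * mpow y v)"
        using insert.hyps by simp
      finally show "(\<Sum>v\<in>V. a v * (2 powi (v $ k) - 2 powi (v0 $ k)) * mpow y v) = 0" by simp
    qed
    moreover have "(2::complex) powi (v $ k) \<noteq> 2 powi (v0 $ k)"
    proof
      assume "(2::complex) powi (v $ k) = 2 powi (v0 $ k)"
      then have "norm ((2::complex) powi (v $ k)) = norm ((2::complex) powi (v0 $ k))" by simp
      then have "(2::real) powi (v $ k) = 2 powi (v0 $ k)" by (simp add: norm_power_int)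
      then show False
        using k power_int_strict_increasing[of "v $ k" "v0 $ k" "2::real"] power_int_strict_increasing[of "v0 $ k" "v $ k" "2::real"]
        by linarith
    qed
    ultimately show ?thesis by simp
  qed
  have "(\<Sum>v\<in>insert v0 V. a v * mpow 1 v) = a v0"
    using insert.hyps zero by (simp add: mpow_def)
  moreover have "(1 :: complex ^ 'a) \<in> torus" by (simp add: torus_def)
  ultimately have "a v0 = 0" using insert.prems(1) by metis
  then show ?case using zero insert.prems(2) by blast
qed

locale lg_model =
  fixes \<Sigma> :: "(real ^ 'n::finite) set set"
    and A :: "'m::finite \<Rightarrow> int ^ 'n"
    and p :: "'r::finite \<Rightarrow> int ^ 'm \<Rightarrow> int"
    and d :: "'r \<Rightarrow> int ^ 'm"
    and g :: "'r \<Rightarrow> int ^ 'm"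
  assumes toric: "smooth_projective_toric \<Sigma> A"
    and p_basis: "dual_lattice_basis A p"
    and d_dual: "dual_basis_of A p d"
    and g_nonneg: "g k $ i \<ge> 0"
    and g_d: "(\<Sum>i\<in>UNIV. g j $ i * d k $ i) = (if j = k then 1 else 0)"
    and g_p: "divisor_class A (g k) = p k"
begin

section \<open>The lattice of exponents\<close>

text \<open>The torus weight of the monomial w^u; the relation lattice is the kernel.\<close>

definition deg :: "int ^ 'm \<Rightarrow> int ^ 'n" where
  "deg u = (\<Sum>i\<in>UNIV. u $ i *s A i)"

lemma deg_add: "deg (u + v) = deg u + deg v" and deg_diff: "deg (u - v) = deg u - deg v"
  and deg_scale: "deg (c *s u) = c *s deg u" and deg_0: "deg 0 = 0"
  by (simp_all add: deg_def vec_eq_iff sum_component distrib_right left_diff_distrib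
      sum.distrib sum_subtractf sum_distrib_left mult.assoc)

lemma deg_sum: "deg (\<Sum>k\<in>K. u k) = (\<Sum>k\<in>K. deg (u k))"
  by (induction K rule: infinite_finite_induct) (simp_all add: deg_0 deg_add)

lemma deg_axis: "deg (axis i 1) = A i"
proof -
  have "deg (axis i 1) = (\<Sum>j\<in>UNIV. if j = i then A j else 0)"
    unfolding deg_def by (rule sum.cong) (auto simp: axis_def vec_eq_iff)
  then show ?thesis by simp
qed

lemma relation_iff: "l \<in> relation_lattice A \<longleftrightarrow> deg l = 0"
  by (simp add: relation_lattice_def deg_def)

text \<open>Pairings with the vectors g_a. On relations these are the coordinates with respect to
  the basis \<open>d\<close>.\<close>

definition gdot :: "int ^ 'm \<Rightarrow> int ^ 'r" where
  "gdot u = (\<chi> k. \<Sum>i\<in>UNIV. g k $ i * u $ i)"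

lemma gdot_add: "gdot (u + v) = gdot u + gdot v" and gdot_scale: "gdot (c *s u) = c *s gdot u"
  and gdot_diff: "gdot (u - v) = gdot u - gdot v" and gdot_uminus: "gdot (- u) = - gdot u" and gdot_0: "gdot 0 = 0"
  by (simp_all add: gdot_def vec_eq_iff distrib_left right_diff_distrib sum.distrib sum_subtractf sum_distrib_left
      sum_negf mult.left_commute)

lemma p_eq: "deg l = 0 \<Longrightarrow> p k l = gdot l $ k"
  unfolding g_p[symmetric] divisor_class_def by (simp add: relation_iff gdot_def)

lemma d_relation: "deg (d k) = 0"
  using d_dual by (simp add: dual_basis_of_def relation_iff)

lemma gdot_d: "gdot (d k) = axis k 1"
  by (simp add: gdot_def vec_eq_iff axis_def g_d)

definition dsum :: "int ^ 'r \<Rightarrow> int ^ 'm" where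
  "dsum e = (\<Sum>k\<in>UNIV. e $ k *s d k)"

lemma dsum_nth: "dsum e $ i = (\<Sum>k\<in>UNIV. e $ k * d k $ i)"
  by (simp add: dsum_def sum_component)

lemma deg_dsum: "deg (dsum e) = 0"
  by (simp add: dsum_def deg_sum deg_scale d_relation)

lemma gdot_dsum: "gdot (dsum e) = e"
proof -
  have "(\<Sum>i\<in>UNIV. g k $ i * (\<Sum>j\<in>UNIV. e $ j * d j $ i)) = (\<Sum>j\<in>UNIV. e $ j * (\<Sum>i\<in>UNIV. g k $ i * d j $ i))" for k
    by (simp only: sum_distrib_left mult.left_commute, subst sum.swap, rule refl)
  then show ?thesis by (simp add: gdot_def dsum_nth vec_eq_iff g_d if_distrib[of "\<lambda>x. _ * x"] cong: if_cong)
qed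

text \<open>A relation that pairs to zero with every g_a vanishes, since each coordinate function
  belongs to the dual lattice and hence is an integral combination of the p_a.\<close>

lemma relation_expand:
  assumes l: "deg l = 0" shows "dsum (gdot l) = l"
proof -
  define l' where "l' = l - dsum (gdot l)"
  have l': "deg l' = 0" "gdot l' = 0" by (simp_all add: l'_def deg_diff l deg_dsum gdot_diff gdot_dsum)
  have "l' $ i = 0" for i
  proof -
    let ?h = "restrict (\<lambda>l. l $ i) (relation_lattice A)"
    have "?h \<in> dual_relation_lattice A"
      unfolding dual_relation_lattice_def by (auto simp: relation_iff deg_add)
    then obtain c where c: "\<And>l. l \<in> relation_lattice A \<Longrightarrow> ?h l = (\<Sum>k\<in>UNIV. c k * p k l)"
      using p_basis unfolding dual_lattice_basis_def by blast
    have "?h l' = 0" using c[of l'] l' by (simp add: relation_iff p_eq)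
    then show ?thesis using l' by (simp add: relation_iff)
  qed
  then have "l' = 0" by (simp add: vec_eq_iff)
  then show ?thesis by (simp add: l'_def)
qed

definition rep :: "int ^ 'n \<Rightarrow> int ^ 'm" where
  "rep v = (SOME u. (\<forall>i. u $ i \<ge> 0) \<and> deg u = v)"

lemma rep_nonneg: "rep v $ i \<ge> 0" and deg_rep: "deg (rep v) = v"
proof -
  have "\<exists>u. (\<forall>i. u $ i \<ge> 0) \<and> deg u = v"
    using toric complete_smooth_fan_generates[of \<Sigma> A v] unfolding smooth_projective_toric_def deg_def by metis
  from someI_ex[OF this] show "rep v $ i \<ge> 0" "deg (rep v) = v" by (auto simp: rep_def)
qed

text \<open>The lift of the weight \<open>v\<close> that pairs to zero with all g_a. Unlike
  \<open>rep\<close> it is additive in \<open>v\<close>, so its monomials define coordinates on the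
  torus.\<close>

definition coef :: "int ^ 'n \<Rightarrow> int ^ 'm" where
  "coef v = rep v - dsum (gdot (rep v))"

lemma coef_deg: "coef (deg u) = u - dsum (gdot u)"
proof -
  have "dsum (gdot (u - rep (deg u))) = u - rep (deg u)"
    by (rule relation_expand) (simp add: deg_diff deg_rep)
  moreover have "dsum (e - f) = dsum e - dsum f" for e f
    by (simp add: dsum_def vec_eq_iff sum_component left_diff_distrib sum_subtractf)
  ultimately have "dsum (gdot u) - dsum (gdot (rep (deg u))) = u - rep (deg u)" by (simp add: gdot_diff)
  then show ?thesis unfolding coef_def by (simp add: algebra_simps)
qed

lemma coef_expand: "(\<Sum>k\<in>UNIV. v $ k *s coef (axis k 1)) = coef v"
proof -
  let ?u = "\<Sum>k\<in>UNIV. v $ k *s rep (axis k 1)"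
  have "deg ?u = v" by (simp add: deg_sum deg_scale deg_rep basis_expansion)
  then have "coef v = ?u - dsum (gdot ?u)" using coef_deg[of ?u] by simp
  moreover have "gdot ?u = (\<Sum>k\<in>UNIV. v $ k *s gdot (rep (axis k 1)))"
  proof -
    have "gdot (\<Sum>k\<in>K. w k) = (\<Sum>k\<in>K. gdot (w k))" for w :: "'n \<Rightarrow> int ^ 'm" and K
      by (induction K rule: infinite_finite_induct) (simp_all add: gdot_0 gdot_add)
    then show ?thesis by (simp add: gdot_scale)
  qed
  moreover have "dsum (\<Sum>k\<in>UNIV. v $ k *s e k) = (\<Sum>k\<in>UNIV. v $ k *s dsum (e k))" for e :: "'n \<Rightarrow> int ^ 'r"
  proof -
    have add: "dsum (e + f) = dsum e + dsum f" and scale: "dsum (c *s e) = c *s dsum e" and zero: "dsum 0 = 0" for c e f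
      by (simp_all add: dsum_def vec_eq_iff sum_component distrib_right sum.distrib sum_distrib_left mult.assoc)
    have "dsum (\<Sum>k\<in>K. w k) = (\<Sum>k\<in>K. dsum (w k))" for w :: "'n \<Rightarrow> int ^ 'r" and K
      by (induction K rule: infinite_finite_induct) (simp_all add: zero add)
    then show ?thesis by (simp add: scale)
  qed
  ultimately show ?thesis
    by (simp add: coef_def vec_eq_iff sum_component right_diff_distrib sum_subtractf)
qed

section \<open>Splitting of the torus fibration\<close>

definition qq :: "complex ^ 'm \<Rightarrow> complex ^ 'r" where
  "qq w = (\<chi> k. mpow w (d k))"

abbreviation "sec \<equiv> LG_section g"

text \<open>The torus component of w: its coordinates are the monomials of weight e_k that equal 1
  on the section.\<close>

definition ytor :: "complex ^ 'm \<Rightarrow> complex ^ 'n" where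
  "ytor w = (\<chi> k. mpow w (coef (axis k 1)))"

abbreviation "S1 \<equiv> S1_nondeg A"
abbreviation "S2 \<equiv> S2_nondeg A g"

lemma S1_torus: "w \<in> S1 \<Longrightarrow> w \<in> torus"
  using S1_nondeg_torus by blast

lemma S2_iff: "q \<in> S2 \<longleftrightarrow> q \<in> torus \<and> sec q \<in> S1"
  by (simp add: S2_nondeg_def torus_def)

lemma qq_torus: "w \<in> torus \<Longrightarrow> qq w \<in> torus" and ytor_torus: "w \<in> torus \<Longrightarrow> ytor w \<in> torus"
  by (simp_all add: qq_def ytor_def torus_def mpow_nonzero)

lemma sec_nth: "sec q $ i = mpow q (\<chi> k. g k $ i)"
  by (simp add: LG_section_def mpow_def)

lemma mpow_qq: "w \<in> torus \<Longrightarrow> mpow (qq w) e = mpow w (dsum e)"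
  by (simp add: qq_def mpow_compose dsum_def)

lemma mpow_relation: "w \<in> torus \<Longrightarrow> deg l = 0 \<Longrightarrow> mpow w l = mpow (qq w) (gdot l)"
  by (simp add: mpow_qq relation_expand)

lemma mpow_ytor: "w \<in> torus \<Longrightarrow> mpow (ytor w) v = mpow w (coef v)"
  by (simp add: ytor_def mpow_compose coef_expand)

lemma mpow_torus_act: "y \<in> torus \<Longrightarrow> mpow (torus_act A y w) e = mpow y (deg e) * mpow w e"
  using mpow_mult[of "\<chi> i. mpow y (A i)" w e] by (simp add: torus_act_def mpow_compose deg_def)

lemma qq_sec: "q \<in> torus \<Longrightarrow> qq (sec q) = q"
proof -
  assume q: "q \<in> torus"
  have "mpow (sec q) (d k) = q $ k" for k
  proof -
    have s: "sec q = (\<chi> i. mpow q (\<chi> k. g k $ i))" by (simp add: vec_eq_iff sec_nth)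
    have "(\<Sum>i\<in>UNIV. d k $ i *s (\<chi> j. g j $ i)) = axis k (1::int)"
      using g_d[of _ k] by (simp add: vec_eq_iff sum_component axis_def mult.commute)
    then show ?thesis unfolding s by (simp add: mpow_compose[OF q] mpow_axis)
  qed
  then show ?thesis by (simp add: qq_def vec_eq_iff)
qed

lemma qq_torus_act: "y \<in> torus \<Longrightarrow> qq (torus_act A y w) = qq w"
  by (simp add: qq_def mpow_torus_act d_relation)

text \<open>For u = e_i the identity \<open>coef (deg u) + dsum (gdot u) = u\<close> says that the
  contributions of the torus component and of the section multiply to the coordinate w_i.\<close>

lemma torus_act_ytor:
  assumes w: "w \<in> torus" shows "torus_act A (ytor w) (sec (qq w)) = w"
proof -
  have "mpow (ytor w) (A i) * sec (qq w) $ i = w $ i" for i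
  proof -
    have "(\<chi> k. g k $ i) = gdot (axis i 1)"
      by (simp add: gdot_def vec_eq_iff axis_def if_distrib[of "\<lambda>x. _ * x"] cong: if_cong)
    then have "mpow (ytor w) (A i) * sec (qq w) $ i = mpow w (coef (deg (axis i 1)) + dsum (gdot (axis i 1)))"
      by (simp add: mpow_ytor w sec_nth mpow_qq mpow_add deg_axis)
    then show ?thesis by (simp add: coef_deg mpow_axis)
  qed
  then show ?thesis by (simp add: torus_act_def vec_eq_iff)
qed

text \<open>Translating w by the inverse of its torus component gives the point of the section, and
  non-degeneracy is invariant under translation.\<close>

lemma qq_S2:
  assumes w: "w \<in> S1" shows "qq w \<in> S2"
proof -
  let ?y = "\<chi> k. inverse (ytor w $ k)"
  have y: "ytor w \<in> torus" by (rule ytor_torus[OF S1_torus[OF w]])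
  then have y': "?y \<in> torus" by (simp add: torus_def)
  have "(\<chi> k. ?y $ k * ytor w $ k) = 1" using torus_nth[OF y] by (simp add: vec_eq_iff)
  then have "mpow ?y e * mpow (ytor w) e = 1" for e
    using mpow_mult[of ?y "ytor w" e] by (simp add: mpow_def)
  then have "mpow ?y (A i) * (mpow (ytor w) (A i) * sec (qq w) $ i) = sec (qq w) $ i" for i
    by (metis mult.assoc mult_1)
  then have "torus_act A ?y (torus_act A (ytor w) (sec (qq w))) = sec (qq w)"
    by (simp add: torus_act_def vec_eq_iff)
  then have "sec (qq w) = torus_act A ?y w" using torus_act_ytor[OF S1_torus[OF w]] by simp
  then have "sec (qq w) \<in> S1" using torus_act_S1[OF y' w] by simp
  then show ?thesis using qq_torus[OF S1_torus[OF w]] by (simp add: S2_iff)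
qed

text \<open>Nonnegativity of the exponents g makes the section polynomial, hence continuous on the
  whole affine space.\<close>

lemma sec_polynomial: "(\<lambda>q. sec q $ i) \<in> polynomial_fun"
proof -
  have pow: "(\<lambda>q::complex ^ 'r. (q $ k) ^ n) \<in> polynomial_fun" for k n
    by (induction n) (auto intro: polynomial_fun.intros)
  have "(\<lambda>q. \<Prod>k\<in>K. (q $ k) ^ nat (g k $ i)) \<in> polynomial_fun" for K
    by (induction K rule: infinite_finite_induct) (auto intro: polynomial_fun.intros pow)
  moreover have "(\<lambda>q. sec q $ i) = (\<lambda>q. \<Prod>k\<in>UNIV. (q $ k) ^ nat (g k $ i))"
    using g_nonneg by (simp add: LG_section_def power_int_def)
  ultimately show ?thesis by simp
qed

lemma open_S2: "open S2"
proof -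
  have "continuous_on UNIV (\<lambda>q. \<chi> i. sec q $ i)"
    by (intro continuous_on_vec_lambda polynomial_fun_continuous sec_polynomial)
  then have "open (torus \<inter> sec -` S1)"
    by (intro open_Int open_torus open_vimage open_S1_nondeg) simp
  moreover have "torus \<inter> sec -` S1 = S2" by (auto simp: S2_iff)
  ultimately show ?thesis by simp
qed

lemma LG_map_None: "LG_map d w $ None = (\<Sum>i\<in>UNIV. w $ i)" and LG_map_Some: "LG_map d w $ Some k = qq w $ k"
  and base_LG_map: "base_pt (LG_map d w) = qq w"
  by (simp_all add: LG_map_def qq_def mpow_def vec_eq_iff)

sublocale line S2
  by unfold_locales (rule open_S2)

sublocale X: open_set S1
  by unfold_locales (rule open_S1_nondeg)

sublocale F: regular_map S1 "line_times S2" "LG_map d"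
proof
  show "LG_map d x \<in> line_times S2" if "x \<in> S1" for x
    using qq_S2[OF that] by (simp add: line_times_iff base_LG_map)
  show "rational_at S1 x (\<lambda>y. LG_map d y $ j)" if "x \<in> S1" for x j
  proof (cases j)
    case None
    then show ?thesis by (simp add: LG_map_None rational_at_sum rational_at_coord)
  next
    case (Some k)
    then show ?thesis by (simp add: LG_map_Some qq_def rational_at_mpow[OF S1_nondeg_torus that])
  qed
qed

lemma qq_rational: "x \<in> S1 \<Longrightarrow> rational_at S1 x (\<lambda>y. qq y $ k)"
  by (simp add: qq_def rational_at_mpow[OF S1_nondeg_torus])

lemma S2_torus: "S2 \<subseteq> torus"
  by (auto simp: S2_iff)

section \<open>Monomials with coefficients on the base\<close>

definition bs :: "(complex ^ 'r \<Rightarrow> complex) \<Rightarrow> int ^ 'm \<Rightarrow> complex ^ 'm \<Rightarrow> complex" where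
  "bs r u = zero_outside S1 (\<lambda>w. r (qq w) * mpow w u)"

lemma bs_apply: "w \<in> S1 \<Longrightarrow> bs r u w = r (qq w) * mpow w u"
  by (simp add: bs_def zero_outside_apply)

lemma bs_outside: "w \<notin> S1 \<Longrightarrow> bs r u w = 0"
  by (simp add: bs_def zero_outside_def)

lemma bs_eqI: "(\<And>w. w \<in> S1 \<Longrightarrow> f w = r (qq w) * mpow w u) \<Longrightarrow> (\<And>w. w \<notin> S1 \<Longrightarrow> f w = 0) \<Longrightarrow> f = bs r u"
  by (rule ext) (auto simp: bs_def zero_outside_def)

lemma bs_regular:
  assumes r: "r \<in> regular_fun S2" shows "bs r u \<in> regular_fun S1"
  unfolding bs_def
proof (rule zero_outside_regular)
  fix w assume w: "w \<in> S1"
  have "rational_at S1 w (\<lambda>w. r (qq w))"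
    by (rule rational_at_compose[OF regular_fun_rational_at[OF r qq_S2[OF w]] qq_rational[OF w] w qq_S2])
  then show "rational_at S1 w (\<lambda>w. r (qq w) * mpow w u)"
    by (intro rational_at_mult rational_at_mpow[OF S1_nondeg_torus w])
qed

lemma bs_add: "bs (r + r') u = bs r u + bs r' u"
  by (rule sym, rule bs_eqI) (simp_all add: pointwise_simps bs_apply bs_outside distrib_right)

text \<open>The monomial of a relation is a function of q, so it can move from the exponent to the
  coefficient.\<close>

lemma bs_shift:
  assumes "deg l = 0"
  shows "bs r (u + l) = bs (\<lambda>q. r q * mpow q (gdot l)) u"
  by (rule bs_eqI) (simp_all add: bs_apply bs_outside mpow_add S1_torus mpow_relation assms)

text \<open>The chain rule: on r(q) w^u the operator w_i \<partial>/\<partial>w_i acts on r as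
  \<Sum>m_ia q_a \<partial>_a + u_i, and division by w_i lowers the exponent.\<close>

lemma D_bs:
  assumes r: "r \<in> regular_fun S2"
  shows "X.D i (bs r u) =
    bs ((\<Sum>k\<in>UNIV. (\<lambda>q. of_int (d k $ i) * q $ k) * S.D k r) + (\<lambda>_. of_int (u $ i)) * r) (u - axis i 1)"
proof (rule bs_eqI)
  fix w assume w: "w \<in> S1"
  have wt: "w \<in> torus" by (rule S1_torus[OF w])
  have "has_gradient (\<lambda>w. qq w $ k) (\<lambda>i. of_int (d k $ i) * mpow w (d k) / w $ i) w" for k
    unfolding qq_def by (simp add: has_gradient_mpow[OF wt])
  then have "has_gradient (\<lambda>w. r (qq w))
      (\<lambda>i. \<Sum>k\<in>UNIV. S.D k r (qq w) * (of_int (d k $ i) * mpow w (d k) / w $ i)) w"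
    by (intro has_gradient_compose regular_fun_gradient[OF S.open_X r qq_S2[OF w]])
  from has_gradient_mult[OF this has_gradient_mpow[OF wt, of u]]
  have "has_gradient (\<lambda>w. r (qq w) * mpow w u)
      (\<lambda>i. (\<Sum>k\<in>UNIV. S.D k r (qq w) * (of_int (d k $ i) * mpow w (d k) / w $ i)) * mpow w u
        + r (qq w) * (of_int (u $ i) * mpow w u / w $ i)) w" .
  from has_gradient_cong[OF this X.open_X w, of "bs r u"]
  have "X.D i (bs r u) w = (\<Sum>k\<in>UNIV. S.D k r (qq w) * (of_int (d k $ i) * mpow w (d k) / w $ i)) * mpow w u
        + r (qq w) * (of_int (u $ i) * mpow w u / w $ i)"
    by (intro partial_op_apply[OF bs_regular[OF r] w]) (simp add: bs_apply)
  moreover have "mpow w (u - axis i 1) = mpow w u / w $ i"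
    using mpow_add[OF wt, of "u - axis i 1" "axis i 1"] torus_nth[OF wt, of i] by (simp add: mpow_axis)
  ultimately show "X.D i (bs r u) w = ((\<Sum>k\<in>UNIV. (\<lambda>q. of_int (d k $ i) * q $ k) * S.D k r) +
      (\<lambda>_. of_int (u $ i)) * r) (qq w) * mpow w (u - axis i 1)"
    by (simp add: pointwise_simps sum_fun_apply sum_distrib_right sum_distrib_left sum_divide_distrib distrib_right distrib_left add_divide_distrib qq_def mult_ac)
qed (simp add: partial_op_def zero_outside_def)

text \<open>On the torus orbit through a point of the section the sum becomes a combination of the
  distinct characters \<open>v\<close>, which are independent.\<close>

lemma bs_unique:
  assumes "finite V" "\<And>v. c v \<in> regular_fun S2" "(\<Sum>v\<in>V. bs (c v) (rep v)) = 0" "v \<in> V"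
  shows "c v = 0"
proof
  fix q
  show "c v q = 0 q"
  proof (cases "q \<in> S2")
    case True
    then have q: "q \<in> torus" "sec q \<in> S1" by (auto simp: S2_iff)
    have "c v q * mpow (sec q) (rep v) = 0"
    proof (rule mpow_independent[OF assms(1) _ assms(4)])
      fix y :: "complex ^ 'n" assume y: "y \<in> torus"
      have w: "torus_act A y (sec q) \<in> S1" by (rule torus_act_S1[OF y q(2)])
      have "(\<Sum>v\<in>V. bs (c v) (rep v)) (torus_act A y (sec q)) = 0" using assms(3) by (simp add: pointwise_simps)
      then show "(\<Sum>v\<in>V. c v q * mpow (sec q) (rep v) * mpow y v) = 0"
        by (simp add: sum_fun_apply bs_apply[OF w] qq_torus_act[OF y] qq_sec[OF q(1)] mpow_torus_act[OF y] deg_rep mult_ac)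
    qed
    then show ?thesis using mpow_nonzero[OF S1_torus[OF q(2)]] by (simp add: pointwise_simps)
  next
    case False
    then show ?thesis by (simp add: regular_fun_outside[OF assms(2)] pointwise_simps)
  qed
qed

section \<open>Decomposition into torus weights\<close>

text \<open>Homogeneity under the coordinate subgroups with index in \<open>K\<close> only, so that
  the coordinates of the torus can be treated one at a time.\<close>

definition weighted :: "'n set \<Rightarrow> (complex ^ 'm \<Rightarrow> complex) \<Rightarrow> ('n \<Rightarrow> int) \<Rightarrow> bool" where
  "weighted K h e \<longleftrightarrow> (\<forall>k\<in>K. \<forall>s w. s \<noteq> 0 \<longrightarrow> w \<in> S1 \<longrightarrow>
     h (weight_act (\<lambda>i. A i $ k) s w) = s powi e k * h w)"

lemma single_act: "weight_act (\<lambda>i. A i $ k) s w = torus_act A (\<chi> j. if j = k then s else 1) w"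
proof -
  have "mpow (\<chi> j. if j = k then s else 1) e = s powi (e $ k)" for e :: "int ^ 'n"
  proof -
    have "mpow (\<chi> j. if j = k then s else 1) e = (\<Prod>j\<in>UNIV. if j = k then s powi (e $ k) else 1)"
      unfolding mpow_def by (rule prod.cong) auto
    then show ?thesis by simp
  qed
  then show ?thesis by (simp add: weight_act_def torus_act_def)
qed

lemma torus_act_mult: "torus_act A y (torus_act A y' w) = torus_act A (\<chi> k. y $ k * y' $ k) w"
  by (simp add: torus_act_def mpow_mult mult.assoc)

lemma weight_act_S1: "s \<noteq> 0 \<Longrightarrow> w \<in> S1 \<Longrightarrow> weight_act (\<lambda>i. A i $ k) s w \<in> S1"
  unfolding single_act by (rule torus_act_S1) (simp add: torus_def)

lemma weight_act_commute:
  "weight_act a s (weight_act b t w) = weight_act b t (weight_act a s w)"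
  by (simp add: weight_act_def mult_ac)

text \<open>The Laurent coefficients in direction \<open>k\<close> are homogeneous for
  \<open>k\<close>, and they keep the weights for \<open>K\<close> because the coordinate subgroups
  commute. At s = 1 they sum to \<open>h\<close>.\<close>

lemma weighted_split:
  assumes h: "h \<in> regular_fun S1" "weighted K h e"
  shows "h \<in> add_span {f \<in> regular_fun S1. \<exists>e. weighted (insert k K) f e}"
proof -
  let ?act = "weight_act (\<lambda>i. A i $ k)"
  obtain N c where c: "\<And>i. c i \<in> regular_fun S1"
    "\<And>w s. w \<in> S1 \<Longrightarrow> s \<noteq> 0 \<Longrightarrow> h (?act s w) * s ^ N = (\<Sum>i\<le>2*N. c i w * s ^ i)"
    by (rule regular_laurent[OF X.open_X weight_act_S1 h(1)]) (assumption | blast)+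
  \<comment> \<open>By uniqueness of Laurent coefficients, a proportionality of two expansions
    passes to each coefficient.\<close>
  have weight_eq: "c i w' = t * c i w"
    if w: "w \<in> S1" "w' \<in> S1" and i: "i \<le> 2 * N" and eq: "\<And>s. s \<noteq> 0 \<Longrightarrow> h (?act s w') = t * h (?act s w)" for i w w' t
  proof -
    have "c i w' - t * c i w = 0"
    proof (rule power_sum_eq_0[OF _ i])
      fix s :: complex assume s: "s \<noteq> 0"
      have "(\<Sum>i\<le>2*N. c i w' * s ^ i) - t * (\<Sum>i\<le>2*N. c i w * s ^ i) = 0"
        using c(2)[OF w(1) s] c(2)[OF w(2) s] eq[OF s] by (simp add: mult.assoc)
      then show "(\<Sum>i\<le>2*N. (c i w' - t * c i w) * s ^ i) = 0"
        by (simp add: left_diff_distrib sum_subtractf sum_distrib_left mult.assoc)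
    qed
    then show ?thesis by simp
  qed
  have "c i \<in> {f \<in> regular_fun S1. \<exists>e. weighted (insert k K) f e}" if i: "i \<le> 2 * N" for i
  proof (intro CollectI conjI exI c)
    show "weighted (insert k K) (c i) (e(k := int i - int N))"
      unfolding weighted_def
    proof (intro ballI allI impI)
      fix k' and t :: complex and w assume k': "k' \<in> insert k K" and t: "t \<noteq> 0" and w: "w \<in> S1"
      have w': "weight_act (\<lambda>i. A i $ k') t w \<in> S1" by (rule weight_act_S1[OF t w])
      show "c i (weight_act (\<lambda>i. A i $ k') t w) = t powi (e(k := int i - int N)) k' * c i w"
      proof (cases "k' = k")
        case True
        \<comment> \<open>Compare the expansion at \<open>s\<close> along the orbit of the translate
          by t with the expansion at \<open>s * t\<close> along the orbit of w.\<close>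
        have "c i (?act t w) * t ^ N - c i w * t ^ i = 0"
        proof (rule power_sum_eq_0[OF _ i])
          fix s :: complex assume s: "s \<noteq> 0"
          have act: "?act s (?act t w) = ?act (s * t) w"
            by (simp add: weight_act_def power_int_mult_distrib mult_ac)
          have "(\<Sum>i\<le>2*N. c i (?act t w) * s ^ i) * t ^ N = h (?act (s * t) w) * s ^ N * t ^ N"
            using c(2)[OF weight_act_S1[OF t w] s, of k] act by simp
          also have "\<dots> = h (?act (s * t) w) * (s * t) ^ N" by (simp add: power_mult_distrib mult_ac)
          also have "\<dots> = (\<Sum>i\<le>2*N. c i w * (s * t) ^ i)" using c(2)[OF w, of "s * t"] s t by simp
          finally show "(\<Sum>i\<le>2*N. (c i (?act t w) * t ^ N - c i w * t ^ i) * s ^ i) = 0"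
            by (simp add: left_diff_distrib right_diff_distrib sum_subtractf sum_distrib_right sum_distrib_left power_mult_distrib mult_ac)
        qed
        then have "c i (?act t w) = c i w * (t powi int i / t powi int N)" using t by (simp add: field_simps)
        then show ?thesis using True t by (simp add: power_int_diff)
      next
        case False
        then have "k' \<in> K" using k' by simp
        then have "h (?act s (weight_act (\<lambda>i. A i $ k') t w)) = t powi e k' * h (?act s w)" if "s \<noteq> 0" for s
          using h(2) t weight_act_S1[OF that w] unfolding weighted_def weight_act_commute[of _ s] by blast
        then show ?thesis using weight_eq[OF w w' i] False by simp
      qed
    qed
  qed
  then have "(\<Sum>i\<le>2*N. c i) \<in> add_span {f \<in> regular_fun S1. \<exists>e. weighted (insert k K) f e}"
    by (intro add_span_sum add_span.base) auto
  moreover have "(\<Sum>i\<le>2*N. c i) = h"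
  proof
    fix w
    have "?act 1 w = w" by (simp add: weight_act_def)
    then show "(\<Sum>i\<le>2*N. c i) w = h w"
      using c(2)[of w 1] by (cases "w \<in> S1")
       (simp_all add: sum_fun_apply regular_fun_outside[OF c(1)] regular_fun_outside[OF h(1)])
  qed
  ultimately show ?thesis by simp
qed

text \<open>By the splitting of the fibration, a function homogeneous under the whole torus is
  determined by its values on the section.\<close>

lemma weighted_bs:
  assumes h: "h \<in> regular_fun S1" "weighted UNIV h e"
  shows "\<exists>r v. r \<in> regular_fun S2 \<and> h = bs r (rep v)"
proof -
  define v where "v = (\<chi> k. e k)"
  have act: "h (torus_act A y w) = mpow y v * h w" if y: "y \<in> torus" and w: "w \<in> S1" for y w
  proof -
    have "h (torus_act A (\<chi> k. if k \<in> K then y $ k else 1) w) = (\<Prod>k\<in>K. y $ k powi e k) * h w" if "finite K" for K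
      using that
    proof (induction K rule: finite_induct)
      case empty
      have "torus_act A (\<chi> k. 1) w = w" by (simp add: torus_act_def mpow_def)
      then show ?case by simp
    next
      case (insert k K)
      let ?z = "\<chi> k. if k \<in> K then y $ k else 1"
      have "(\<chi> j. (\<chi> j. if j = k then y $ k else 1) $ j * ?z $ j) = (\<chi> j. if j \<in> insert k K then y $ j else 1)"
        using insert.hyps by (auto simp: vec_eq_iff)
      then have "torus_act A (\<chi> j. if j \<in> insert k K then y $ j else 1) w =
          weight_act (\<lambda>i. A i $ k) (y $ k) (torus_act A ?z w)"
        by (simp only: single_act torus_act_mult)
      moreover have "torus_act A ?z w \<in> S1"
        by (rule torus_act_S1[OF _ w]) (use y in \<open>auto simp: torus_def\<close>)
      ultimately show ?case
        using h(2) torus_nth[OF y, of k] insert unfolding weighted_def by simp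
    qed
    from this[of UNIV] show ?thesis by (simp add: mpow_def v_def)
  qed
  \<comment> \<open>On the section the monomial with exponent \<open>rep v\<close> equals q^(gdot
    (rep v)), which has to be divided out.\<close>
  define r where "r = zero_outside S2 (\<lambda>q. h (sec q) * mpow q (- gdot (rep v)))"
  have "r \<in> regular_fun S2"
    unfolding r_def
  proof (intro zero_outside_regular rational_at_mult rational_at_mpow[OF S2_torus])
    fix q assume q: "q \<in> S2"
    show "rational_at S2 q (\<lambda>y. h (sec y))"
      by (rule rational_at_compose[OF regular_fun_rational_at[OF h(1)] rational_at_polynomial[OF sec_polynomial] q])
         (use q in \<open>simp_all add: S2_iff\<close>)
  qed
  moreover have "h = bs r (rep v)"
  proof (rule bs_eqI)
    fix w assume w: "w \<in> S1"
    have wt: "w \<in> torus" by (rule S1_torus[OF w])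
    have q: "qq w \<in> S2" by (rule qq_S2[OF w])
    have "mpow w (rep v) = mpow w (coef v) * mpow (qq w) (gdot (rep v))"
      using mpow_add[OF wt, of "coef v" "dsum (gdot (rep v))"] by (simp add: coef_def mpow_qq[OF wt])
    then have "mpow (qq w) (- gdot (rep v)) * mpow w (rep v) = mpow w (coef v)"
      using mpow_nonzero[OF qq_torus[OF wt]] by (simp add: mpow_uminus[OF qq_torus[OF wt]])
    moreover have "h w = mpow (ytor w) v * h (sec (qq w))"
      using act[OF ytor_torus[OF wt], of "sec (qq w)"] q torus_act_ytor[OF wt] by (simp add: S2_iff)
    ultimately show "h w = r (qq w) * mpow w (rep v)"
      using q by (simp add: r_def zero_outside_apply mpow_ytor[OF wt] mult_ac)
  qed (simp add: regular_fun_outside[OF h(1)])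
  ultimately show ?thesis by blast
qed

lemma regular_S1_span:
  assumes "h \<in> regular_fun S1"
  shows "h \<in> add_span {bs r (rep v) | v r. r \<in> regular_fun S2}"
proof -
  have "h \<in> add_span {f \<in> regular_fun S1. \<exists>e. weighted K f e}" if "finite K" for K
    using that
  proof (induction K rule: finite_induct)
    case empty
    then show ?case using assms by (intro add_span.base) (simp add: weighted_def)
  next
    case (insert k K)
    then have "h \<in> add_span {f \<in> regular_fun S1. \<exists>e. weighted K f e}" by simp
    then show ?case by (rule add_span_mono) (use weighted_split in blast)
  qed
  from this[OF finite] show ?thesis
    by (rule add_span_mono) (use weighted_bs in \<open>fastforce intro: add_span.base\<close>)
qed

lemma bs_mult_mpow: "bs r u * zero_outside S1 (\<lambda>w. mpow w s) = bs r (s + u)"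
  by (rule bs_eqI) (simp_all add: pointwise_simps bs_apply bs_outside zero_outside_apply mpow_add S1_torus mult_ac)

lemma regular_mpow: "zero_outside S1 (\<lambda>w. mpow w s) \<in> regular_fun S1"
  by (intro zero_outside_regular rational_at_mpow[OF S1_nondeg_torus])

text \<open>Multiplication by w^s is invertible on the torus, so the monomial basis may start at any
  exponent; the inductions below start at \<open>u0\<close> or at
  \<open>u0 + axis i 1\<close>.\<close>

lemma regular_S1_induct [consumes 1, case_names bs add]:
  assumes h: "h \<in> regular_fun S1"
    and base: "\<And>r u. r \<in> regular_fun S2 \<Longrightarrow> (\<And>i. u $ i \<ge> 0) \<Longrightarrow> C (bs r (s + u))"
    and add: "\<And>f h. f \<in> regular_fun S1 \<Longrightarrow> h \<in> regular_fun S1 \<Longrightarrow> C f \<Longrightarrow> C h \<Longrightarrow> C (f + h)"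
  shows "C h"
proof -
  let ?m = "\<lambda>s. zero_outside S1 (\<lambda>w. mpow w s)"
  have "C (f * ?m s) \<and> f * ?m s \<in> regular_fun S1" if "f \<in> add_span {bs r (rep v) | v r. r \<in> regular_fun S2}" for f
    using that
  proof (induction rule: add_span.induct)
    case (base f)
    then show ?case using assms(2) rep_nonneg by (auto simp: bs_mult_mpow bs_regular)
  next
    case (add x y)
    then show ?case using assms(3) by (simp add: distrib_right regular_fun_add)
  qed
  moreover have "h * ?m (- s) \<in> regular_fun S1" using h regular_mpow by (intro regular_fun_mult)
  ultimately have "C (h * ?m (- s) * ?m s)" using regular_S1_span by blast
  moreover have "h * ?m (- s) * ?m s = h"
    using mpow_add[of _ "- s" s] by (auto simp: fun_eq_iff pointwise_simps zero_outside_def regular_fun_outside[OF h] S1_torus)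
  ultimately show ?thesis by simp
qed

lemma regular_S1_extend:
  fixes G :: "int ^ 'n \<Rightarrow> (complex ^ 'r \<Rightarrow> complex) \<Rightarrow> 'c::ab_group_add"
  assumes "\<And>v r r'. r \<in> regular_fun S2 \<Longrightarrow> r' \<in> regular_fun S2 \<Longrightarrow> G v (r + r') = G v r + G v r'"
  obtains L where "\<And>f h. f \<in> regular_fun S1 \<Longrightarrow> h \<in> regular_fun S1 \<Longrightarrow> L (f + h) = L f + L h"
    and "\<And>v r. r \<in> regular_fun S2 \<Longrightarrow> L (bs r (rep v)) = G v r"
proof (rule additive_extend[OF additive_set_regular, of S2 "\<lambda>v r. bs r (rep v)" G])
  show "bs (a + b) (rep v) = bs a (rep v) + bs b (rep v)" for a b v by (rule bs_add)
  show "G v (a + b) = G v a + G v b" if "a \<in> regular_fun S2" "b \<in> regular_fun S2" for a b v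
    by (rule assms[OF that])
  show "c v = 0" if "finite B" "\<And>v. c v \<in> regular_fun S2" "(\<Sum>v\<in>B. bs (c v) (rep v)) = 0" "v \<in> B" for B c v
    by (rule bs_unique[OF that])
  fix L assume L: "\<And>x y. x \<in> add_span {bs r (rep i) |i r. r \<in> regular_fun S2} \<Longrightarrow>
      y \<in> add_span {bs r (rep i) |i r. r \<in> regular_fun S2} \<Longrightarrow> L (x + y) = L x + L y"
    "\<And>i r. r \<in> regular_fun S2 \<Longrightarrow> L (bs r (rep i)) = G i r"
  show thesis by (rule that[OF L(1)[OF regular_S1_span regular_S1_span] L(2)])
qed

end

section \<open>Operators on the punctured line\<close>

context monoid
begin

text \<open>The quantum operators are products in a noncommutative ring whose factors commute
  pairwise. For such families the fold behind \<open>finprod\<close> obeys the usual laws.\<close>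

definition commuting :: "('i \<Rightarrow> 'a) \<Rightarrow> 'i set \<Rightarrow> bool" where
  "commuting f A \<longleftrightarrow> (\<forall>x\<in>A. f x \<in> carrier G) \<and> (\<forall>x\<in>A. \<forall>y\<in>A. f x \<otimes> f y = f y \<otimes> f x)"

lemma finprod_commuting_insert:
  assumes A: "finite A" "a \<notin> A" and f: "commuting f (insert a A)"
  shows "finprod G f (insert a A) = f a \<otimes> finprod G f A"
proof -
  have comm: "f x \<otimes> (f y \<otimes> z) = f y \<otimes> (f x \<otimes> z)" if "x \<in> insert a A" "y \<in> insert a A" "z \<in> carrier G" for x y z
    using f that unfolding commuting_def by (metis m_assoc)
  interpret LCD "insert a A" "carrier G" "(\<otimes>) \<circ> f"
    by unfold_locales (use f comm in \<open>auto simp: commuting_def o_apply\<close>)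
  show ?thesis
    using foldD_insert[of A a "\<one>"] A by (simp add: finprod_def subset_insertI o_apply)
qed

lemma finprod_commuting_closed: "finite A \<Longrightarrow> commuting f A \<Longrightarrow> finprod G f A \<in> carrier G"
proof (induction A rule: finite_induct)
  case empty
  then show ?case by (simp add: finprod_def)
next
  case (insert a A)
  then have "commuting f A" by (simp add: commuting_def)
  then show ?case
    unfolding finprod_commuting_insert[OF insert.hyps insert.prems]
    using insert by (intro m_closed insert.IH) (simp_all add: commuting_def)
qed

lemma finprod_commuting_cong:
  assumes "finite A" "commuting f A" "\<And>x. x \<in> A \<Longrightarrow> f x = h x"
  shows "finprod G f A = finprod G h A"
  using assms
proof (induction A rule: finite_induct)
  case empty
  then show ?case by (simp add: finprod_def)
next
  case (insert a A)
  have f: "commuting f A" using insert.prems(1) by (simp add: commuting_def)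
  have h: "commuting h (insert a A)"
    unfolding commuting_def
  proof (intro conjI ballI)
    fix x y assume x: "x \<in> insert a A" and y: "y \<in> insert a A"
    show "h x \<otimes> h y = h y \<otimes> h x"
      unfolding insert.prems(2)[OF x, symmetric] insert.prems(2)[OF y, symmetric]
      using insert.prems(1) x y unfolding commuting_def by blast
  next
    fix x assume x: "x \<in> insert a A"
    show "h x \<in> carrier G"
      unfolding insert.prems(2)[OF x, symmetric] using insert.prems(1) x unfolding commuting_def by blast
  qed
  have "finprod G f A = finprod G h A" by (rule insert.IH[OF f]) (simp add: insert.prems)
  then show ?case
    by (simp only: finprod_commuting_insert[OF insert.hyps insert.prems(1)] finprod_commuting_insert[OF insert.hyps h]
        insert.prems(2)[OF insertI1])
qed

lemma finprod_commuting_neutral: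
  assumes "finite B" "commuting f (A \<union> B)" "finite A" "A \<inter> B = {}" "\<And>x. x \<in> B \<Longrightarrow> f x = \<one>"
  shows "finprod G f (A \<union> B) = finprod G f A"
  using assms
proof (induction B rule: finite_induct)
  case empty
  then show ?case by simp
next
  case (insert b B)
  then have f: "commuting f (insert b (A \<union> B))" "commuting f (A \<union> B)" by (simp_all add: commuting_def)
  have "finprod G f (insert b (A \<union> B)) = f b \<otimes> finprod G f (A \<union> B)"
    by (rule finprod_commuting_insert[OF _ _ f(1)]) (use insert in auto)
  also have "\<dots> = finprod G f (A \<union> B)"
    using insert.prems finprod_commuting_closed[OF _ f(2)] insert.hyps by simp
  finally show ?case using insert f(2) by simp
qed

end

context open_set
begin

lemma const_diff_op: "M (\<lambda>_. c) \<in> diff_op X"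
  by (intro mult_op_diff_op rational_at_const)

lemma const_central:
  assumes "P \<in> diff_op X" shows "M (\<lambda>_. c) \<cdot> P = P \<cdot> M (\<lambda>_. c)"
  using assms
proof (induction rule: diff_op_induct)
  case (mult f)
  then show ?case by (simp add: M_comp rational_at_const regular_fun_rational_at mult.commute)
next
  case (partial i)
  have "D i \<cdot> M (zero_outside X (\<lambda>_. c)) = M 0 + M (zero_outside X (\<lambda>_. c)) \<cdot> D i"
    by (simp only: D_M[OF regular_fun_const] partial_op_const[OF open_X])
  then show ?case by (simp add: mult_op_zero_outside mult_op_0)
next
  case (add P Q)
  then show ?case by (simp add: comp_left_simps comp_plus_right const_diff_op)
next
  case (comp P Q)
  have "M (\<lambda>_. c) \<cdot> (P \<cdot> Q) = (M (\<lambda>_. c) \<cdot> P) \<cdot> Q" by (simp only: o_assoc)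
  also have "\<dots> = P \<cdot> (M (\<lambda>_. c) \<cdot> Q)" by (simp only: comp.IH(1) o_assoc)
  also have "\<dots> = (P \<cdot> Q) \<cdot> M (\<lambda>_. c)" by (simp only: comp.IH(2) o_assoc)
  finally show ?case .
qed

lemma M_commute:
  assumes "\<And>x. x \<in> X \<Longrightarrow> rational_at X x f" "\<And>x. x \<in> X \<Longrightarrow> rational_at X x g"
  shows "M f \<cdot> M g = M g \<cdot> M f"
  by (simp only: M_comp[OF assms(1)] M_comp[OF assms(2)] mult.commute)

lemma commute_comp: "c \<cdot> P = P \<cdot> c \<Longrightarrow> c \<cdot> Q = Q \<cdot> c \<Longrightarrow> c \<cdot> (P \<cdot> Q) = (P \<cdot> Q) \<cdot> c"
  for c :: "('k, 'k) operator"
  by (metis o_assoc)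

lemma commute_sum:
  assumes "c \<in> diff_op X" "\<And>i. i \<in> A \<Longrightarrow> P i \<in> diff_op X" "\<And>i. i \<in> A \<Longrightarrow> c \<cdot> P i = P i \<cdot> c"
  shows "c \<cdot> sum P A = sum P A \<cdot> c"
  using assms by (simp add: comp_sum_right comp_sum_left)

lemma commute_diff:
  assumes "c \<in> diff_op X" "P \<in> diff_op X" "Q \<in> diff_op X" "c \<cdot> P = P \<cdot> c" "c \<cdot> Q = Q \<cdot> c"
  shows "c \<cdot> (P - Q) = (P - Q) \<cdot> c"
  using assms by (simp add: comp_diff_right comp_diff_left)

lemma M_add_const: "M (\<lambda>_. a + b) = M (\<lambda>_. a) + M (\<lambda>_. b)"
  using mult_op_add[of X "\<lambda>_. a" "\<lambda>_. b"] by (simp add: plus_fun_def)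

lemma M_const_comp: "M (\<lambda>_. a) \<cdot> M (\<lambda>_. b) = M (\<lambda>_. a * b)"
  by (simp add: M_comp rational_at_const times_fun_def)

end

section \<open>Commutation rules on the punctured line\<close>

context line
begin

abbreviation "\<tau> \<equiv> U.M (\<lambda>y. y $ None)"
abbreviation "\<zeta> \<equiv> U.M (\<lambda>y. inverse (y $ None))"
abbreviation "Mq r \<equiv> U.M (lift r)"
abbreviation "Cn c \<equiv> U.M (\<lambda>_. c)"
abbreviation "Dt \<equiv> U.D None"
abbreviation "Dq k \<equiv> U.D (Some k)"
abbreviation "V \<equiv> punctured_line_times S"

lemma lift_rational_U: "r \<in> regular_fun S \<Longrightarrow> y \<in> V \<Longrightarrow> rational_at V y (lift r)"
  by (rule rational_at_subset[OF lift_rational UY.U_sub]) (use UY.U_sub in auto)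

lemma inverse_rational_U: "y \<in> V \<Longrightarrow> rational_at V y (\<lambda>y. inverse (y $ None))"
  by (intro rational_at_inverse rational_at_coord) (simp_all add: punctured_iff)

lemma Mq_closed: "r \<in> regular_fun S \<Longrightarrow> Mq r \<in> diff_op V"
  by (intro mult_op_diff_op lift_rational_U)

lemma \<zeta>_closed: "\<zeta> \<in> diff_op V" and \<tau>_closed: "\<tau> \<in> diff_op V"
  by (intro mult_op_diff_op inverse_rational_U, assumption) (intro mult_op_diff_op rational_at_coord)

lemmas U_closed = Mq_closed \<zeta>_closed \<tau>_closed U.const_diff_op diff_op.partial diff_op.comp diff_op_plus
  U.diff_op_minus U.diff_op_uminus U.diff_op_sum zero_diff_op

lemmas U_dist = U.comp_plus_right U.comp_diff_right U.comp_uminus_right U.comp_sum_right comp_plus_left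
  comp_diff_left comp_uminus_left comp_sum_left

lemma \<zeta>_\<tau>: "\<zeta> \<cdot> \<tau> = U.I" and \<tau>_\<zeta>: "\<tau> \<cdot> \<zeta> = U.I"
proof -
  show *: "\<zeta> \<cdot> \<tau> = U.I"
    by (subst U.M_comp[OF rational_at_coord], rule mult_op_cong) (simp add: punctured_iff times_fun_def)
  show "\<tau> \<cdot> \<zeta> = U.I"
    using U.M_commute[OF rational_at_coord inverse_rational_U] * by simp
qed

lemma Mq_comp: "r \<in> regular_fun S \<Longrightarrow> r' \<in> regular_fun S \<Longrightarrow> Mq r \<cdot> Mq r' = Mq (r * r')"
  by (simp add: U.M_comp lift_rational_U) (simp add: lift_def times_fun_def)

lemma Mq_add: "Mq (r + r') = Mq r + Mq r'"
  unfolding mult_op_add[symmetric] by (simp add: lift_def plus_fun_def)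

lemma Mq_const_mult: "r \<in> regular_fun S \<Longrightarrow> Mq ((\<lambda>_. c) * r) = Cn c \<cdot> Mq r"
  by (simp add: U.M_comp lift_rational_U) (simp add: lift_def times_fun_def)

lemma Mq_one: "Mq (zero_outside S (\<lambda>_. c)) = Cn c"
  by (rule mult_op_cong) (simp add: lift_def zero_outside_apply punctured_iff)

lemma Mq_commute: "r \<in> regular_fun S \<Longrightarrow> r' \<in> regular_fun S \<Longrightarrow> Mq r \<cdot> Mq r' = Mq r' \<cdot> Mq r"
  by (simp add: Mq_comp mult.commute)

lemma \<tau>_Mq: "r \<in> regular_fun S \<Longrightarrow> \<tau> \<cdot> Mq r = Mq r \<cdot> \<tau>" and \<zeta>_Mq: "r \<in> regular_fun S \<Longrightarrow> \<zeta> \<cdot> Mq r = Mq r \<cdot> \<zeta>"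
  by (intro U.M_commute lift_rational_U rational_at_coord inverse_rational_U; assumption)+

text \<open>Obtained by restricting the corresponding identity from the whole line, as are
  \<open>Dq_Mq\<close> and \<open>Dt_\<tau>\<close>.\<close>

lemma Dt_Mq:
  assumes r: "r \<in> regular_fun S" shows "Dt \<cdot> Mq r = Mq r \<cdot> Dt"
proof -
  note rules = UY.restrict_comp UY.restrict_D UY.restrict_M[OF lift_rational[OF r]]
  have "Y.M (lift r) \<in> diff_op Y" by (intro mult_op_diff_op lift_rational r)
  then show ?thesis
    using arg_cong[OF D_None_lift[OF r], of "restrict_op Y V"] by (simp add: rules diff_op.partial)
qed

lemma Dq_Mq:
  assumes r: "r \<in> regular_fun S" shows "Dq k \<cdot> Mq r = Mq (S.D k r) + Mq r \<cdot> Dq k"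
proof -
  have r': "S.D k r \<in> regular_fun S" by (rule partial_op_regular[OF S.open_X r])
  note rules = UY.restrict_comp UY.restrict_add UY.restrict_D UY.restrict_M[OF lift_rational[OF r]]
    UY.restrict_M[OF lift_rational[OF r']]
  have cl: "Y.M (lift r) \<in> diff_op Y" "Y.M (lift (S.D k r)) \<in> diff_op Y"
    by (intro mult_op_diff_op lift_rational r r'; assumption)+
  have "Y.D (Some k) \<cdot> Y.M (lift r) = Y.M (lift (S.D k r)) + Y.M (lift r) \<cdot> Y.D (Some k)"
    using Y.D_M[OF lift_regular[OF r], of "Some k"] D_Some_mono[OF r, of k 0] by (simp add: mono_0)
  from arg_cong[OF this, of "restrict_op Y V"] show ?thesis
    using cl by (simp add: rules diff_op.partial diff_op.comp)
qed

lemma Dt_\<tau>: "Dt \<cdot> \<tau> = U.I + \<tau> \<cdot> Dt"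
proof -
  have I: "restrict_op Y V Y.I = U.I" and t: "restrict_op Y V (Y.M (\<lambda>y. y $ None)) = \<tau>"
    by (rule UY.restrict_M, rule rational_at_const) (rule UY.restrict_M, rule rational_at_coord)
  show ?thesis
    using arg_cong[OF D_None_t, of "restrict_op Y V"]
    by (simp add: UY.restrict_comp UY.restrict_add UY.restrict_D I t diff_op.partial diff_op.comp M_t_diff_op one_diff_op)
qed

lemma Dq_\<tau>: "Dq k \<cdot> \<tau> = \<tau> \<cdot> Dq k"
proof -
  have "Dq k \<cdot> U.M (zero_outside V (\<lambda>y. y $ None)) =
      U.M (zero_outside V (\<lambda>_. 0)) + U.M (zero_outside V (\<lambda>y. y $ None)) \<cdot> Dq k"
    using U.D_M[OF regular_coord, of "Some k" None] by (simp add: partial_op_coord[OF U.open_X])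
  then show ?thesis using mult_op_0[of V] by (simp add: mult_op_zero_outside zero_fun_def)
qed

lemma Dq_\<zeta>: "Dq k \<cdot> \<zeta> = \<zeta> \<cdot> Dq k"
proof -
  have "Dq k \<cdot> \<zeta> = (\<zeta> \<cdot> \<tau>) \<cdot> (Dq k \<cdot> \<zeta>)" by (simp add: \<zeta>_\<tau> U_closed)
  also have "\<dots> = \<zeta> \<cdot> (\<tau> \<cdot> Dq k) \<cdot> \<zeta>" by (simp only: o_assoc)
  also have "\<dots> = (\<zeta> \<cdot> Dq k) \<cdot> (\<tau> \<cdot> \<zeta>)" by (simp only: Dq_\<tau>[symmetric] o_assoc)
  also have "\<dots> = \<zeta> \<cdot> Dq k" by (simp add: \<tau>_\<zeta> U_closed)
  finally show ?thesis .
qed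

text \<open>Multiply \<partial>_\<tau> \<tau> = 1 + \<tau> \<partial>_\<tau> by z on both
  sides.\<close>

lemma Dt_\<zeta>: "Dt \<cdot> \<zeta> = \<zeta> \<cdot> Dt - \<zeta> \<cdot> \<zeta>"
proof -
  have "\<zeta> \<cdot> (Dt \<cdot> \<tau>) \<cdot> \<zeta> = \<zeta> \<cdot> Dt \<cdot> (\<tau> \<cdot> \<zeta>)" by (simp only: o_assoc)
  also have "\<dots> = \<zeta> \<cdot> Dt" by (simp add: \<tau>_\<zeta> U_closed)
  finally have 1: "\<zeta> \<cdot> (Dt \<cdot> \<tau>) \<cdot> \<zeta> = \<zeta> \<cdot> Dt" .
  have "\<zeta> \<cdot> (U.I + \<tau> \<cdot> Dt) \<cdot> \<zeta> = \<zeta> \<cdot> \<zeta> + (\<zeta> \<cdot> \<tau>) \<cdot> Dt \<cdot> \<zeta>"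
    by (simp add: U_dist U_closed o_assoc)
  also have "\<dots> = \<zeta> \<cdot> \<zeta> + Dt \<cdot> \<zeta>" by (simp add: \<zeta>_\<tau> U_closed)
  finally show ?thesis using 1 by (simp add: Dt_\<tau> algebra_simps)
qed

definition \<theta> :: "'r \<Rightarrow> ('r option, 'r option) operator" where
  "\<theta> k = U.M (\<lambda>y. y $ Some k) \<cdot> Dq k"

abbreviation "qc k \<equiv> zero_outside S (\<lambda>q. q $ k)"

lemma q_coord: "U.M (\<lambda>y. y $ Some k) = Mq (qc k)"
  by (rule mult_op_cong) (simp add: lift_def zero_outside_apply punctured_iff)

lemma \<theta>_Mq: "\<theta> k = Mq (qc k) \<cdot> Dq k"
  by (simp add: \<theta>_def q_coord)

lemma \<theta>_closed: "\<theta> k \<in> diff_op V"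
  unfolding \<theta>_Mq by (intro U_closed regular_coord)

lemma \<theta>_comp_Mq:
  assumes r: "r \<in> regular_fun S"
  shows "\<theta> k \<cdot> Mq r = Mq r \<cdot> \<theta> k + Mq (qc k * S.D k r)"
proof -
  have r': "S.D k r \<in> regular_fun S" by (rule partial_op_regular[OF S.open_X r])
  have "\<theta> k \<cdot> Mq r = Mq (qc k) \<cdot> (Dq k \<cdot> Mq r)" by (simp only: \<theta>_Mq o_assoc)
  also have "\<dots> = Mq (qc k) \<cdot> Mq (S.D k r) + Mq (qc k) \<cdot> (Mq r \<cdot> Dq k)"
    by (simp add: Dq_Mq[OF r] U_dist U_closed regular_coord r r')
  also have "Mq (qc k) \<cdot> (Mq r \<cdot> Dq k) = Mq r \<cdot> \<theta> k"
    by (simp only: \<theta>_Mq o_assoc Mq_commute[OF regular_coord r])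
  finally show ?thesis by (simp only: Mq_comp[OF regular_coord r'] add.commute)
qed

lemma \<theta>_commute: "\<theta> k \<cdot> \<theta> l = \<theta> l \<cdot> \<theta> k"
proof (cases "k = l")
  case False
  have *: "\<theta> k \<cdot> \<theta> l = Mq (qc l) \<cdot> Mq (qc k) \<cdot> (Dq k \<cdot> Dq l)" if "k \<noteq> l" for k l
  proof -
    have "S.D k (qc l) = 0"
      using that by (simp add: partial_op_coord[OF S.open_X]) (simp add: zero_outside_def zero_fun_def)
    then have "\<theta> k \<cdot> Mq (qc l) = Mq (qc l) \<cdot> \<theta> k"
      using \<theta>_comp_Mq[OF regular_coord, of k l] by (simp add: lift_def mult_op_0 zero_fun_apply flip: zero_fun_def)
    then have "\<theta> k \<cdot> Mq (qc l) \<cdot> Dq l = Mq (qc l) \<cdot> \<theta> k \<cdot> Dq l" by simp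
    then show ?thesis unfolding \<theta>_Mq[of l] by (simp only: \<theta>_Mq[of k] o_assoc)
  qed
  show ?thesis using *[OF False] *[of l k] False Mq_commute[OF regular_coord regular_coord, of k l] U.D_D[of "Some k" "Some l"]
    by simp
qed simp

lemma \<zeta>_\<theta>: "\<zeta> \<cdot> \<theta> k = \<theta> k \<cdot> \<zeta>"
  unfolding \<theta>_Mq by (rule U.commute_comp) (simp_all add: \<zeta>_Mq regular_coord Dq_\<zeta>)

lemma Dt_\<theta>: "Dt \<cdot> \<theta> k = \<theta> k \<cdot> Dt"
  unfolding \<theta>_Mq by (rule U.commute_comp) (simp_all add: Dt_Mq regular_coord U.D_D)

end

section \<open>The quantum ideal\<close>

definition pos :: "int ^ 'a \<Rightarrow> int ^ 'a" where
  "pos u = (\<chi> i. max 0 (u $ i))"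

lemma pos_nth: "pos u $ i = max 0 (u $ i)"
  by (simp add: pos_def)

lemma pos_diff: "pos u - pos (- u) = u"
  by (simp add: vec_eq_iff pos_nth max_def)

context lg_model
begin

abbreviation "one_S \<equiv> zero_outside S2 (\<lambda>_. 1)"

definition me :: "int ^ 'r \<Rightarrow> complex ^ 'r \<Rightarrow> complex" where
  "me e = zero_outside S2 (\<lambda>q. mpow q e)"

lemma me_regular: "me e \<in> regular_fun S2"
  unfolding me_def by (intro zero_outside_regular rational_at_mpow[OF S2_torus])

lemma me_add: "me (e + f) = me e * me f"
  using S2_torus by (auto simp: me_def zero_outside_def fun_eq_iff pointwise_simps mpow_add)

lemma me_0: "me 0 = one_S"
  by (simp add: me_def)

lemma me_axis: "me (axis k 1) = qc k"
  by (simp add: me_def mpow_axis)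

lemma qc_D_me: "qc k * S.D k (me e) = (\<lambda>_. of_int (e $ k)) * me e"
proof
  fix q
  show "(qc k * S.D k (me e)) q = ((\<lambda>_. of_int (e $ k)) * me e) q"
  proof (cases "q \<in> S2")
    case True
    then have q: "q \<in> torus" using S2_torus by blast
    have "has_gradient (me e) (\<lambda>k. of_int (e $ k) * mpow q e / q $ k) q"
      by (rule has_gradient_cong[OF has_gradient_mpow[OF q] open_S2 True]) (simp add: me_def zero_outside_apply)
    then have "S.D k (me e) q = of_int (e $ k) * mpow q e / q $ k"
      by (rule partial_op_apply[OF me_regular True])
    then show ?thesis using True torus_nth[OF q] by (simp add: pointwise_simps me_def zero_outside_apply)
  next
    case False
    then show ?thesis by (simp add: pointwise_simps me_def zero_outside_def)
  qed
qed

section \<open>The operators attached to monomials\<close>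

definition Eu :: "'m \<Rightarrow> ('r option, 'r option) operator" where
  "Eu i = (\<Sum>k\<in>UNIV. Cn (of_int (d k $ i)) \<cdot> \<theta> k)"

lemma Eu_closed: "Eu i \<in> diff_op V"
  unfolding Eu_def by (intro U_closed \<theta>_closed)

definition fac :: "'m \<Rightarrow> int \<Rightarrow> ('r option, 'r option) operator" where
  "fac i n = \<zeta> \<cdot> (Eu i - Cn (of_int n))"

lemma fac_closed: "fac i n \<in> diff_op V"
  unfolding fac_def by (intro U_closed Eu_closed)

lemma Eu_Mq:
  assumes r: "r \<in> regular_fun S2"
  shows "Eu i \<cdot> Mq r = Mq r \<cdot> Eu i + (\<Sum>k\<in>UNIV. Cn (of_int (d k $ i)) \<cdot> Mq (qc k * S.D k r))"
proof -
  have r': "qc k * S.D k r \<in> regular_fun S2" for k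
    by (intro regular_fun_mult regular_coord partial_op_regular[OF open_S2 r])
  note cl = U_closed \<theta>_closed r r'
  have "Eu i \<cdot> Mq r = (\<Sum>k\<in>UNIV. Cn (of_int (d k $ i)) \<cdot> (\<theta> k \<cdot> Mq r))"
    unfolding Eu_def comp_sum_left by (simp only: o_assoc)
  also have "\<dots> = (\<Sum>k\<in>UNIV. Cn (of_int (d k $ i)) \<cdot> (Mq r \<cdot> \<theta> k) + Cn (of_int (d k $ i)) \<cdot> Mq (qc k * S.D k r))"
    by (simp add: \<theta>_comp_Mq[OF r] U.comp_plus_right cl)
  also have "\<dots> = (\<Sum>k\<in>UNIV. Cn (of_int (d k $ i)) \<cdot> (Mq r \<cdot> \<theta> k)) + (\<Sum>k\<in>UNIV. Cn (of_int (d k $ i)) \<cdot> Mq (qc k * S.D k r))"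
    by (rule sum.distrib)
  also have "(\<Sum>k\<in>UNIV. Cn (of_int (d k $ i)) \<cdot> (Mq r \<cdot> \<theta> k)) = Mq r \<cdot> Eu i"
  proof -
    have "Mq r \<cdot> Eu i = (\<Sum>k\<in>UNIV. Mq r \<cdot> (Cn (of_int (d k $ i)) \<cdot> \<theta> k))"
      unfolding Eu_def by (rule U.comp_sum_right) (intro cl)+
    then show ?thesis by (simp only: o_assoc U.const_central[OF Mq_closed[OF r]])
  qed
  finally show ?thesis .
qed

text \<open>E_i multiplies q^e by the \<open>i\<close>-th entry of \<Sum>e_a d_a, so moving it past
  q^e adds this number.\<close>

lemma Eu_me: "Eu i \<cdot> Mq (me e) = Mq (me e) \<cdot> (Eu i + Cn (of_int (dsum e $ i)))"
proof -
  have "(\<Sum>k\<in>UNIV. Cn (of_int (d k $ i)) \<cdot> Mq (qc k * S.D k (me e))) = (\<Sum>k\<in>UNIV. Cn (of_int (e $ k * d k $ i))) \<cdot> Mq (me e)"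
    unfolding comp_sum_left
    by (rule sum.cong[OF refl]) (simp only: qc_D_me Mq_const_mult[OF me_regular] o_assoc U.M_const_comp of_int_mult, simp only: mult.commute)
  also have "(\<Sum>k\<in>UNIV. Cn (of_int (e $ k * d k $ i))) = Cn (of_int (dsum e $ i))"
  proof -
    have "(\<Sum>k\<in>K. Cn (of_int (f k))) = Cn (of_int (\<Sum>k\<in>K. f k))" for f :: "'r \<Rightarrow> int" and K
      using mult_op_0[of V]
      by (induction K rule: infinite_finite_induct) (simp_all add: zero_fun_def U.M_add_const)
    then show ?thesis by (simp only: dsum_nth)
  qed
  finally show ?thesis
    by (simp add: Eu_Mq[OF me_regular] U.comp_plus_right U_closed Eu_closed me_regular U.const_central)
qed

lemma \<zeta>_Eu: "\<zeta> \<cdot> Eu i = Eu i \<cdot> \<zeta>" and Dt_Eu: "Dt \<cdot> Eu i = Eu i \<cdot> Dt"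
  unfolding Eu_def
  by (intro U.commute_sum U_closed \<theta>_closed U.commute_comp \<zeta>_\<theta> Dt_\<theta> U.const_central[symmetric])+

lemma Eu_commute: "Eu i \<cdot> Eu j = Eu j \<cdot> Eu i"
proof -
  have "Eu i \<cdot> \<theta> k = \<theta> k \<cdot> Eu i" for k
    unfolding Eu_def
    by (rule sym) (intro U.commute_sum U_closed \<theta>_closed U.commute_comp \<theta>_commute U.const_central[symmetric])
  then show ?thesis unfolding Eu_def[of j]
    by (intro U.commute_sum U_closed \<theta>_closed Eu_closed U.commute_comp U.const_central[symmetric])
qed

lemma fac_commute: "fac i n \<cdot> fac j m = fac j m \<cdot> fac i n"
proof -
  have \<zeta>: "\<zeta> \<cdot> (Eu j - Cn c) = (Eu j - Cn c) \<cdot> \<zeta>" for j c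
    by (intro U.commute_diff U_closed Eu_closed \<zeta>_Eu U.const_central[symmetric])
  have Eu: "(Eu i - Cn c) \<cdot> (Eu j - Cn c') = (Eu j - Cn c') \<cdot> (Eu i - Cn c)" for i j c c'
  proof -
    have "Eu j \<cdot> (Eu i - Cn c) = (Eu i - Cn c) \<cdot> Eu j" for i j
      by (intro U.commute_diff U_closed Eu_closed Eu_commute U.const_central[symmetric])
    moreover have "Cn c' \<cdot> (Eu i - Cn c) = (Eu i - Cn c) \<cdot> Cn c'"
      by (intro U.const_central U_closed Eu_closed)
    ultimately show ?thesis by (intro U.commute_diff U_closed Eu_closed) simp_all
  qed
  have "\<zeta> \<cdot> fac j m = fac j m \<cdot> \<zeta>" for j m
    unfolding fac_def by (rule U.commute_comp[OF refl \<zeta>])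
  moreover have "(Eu i - Cn (of_int n)) \<cdot> fac j m = fac j m \<cdot> (Eu i - Cn (of_int n))"
    unfolding fac_def by (rule U.commute_comp[OF \<zeta>[symmetric] Eu])
  ultimately have "fac j m \<cdot> fac i n = fac i n \<cdot> fac j m" unfolding fac_def[of i] by (intro U.commute_comp) (rule sym, assumption)+
  then show ?thesis by (rule sym)
qed

lemma fac_Suc: "fac i (n + 1) = fac i n - \<zeta>"
  by (simp add: fac_def U.M_add_const U_dist U_closed Eu_closed algebra_simps)

text \<open>The index changes exactly as the exponent of w_i does when the monomial of a relation is
  absorbed into q; this makes the operators compatible with the box relations.\<close>

lemma fac_me: "fac i n \<cdot> Mq (me e) = Mq (me e) \<cdot> fac i (n - dsum e $ i)"
proof -
  note cl = U_closed Eu_closed me_regular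
  have "(Eu i - Cn (of_int n)) \<cdot> Mq (me e) = Mq (me e) \<cdot> (Eu i - Cn (of_int (n - dsum e $ i)))"
    using U.M_add_const[of "of_int (n - dsum e $ i)" "of_int (dsum e $ i)"]
    by (simp add: Eu_me U_dist cl U.const_central algebra_simps)
  then have "\<zeta> \<cdot> ((Eu i - Cn (of_int n)) \<cdot> Mq (me e)) = \<zeta> \<cdot> Mq (me e) \<cdot> (Eu i - Cn (of_int (n - dsum e $ i)))"
    by (simp only: o_assoc)
  then show ?thesis unfolding fac_def \<zeta>_Mq[OF me_regular] by (simp only: o_assoc)
qed

text \<open>The leading factor z depends on \<tau>: its derivative - z^2 produces the second term,
  while E_i commutes with \<partial>_\<tau>.\<close>

lemma Dt_fac: "Dt \<cdot> fac i n = fac i n \<cdot> Dt - \<zeta> \<cdot> fac i n"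
proof -
  note cl = U_closed Eu_closed
  have D: "Dt \<cdot> (Eu i - Cn (of_int n)) = (Eu i - Cn (of_int n)) \<cdot> Dt"
    by (intro U.commute_diff cl Dt_Eu U.const_central[symmetric])
  have "Dt \<cdot> fac i n = (\<zeta> \<cdot> Dt - \<zeta> \<cdot> \<zeta>) \<cdot> (Eu i - Cn (of_int n))"
    unfolding fac_def o_assoc Dt_\<zeta> ..
  also have "\<dots> = \<zeta> \<cdot> (Dt \<cdot> (Eu i - Cn (of_int n))) - \<zeta> \<cdot> fac i n"
    unfolding fac_def by (simp only: comp_diff_left o_assoc)
  finally show ?thesis unfolding D by (simp only: fac_def o_assoc)
qed

abbreviation "DV \<equiv> D_ring V"

definition facs :: "'m \<Rightarrow> nat \<Rightarrow> ('r option, 'r option) operator" where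
  "facs i n = finprod DV (\<lambda>\<nu>. fac i (int \<nu>)) {..<n}"

text \<open>The operator to which the monomial w^u, shifted by u_0, will correspond. Nonpositive
  entries of \<open>u\<close> contribute trivial factors.\<close>

definition Bop :: "int ^ 'm \<Rightarrow> ('r option, 'r option) operator" where
  "Bop u = finprod DV (\<lambda>i. facs i (nat (u $ i))) UNIV"

lemma commuting_fac: "U.DR.commuting (\<lambda>\<nu>. fac i (int \<nu>)) B"
  by (simp add: U.DR.commuting_def fac_closed fac_commute)

lemma facs_closed: "facs i n \<in> diff_op V"
  using U.DR.finprod_commuting_closed[OF _ commuting_fac, of "{..<n}" i] by (simp add: facs_def)

lemma facs_0: "facs i 0 = U.I"
  by (simp add: facs_def finprod_def U.const_diff_op)

lemma facs_Suc: "facs i (Suc n) = fac i (int n) \<cdot> facs i n"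
  using U.DR.finprod_commuting_insert[OF _ _ commuting_fac, of "{..<n}" n i] by (simp add: facs_def lessThan_Suc)

lemma fac_facs: "fac i n \<cdot> facs j m = facs j m \<cdot> fac i n"
  by (induction m) (simp_all add: facs_0 fac_closed facs_Suc U.commute_comp fac_commute)

lemma facs_commute: "facs i n \<cdot> facs j m = facs j m \<cdot> facs i n"
  by (induction m) (simp_all add: facs_0 facs_closed facs_Suc U.commute_comp fac_facs[symmetric])

lemma commuting_facs: "U.DR.commuting (\<lambda>i. facs i (f i)) B"
  by (simp add: U.DR.commuting_def facs_closed facs_commute)

lemma Bop_closed: "Bop u \<in> diff_op V"
  using U.DR.finprod_commuting_closed[OF _ commuting_facs, of UNIV] by (simp add: Bop_def)

lemma Bop_0: "Bop 0 = U.I"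
proof -
  have "finprod DV (\<lambda>i. facs i 0) ({} \<union> UNIV) = finprod DV (\<lambda>i. facs i 0) {}"
    by (rule U.DR.finprod_commuting_neutral[OF finite commuting_facs]) (simp_all add: facs_0)
  also have "\<dots> = U.I" by (simp add: finprod_def U.const_diff_op)
  finally show ?thesis by (simp add: Bop_def)
qed

lemma Bop_step:
  assumes "u $ i \<ge> 0" shows "Bop (u + axis i 1) = fac i (u $ i) \<cdot> Bop u"
proof -
  let ?f = "\<lambda>u j. facs j (nat (u $ j))"
  have split: "Bop u = ?f u i \<cdot> finprod DV (?f u) (UNIV - {i})" for u
    using U.DR.finprod_commuting_insert[OF _ _ commuting_facs, of "UNIV - {i}" i "\<lambda>j. nat (u $ j)"]
    by (simp add: Bop_def insert_UNIV)
  have "finprod DV (?f (u + axis i 1)) (UNIV - {i}) = finprod DV (?f u) (UNIV - {i})"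
    by (rule U.DR.finprod_commuting_cong[OF _ commuting_facs]) (simp_all add: axis_def)
  moreover have "nat ((u + axis i 1) $ i) = Suc (nat (u $ i))" "int (nat (u $ i)) = u $ i" using assms by (simp_all add: axis_def)
  then have "?f (u + axis i 1) i = fac i (u $ i) \<cdot> ?f u i" by (simp add: facs_Suc)
  ultimately show ?thesis by (simp only: split o_assoc)
qed

definition Iq :: "('r option, 'r option) operator set" where
  "Iq = quantum_ideal S2 A p d"

lemma Dtau_eq: "Dtau S2 = DV"
  by (simp add: Dtau_def)

lemma q_euler_eq: "q_euler S2 k = \<theta> k"
  by (simp add: q_euler_def Dtau_eq \<theta>_def)

lemma box_factor_eq: "box_factor S2 d i \<nu> = fac i (int \<nu>)"
proof -
  have M: "U.M (\<lambda>y. c * inverse (y $ None)) = Cn c \<cdot> \<zeta>" for c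
    by (simp add: U.M_comp inverse_rational_U times_fun_def)
  have cl: "Cn c \<cdot> \<zeta> \<cdot> \<theta> k \<in> diff_op V" for c k by (intro U_closed \<theta>_closed)
  have "finsum DV (\<lambda>k. (Cn (of_int (d k $ i)) \<cdot> \<zeta>) \<cdot> \<theta> k) UNIV = (\<Sum>k\<in>UNIV. (Cn (of_int (d k $ i)) \<cdot> \<zeta>) \<cdot> \<theta> k)"
    by (rule U.finsum_D_ring) (simp_all add: cl)
  also have "\<dots> = \<zeta> \<cdot> Eu i"
  proof -
    have "\<zeta> \<cdot> Eu i = (\<Sum>k\<in>UNIV. \<zeta> \<cdot> (Cn (of_int (d k $ i)) \<cdot> \<theta> k))"
      unfolding Eu_def by (rule U.comp_sum_right) (intro U_closed \<theta>_closed)+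
    then show ?thesis by (simp only: o_assoc U.const_central[OF \<zeta>_closed])
  qed
  finally show ?thesis
    unfolding box_factor_def Dtau_eq q_euler_eq M
    by (simp add: U_closed U.const_central fac_def U.comp_diff_right Eu_closed)
qed

text \<open>The product over the negative entries of \<open>l\<close> is extended to all indices by
  trivial factors.\<close>

lemma box_half_eq:
  assumes l: "deg l = 0"
  shows "box_half S2 p d l = Mq (me (pos (gdot l))) \<cdot> Bop (pos (- l))"
proof -
  have "(\<Prod>k | p k l > 0. (y $ Some k) ^ nat (p k l)) = mpow (base_pt y) (pos (gdot l))" for y :: "complex ^ 'r option"
    unfolding mpow_def
    by (rule prod.mono_neutral_cong_left) (auto simp: p_eq[OF l] pos_nth power_int_def max_def)
  then have M: "U.M (\<lambda>y. \<Prod>k | p k l > 0. (y $ Some k) ^ nat (p k l)) = Mq (me (pos (gdot l)))"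
    by (intro mult_op_cong) (simp add: lift_def me_def zero_outside_apply punctured_iff)
  have "finprod DV (\<lambda>i. facs i (nat (- (l $ i)))) {i. l $ i < 0} = finprod DV (\<lambda>i. facs i (nat (- (l $ i)))) ({i. l $ i < 0} \<union> {i. \<not> l $ i < 0})"
    by (rule U.DR.finprod_commuting_neutral[OF _ commuting_facs, symmetric]) (auto simp: facs_0)
  also have "{i. l $ i < 0} \<union> {i. \<not> l $ i < 0} = UNIV" by blast
  also have "finprod DV (\<lambda>i. facs i (nat (- (l $ i)))) UNIV = Bop (pos (- l))"
    unfolding Bop_def by (rule U.DR.finprod_commuting_cong[OF finite commuting_facs]) (simp add: pos_nth max_def)
  finally show ?thesis
    unfolding box_half_def Dtau_eq box_factor_eq M facs_def by simp
qed

lemma box_op_eq: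
  assumes l: "deg l = 0"
  shows "box_op S2 p d l = Mq (me (pos (gdot l))) \<cdot> Bop (pos (- l)) - Mq (me (pos (- gdot l))) \<cdot> Bop (pos l)"
proof -
  have "deg (- l) = 0" using deg_diff[of 0 l] by (simp add: l deg_0)
  from box_half_eq[OF this] show ?thesis
    by (simp add: box_op_def box_half_eq[OF l] Dtau_eq gdot_uminus Mq_closed me_regular Bop_closed diff_op.comp)
qed

text \<open>The anticanonical class has the value \<Sum>_i m_ia on d_a, so the sum over the base
  recombines to \<Sum>_i E_i; the remaining term is z \<partial>_z = - \<tau>
  \<partial>_\<tau>.\<close>

lemma euler_op_eq: "euler_op S2 A d = (\<Sum>i\<in>UNIV. Eu i) - \<tau> \<cdot> Dt"
proof -
  have "anticanonical_class A (d k) = (\<Sum>i\<in>UNIV. d k $ i)" for k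
    by (simp add: anticanonical_class_def divisor_class_def relation_iff d_relation axis_def if_distrib[of "\<lambda>x. x * _"] cong: if_cong)
  moreover have "(\<Sum>i\<in>UNIV. Eu i) = (\<Sum>k\<in>UNIV. Cn (of_int (\<Sum>i\<in>UNIV. d k $ i)) \<cdot> \<theta> k)"
  proof -
    have "(\<Sum>i\<in>I. Cn (of_int (f i)) \<cdot> \<theta> k) = Cn (of_int (\<Sum>i\<in>I. f i)) \<cdot> \<theta> k" for f :: "'m \<Rightarrow> int" and I k
      using mult_op_0[of V]
      by (induction I rule: infinite_finite_induct) (simp_all add: zero_fun_def[symmetric] comp_zero_left U.M_add_const comp_plus_left)
    then show ?thesis unfolding Eu_def by (subst sum.swap) simp
  qed
  moreover have "finsum DV (\<lambda>k. Cn (of_int (anticanonical_class A (d k))) \<cdot> \<theta> k) UNIV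
      = (\<Sum>k\<in>UNIV. Cn (of_int (anticanonical_class A (d k))) \<cdot> \<theta> k)"
    by (rule U.finsum_D_ring) (auto intro: U_closed \<theta>_closed)
  ultimately show ?thesis
    by (simp add: euler_op_def z_euler_def Dtau_eq q_euler_eq U_closed)
qed

lemma quantum_generators:
  "insert (euler_op S2 A d) (box_op S2 p d ` relation_lattice A) \<subseteq> carrier DV"
proof -
  have "box_op S2 p d l \<in> diff_op V" if "deg l = 0" for l
    unfolding box_op_eq[OF that] by (intro U_closed Bop_closed me_regular)
  moreover have "euler_op S2 A d \<in> diff_op V" unfolding euler_op_eq by (intro U_closed Eu_closed)
  ultimately show ?thesis by (auto simp: relation_iff)
qed

lemma Iq_left_ideal: "left_ideal DV Iq"
  unfolding Iq_def quantum_ideal_def Dtau_eq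
  by (rule generated_left_ideal_is_left_ideal[OF U.ring_D_ring quantum_generators])

lemma Iq_comp: "P \<in> diff_op V \<Longrightarrow> Q \<in> Iq \<Longrightarrow> P \<cdot> Q \<in> Iq"
  using Iq_left_ideal by (simp add: left_ideal_def)

lemma Iq_closed: "P \<in> Iq \<Longrightarrow> P \<in> diff_op V"
  using additive_subgroup.a_subset[of Iq DV] Iq_left_ideal by (auto simp: left_ideal_def)

lemma Iq_0: "0 \<in> Iq" and Iq_add: "P \<in> Iq \<Longrightarrow> Q \<in> Iq \<Longrightarrow> P + Q \<in> Iq"
  using additive_subgroup.zero_closed[of Iq DV] additive_subgroup.a_closed[of Iq DV P Q] Iq_left_ideal
  by (simp_all add: left_ideal_def)

lemma Iq_uminus: "P \<in> Iq \<Longrightarrow> - P \<in> Iq"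
  using Iq_comp[of "- U.I" P] by (simp add: comp_uminus_left U_closed Iq_closed)

lemma Iq_diff: "P \<in> Iq \<Longrightarrow> Q \<in> Iq \<Longrightarrow> P - Q \<in> Iq"
  using Iq_add[OF _ Iq_uminus] by simp

lemma additive_set_Iq: "additive_set Iq"
  by (simp add: additive_set_def Iq_0 Iq_diff)

section \<open>Congruence modulo the quantum ideal\<close>

text \<open>Membership in the ring is built in, which saves side conditions in chains. As the ideal
  is a left ideal, congruences are composed with operators from the left.\<close>

definition equ :: "('r option, 'r option) operator \<Rightarrow> ('r option, 'r option) operator \<Rightarrow> bool" (infix "\<doteq>" 50) where
  "P \<doteq> Q \<longleftrightarrow> P \<in> diff_op V \<and> Q \<in> diff_op V \<and> P - Q \<in> Iq"

lemma equ_refl: "P \<in> diff_op V \<Longrightarrow> P \<doteq> P"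
  by (simp add: equ_def Iq_0)

lemma equ_sym: "P \<doteq> Q \<Longrightarrow> Q \<doteq> P"
  unfolding equ_def using Iq_uminus[of "P - Q"] by simp

lemma equ_trans [trans]: "P \<doteq> Q \<Longrightarrow> Q \<doteq> R \<Longrightarrow> P \<doteq> R"
  unfolding equ_def using Iq_add[of "P - Q" "Q - R"] by simp

lemma eq_equ_trans [trans]: "P = Q \<Longrightarrow> Q \<doteq> R \<Longrightarrow> P \<doteq> R" and equ_eq_trans [trans]: "P \<doteq> Q \<Longrightarrow> Q = R \<Longrightarrow> P \<doteq> R"
  by simp_all

lemma equ_add: "P \<doteq> Q \<Longrightarrow> P' \<doteq> Q' \<Longrightarrow> P + P' \<doteq> Q + Q'"
  unfolding equ_def using Iq_add[of "P - Q" "P' - Q'"] by (simp add: U_closed add_diff_add)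

lemma equ_uminus: "P \<doteq> Q \<Longrightarrow> - P \<doteq> - Q"
  unfolding equ_def using Iq_uminus[of "P - Q"] by (simp add: U_closed)

lemma equ_diff: "P \<doteq> Q \<Longrightarrow> P' \<doteq> Q' \<Longrightarrow> P - P' \<doteq> Q - Q'"
  using equ_add[OF _ equ_uminus] by fastforce

lemma equ_sum: "(\<And>i. i \<in> I \<Longrightarrow> P i \<doteq> Q i) \<Longrightarrow> sum P I \<doteq> sum Q I"
  by (induction I rule: infinite_finite_induct) (simp_all add: equ_refl equ_add zero_diff_op)

lemma equ_comp: "R \<in> diff_op V \<Longrightarrow> P \<doteq> Q \<Longrightarrow> R \<cdot> P \<doteq> R \<cdot> Q"
  unfolding equ_def using Iq_comp[of R "P - Q"] by (simp add: U_closed U.comp_diff_right)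

lemma equ_0_iff: "P \<doteq> 0 \<longleftrightarrow> P \<in> Iq"
  using Iq_closed by (auto simp: equ_def zero_diff_op)

end

section \<open>The evaluation of functions in the quantum module\<close>

lemma nonneg_vec_induct [consumes 1, case_names zero step]:
  fixes u :: "int ^ 'a::finite"
  assumes "\<And>i. u $ i \<ge> 0" "C 0" "\<And>u i. (\<And>i. u $ i \<ge> 0) \<Longrightarrow> C u \<Longrightarrow> C (u + axis i 1)"
  shows "C u"
  using assms(1)
proof (induction "nat (\<Sum>i\<in>UNIV. u $ i)" arbitrary: u rule: less_induct)
  case less
  show ?case
  proof (cases "u = 0")
    case True
    then show ?thesis using assms(2) by simp
  next
    case False
    then obtain i where "u $ i \<noteq> 0" by (auto simp: vec_eq_iff)
    then have i: "u $ i > 0" using less.prems[of i] by simp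
    let ?u = "u - axis i 1"
    have u: "?u $ j \<ge> 0" for j using i less.prems[of j] by (simp add: axis_def)
    have "(\<Sum>j\<in>UNIV. ?u $ j) = (\<Sum>j\<in>UNIV. u $ j) - 1" by (simp add: sum_subtractf axis_def)
    moreover have "(\<Sum>j\<in>UNIV. ?u $ j) \<ge> 0" using u by (simp add: sum_nonneg)
    ultimately have "C ?u" by (intro less.hyps u) linarith
    from assms(3)[OF u this, of i] show ?thesis by simp
  qed
qed

context lg_model
begin

lemma bs_cong: "(\<And>q. q \<in> S2 \<Longrightarrow> r q = r' q) \<Longrightarrow> bs r u = bs r' u"
  by (rule ext) (simp add: bs_def zero_outside_def qq_S2)

lemma bs_mult: "bs r u * bs r' u' = bs (r * r') (u + u')"
  by (rule bs_eqI) (simp_all add: pointwise_simps bs_apply bs_outside mpow_add S1_torus mult_ac)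

lemma bs_0: "bs 0 u = 0"
  by (rule ext) (simp add: bs_def zero_outside_def pointwise_simps)

lemma bs_shift_me: "deg l = 0 \<Longrightarrow> bs r (u + l) = bs (r * me (gdot l)) u"
  by (subst bs_shift, assumption, rule bs_cong) (simp add: pointwise_simps me_def zero_outside_apply)

lemma one_S_mult: "r \<in> regular_fun S2 \<Longrightarrow> one_S * r = r" "r \<in> regular_fun S2 \<Longrightarrow> r * one_S = r"
  by (auto simp: fun_eq_iff pointwise_simps zero_outside_def regular_fun_outside)

lemma const_mult_regular: "r \<in> regular_fun X \<Longrightarrow> (\<lambda>_. c) * r \<in> regular_fun X"
  by (rule regular_fun_mult_rational(1)[OF _ rational_at_const])

lemma Mq_one_S: "Mq one_S = U.I"
  by (rule Mq_one)

lemma Cn_0: "Cn 0 = 0"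
  using mult_op_0[of V] by (simp add: zero_fun_def)

lemma Cn_sum: "Cn (of_int (\<Sum>k\<in>K. f k)) = (\<Sum>k\<in>K. Cn (of_int (f k)))"
  by (induction K rule: infinite_finite_induct) (simp_all add: Cn_0 U.M_add_const)

lemma Mq_sum: "Mq (\<Sum>k\<in>K. r k) = (\<Sum>k\<in>K. Mq (r k))"
proof -
  have "Mq 0 = 0" using mult_op_0[of V] by (simp add: lift_def zero_fun_def)
  then show ?thesis by (induction K rule: infinite_finite_induct) (simp_all add: Mq_add)
qed

text \<open>For m = 0 this is the box operator of \<open>l\<close>, multiplied by an invertible
  monomial in q. Each further factor is composed from the left and moved past q^(gdot l) by
  \<open>fac_me\<close>, which shifts its index as required.\<close>

lemma Bop_shift:
  assumes m: "\<And>i. m $ i \<ge> 0" and l: "deg l = 0"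
  shows "Bop (m + pos l) \<doteq> Mq (me (gdot l)) \<cdot> Bop (m + pos (- l))"
  using m
proof (induction rule: nonneg_vec_induct)
  case zero
  let ?g = "gdot l"
  have "box_op S2 p d l \<in> Iq"
    unfolding Iq_def quantum_ideal_def by (rule generated_left_ideal_incl) (simp add: relation_iff l)
  then have "Mq (me (pos ?g)) \<cdot> Bop (pos (- l)) \<doteq> Mq (me (pos (- ?g))) \<cdot> Bop (pos l)"
    by (simp add: equ_def box_op_eq[OF l] U_closed Bop_closed me_regular)
  \<comment> \<open>Divide by the monomial in front of \<open>Bop (pos l)\<close>.\<close>
  from equ_comp[OF Mq_closed[OF me_regular] this, of "- pos (- ?g)"]
  have "Mq (me (- pos (- ?g) + pos ?g)) \<cdot> Bop (pos (- l)) \<doteq> Mq (me (- pos (- ?g) + pos (- ?g))) \<cdot> Bop (pos l)"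
    by (simp only: o_assoc Mq_comp[OF me_regular me_regular] me_add)
  moreover have "- pos (- ?g) + pos ?g = ?g" using pos_diff[of ?g] by (simp add: algebra_simps)
  ultimately show ?case
    by - (rule equ_sym, simp add: me_0 Mq_one_S Bop_closed)
next
  case (step m i)
  let ?l = "pos l" and ?l' = "pos (- l)"
  have nn: "(m + ?l) $ i \<ge> 0" "(m + ?l') $ i \<ge> 0" using step.hyps[of i] by (simp_all add: pos_nth)
  have eq: "(m + ?l) $ i - dsum (gdot l) $ i = (m + ?l') $ i"
    using pos_diff[of l] relation_expand[OF l] by (simp add: vec_eq_iff algebra_simps)
  have "Bop (m + axis i 1 + ?l) = fac i ((m + ?l) $ i) \<cdot> Bop (m + ?l)"
    using Bop_step[OF nn(1)] by (simp only: add.assoc add.commute[of "axis i 1"])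
  also have "\<dots> \<doteq> fac i ((m + ?l) $ i) \<cdot> (Mq (me (gdot l)) \<cdot> Bop (m + ?l'))"
    by (rule equ_comp[OF fac_closed step.IH])
  also have "\<dots> = Mq (me (gdot l)) \<cdot> (fac i ((m + ?l') $ i) \<cdot> Bop (m + ?l'))"
    by (simp only: o_assoc fac_me eq)
  also have "\<dots> = Mq (me (gdot l)) \<cdot> Bop (m + axis i 1 + ?l')"
    using Bop_step[OF nn(2)] by (simp only: add.assoc add.commute[of "axis i 1"])
  finally show ?case .
qed

text \<open>For u = 0 this is z times the Euler operator. Moving \<partial>_\<tau> past a further
  factor \<open>fac i n\<close> costs - z, and this is the change from \<open>fac i n\<close> to
  \<open>fac i (n + 1)\<close> in the sum.\<close>

lemma Dt_Bop:
  assumes u: "\<And>i. u $ i \<ge> 0"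
  shows "Dt \<cdot> Bop u \<doteq> (\<Sum>i\<in>UNIV. fac i (u $ i)) \<cdot> Bop u"
  using u
proof (induction rule: nonneg_vec_induct)
  case zero
  have "euler_op S2 A d \<in> Iq"
    unfolding Iq_def quantum_ideal_def by (rule generated_left_ideal_incl) simp
  then have "(\<Sum>i\<in>UNIV. Eu i) \<doteq> \<tau> \<cdot> Dt"
    by (simp add: equ_def euler_op_eq U_closed Eu_closed)
  from equ_comp[OF \<zeta>_closed this] have "(\<Sum>i\<in>UNIV. fac i 0) \<doteq> \<zeta> \<cdot> \<tau> \<cdot> Dt"
    by (simp add: U.comp_sum_right U_closed Eu_closed fac_def Cn_0 o_assoc)
  then show ?case by - (rule equ_sym, simp add: \<zeta>_\<tau> Bop_0 U_closed fac_closed)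
next
  case (step u i)
  let ?s = "\<Sum>j\<in>UNIV. fac j (u $ j)" and ?n = "u $ i"
  note cl = U_closed fac_closed Bop_closed
  have B: "Bop (u + axis i 1) = fac i ?n \<cdot> Bop u" by (rule Bop_step[OF step.hyps])
  have s: "fac i ?n \<cdot> ?s = ?s \<cdot> fac i ?n" by (intro U.commute_sum cl fac_commute)
  have "fac j ((u + axis i 1) $ j) = fac j (u $ j) - (if j = i then \<zeta> else 0)" for j
    by (simp add: axis_def fac_Suc)
  then have s': "(\<Sum>j\<in>UNIV. fac j ((u + axis i 1) $ j)) = ?s - \<zeta>" by (simp only: sum_subtractf) simp
  have "Dt \<cdot> Bop (u + axis i 1) = (Dt \<cdot> fac i ?n) \<cdot> Bop u" by (simp only: B o_assoc)
  also have "\<dots> = fac i ?n \<cdot> (Dt \<cdot> Bop u) - \<zeta> \<cdot> Bop (u + axis i 1)"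
    by (simp only: Dt_fac comp_diff_left o_assoc B)
  also have "\<dots> \<doteq> fac i ?n \<cdot> (?s \<cdot> Bop u) - \<zeta> \<cdot> Bop (u + axis i 1)"
    by (intro equ_diff equ_comp step.IH equ_refl cl)
  also have "fac i ?n \<cdot> (?s \<cdot> Bop u) = ?s \<cdot> Bop (u + axis i 1)"
    unfolding B o_assoc s ..
  also have "?s \<cdot> Bop (u + axis i 1) - \<zeta> \<cdot> Bop (u + axis i 1) = (?s - \<zeta>) \<cdot> Bop (u + axis i 1)"
    by (rule comp_diff_left[symmetric])
  finally show ?case unfolding s' .
qed

section \<open>The map from functions to operators\<close>

text \<open>Prescribed on the basis of monomials with the chosen exponents \<open>rep v\<close>. The
  choice affects the operators but not their classes modulo the ideal.\<close>

definition Psi :: "(complex ^ 'm \<Rightarrow> complex) \<Rightarrow> ('r option, 'r option) operator" where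
  "Psi = (SOME L. (\<forall>f\<in>regular_fun S1. \<forall>h\<in>regular_fun S1. L (f + h) = L f + L h) \<and>
     (\<forall>v. \<forall>r\<in>regular_fun S2. L (bs r (rep v)) = Mq r \<cdot> Bop (rep v)))"

lemma Psi_add: "f \<in> regular_fun S1 \<Longrightarrow> h \<in> regular_fun S1 \<Longrightarrow> Psi (f + h) = Psi f + Psi h"
  and Psi_rep: "r \<in> regular_fun S2 \<Longrightarrow> Psi (bs r (rep v)) = Mq r \<cdot> Bop (rep v)"
proof -
  have "\<exists>L. (\<forall>f\<in>regular_fun S1. \<forall>h\<in>regular_fun S1. L (f + h) = L f + L h) \<and>
      (\<forall>v. \<forall>r\<in>regular_fun S2. L (bs r (rep v)) = Mq r \<cdot> Bop (rep v))"
    by (rule regular_S1_extend[of "\<lambda>v r. Mq r \<cdot> Bop (rep v)"]) (simp add: Mq_add comp_plus_left, blast)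
  from someI_ex[OF this, folded Psi_def]
  show "f \<in> regular_fun S1 \<Longrightarrow> h \<in> regular_fun S1 \<Longrightarrow> Psi (f + h) = Psi f + Psi h"
    "r \<in> regular_fun S2 \<Longrightarrow> Psi (bs r (rep v)) = Mq r \<cdot> Bop (rep v)" by blast+
qed

lemma Psi_closed: "h \<in> regular_fun S1 \<Longrightarrow> Psi h \<in> diff_op V"
proof -
  have "Psi h \<in> diff_op V \<and> h \<in> regular_fun S1" if "h \<in> add_span {bs r (rep v) | v r. r \<in> regular_fun S2}" for h
    using that
  proof (induction rule: add_span.induct)
    case (base h)
    then show ?case by (auto simp: Psi_rep bs_regular intro!: U_closed Bop_closed)
  next
    case (add f h)
    then show ?case by (simp add: Psi_add diff_op_plus regular_fun_add)
  qed
  then show "h \<in> regular_fun S1 \<Longrightarrow> Psi h \<in> diff_op V" using regular_S1_span by blast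
qed

text \<open>\<open>u\<close> and the chosen exponent of the same weight differ by a relation
  \<open>l\<close>. After their common part \<open>m\<close> is split off, the two operators are
  compared by \<open>Bop_shift\<close>.\<close>

lemma Psi_bs:
  assumes r: "r \<in> regular_fun S2" and u: "\<And>i. u $ i \<ge> 0"
  shows "Psi (bs r u) \<doteq> Mq r \<cdot> Bop u"
proof -
  let ?v = "deg u"
  define l where "l = u - rep ?v"
  define m :: "int ^ 'm" where "m = (\<chi> i. min (u $ i) (rep ?v $ i))"
  have l: "deg l = 0" by (simp add: l_def deg_diff deg_rep)
  have m: "m $ i \<ge> 0" for i using u rep_nonneg by (simp add: m_def)
  have u_eq: "m + pos l = u" and rep_eq: "m + pos (- l) = rep ?v"
    by (simp_all add: vec_eq_iff m_def pos_nth l_def min_def max_def)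
  have rm: "r * me (gdot l) \<in> regular_fun S2" by (intro regular_fun_mult r me_regular)
  have "bs r u = bs (r * me (gdot l)) (rep ?v)" using bs_shift_me[OF l, of r "rep ?v"] by (simp add: l_def)
  then have "Psi (bs r u) = Mq r \<cdot> (Mq (me (gdot l)) \<cdot> Bop (m + pos (- l)))"
    by (simp only: Psi_rep[OF rm] Mq_comp[OF r me_regular, symmetric] rep_eq o_assoc)
  also have "\<dots> \<doteq> Mq r \<cdot> Bop (m + pos l)"
    by (intro equ_comp[OF Mq_closed[OF r]] equ_sym[OF Bop_shift[OF m l]])
  finally show ?thesis by (simp only: u_eq)
qed

text \<open>The shift comes from the volume form: with it, the constants produced by moving the derivations
  \<open>\<partial>\<^sub>q\<^sub>a\<close> past \<open>q\<^sub>a\<close> cancel in \<open>psi0_D\<close> and \<open>K_step\<close>.\<close>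

definition u0 :: "int ^ 'm" where
  "u0 = (\<chi> i. (\<Sum>k\<in>UNIV. d k $ i) - 1)"

text \<open>Normalised so that the monomial with exponent \<open>u0\<close> goes to the class of
  1.\<close>

definition psi0 :: "(complex ^ 'm \<Rightarrow> complex) \<Rightarrow> ('r option, 'r option) operator" where
  "psi0 h = Psi (h * zero_outside S1 (\<lambda>w. mpow w (- u0)))"

lemma psi0_add: "f \<in> regular_fun S1 \<Longrightarrow> h \<in> regular_fun S1 \<Longrightarrow> psi0 (f + h) = psi0 f + psi0 h"
  by (simp add: psi0_def distrib_right Psi_add regular_fun_mult regular_mpow)

lemma psi0_closed: "h \<in> regular_fun S1 \<Longrightarrow> psi0 h \<in> diff_op V"
  unfolding psi0_def by (intro Psi_closed regular_fun_mult regular_mpow)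

lemma psi0_0: "psi0 0 = 0"
  using psi0_add[of 0 0] by simp

lemma psi0_sum: "(\<And>i. i \<in> I \<Longrightarrow> f i \<in> regular_fun S1) \<Longrightarrow> psi0 (sum f I) = (\<Sum>i\<in>I. psi0 (f i))"
  by (induction I rule: infinite_finite_induct) (simp_all add: psi0_0 psi0_add regular_fun_sum)

lemma psi0_bs:
  assumes "r \<in> regular_fun S2" "\<And>i. u $ i \<ge> 0"
  shows "psi0 (bs r (u0 + u)) \<doteq> Mq r \<cdot> Bop u"
  using Psi_bs[OF assms] by (simp add: psi0_def bs_mult_mpow)

lemma psi0_Mq:
  assumes h: "h \<in> regular_fun S1" and r: "r \<in> regular_fun S2"
  shows "psi0 (bs r 0 * h) \<doteq> Mq r \<cdot> psi0 h"
  using h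
proof (induction rule: regular_S1_induct[where s = u0])
  case (bs r' u)
  have "psi0 (bs r 0 * bs r' (u0 + u)) \<doteq> Mq (r * r') \<cdot> Bop u"
    unfolding bs_mult add_0_left by (intro psi0_bs regular_fun_mult r bs)
  also have "\<dots> = Mq r \<cdot> (Mq r' \<cdot> Bop u)" by (simp only: Mq_comp[OF r bs(1), symmetric] o_assoc)
  also have "\<dots> \<doteq> Mq r \<cdot> psi0 (bs r' (u0 + u))"
    by (intro equ_comp[OF Mq_closed[OF r]] equ_sym[OF psi0_bs] bs)
  finally show ?case .
next
  case (add f h)
  then show ?case using equ_add[of "psi0 (bs r 0 * f)" "Mq r \<cdot> psi0 f" "psi0 (bs r 0 * h)" "Mq r \<cdot> psi0 h"]
    by (simp add: distrib_left psi0_add regular_fun_mult bs_regular r U.comp_plus_right Mq_closed psi0_closed)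
qed

definition fco :: "'r option \<Rightarrow> complex ^ 'm \<Rightarrow> complex" where
  "fco j = zero_outside S1 (\<lambda>w. LG_map d w $ j)"

lemma fco_None: "fco None = (\<Sum>i\<in>UNIV. bs one_S (axis i 1))"
  by (rule ext) (simp add: fco_def bs_def zero_outside_def LG_map_None sum_fun_apply mpow_axis qq_S2)

lemma fco_Some: "fco (Some k) = bs one_S (d k)"
  by (rule ext) (simp add: fco_def bs_def zero_outside_def LG_map_Some qq_S2, simp add: qq_def)

lemma fco_regular: "fco j \<in> regular_fun S1"
  by (cases j) (auto simp: fco_None fco_Some intro!: regular_fun_sum bs_regular regular_fun_const)

lemma D_bs_one: "X.D i (bs one_S u) = bs ((\<lambda>_. of_int (u $ i)) * one_S) (u - axis i 1)"
  by (simp add: D_bs[OF regular_fun_const] partial_op_const[OF open_S2])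

lemma D_fco_None: "X.D i (fco None) = bs one_S 0"
proof -
  have "X.D i (sum f I) = (\<Sum>i'\<in>I. X.D i (f i'))" if "\<And>j. f j \<in> regular_fun S1" for f :: "'m \<Rightarrow> _" and I
    by (induction I rule: infinite_finite_induct)
       (simp_all add: X.diff_op_fun_0[OF diff_op.partial] partial_op_add[OF X.open_X] that regular_fun_sum)
  from this[OF bs_regular[OF regular_fun_const]]
  have "X.D i (fco None) = (\<Sum>j\<in>UNIV. bs ((\<lambda>_. of_int (axis j 1 $ i)) * one_S) (axis j 1 - axis i 1))"
    by (simp only: fco_None D_bs_one)
  also have "\<dots> = (\<Sum>j\<in>UNIV. if j = i then bs one_S 0 else 0)"
  proof (rule sum.cong[OF refl])
    fix j
    have "(\<lambda>_. 1) * one_S = one_S" "(\<lambda>_. 0) * one_S = 0"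
      by (simp_all add: fun_eq_iff pointwise_simps)
    then show "bs ((\<lambda>_. of_int (axis j 1 $ i)) * one_S) (axis j 1 - axis i 1) = (if j = i then bs one_S 0 else 0)"
      by (auto simp: axis_def bs_0)
  qed
  finally show ?thesis by simp
qed

lemma D_fco_Some: "X.D i (fco (Some k)) = bs ((\<lambda>_. of_int (d k $ i)) * one_S) (d k - axis i 1)"
  by (simp only: fco_Some D_bs_one)

text \<open>W w^u is the sum of the monomials with one exponent raised by 1, so this is
  \<open>Dt_Bop\<close> read on functions.\<close>

lemma psi0_W:
  assumes h: "h \<in> regular_fun S1"
  shows "psi0 (fco None * h) \<doteq> Dt \<cdot> psi0 h"
  using h
proof (induction rule: regular_S1_induct[where s = u0])
  case (bs r u)
  note cl = U_closed fac_closed Bop_closed bs(1)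
  have "fco None * bs r (u0 + u) = (\<Sum>i\<in>UNIV. bs r (u0 + (u + axis i 1)))"
    unfolding fco_None sum_distrib_right bs_mult one_S_mult(1)[OF bs(1)] by (simp add: add_ac)
  then have "psi0 (fco None * bs r (u0 + u)) = (\<Sum>i\<in>UNIV. psi0 (bs r (u0 + (u + axis i 1))))"
    by (simp only: psi0_sum[OF bs_regular[OF bs(1)]])
  also have "\<dots> \<doteq> (\<Sum>i\<in>UNIV. Mq r \<cdot> Bop (u + axis i 1))"
    by (intro equ_sum psi0_bs bs) (use bs(2) in \<open>simp add: axis_def\<close>)
  also have "\<dots> = (\<Sum>i\<in>UNIV. Mq r \<cdot> (fac i (u $ i) \<cdot> Bop u))"
    by (simp only: Bop_step[OF bs(2)])
  also have "\<dots> = Mq r \<cdot> ((\<Sum>i\<in>UNIV. fac i (u $ i)) \<cdot> Bop u)"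
    unfolding comp_sum_left by (rule U.comp_sum_right[symmetric]) (intro cl)+
  also have "\<dots> \<doteq> Mq r \<cdot> (Dt \<cdot> Bop u)"
    by (intro equ_comp cl equ_sym[OF Dt_Bop] bs)
  also have "\<dots> = Dt \<cdot> (Mq r \<cdot> Bop u)" by (simp only: o_assoc Dt_Mq[OF bs(1)])
  also have "\<dots> \<doteq> Dt \<cdot> psi0 (bs r (u0 + u))" by (intro equ_comp cl equ_sym[OF psi0_bs] bs)
  finally show ?case .
next
  case (add f h)
  then show ?case using equ_add[of "psi0 (fco None * f)" "Dt \<cdot> psi0 f" "psi0 (fco None * h)" "Dt \<cdot> psi0 h"]
    by (simp add: distrib_left psi0_add regular_fun_mult fco_regular U.comp_plus_right diff_op.partial psi0_closed)
qed

text \<open>The relation that the vector field \<partial>/\<partial>w_i imposes on the direct image.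
  The chain rule terms become \<tau>, since \<partial>W/\<partial>w_i = 1, and - \<partial>_q; the
  last term is the action on \<open>h\<close>. For monomials all terms are operators composed with
  the same \<open>Bop u\<close>, and these operators add up to 0.\<close>

lemma psi0_D:
  assumes h: "h \<in> regular_fun S1"
  shows "\<tau> \<cdot> psi0 h - (\<Sum>k\<in>UNIV. Dq k \<cdot> psi0 (h * X.D i (fco (Some k)))) + psi0 (X.D i h) \<doteq> 0" (is "?E h \<doteq> 0")
  using h
\<comment> \<open>The starting exponent is raised by e_i because \<partial>/\<partial>w_i lowers it
  again.\<close>
proof (induction rule: regular_S1_induct[where s = "u0 + axis i 1"])
  case (bs r u)
  note r = bs(1)
  let ?c = "\<lambda>k. of_int (d k $ i) :: complex" and ?h = "bs r (u0 + axis i 1 + u)"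
  have r': "S.D k r \<in> regular_fun S2" for k by (rule partial_op_regular[OF open_S2 r])
  have qr: "qc k * r \<in> regular_fun S2" and qr': "qc k * S.D k r \<in> regular_fun S2" for k
    by (intro regular_fun_mult regular_coord r r')+
  note cl = U_closed \<theta>_closed fac_closed Bop_closed Eu_closed r r' qr qr' const_mult_regular psi0_closed bs_regular
  let ?N = "Cn (of_int (u $ i))" and ?C = "\<Sum>k\<in>UNIV. Cn (?c k)"
  have 1: "\<tau> \<cdot> psi0 ?h \<doteq> (Mq r \<cdot> (Eu i - ?N)) \<cdot> Bop u"
  proof -
    have "psi0 (bs r (u0 + (u + axis i 1))) \<doteq> Mq r \<cdot> Bop (u + axis i 1)"
      by (intro psi0_bs bs) (use bs(2) in \<open>simp add: axis_def\<close>)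
    then have "\<tau> \<cdot> psi0 ?h \<doteq> \<tau> \<cdot> (Mq r \<cdot> Bop (u + axis i 1))"
      by (intro equ_comp cl) (simp add: add_ac)
    also have "\<dots> = Mq r \<cdot> (\<tau> \<cdot> \<zeta>) \<cdot> (Eu i - ?N) \<cdot> Bop u"
      unfolding Bop_step[OF bs(2)] fac_def by (simp only: o_assoc \<tau>_Mq[OF r])
    finally show ?thesis by (simp add: \<tau>_\<zeta> cl)
  qed
  have 2: "psi0 (?h * X.D i (fco (Some k))) \<doteq> (Cn (?c k) \<cdot> Mq (qc k * r)) \<cdot> Bop u" for k
  proof -
    have "?h * X.D i (fco (Some k)) = bs (r * ((\<lambda>_. ?c k) * one_S)) (u0 + u + d k)"
      by (simp add: D_fco_Some bs_mult algebra_simps)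
    also have "\<dots> = bs (r * ((\<lambda>_. ?c k) * one_S) * me (gdot (d k))) (u0 + u)"
      by (rule bs_shift_me[OF d_relation])
    also have "\<dots> = bs ((\<lambda>_. ?c k) * (qc k * r)) (u0 + u)"
      by (rule bs_cong) (simp add: gdot_d me_axis pointwise_simps zero_outside_apply)
    finally show ?thesis
      using psi0_bs[OF const_mult_regular[OF qr] bs(2), of "?c k" k] by (simp only: Mq_const_mult[OF qr])
  qed
  have 3: "psi0 (X.D i ?h) \<doteq> ((\<Sum>k\<in>UNIV. Cn (?c k) \<cdot> Mq (qc k * S.D k r)) + (?C + ?N) \<cdot> Mq r) \<cdot> Bop u"
  proof -
    \<comment> \<open>The -1 in \<open>u0\<close> cancels the raised exponent, which leaves \<Sum>_a
      m_ia + u_i. The first sum will cancel the constants from \<partial>_q q = 1 + q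
      \<partial>_q.\<close>
    let ?v = "of_int (\<Sum>k\<in>UNIV. d k $ i) + of_int (u $ i) :: complex"
    have v: "of_int ((u0 + axis i 1 + u) $ i) = ?v" by (simp add: u0_def)
    have "X.D i ?h = bs ((\<Sum>k\<in>UNIV. (\<lambda>q. ?c k * q $ k) * S.D k r) + (\<lambda>_. ?v) * r) (u0 + u)"
      unfolding D_bs[OF r] v by (simp add: algebra_simps)
    also have "\<dots> = bs ((\<Sum>k\<in>UNIV. (\<lambda>_. ?c k) * (qc k * S.D k r)) + (\<lambda>_. ?v) * r) (u0 + u)"
      by (rule bs_cong) (simp add: pointwise_simps sum_fun_apply zero_outside_apply mult_ac)
    finally have "psi0 (X.D i ?h) \<doteq> Mq ((\<Sum>k\<in>UNIV. (\<lambda>_. ?c k) * (qc k * S.D k r)) + (\<lambda>_. ?v) * r) \<cdot> Bop u"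
      by (simp only:) (intro psi0_bs regular_fun_add regular_fun_sum const_mult_regular qr' r bs(2))
    moreover have "Cn ?v = ?C + ?N" by (simp only: U.M_add_const Cn_sum)
    ultimately show ?thesis by (simp only: Mq_add Mq_sum Mq_const_mult[OF qr'] Mq_const_mult[OF r])
  qed
  have D: "Dq k \<cdot> (Cn (?c k) \<cdot> Mq (qc k * r)) =
      Cn (?c k) \<cdot> Mq r + Cn (?c k) \<cdot> Mq (qc k * S.D k r) + Cn (?c k) \<cdot> (Mq r \<cdot> \<theta> k)" for k
  proof -
    have "S.D k (qc k * r) = r + qc k * S.D k r"
      using one_S_mult(1)[OF r] by (simp add: partial_op_mult[OF open_S2 regular_coord r] partial_op_coord[OF open_S2])
    then have "Dq k \<cdot> Mq (qc k * r) = Mq r + Mq (qc k * S.D k r) + Mq (qc k * r) \<cdot> Dq k"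
      by (simp only: Dq_Mq[OF qr] Mq_add)
    moreover have "Mq (qc k * r) \<cdot> Dq k = Mq r \<cdot> \<theta> k"
      by (simp only: \<theta>_Mq o_assoc Mq_comp[OF r regular_coord] mult.commute)
    moreover have "Dq k \<cdot> (Cn (?c k) \<cdot> Mq (qc k * r)) = Cn (?c k) \<cdot> (Dq k \<cdot> Mq (qc k * r))"
      by (simp only: o_assoc U.const_central[OF diff_op.partial])
    ultimately show ?thesis by (simp add: U.comp_plus_right cl)
  qed
  have Mr: "Mq r \<cdot> (Eu i - ?N) = (\<Sum>k\<in>UNIV. Cn (?c k) \<cdot> (Mq r \<cdot> \<theta> k)) - ?N \<cdot> Mq r"
  proof -
    have "Mq r \<cdot> Eu i = (\<Sum>k\<in>UNIV. Mq r \<cdot> (Cn (?c k) \<cdot> \<theta> k))"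
      unfolding Eu_def by (rule U.comp_sum_right) (intro cl)+
    then have "Mq r \<cdot> Eu i = (\<Sum>k\<in>UNIV. Cn (?c k) \<cdot> (Mq r \<cdot> \<theta> k))"
      by (simp only: o_assoc U.const_central[OF Mq_closed[OF r]])
    then show ?thesis by (simp add: U.comp_diff_right cl U.const_central)
  qed
  have "?E ?h \<doteq> (Mq r \<cdot> (Eu i - ?N)) \<cdot> Bop u
      - (\<Sum>k\<in>UNIV. Dq k \<cdot> ((Cn (?c k) \<cdot> Mq (qc k * r)) \<cdot> Bop u))
      + ((\<Sum>k\<in>UNIV. Cn (?c k) \<cdot> Mq (qc k * S.D k r)) + (?C + ?N) \<cdot> Mq r) \<cdot> Bop u"
    by (intro equ_add equ_diff equ_sum equ_comp diff_op.partial 1 2 3)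
  also have "\<dots> = (Mq r \<cdot> (Eu i - ?N) - (\<Sum>k\<in>UNIV. Dq k \<cdot> (Cn (?c k) \<cdot> Mq (qc k * r)))
      + ((\<Sum>k\<in>UNIV. Cn (?c k) \<cdot> Mq (qc k * S.D k r)) + (?C + ?N) \<cdot> Mq r)) \<cdot> Bop u"
    by (simp only: comp_plus_left comp_diff_left comp_sum_left o_assoc)
  also have "Mq r \<cdot> (Eu i - ?N) - (\<Sum>k\<in>UNIV. Dq k \<cdot> (Cn (?c k) \<cdot> Mq (qc k * r)))
      + ((\<Sum>k\<in>UNIV. Cn (?c k) \<cdot> Mq (qc k * S.D k r)) + (?C + ?N) \<cdot> Mq r) = 0"
    unfolding D Mr by (simp add: sum.distrib comp_plus_left comp_sum_left)
  finally show ?case by (simp only: comp_zero_left)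
next
  case (add f h)
  note cl = diff_op.partial psi0_closed U_closed regular_fun_mult fco_regular partial_op_regular[OF X.open_X]
  have "?E (f + h) = ?E f + ?E h"
    using add(1,2)
    by (simp add: distrib_right psi0_add cl U.comp_plus_right partial_op_add[OF X.open_X] sum.distrib)
  then show ?case using equ_add[OF add(3,4)] by simp
qed

end

section \<open>The inverse map on the transfer module\<close>

context regular_map
begin

text \<open>Normal forms are built by appending derivatives on the right, the side on which the
  operators of the target act.\<close>

lemma transfer_partial_induct [consumes 1, case_names pull partial add]:
  assumes T: "T \<in> transfer_op X Y F"
    and pull: "\<And>\<phi>. \<phi> \<in> regular_fun X \<Longrightarrow> C (pull F \<phi> Y.I)"
    and partial: "\<And>T j. T \<in> transfer_op X Y F \<Longrightarrow> C T \<Longrightarrow> C (T \<cdot> Y.D j)"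
    and add: "\<And>S T. S \<in> transfer_op X Y F \<Longrightarrow> T \<in> transfer_op X Y F \<Longrightarrow> C S \<Longrightarrow> C T \<Longrightarrow> C (S + T)"
  shows "C T"
  using T
proof (induction rule: transfer_span_induct)
  case (pull \<phi> \<beta>)
  show ?case
  proof (induction \<beta>)
    case empty
    show ?case using assms(2)[OF pull] by simp
  next
    case (add j \<beta>)
    show ?case
      using partial[OF transfer_pull[OF pull Y.dpow_diff_op] add, of j]
      by (simp only: Y.dpow_add_mset_right pull_comp)
  qed
qed (rule add)

lemma transfer_zero: "0 \<in> transfer_op X Y F"
  using transfer_pull[OF regular_fun_0 one_diff_op] by (simp only: pull_zero_left)

lemma transfer_uminus: "T \<in> transfer_op X Y F \<Longrightarrow> - T \<in> transfer_op X Y F"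
proof (induction rule: transfer_span_induct)
  case (pull \<phi> \<beta>)
  then show ?case unfolding pull_uminus_left[symmetric] by (intro transfer_pull regular_fun_uminus Y.dpow_diff_op)
next
  case (add S T)
  then show ?case using transfer_plus[of "- S" "- T"] by simp
qed

lemma transfer_comp_uminus:
  assumes "T \<in> transfer_op X Y F" "Q \<in> diff_op Y" shows "T \<cdot> (- Q) = - (T \<cdot> Q)"
proof -
  have "T \<cdot> 0 = 0" by (rule ext) (simp add: transfer_fun_0[OF assms(1)] pointwise_simps)
  then have "T \<cdot> (- Q) + T \<cdot> Q = 0"
    using transfer_comp_plus_right[OF assms(1) Y.diff_op_uminus[OF assms(2)] assms(2)] by (metis left_minus)
  then show ?thesis by (simp add: eq_neg_iff_add_eq_0)
qed

end

lemma sum_option: "(\<Sum>j\<in>UNIV. f j) = f None + (\<Sum>k\<in>UNIV. f (Some k))"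
  for f :: "'k::finite option \<Rightarrow> 'c::comm_monoid_add"
  by (simp add: UNIV_option_conv sum.reindex o_def)

context lg_model
begin

abbreviation "Tr \<equiv> transfer_op S1 Y (LG_map d)"
abbreviation "pl \<equiv> pull (LG_map d)"

text \<open>The operators by which \<open>\<partial>\<^sub>t\<close> and \<open>\<partial>\<^sub>q\<^sub>a\<close>, acting from the right on the transfer module, act on
  the left after taking adjoints and the Fourier--Laplace transformation.\<close>

definition Eo :: "'r option \<Rightarrow> ('r option, 'r option) operator" where
  "Eo j = (case j of None \<Rightarrow> \<tau> | Some k \<Rightarrow> - Dq k)"

lemma Eo_simps: "Eo None = \<tau>" "Eo (Some k) = - Dq k"
  by (simp_all add: Eo_def)

lemma Eo_closed: "Eo j \<in> diff_op V"
  by (cases j) (simp_all add: Eo_simps U_closed)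

lemma Eo_commute: "Eo i \<cdot> Eo j = Eo j \<cdot> Eo i"
  by (cases i; cases j) (simp_all add: Eo_simps U.comp_uminus_right comp_uminus_left U_closed Dq_\<tau> U.D_D)

definition Ep :: "'r option multiset \<Rightarrow> ('r option, 'r option) operator" where
  "Ep \<beta> = fold_mset (\<lambda>j P. Eo j \<cdot> P) U.I \<beta>"

lemma Ep_empty: "Ep {#} = U.I"
  by (simp add: Ep_def)

lemma Ep_add_mset: "Ep (add_mset j \<beta>) = Eo j \<cdot> Ep \<beta>"
proof -
  interpret comp_fun_commute "\<lambda>j (P :: ('r option, 'r option) operator). Eo j \<cdot> P"
  proof
    fix i j
    have "Eo i \<cdot> (Eo j \<cdot> P) = Eo j \<cdot> (Eo i \<cdot> P)" for P :: "('r option, 'r option) operator"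
      by (metis Eo_commute comp_assoc)
    then show "(\<lambda>P. Eo j \<cdot> P) \<cdot> (\<lambda>P. Eo i \<cdot> P) = (\<lambda>P. Eo i \<cdot> P) \<cdot> (\<lambda>P :: ('r option, 'r option) operator. Eo j \<cdot> P)"
      by (auto simp: fun_eq_iff o_apply)
  qed
  show ?thesis by (simp add: Ep_def)
qed

lemma Ep_closed: "Ep \<beta> \<in> diff_op V"
  by (induction \<beta>) (auto simp: Ep_empty Ep_add_mset intro: U_closed Eo_closed)

lemma Ep_add_mset_right: "Ep (add_mset j \<beta>) = Ep \<beta> \<cdot> Eo j"
proof -
  have "Eo j \<cdot> Ep \<beta> = Ep \<beta> \<cdot> Eo j"
    by (induction \<beta>) (simp_all add: Ep_empty Ep_add_mset Eo_closed U.commute_comp Eo_commute)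
  then show ?thesis by (simp add: Ep_add_mset)
qed

text \<open>The candidate for the inverse: \<phi> \<partial>^\<beta> \<otimes> h goes to
  \<open>Ep \<beta> \<cdot> psi0 (\<phi> * h)\<close>. It exists because the transfer module is free
  on the \<partial>^\<beta>; the tensor relations over the operators on S_1 are then respected
  modulo the ideal.\<close>

definition Lam :: "(complex ^ 'm \<Rightarrow> complex) \<Rightarrow> ('r option, 'm) operator \<Rightarrow> ('r option, 'r option) operator" where
  "Lam h = (SOME L. (\<forall>S\<in>Tr. \<forall>T\<in>Tr. L (S + T) = L S + L T) \<and>
     (\<forall>\<beta>. \<forall>\<phi>\<in>regular_fun S1. L (pl \<phi> (Y.dpow \<beta>)) = Ep \<beta> \<cdot> psi0 (\<phi> * h)))"

context
  fixes h :: "complex ^ 'm \<Rightarrow> complex"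
  assumes h: "h \<in> regular_fun S1"
begin

lemma Lam_add: "S \<in> Tr \<Longrightarrow> T \<in> Tr \<Longrightarrow> Lam h (S + T) = Lam h S + Lam h T"
  and Lam_dpow: "\<phi> \<in> regular_fun S1 \<Longrightarrow> Lam h (pl \<phi> (Y.dpow \<beta>)) = Ep \<beta> \<cdot> psi0 (\<phi> * h)"
proof -
  have G: "Ep \<beta> \<cdot> psi0 ((\<phi> + \<psi>) * h) = Ep \<beta> \<cdot> psi0 (\<phi> * h) + Ep \<beta> \<cdot> psi0 (\<psi> * h)"
    if "\<phi> \<in> regular_fun S1" "\<psi> \<in> regular_fun S1" for \<beta> \<phi> \<psi>
    using that h by (simp add: distrib_right psi0_add regular_fun_mult U.comp_plus_right Ep_closed psi0_closed)
  have "\<exists>L. (\<forall>S\<in>Tr. \<forall>T\<in>Tr. L (S + T) = L S + L T) \<and>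
     (\<forall>\<beta>. \<forall>\<phi>\<in>regular_fun S1. L (pl \<phi> (Y.dpow \<beta>)) = Ep \<beta> \<cdot> psi0 (\<phi> * h))"
    by (rule F.transfer_extend[of "\<lambda>\<beta> \<phi>. Ep \<beta> \<cdot> psi0 (\<phi> * h)", OF G]) (assumption | blast)+
  from someI_ex[OF this, folded Lam_def]
  show "S \<in> Tr \<Longrightarrow> T \<in> Tr \<Longrightarrow> Lam h (S + T) = Lam h S + Lam h T"
    "\<phi> \<in> regular_fun S1 \<Longrightarrow> Lam h (pl \<phi> (Y.dpow \<beta>)) = Ep \<beta> \<cdot> psi0 (\<phi> * h)" by blast+
qed

lemma Lam_pull: "\<phi> \<in> regular_fun S1 \<Longrightarrow> Lam h (pl \<phi> Y.I) = psi0 (\<phi> * h)"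
  using Lam_dpow[of \<phi> "{#}"] h by (simp add: Ep_empty psi0_closed regular_fun_mult)

lemma Lam_zero: "Lam h 0 = 0"
  using Lam_add[OF F.transfer_zero F.transfer_zero] by simp

lemma Lam_uminus: "T \<in> Tr \<Longrightarrow> Lam h (- T) = - Lam h T"
  using Lam_add[OF F.transfer_uminus, of T T] by (simp add: Lam_zero eq_neg_iff_add_eq_0)

lemma Lam_sum: "(\<And>i. i \<in> I \<Longrightarrow> T i \<in> Tr) \<Longrightarrow> Lam h (sum T I) = (\<Sum>i\<in>I. Lam h (T i))"
  by (induction I rule: infinite_finite_induct) (simp_all add: Lam_zero Lam_add F.transfer_sum)

lemma Lam_closed: "T \<in> Tr \<Longrightarrow> Lam h T \<in> diff_op V"
  by (induction rule: F.transfer_span_induct)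
     (auto simp: Lam_dpow Lam_add h intro!: U_closed Ep_closed psi0_closed regular_fun_mult)

lemma Lam_partial: "T \<in> Tr \<Longrightarrow> Lam h (T \<cdot> Y.D j) = Eo j \<cdot> Lam h T"
proof (induction rule: F.transfer_span_induct)
  case (pull \<phi> \<beta>)
  then show ?case
    by (simp only: pull_comp Y.dpow_add_mset_right[symmetric] Lam_dpow Ep_add_mset o_assoc)
next
  case (add S T)
  have "Lam h (S \<cdot> Y.D j + T \<cdot> Y.D j) = Lam h (S \<cdot> Y.D j) + Lam h (T \<cdot> Y.D j)"
    by (intro Lam_add F.transfer_comp_right add diff_op.partial)
  then show ?case
    by (simp only: comp_plus_left add Lam_add[OF add(1,2)] U.comp_plus_right[OF Eo_closed Lam_closed[OF add(1)] Lam_closed[OF add(2)]])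
qed

end

lemma Lam_add_left:
  assumes f: "f \<in> regular_fun S1" and h: "h \<in> regular_fun S1" and T: "T \<in> Tr"
  shows "Lam (f + h) T = Lam f T + Lam h T"
  using T
proof (induction rule: F.transfer_span_induct)
  case (pull \<phi> \<beta>)
  then show ?case using f h
    by (simp add: Lam_dpow regular_fun_add distrib_left psi0_add regular_fun_mult U.comp_plus_right Ep_closed psi0_closed)
next
  case (add S T)
  then show ?case using f h by (simp add: Lam_add regular_fun_add)
qed

lemma Lam_M:
  assumes f: "f \<in> regular_fun S1" and h: "h \<in> regular_fun S1" and T: "T \<in> Tr"
  shows "Lam h (X.M f \<cdot> T) = Lam (f * h) T"
  using T
proof (induction rule: F.transfer_span_induct)
  case (pull \<phi> \<beta>)
  then show ?case
    by (simp add: F.M_pull Y.dpow_diff_op Lam_dpow h f regular_fun_mult mult_ac)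
next
  case (add S T)
  have M: "X.M f \<in> diff_op S1" using f by (rule diff_op.mult)
  have "Lam h (X.M f \<cdot> S + X.M f \<cdot> T) = Lam h (X.M f \<cdot> S) + Lam h (X.M f \<cdot> T)"
    by (intro Lam_add h F.transfer_comp_left M add)
  then show ?case
    by (simp only: F.comp_transfer_plus[OF M add(1,2)] add Lam_add[OF regular_fun_mult[OF f h] add(1,2)])
qed

text \<open>After the chain rule and the product rule this is \<open>psi0_D\<close> for \<phi> h,
  composed with \<open>Ep \<beta>\<close> from the left.\<close>

lemma Lam_D:
  assumes h: "h \<in> regular_fun S1" and T: "T \<in> Tr"
  shows "Lam h (X.D i \<cdot> T) \<doteq> - Lam (X.D i h) T"
  using T
proof (induction rule: F.transfer_span_induct)
  case (pull \<phi> \<beta>)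
  let ?g = "\<phi> * h"
  have Dh: "X.D i h \<in> regular_fun S1" and D\<phi>: "X.D i \<phi> \<in> regular_fun S1" and Df: "X.D i (fco j) \<in> regular_fun S1" for j
    by (intro partial_op_regular[OF X.open_X] h pull fco_regular)+
  note cl = U_closed Ep_closed Eo_closed psi0_closed regular_fun_mult h pull Dh D\<phi> Df
  have "X.D i \<cdot> pl \<phi> (Y.dpow \<beta>) = pl (X.D i \<phi>) (Y.dpow \<beta>) + (\<Sum>j\<in>UNIV. pl (\<phi> * X.D i (fco j)) (Y.dpow (add_mset j \<beta>)))"
    by (simp only: F.D_pull[OF pull Y.dpow_diff_op] fco_def Y.dpow_add_mset)
  then have "Lam h (X.D i \<cdot> pl \<phi> (Y.dpow \<beta>)) =
      Lam h (pl (X.D i \<phi>) (Y.dpow \<beta>)) + (\<Sum>j\<in>UNIV. Lam h (pl (\<phi> * X.D i (fco j)) (Y.dpow (add_mset j \<beta>))))"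
    by (simp add: Lam_add Lam_sum F.transfer_sum F.transfer_pull Y.dpow_diff_op cl)
  also have "\<dots> = Ep \<beta> \<cdot> psi0 (X.D i \<phi> * h) + (\<Sum>j\<in>UNIV. Ep \<beta> \<cdot> (Eo j \<cdot> psi0 (\<phi> * X.D i (fco j) * h)))"
    by (simp add: Lam_dpow cl Ep_add_mset_right o_assoc)
  also have "\<dots> = Ep \<beta> \<cdot> (psi0 (X.D i \<phi> * h) + (\<Sum>j\<in>UNIV. Eo j \<cdot> psi0 (\<phi> * X.D i (fco j) * h)))"
    by (simp add: U.comp_plus_right U.comp_sum_right cl)
  also have "\<dots> \<doteq> Ep \<beta> \<cdot> (- psi0 (\<phi> * X.D i h))"
  proof (rule equ_comp[OF Ep_closed])
    let ?K = "\<Sum>k\<in>UNIV. Dq k \<cdot> psi0 (?g * X.D i (fco (Some k)))"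
    have "bs one_S 0 * h = h"
      by (rule ext) (simp add: bs_def zero_outside_def pointwise_simps regular_fun_outside[OF h] qq_S2)
    then have None: "Eo None \<cdot> psi0 (\<phi> * X.D i (fco None) * h) = \<tau> \<cdot> psi0 ?g"
      by (simp add: Eo_simps D_fco_None mult.assoc)
    have Some: "Eo (Some k) \<cdot> psi0 (\<phi> * X.D i (fco (Some k)) * h) = - (Dq k \<cdot> psi0 (?g * X.D i (fco (Some k))))" for k
      by (simp add: Eo_simps comp_uminus_left mult_ac)
    have "(\<Sum>j\<in>UNIV. Eo j \<cdot> psi0 (\<phi> * X.D i (fco j) * h)) = \<tau> \<cdot> psi0 ?g - ?K"
      by (simp only: sum_option None Some sum_negf) simp
    moreover have "psi0 (X.D i ?g) = psi0 (X.D i \<phi> * h) + psi0 (\<phi> * X.D i h)"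
      by (simp add: partial_op_mult[OF X.open_X pull h] psi0_add cl)
    ultimately have "psi0 (X.D i \<phi> * h) + (\<Sum>j\<in>UNIV. Eo j \<cdot> psi0 (\<phi> * X.D i (fco j) * h)) - (- psi0 (\<phi> * X.D i h)) =
        \<tau> \<cdot> psi0 ?g - ?K + psi0 (X.D i ?g)" by simp
    then show "psi0 (X.D i \<phi> * h) + (\<Sum>j\<in>UNIV. Eo j \<cdot> psi0 (\<phi> * X.D i (fco j) * h)) \<doteq> - psi0 (\<phi> * X.D i h)"
      using psi0_D[OF regular_fun_mult[OF pull h], of i] by (simp add: equ_def equ_0_iff cl)
  qed
  also have "\<dots> = - Lam (X.D i h) (pl \<phi> (Y.dpow \<beta>))"
    by (simp add: Lam_dpow cl U.comp_uminus_right)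
  finally show ?case .
next
  case (add S T)
  have Dh: "X.D i h \<in> regular_fun S1" by (rule partial_op_regular[OF X.open_X h])
  have "X.D i \<cdot> (S + T) = X.D i \<cdot> S + X.D i \<cdot> T" by (rule F.comp_transfer_plus[OF diff_op.partial add(1,2)])
  moreover have "Lam h (X.D i \<cdot> S + X.D i \<cdot> T) = Lam h (X.D i \<cdot> S) + Lam h (X.D i \<cdot> T)"
    by (intro Lam_add h F.transfer_comp_left diff_op.partial add)
  ultimately show ?case using equ_add[OF add(3,4)] by (simp add: Lam_add[OF Dh add(1,2)])
qed

text \<open>The balancing relation over the operators on S_1, by which \<open>Lam\<close> descends
  to the direct image modulo the ideal.\<close>

lemma Lam_adjoint:
  assumes P: "P \<in> diff_op S1" and h: "h \<in> regular_fun S1" and T: "T \<in> Tr"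
  shows "Lam h (adjoint_op S1 P \<cdot> T) \<doteq> Lam (P h) T"
  using P h T
proof (induction arbitrary: h T rule: diff_op_induct)
  case (mult f)
  then show ?case
    by (simp add: X.adjoint_M regular_fun_rational_at Lam_M mult_op_apply equ_refl Lam_closed regular_fun_mult)
next
  case (partial i)
  have "X.D i \<cdot> T \<in> Tr" by (intro F.transfer_comp_left diff_op.partial partial)
  then have "Lam h (adjoint_op S1 (X.D i) \<cdot> T) = - Lam h (X.D i \<cdot> T)"
    by (simp add: X.adjoint_D comp_uminus_left Lam_uminus partial)
  then show ?case using equ_uminus[OF Lam_D[OF partial, of i]] by simp
next
  case (add P Q)
  note adj = X.adjoint_closed[OF add(1)] X.adjoint_closed[OF add(2)]
  have "Lam h (adjoint_op S1 (P + Q) \<cdot> T) = Lam h (adjoint_op S1 P \<cdot> T) + Lam h (adjoint_op S1 Q \<cdot> T)"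
    unfolding X.adjoint_add[OF add(1,2)] comp_plus_left by (intro Lam_add F.transfer_comp_left adj add(5,6))
  also have "\<dots> \<doteq> Lam (P h) T + Lam (Q h) T" by (intro equ_add add(3,4) add(5,6))
  also have "\<dots> = Lam ((P + Q) h) T"
    using Lam_add_left[OF X.diff_op_regular[OF add(1,5)] X.diff_op_regular[OF add(2,5)] add(6)] by (simp add: plus_fun_apply)
  finally show ?case .
next
  case (comp P Q)
  note adj = X.adjoint_closed[OF comp(1)] X.adjoint_closed[OF comp(2)]
  have "Lam h (adjoint_op S1 (P \<cdot> Q) \<cdot> T) = Lam h (adjoint_op S1 Q \<cdot> (adjoint_op S1 P \<cdot> T))"
    by (simp only: X.adjoint_comp[OF comp(1,2)] o_assoc)
  also have "\<dots> \<doteq> Lam (Q h) (adjoint_op S1 P \<cdot> T)"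
    by (intro comp(4) comp(5) F.transfer_comp_left adj comp(6))
  also have "\<dots> \<doteq> Lam (P (Q h)) T" by (intro comp(3) X.diff_op_regular[OF comp(2,5)] comp(6))
  also have "\<dots> = Lam ((P \<cdot> Q) h) T" by (simp only: o_apply)
  finally show ?case .
qed

section \<open>Linearity of the inverse map over the base\<close>

lemma pull_lift:
  assumes \<phi>: "\<phi> \<in> regular_fun S1" and r: "r \<in> regular_fun S2"
  shows "pl \<phi> Y.I \<cdot> Y.M (lift r) = pl (bs r 0 * \<phi>) Y.I"
proof -
  have "Y.M (lift r) \<in> diff_op Y" by (intro diff_op.mult lift_regular r)
  then have "pl \<phi> Y.I \<cdot> Y.M (lift r) = pl \<phi> (Y.M (lift r) \<cdot> Y.I)" by (simp add: pull_comp)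
  moreover have "(\<lambda>x. \<phi> x * lift r (LG_map d x)) = bs r 0 * \<phi>"
    by (rule ext) (simp add: pointwise_simps bs_def zero_outside_def lift_def base_LG_map regular_fun_outside[OF \<phi>])
  ultimately show ?thesis by (simp only: F.pull_M[OF one_diff_op])
qed

lemma pull_t:
  assumes \<phi>: "\<phi> \<in> regular_fun S1"
  shows "pl \<phi> Y.I \<cdot> Y.M (\<lambda>y. y $ None) = pl (fco None * \<phi>) Y.I"
proof -
  have "pl \<phi> Y.I \<cdot> Y.M (\<lambda>y. y $ None) = pl \<phi> (Y.M (\<lambda>y. y $ None) \<cdot> Y.I)"
    by (simp add: pull_comp M_t_diff_op)
  moreover have "(\<lambda>x. \<phi> x * LG_map d x $ None) = fco None * \<phi>"
    by (rule ext) (simp add: pointwise_simps fco_def zero_outside_def regular_fun_outside[OF \<phi>])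
  ultimately show ?thesis by (simp only: F.pull_M[OF one_diff_op])
qed

text \<open>The generators act on the transformed direct image by composition on the right with
  these operators.\<close>

lemma adjoint_FL:
  "adjoint_op Y (FL_hom S2 (Y.M (\<lambda>y. y $ None))) = Y.D None"
  "r \<in> regular_fun S2 \<Longrightarrow> adjoint_op Y (FL_hom S2 (Y.M (lift r))) = Y.M (lift r)"
  "adjoint_op Y (FL_hom S2 (Y.D None)) = Y.M (\<lambda>y. y $ None)"
  "adjoint_op Y (FL_hom S2 (Y.D (Some k))) = - Y.D (Some k)"
  by (simp_all add: FL_t FL_lift FL_D_None FL_D_Some Y.adjoint_uminus diff_op.partial Y.adjoint_D Y.adjoint_M
      lift_rational rational_at_coord)

lemma restrict_generators:
  "restrict_op Y V (Y.M (\<lambda>y. y $ None)) = \<tau>" "r \<in> regular_fun S2 \<Longrightarrow> restrict_op Y V (Y.M (lift r)) = Mq r"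
  "restrict_op Y V (Y.D None) = Dt" "restrict_op Y V (Y.D (Some k)) = Dq k"
  by (rule UY.restrict_M, rule rational_at_coord) (simp_all add: UY.restrict_M UY.restrict_D lift_rational)

text \<open>A function of q is moved past the derivatives of the transfer operator; each commutator
  with \<partial>_q on the right is matched by the same commutator on the left.\<close>

lemma Lam_lift:
  assumes h: "h \<in> regular_fun S1" and T: "T \<in> Tr" and r: "r \<in> regular_fun S2"
  shows "Lam h (T \<cdot> Y.M (lift r)) \<doteq> Mq r \<cdot> Lam h T"
  using T r
proof (induction arbitrary: r rule: F.transfer_partial_induct)
  case (pull \<phi>)
  have "Lam h (pl \<phi> Y.I \<cdot> Y.M (lift r)) = psi0 (bs r 0 * (\<phi> * h))"
    using Lam_pull[OF h regular_fun_mult[OF bs_regular pull(1)]] pull(2) by (simp add: pull_lift pull mult.assoc)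
  then show ?case using psi0_Mq[OF regular_fun_mult[OF pull(1) h] pull(2)] by (simp add: Lam_pull[OF h pull(1)])
next
  case (partial T j)
  note r = partial(3)
  have cl: "Y.M (lift r) \<in> diff_op Y" if "r \<in> regular_fun S2" for r by (intro diff_op.mult lift_regular that)
  have LT: "Lam h T \<in> diff_op V" by (rule Lam_closed[OF h partial(1)])
  have TM: "T \<cdot> Y.M (lift r) \<in> Tr" if "r \<in> regular_fun S2" for r by (rule F.transfer_comp_right[OF partial(1) cl[OF that]])
  have IH: "Lam h (T \<cdot> Y.M (lift r) \<cdot> Y.D j) \<doteq> Eo j \<cdot> (Mq r \<cdot> Lam h T)"
    unfolding Lam_partial[OF h TM[OF r]] by (rule equ_comp[OF Eo_closed partial(2)[OF r]])
  show ?case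
  proof (cases j)
    case None
    have "T \<cdot> Y.D j \<cdot> Y.M (lift r) = T \<cdot> Y.M (lift r) \<cdot> Y.D j"
      by (simp only: None comp_assoc D_None_lift[OF r])
    moreover have "Eo j \<cdot> (Mq r \<cdot> Lam h T) = Mq r \<cdot> Lam h (T \<cdot> Y.D j)"
      by (simp only: None Lam_partial[OF h partial(1)] Eo_simps o_assoc \<tau>_Mq[OF r])
    ultimately show ?thesis using IH by simp
  next
    case (Some k)
    have r': "S.D k r \<in> regular_fun S2" by (rule partial_op_regular[OF open_S2 r])
    have "Y.D j \<cdot> Y.M (lift r) = Y.M (lift (S.D k r)) + Y.M (lift r) \<cdot> Y.D j"
      using Y.D_M[OF lift_regular[OF r], of j] D_Some_mono[OF r, of k 0] by (simp add: mono_0 Some)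
    then have "T \<cdot> Y.D j \<cdot> Y.M (lift r) = T \<cdot> Y.M (lift (S.D k r)) + T \<cdot> Y.M (lift r) \<cdot> Y.D j"
      using F.transfer_comp_plus_right[OF partial(1) cl[OF r'] diff_op.comp[OF cl[OF r] diff_op.partial], of j]
      by (simp only: comp_assoc)
    moreover have "T \<cdot> Y.M (lift r) \<cdot> Y.D j \<in> Tr"
      by (intro F.transfer_comp_right TM r diff_op.partial)
    ultimately have "Lam h (T \<cdot> Y.D j \<cdot> Y.M (lift r)) = Lam h (T \<cdot> Y.M (lift (S.D k r))) + Lam h (T \<cdot> Y.M (lift r) \<cdot> Y.D j)"
      by (simp add: Lam_add[OF h TM[OF r']])
    also have "\<dots> \<doteq> Mq (S.D k r) \<cdot> Lam h T + Eo j \<cdot> (Mq r \<cdot> Lam h T)"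
      by (rule equ_add[OF partial(2)[OF r'] IH])
    also have "Eo j \<cdot> (Mq r \<cdot> Lam h T) = - (Dq k \<cdot> Mq r) \<cdot> Lam h T"
      by (simp only: Some Eo_simps comp_uminus_left o_assoc)
    also have "Mq (S.D k r) \<cdot> Lam h T + - (Dq k \<cdot> Mq r) \<cdot> Lam h T = - (Mq r \<cdot> (Dq k \<cdot> Lam h T))"
      by (simp add: Dq_Mq[OF r] comp_plus_left comp_uminus_left comp_diff_left comp_assoc)
    also have "\<dots> = Mq r \<cdot> Lam h (T \<cdot> Y.D j)"
      by (simp add: Some Lam_partial[OF h partial(1)] Eo_simps comp_uminus_left U.comp_uminus_right U_closed r LT)
    finally show ?thesis .
  qed
next
  case (add S T)
  have cl: "Y.M (lift r) \<in> diff_op Y" by (intro diff_op.mult lift_regular add)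
  have "Lam h (S \<cdot> Y.M (lift r) + T \<cdot> Y.M (lift r)) = Lam h (S \<cdot> Y.M (lift r)) + Lam h (T \<cdot> Y.M (lift r))"
    by (intro Lam_add h F.transfer_comp_right cl add)
  then show ?case using equ_add[OF add(3)[OF add(5)] add(4)[OF add(5)]]
    by (simp add: comp_plus_left Lam_add[OF h add(1,2)] U.comp_plus_right Mq_closed add(5) Lam_closed[OF h add(1)] Lam_closed[OF h add(2)])
qed

text \<open>Without derivatives this is \<open>psi0_W\<close>. The commutator of \<partial>_t with t
  on the right is matched by the one of \<partial>_\<tau> with \<tau> on the left.\<close>

lemma Lam_t:
  assumes h: "h \<in> regular_fun S1" and T: "T \<in> Tr"
  shows "Lam h (T \<cdot> Y.M (\<lambda>y. y $ None)) \<doteq> Dt \<cdot> Lam h T"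
  using T
proof (induction rule: F.transfer_partial_induct)
  case (pull \<phi>)
  have "Lam h (pl \<phi> Y.I \<cdot> Y.M (\<lambda>y. y $ None)) = psi0 (fco None * (\<phi> * h))"
    using Lam_pull[OF h regular_fun_mult[OF fco_regular pull(1)]] by (simp add: pull_t pull mult.assoc)
  then show ?case using psi0_W[OF regular_fun_mult[OF pull(1) h]] by (simp add: Lam_pull[OF h pull(1)])
next
  case (partial T j)
  let ?t = "Y.M (\<lambda>y. y $ None)"
  have LT: "Lam h T \<in> diff_op V" by (rule Lam_closed[OF h partial(1)])
  have Tt: "T \<cdot> ?t \<in> Tr" by (rule F.transfer_comp_right[OF partial(1) M_t_diff_op])
  have IH: "Lam h (T \<cdot> ?t \<cdot> Y.D j) \<doteq> Eo j \<cdot> (Dt \<cdot> Lam h T)"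
    unfolding Lam_partial[OF h Tt] by (rule equ_comp[OF Eo_closed partial(2)])
  show ?case
  proof (cases j)
    case None
    have "T \<cdot> Y.D j \<cdot> ?t = T + T \<cdot> ?t \<cdot> Y.D j"
      using F.transfer_comp_plus_right[OF partial(1) one_diff_op diff_op.comp[OF M_t_diff_op diff_op.partial]]
      by (simp only: None comp_assoc D_None_t F.transfer_comp_I[OF partial(1)])
    moreover have "T \<cdot> ?t \<cdot> Y.D j \<in> Tr" by (intro F.transfer_comp_right Tt diff_op.partial)
    ultimately have "Lam h (T \<cdot> Y.D j \<cdot> ?t) = Lam h T + Lam h (T \<cdot> ?t \<cdot> Y.D j)"
      by (simp add: Lam_add[OF h partial(1)])
    also have "\<dots> \<doteq> Lam h T + Eo j \<cdot> (Dt \<cdot> Lam h T)" by (rule equ_add[OF equ_refl[OF LT] IH])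
    also have "\<dots> = (U.I + \<tau> \<cdot> Dt) \<cdot> Lam h T" by (simp add: None Eo_simps comp_plus_left comp_assoc LT)
    also have "\<dots> = Dt \<cdot> Lam h (T \<cdot> Y.D j)"
      by (simp only: Dt_\<tau>[symmetric] None Lam_partial[OF h partial(1)] Eo_simps o_assoc)
    finally show ?thesis .
  next
    case (Some k)
    have "Y.D (Some k) \<cdot> Y.M (zero_outside Y (\<lambda>y. y $ None)) =
        Y.M (zero_outside Y (\<lambda>_. 0)) + Y.M (zero_outside Y (\<lambda>y. y $ None)) \<cdot> Y.D (Some k)"
      using Y.D_M[OF regular_coord, of "Some k" None] by (simp add: partial_op_coord[OF Y.open_X])
    then have "Y.D j \<cdot> ?t = ?t \<cdot> Y.D j"
      using mult_op_0[of Y] by (simp add: Some mult_op_zero_outside zero_fun_def)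
    then have "T \<cdot> Y.D j \<cdot> ?t = T \<cdot> ?t \<cdot> Y.D j" by (simp only: comp_assoc)
    moreover have "Eo j \<cdot> (Dt \<cdot> Lam h T) = Dt \<cdot> Lam h (T \<cdot> Y.D j)"
      by (simp add: Some Lam_partial[OF h partial(1)] Eo_simps comp_uminus_left U.comp_uminus_right U_closed LT)
         (simp only: o_assoc U.D_D)
    ultimately show ?thesis using IH by simp
  qed
next
  case (add S T)
  have "Lam h (S \<cdot> Y.M (\<lambda>y. y $ None) + T \<cdot> Y.M (\<lambda>y. y $ None)) = Lam h (S \<cdot> Y.M (\<lambda>y. y $ None)) + Lam h (T \<cdot> Y.M (\<lambda>y. y $ None))"
    by (intro Lam_add h F.transfer_comp_right M_t_diff_op add)
  then show ?case using equ_add[OF add(3,4)]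
    by (simp add: comp_plus_left Lam_add[OF h add(1,2)] U.comp_plus_right diff_op.partial Lam_closed[OF h add(1)] Lam_closed[OF h add(2)])
qed

text \<open>Both sides are compatible with sums and products of operators, so only the four kinds of
  generators have to be treated. This linearity will balance the tensor product of the
  localization.\<close>

lemma Lam_FL:
  assumes P: "P \<in> diff_op Y" and h: "h \<in> regular_fun S1" and T: "T \<in> Tr"
  shows "Lam h (T \<cdot> adjoint_op Y (FL_hom S2 P)) \<doteq> restrict_op Y V P \<cdot> Lam h T"
  using P T
proof (induction arbitrary: T rule: line_diff_op_induct)
  case t
  show ?case
    by (simp add: adjoint_FL restrict_generators Lam_partial[OF h t] Eo_simps equ_refl U_closed Lam_closed[OF h t])
next
  case (lift r)
  show ?case using Lam_lift[OF h lift(2,1)] by (simp add: adjoint_FL restrict_generators lift(1))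
next
  case D_None
  show ?case using Lam_t[OF h D_None] by (simp add: adjoint_FL restrict_generators)
next
  case (D_Some k)
  have "T \<cdot> Y.D (Some k) \<in> Tr" by (intro F.transfer_comp_right D_Some diff_op.partial)
  then show ?case
    by (simp add: adjoint_FL restrict_generators F.transfer_comp_uminus[OF D_Some] diff_op.partial Lam_uminus[OF h]
        Lam_partial[OF h D_Some] Eo_simps comp_uminus_left equ_refl U_closed Lam_closed[OF h D_Some])
next
  case (add P Q)
  let ?a = "\<lambda>P. adjoint_op Y (FL_hom S2 P)"
  have a: "?a P \<in> diff_op Y" "?a Q \<in> diff_op Y" by (intro Y.adjoint_closed FL_closed add)+
  have "?a (P + Q) = ?a P + ?a Q" by (simp add: FL_add add(1,2) Y.adjoint_add FL_closed)
  then have "T \<cdot> ?a (P + Q) = T \<cdot> ?a P + T \<cdot> ?a Q" by (simp add: F.transfer_comp_plus_right[OF add(5) a])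
  then have "Lam h (T \<cdot> ?a (P + Q)) = Lam h (T \<cdot> ?a P) + Lam h (T \<cdot> ?a Q)"
    using Lam_add[OF h F.transfer_comp_right[OF add(5) a(1)] F.transfer_comp_right[OF add(5) a(2)]] by simp
  also have "\<dots> \<doteq> restrict_op Y V P \<cdot> Lam h T + restrict_op Y V Q \<cdot> Lam h T" by (intro equ_add add(3,4) add(5))
  finally show ?case by (simp add: UY.restrict_add[OF add(1,2)] comp_plus_left)
next
  case (comp P Q)
  let ?a = "\<lambda>P. adjoint_op Y (FL_hom S2 P)"
  have a: "?a P \<in> diff_op Y" "?a Q \<in> diff_op Y" by (intro Y.adjoint_closed FL_closed comp)+
  have "?a (P \<cdot> Q) = ?a Q \<cdot> ?a P" by (simp only: FL_comp[OF comp(1,2)] Y.adjoint_comp[OF FL_closed[OF comp(1)] FL_closed[OF comp(2)]])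
  then have "Lam h (T \<cdot> ?a (P \<cdot> Q)) = Lam h ((T \<cdot> ?a Q) \<cdot> ?a P)" by (simp only: o_assoc)
  also have "\<dots> \<doteq> restrict_op Y V P \<cdot> Lam h (T \<cdot> ?a Q)" by (intro comp(3) F.transfer_comp_right comp(5) a)
  also have "\<dots> \<doteq> restrict_op Y V P \<cdot> (restrict_op Y V Q \<cdot> Lam h T)"
    by (intro equ_comp UY.restrict_closed comp(1) comp(4) comp(5))
  finally show ?case by (simp only: UY.restrict_comp[OF comp(1,2)] o_assoc)
qed

end

section \<open>The cyclic generator\<close>

lemma abelian_group_funI:
  fixes M :: "('a::ab_group_add, 'm) ring_scheme"
  assumes "\<And>x y. x \<oplus>\<^bsub>M\<^esub> y = x + y" "\<zero>\<^bsub>M\<^esub> = 0" "additive_set (carrier M)"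
  shows "abelian_group M"
proof (rule abelian_groupI)
  show "\<exists>y\<in>carrier M. y \<oplus>\<^bsub>M\<^esub> x = \<zero>\<^bsub>M\<^esub>" if "x \<in> carrier M" for x
    using that additive_setD(3)[OF assms(3)] by (intro bexI[of _ "- x"]) (simp_all add: assms)
qed (simp_all add: assms(1,2) additive_setD[OF assms(3)] add_ac)

lemma sum_rel_induct:
  fixes f :: "'i \<Rightarrow> 'a::comm_monoid_add" and g :: "'i \<Rightarrow> 'b::comm_monoid_add"
  assumes "finite B" "B \<noteq> {}" "\<And>k. k \<in> B \<Longrightarrow> R (f k) (g k)"
    and "\<And>a b a' b'. R a b \<Longrightarrow> R a' b' \<Longrightarrow> R (a + a') (b + b')"
  shows "R (sum f B) (sum g B)"
  using assms by (induction rule: finite_ne_induct) simp_all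

lemma left_moduleD:
  assumes "left_module R M"
  shows "ring R" "abelian_group M" "r \<in> carrier R \<Longrightarrow> x \<in> carrier M \<Longrightarrow> r \<odot>\<^bsub>M\<^esub> x \<in> carrier M"
    "r \<in> carrier R \<Longrightarrow> s \<in> carrier R \<Longrightarrow> x \<in> carrier M \<Longrightarrow> (r \<oplus>\<^bsub>R\<^esub> s) \<odot>\<^bsub>M\<^esub> x = r \<odot>\<^bsub>M\<^esub> x \<oplus>\<^bsub>M\<^esub> s \<odot>\<^bsub>M\<^esub> x"
    "r \<in> carrier R \<Longrightarrow> s \<in> carrier R \<Longrightarrow> x \<in> carrier M \<Longrightarrow> (r \<otimes>\<^bsub>R\<^esub> s) \<odot>\<^bsub>M\<^esub> x = r \<odot>\<^bsub>M\<^esub> (s \<odot>\<^bsub>M\<^esub> x)"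
    "r \<in> carrier R \<Longrightarrow> x \<in> carrier M \<Longrightarrow> y \<in> carrier M \<Longrightarrow> r \<odot>\<^bsub>M\<^esub> (x \<oplus>\<^bsub>M\<^esub> y) = r \<odot>\<^bsub>M\<^esub> x \<oplus>\<^bsub>M\<^esub> r \<odot>\<^bsub>M\<^esub> y"
    "x \<in> carrier M \<Longrightarrow> \<one>\<^bsub>R\<^esub> \<odot>\<^bsub>M\<^esub> x = x"
  using assms unfolding left_module_def by blast+

lemma annihilator_left_ideal:
  assumes M: "left_module R M" and m: "m \<in> carrier M"
  shows "left_ideal R {r \<in> carrier R. r \<odot>\<^bsub>M\<^esub> m = \<zero>\<^bsub>M\<^esub>}"
proof -
  interpret R: ring R by (rule left_moduleD(1)[OF M])
  interpret M: abelian_group M by (rule left_moduleD(2)[OF M])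
  note LM = left_moduleD[OF M]
  have zero: "\<zero>\<^bsub>R\<^esub> \<odot>\<^bsub>M\<^esub> m = \<zero>\<^bsub>M\<^esub>"
    using LM(4)[of "\<zero>\<^bsub>R\<^esub>" "\<zero>\<^bsub>R\<^esub>" m] LM(3)[of "\<zero>\<^bsub>R\<^esub>" m] m M.add.r_cancel_one by (metis R.l_zero R.zero_closed)
  have zero': "r \<odot>\<^bsub>M\<^esub> \<zero>\<^bsub>M\<^esub> = \<zero>\<^bsub>M\<^esub>" if "r \<in> carrier R" for r
    using LM(6)[of r "\<zero>\<^bsub>M\<^esub>" "\<zero>\<^bsub>M\<^esub>"] LM(3)[of r "\<zero>\<^bsub>M\<^esub>"] that M.add.r_cancel_one by (metis M.l_zero M.zero_closed)
  have inv: "(\<ominus>\<^bsub>R\<^esub> r) \<odot>\<^bsub>M\<^esub> m = \<zero>\<^bsub>M\<^esub>" if r: "r \<in> carrier R" "r \<odot>\<^bsub>M\<^esub> m = \<zero>\<^bsub>M\<^esub>" for r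
    using LM(4)[of "\<ominus>\<^bsub>R\<^esub> r" r m] LM(3)[of "\<ominus>\<^bsub>R\<^esub> r" m] r m zero by (simp add: R.l_neg)
  show ?thesis unfolding left_ideal_def
  proof (intro conjI ballI)
    show "additive_subgroup {r \<in> carrier R. r \<odot>\<^bsub>M\<^esub> m = \<zero>\<^bsub>M\<^esub>} R"
    proof (intro additive_subgroup.intro subgroup.intro)
      show "inv\<^bsub>add_monoid R\<^esub> x \<in> {r \<in> carrier R. r \<odot>\<^bsub>M\<^esub> m = \<zero>\<^bsub>M\<^esub>}" if "x \<in> {r \<in> carrier R. r \<odot>\<^bsub>M\<^esub> m = \<zero>\<^bsub>M\<^esub>}" for x
        using that inv[of x] by (simp add: a_inv_def[symmetric])
    qed (auto simp: zero LM(4) m)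
  qed (auto simp: LM(5) m zero')
qed

context lg_model
begin

abbreviation "TM \<equiv> transfer_module S1 Y (LG_map d)"
abbreviation "OM \<equiv> structure_module S1"
abbreviation "M0 \<equiv> direct_image_H0 S1 Y (LG_map d) OM"
abbreviation "N0 \<equiv> fourier_laplace S2 M0"
abbreviation "LM \<equiv> \<lparr>carrier = diff_op V, mult = undefined, one = undefined, zero = \<zero>\<^bsub>DV\<^esub>, add = (\<oplus>\<^bsub>DV\<^esub>), smult = (\<otimes>\<^bsub>DV\<^esub>)\<rparr>"

lemma TM_simps: "carrier TM = Tr" "S \<oplus>\<^bsub>TM\<^esub> T = S + T" "\<zero>\<^bsub>TM\<^esub> = 0" "Q \<odot>\<^bsub>TM\<^esub> T = T \<cdot> adjoint_op Y Q"
  by (simp_all add: transfer_module_def fun_eq_iff plus_fun_apply zero_fun_apply)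

lemma OM_simps: "carrier OM = regular_fun S1" "f \<oplus>\<^bsub>OM\<^esub> h = f + h" "\<zero>\<^bsub>OM\<^esub> = 0" "P \<odot>\<^bsub>OM\<^esub> f = P f"
  by (simp_all add: structure_module_def fun_eq_iff plus_fun_apply zero_fun_apply)

lemma abelian_group_TM: "abelian_group TM"
  by (rule abelian_group_funI)
     (use F.transfer_plus[OF _ F.transfer_uminus] in \<open>fastforce simp: TM_simps additive_set_def F.transfer_zero\<close>)+

lemma left_module_TM: "left_module (D_ring Y) TM"
  unfolding left_module_def
proof (intro conjI ballI)
  note adj = Y.adjoint_closed
  show "(P \<oplus>\<^bsub>D_ring Y\<^esub> Q) \<odot>\<^bsub>TM\<^esub> T = P \<odot>\<^bsub>TM\<^esub> T \<oplus>\<^bsub>TM\<^esub> Q \<odot>\<^bsub>TM\<^esub> T"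
    if "P \<in> carrier (D_ring Y)" "Q \<in> carrier (D_ring Y)" "T \<in> carrier TM" for P Q T
    using that by (simp add: TM_simps Y.adjoint_add F.transfer_comp_plus_right adj)
  show "(P \<otimes>\<^bsub>D_ring Y\<^esub> Q) \<odot>\<^bsub>TM\<^esub> T = P \<odot>\<^bsub>TM\<^esub> (Q \<odot>\<^bsub>TM\<^esub> T)"
    if "P \<in> carrier (D_ring Y)" "Q \<in> carrier (D_ring Y)" "T \<in> carrier TM" for P Q T
    using that by (simp add: TM_simps Y.adjoint_comp o_assoc)
  show "\<one>\<^bsub>D_ring Y\<^esub> \<odot>\<^bsub>TM\<^esub> T = T" if "T \<in> carrier TM" for T
    using that by (simp add: TM_simps Y.adjoint_M rational_at_const F.transfer_comp_I)
qed (simp_all add: Y.ring_D_ring abelian_group_TM TM_simps F.transfer_comp_right Y.adjoint_closed comp_plus_left)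

sublocale T1: tensor_bimodule "D_ring S1" TM "\<lambda>T P. adjoint_op S1 P \<circ> T" OM "D_ring Y"
proof (intro tensor_bimodule.intro tensor.intro tensor_bimodule_axioms.intro)
  show "abelian_group OM"
    by (rule abelian_group_funI) (simp_all add: OM_simps additive_set_regular)
  show "adjoint_op S1 P \<circ> T \<in> carrier TM" if "T \<in> carrier TM" "P \<in> carrier (D_ring S1)" for T P
    using that by (simp add: TM_simps F.transfer_comp_left X.adjoint_closed)
  show "P \<odot>\<^bsub>OM\<^esub> f \<in> carrier OM" if "P \<in> carrier (D_ring S1)" "f \<in> carrier OM" for P f
    using that by (simp add: OM_simps X.diff_op_regular)
qed (simp_all add: abelian_group_TM left_module_TM, simp add: TM_simps o_assoc)

lemma M0_eq: "M0 = T1.T"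
  by (simp add: direct_image_H0_def)

lemma left_module_N0: "left_module (D_ring Y) N0"
  unfolding fourier_laplace_def M0_eq
  by (rule left_module_restrict_scalars[OF T1.left_module_T Y.ring_D_ring FL_ring_hom])

lemma N0_simps: "carrier N0 = carrier M0" "m \<oplus>\<^bsub>N0\<^esub> m' = m \<oplus>\<^bsub>M0\<^esub> m'" "P \<odot>\<^bsub>N0\<^esub> m = FL_hom S2 P \<odot>\<^bsub>M0\<^esub> m"
  by (simp_all add: fourier_laplace_def restrict_scalars_def)

lemma additive_set_diff_op: "additive_set (diff_op V)"
  by (simp add: additive_set_def U_closed)

lemma abelian_group_LM: "abelian_group LM"
  by (rule abelian_group_funI) (simp_all add: additive_set_diff_op)

sublocale T2: tensor_bimodule "D_ring Y" LM "\<lambda>Q P. Q \<otimes>\<^bsub>DV\<^esub> restrict_op Y V P" N0 DV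
proof (intro tensor_bimodule.intro tensor.intro tensor_bimodule_axioms.intro)
  show "abelian_group N0" by (rule left_moduleD(2)[OF left_module_N0])
  show "P \<odot>\<^bsub>N0\<^esub> m \<in> carrier N0" if "P \<in> carrier (D_ring Y)" "m \<in> carrier N0" for P m
    by (rule left_moduleD(3)[OF left_module_N0 that])
  show "left_module DV LM"
    unfolding left_module_def using abelian_group_LM U.ring_D_ring
    by (simp add: U_closed comp_plus_left U.comp_plus_right o_assoc)
  show "abelian_group LM" by (rule abelian_group_LM)
qed (simp_all add: U_closed UY.restrict_closed o_assoc)

definition "NN = localization Y V N0"

lemma NN_eq: "NN = T2.T"
  unfolding NN_def localization_def ..

lemma left_module_NN: "left_module DV NN"
  unfolding NN_eq by (rule T2.left_module_T)

lemmas NN_module = left_moduleD[OF left_module_NN, simplified]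

text \<open>The class of 1 \<otimes> (T \<otimes> h) in the localized transform.\<close>

definition J :: "('r option, 'm) operator \<Rightarrow> (complex ^ 'm \<Rightarrow> complex) \<Rightarrow> _" where
  "J T h = T2.tensor_cls U.I (T1.tensor_cls T h)"

lemma tensor1_closed: "T \<in> Tr \<Longrightarrow> h \<in> regular_fun S1 \<Longrightarrow> T1.tensor_cls T h \<in> carrier N0"
  using T1.tensor_cls_closed[of T h, folded M0_eq] by (simp add: N0_simps TM_simps OM_simps)

lemma J_closed: "T \<in> Tr \<Longrightarrow> h \<in> regular_fun S1 \<Longrightarrow> J T h \<in> carrier NN"
  unfolding J_def NN_eq by (rule T2.tensor_cls_closed) (simp_all add: one_diff_op tensor1_closed)

lemma J_add_left:
  "S \<in> Tr \<Longrightarrow> T \<in> Tr \<Longrightarrow> h \<in> regular_fun S1 \<Longrightarrow> J (S + T) h = J S h \<oplus>\<^bsub>NN\<^esub> J T h"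
  using T1.tensor_cls_add_left[of S T h, folded M0_eq] T2.tensor_cls_add_right[of U.I "T1.tensor_cls S h" "T1.tensor_cls T h", folded NN_eq]
  by (simp add: J_def TM_simps OM_simps N0_simps(2) one_diff_op tensor1_closed)

lemma J_add_right:
  "T \<in> Tr \<Longrightarrow> f \<in> regular_fun S1 \<Longrightarrow> h \<in> regular_fun S1 \<Longrightarrow> J T (f + h) = J T f \<oplus>\<^bsub>NN\<^esub> J T h"
  using T1.tensor_cls_add_right[of T f h, folded M0_eq] T2.tensor_cls_add_right[of U.I "T1.tensor_cls T f" "T1.tensor_cls T h", folded NN_eq]
  by (simp add: J_def TM_simps OM_simps N0_simps(2) one_diff_op tensor1_closed)

lemma J_adjoint:
  "T \<in> Tr \<Longrightarrow> P \<in> diff_op S1 \<Longrightarrow> h \<in> regular_fun S1 \<Longrightarrow> J (adjoint_op S1 P \<cdot> T) h = J T (P h)"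
  using T1.tensor_cls_balanced[of T P h] by (simp add: J_def TM_simps OM_simps)

lemma N0_smult:
  "P \<in> diff_op Y \<Longrightarrow> P \<odot>\<^bsub>N0\<^esub> T1.tensor_cls T h = T1.tensor_cls (T \<cdot> adjoint_op Y (FL_hom S2 P)) h"
  using T1.smult_tensor_cls[of "FL_hom S2 P" T h, folded M0_eq] by (simp add: N0_simps FL_closed TM_simps)

lemma J_smult:
  assumes P: "P \<in> diff_op Y" and T: "T \<in> Tr" and h: "h \<in> regular_fun S1"
  shows "restrict_op Y V P \<odot>\<^bsub>NN\<^esub> J T h = J (T \<cdot> adjoint_op Y (FL_hom S2 P)) h"
  using T2.smult_tensor_cls[of "restrict_op Y V P" U.I "T1.tensor_cls T h", folded NN_eq]
    T2.tensor_cls_balanced[of U.I P "T1.tensor_cls T h"] assms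
  by (simp add: J_def UY.restrict_closed one_diff_op tensor1_closed N0_smult)

text \<open>The addition of \<open>NN\<close> is a record field, so finite sums of operators are
  carried over to it by induction over nonempty index sets.\<close>

lemma J_sum_left:
  assumes "finite B" "B \<noteq> {}" "\<And>k. k \<in> B \<Longrightarrow> T k \<in> Tr" "\<And>k. k \<in> B \<Longrightarrow> P k \<in> diff_op V"
    and "\<And>k. k \<in> B \<Longrightarrow> J (T k) h = P k \<odot>\<^bsub>NN\<^esub> m" and h: "h \<in> regular_fun S1" and m: "m \<in> carrier NN"
  shows "J (sum T B) h = sum P B \<odot>\<^bsub>NN\<^esub> m"
proof -
  have "sum T B \<in> Tr \<and> sum P B \<in> diff_op V \<and> J (sum T B) h = sum P B \<odot>\<^bsub>NN\<^esub> m"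
    by (rule sum_rel_induct[OF assms(1,2), where R = "\<lambda>T P. T \<in> Tr \<and> P \<in> diff_op V \<and> J T h = P \<odot>\<^bsub>NN\<^esub> m"])
       (use assms in \<open>auto simp: J_add_left F.transfer_plus NN_module(4) diff_op_plus\<close>)
  then show ?thesis by simp
qed

lemma J_sum_right:
  assumes "finite B" "B \<noteq> {}" "\<And>k. k \<in> B \<Longrightarrow> f k \<in> regular_fun S1" "\<And>k. k \<in> B \<Longrightarrow> P k \<in> diff_op V"
    and "\<And>k. k \<in> B \<Longrightarrow> J T (f k) = P k \<odot>\<^bsub>NN\<^esub> m" and T: "T \<in> Tr" and m: "m \<in> carrier NN"
  shows "J T (sum f B) = sum P B \<odot>\<^bsub>NN\<^esub> m"
proof -
  have "sum f B \<in> regular_fun S1 \<and> sum P B \<in> diff_op V \<and> J T (sum f B) = sum P B \<odot>\<^bsub>NN\<^esub> m"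
    by (rule sum_rel_induct[OF assms(1,2), where R = "\<lambda>f P. f \<in> regular_fun S1 \<and> P \<in> diff_op V \<and> J T f = P \<odot>\<^bsub>NN\<^esub> m"])
       (use assms in \<open>auto simp: J_add_right regular_fun_add NN_module(4) diff_op_plus\<close>)
  then show ?thesis by simp
qed

abbreviation "one1 \<equiv> zero_outside S1 (\<lambda>_. 1)"

text \<open>The canonical element 1 \<otimes> 1 of the transfer module, that is, composition with
  the Landau-Ginzburg map. With it, \<open>K h\<close> below is the class of the function
  \<open>h\<close>.\<close>

definition Fs :: "('r option, 'm) operator" where
  "Fs = pl one1 Y.I"

lemma Fs_Tr: "Fs \<in> Tr"
  unfolding Fs_def by (intro F.transfer_pull regular_fun_const one_diff_op)

lemma one1_mult: "h \<in> regular_fun S1 \<Longrightarrow> one1 * h = h" "h \<in> regular_fun S1 \<Longrightarrow> h * one1 = h"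
  by (auto simp: fun_eq_iff pointwise_simps zero_outside_def regular_fun_outside)

lemma pull_Fs: "Q \<in> diff_op Y \<Longrightarrow> \<phi> \<in> regular_fun S1 \<Longrightarrow> pl \<phi> Q = X.M \<phi> \<cdot> (Fs \<cdot> Q)"
  by (simp add: Fs_def pull_comp F.M_pull regular_fun_const one1_mult)

lemma J_M:
  assumes "T \<in> Tr" "\<phi> \<in> regular_fun S1" "h \<in> regular_fun S1"
  shows "J (X.M \<phi> \<cdot> T) h = J T (\<phi> * h)"
  using J_adjoint[OF assms(1) diff_op.mult[OF assms(2)] assms(3)] assms
  by (simp add: X.adjoint_M regular_fun_rational_at mult_op_apply)

lemma J_pull: "Q \<in> diff_op Y \<Longrightarrow> \<phi> \<in> regular_fun S1 \<Longrightarrow> h \<in> regular_fun S1 \<Longrightarrow> J (pl \<phi> Q) h = J (Fs \<cdot> Q) (\<phi> * h)"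
  by (simp add: pull_Fs J_M F.transfer_comp_right Fs_Tr)

abbreviation "K \<equiv> J Fs"

lemma K_closed: "h \<in> regular_fun S1 \<Longrightarrow> K h \<in> carrier NN"
  by (rule J_closed[OF Fs_Tr])

lemma K_pull: "\<phi> \<in> regular_fun S1 \<Longrightarrow> h \<in> regular_fun S1 \<Longrightarrow> J (pl \<phi> Y.I) h = K (\<phi> * h)"
  using J_pull[OF one_diff_op] by (simp add: F.transfer_comp_I[OF Fs_Tr])

lemma K_lift:
  assumes r: "r \<in> regular_fun S2" and h: "h \<in> regular_fun S1"
  shows "Mq r \<odot>\<^bsub>NN\<^esub> K h = K (bs r 0 * h)"
proof -
  have "Y.M (lift r) \<in> diff_op Y" by (intro diff_op.mult lift_regular r)
  from J_smult[OF this Fs_Tr h] have "Mq r \<odot>\<^bsub>NN\<^esub> K h = J (pl (bs r 0 * one1) Y.I) h"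
    by (simp only: adjoint_FL restrict_generators r Fs_def pull_lift[OF regular_fun_const r])
  then show ?thesis by (simp add: one1_mult bs_regular r K_pull h)
qed

lemma K_Dt: "h \<in> regular_fun S1 \<Longrightarrow> Dt \<odot>\<^bsub>NN\<^esub> K h = K (fco None * h)"
proof -
  assume h: "h \<in> regular_fun S1"
  from J_smult[OF diff_op.partial Fs_Tr h, of None] have "Dt \<odot>\<^bsub>NN\<^esub> K h = J (pl (fco None * one1) Y.I) h"
    by (simp only: adjoint_FL restrict_generators Fs_def pull_t[OF regular_fun_const])
  then show ?thesis by (simp add: one1_mult fco_regular K_pull h)
qed

lemma J_\<tau>: "T \<in> Tr \<Longrightarrow> h \<in> regular_fun S1 \<Longrightarrow> \<tau> \<odot>\<^bsub>NN\<^esub> J T h = J (T \<cdot> Y.D None) h"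
  using J_smult[OF M_t_diff_op, of T h] by (simp add: adjoint_FL restrict_generators)

lemma J_Dq: "T \<in> Tr \<Longrightarrow> h \<in> regular_fun S1 \<Longrightarrow> Dq k \<odot>\<^bsub>NN\<^esub> J T h = J (- (T \<cdot> Y.D (Some k))) h"
  using J_smult[OF diff_op.partial, of T h "Some k"]
  by (simp add: adjoint_FL restrict_generators F.transfer_comp_uminus diff_op.partial)

text \<open>\<partial>/\<partial>w_i composed with \<open>Fs\<close> is expanded by the chain rule.
  As \<partial>W/\<partial>w_i = 1, the term with \<partial>_t is
  \<open>Fs \<cdot> Y.D None\<close>, which is how \<tau> acts; the other terms combine to E_i -
  u_i, and z removes \<tau>.\<close>

lemma K_step:
  assumes u: "\<And>i. u $ i \<ge> 0"
  shows "K (bs one_S (u0 + (u + axis i 1))) = fac i (u $ i) \<odot>\<^bsub>NN\<^esub> K (bs one_S (u0 + u))"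
proof -
  let ?h = "bs one_S (u0 + (u + axis i 1))" and ?h' = "bs one_S (u0 + u)"
  let ?c = "\<lambda>k. of_int (d k $ i) :: complex"
  let ?v = "of_int (\<Sum>k\<in>UNIV. d k $ i) + of_int (u $ i) :: complex"
  have one: "one_S \<in> regular_fun S2" "one1 \<in> regular_fun S1" by (rule regular_fun_const)+
  have h: "?h \<in> regular_fun S1" and h': "?h' \<in> regular_fun S1" by (intro bs_regular one)+
  have Df: "X.D i (fco j) \<in> regular_fun S1" for j by (intro partial_op_regular[OF X.open_X] fco_regular)
  note cl = U_closed regular_coord const_mult_regular one
  have Kh': "K ?h' \<in> carrier NN" by (rule K_closed[OF h'])
  let ?T = "\<lambda>k. - pl (X.D i (fco (Some k))) (Y.D (Some k))"
  have T: "?T k \<in> Tr" for k by (intro F.transfer_uminus F.transfer_pull Df diff_op.partial)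
  have DF: "X.D i \<cdot> Fs \<in> Tr" by (intro F.transfer_comp_left diff_op.partial Fs_Tr)
  have "X.D i \<cdot> Fs = (\<Sum>j\<in>UNIV. pl (X.D i (fco j)) (Y.D j))"
    using partial_op_const[OF X.open_X, of i 1]
    by (simp add: Fs_def F.D_pull one one_diff_op fco_def[symmetric] one1_mult Df diff_op.partial pull_zero_left)
  also have "\<dots> = pl (X.D i (fco None)) (Y.D None) + (\<Sum>k\<in>UNIV. pl (X.D i (fco (Some k))) (Y.D (Some k)))"
    by (rule sum_option)
  also have "X.D i (fco None) = one1"
    unfolding D_fco_None by (rule ext) (simp add: bs_def zero_outside_def qq_S2)
  also have "pl one1 (Y.D None) = Fs \<cdot> Y.D None" by (simp add: Fs_def pull_comp diff_op.partial)
  \<comment> \<open>The chain rule solved for the term that carries \<tau>.\<close>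
  finally have split: "Fs \<cdot> Y.D None = X.D i \<cdot> Fs + sum ?T UNIV" by (simp add: sum_negf)
  have 1: "J (X.D i \<cdot> Fs) h = Cn (- ?v) \<odot>\<^bsub>NN\<^esub> K ?h'" if "h = ?h" for h
  proof -
    \<comment> \<open>By the balancing relation the vector field passes to the function, with a
      sign.\<close>
    have "adjoint_op S1 (- X.D i) = X.D i" by (simp add: X.adjoint_uminus X.adjoint_D diff_op.partial)
    then have "J (X.D i \<cdot> Fs) ?h = K ((- X.D i) ?h)"
      using J_adjoint[OF Fs_Tr X.diff_op_uminus[OF diff_op.partial] h, of i] by simp
    also have "(- X.D i) ?h = bs ((\<lambda>_. - ?v) * one_S) 0 * ?h'"
    proof -
      have v: "of_int ((u0 + (u + axis i 1)) $ i) = ?v" by (simp add: u0_def)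
      have shift: "u0 + (u + axis i 1) - axis i 1 = u0 + u" by simp
      show ?thesis
        unfolding uminus_apply D_bs_one v shift bs_mult add_0_left
        by (rule ext) (simp add: bs_def zero_outside_def pointwise_simps algebra_simps)
    qed
    also have "K \<dots> = Mq ((\<lambda>_. - ?v) * one_S) \<odot>\<^bsub>NN\<^esub> K ?h'"
      by (rule K_lift[OF const_mult_regular[OF one(1)] h', symmetric])
    also have "Mq ((\<lambda>_. - ?v) * one_S) = Cn (- ?v)"
      by (simp add: Mq_const_mult[OF one(1)] Mq_one_S U_closed)
    finally show ?thesis using that by simp
  qed
  have 2: "J (?T k) ?h = (Cn (?c k) \<cdot> (U.I + \<theta> k)) \<odot>\<^bsub>NN\<^esub> K ?h'" for k
  proof -
    let ?\<phi> = "X.D i (fco (Some k))"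
    have FD: "Fs \<cdot> Y.D (Some k) \<in> Tr" by (intro F.transfer_comp_right Fs_Tr diff_op.partial)
    have "?T k = X.M ?\<phi> \<cdot> (- (Fs \<cdot> Y.D (Some k)))"
    proof -
      have "X.M ?\<phi> \<cdot> (- (Fs \<cdot> Y.D (Some k))) + X.M ?\<phi> \<cdot> (Fs \<cdot> Y.D (Some k)) = X.M ?\<phi> \<cdot> (- (Fs \<cdot> Y.D (Some k)) + Fs \<cdot> Y.D (Some k))"
        by (rule F.comp_transfer_plus[OF diff_op.mult[OF Df] F.transfer_uminus[OF FD] FD, symmetric])
      also have "\<dots> = 0"
        using X.diff_op_fun_0[OF diff_op.mult[OF Df]] by (simp add: fun_eq_iff pointwise_simps)
      finally have "X.M ?\<phi> \<cdot> (- (Fs \<cdot> Y.D (Some k))) = - (X.M ?\<phi> \<cdot> (Fs \<cdot> Y.D (Some k)))"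
        by (simp only: eq_neg_iff_add_eq_0)
      then show ?thesis by (simp only: pull_Fs[OF diff_op.partial Df])
    qed
    then have "J (?T k) ?h = J (- (Fs \<cdot> Y.D (Some k))) (?\<phi> * ?h)"
      by (simp add: J_M F.transfer_uminus[OF FD] Df h)
    also have "\<dots> = Dq k \<odot>\<^bsub>NN\<^esub> K (?\<phi> * ?h)" by (rule J_Dq[OF Fs_Tr regular_fun_mult[OF Df h], symmetric])
    also have "?\<phi> * ?h = bs ((\<lambda>_. ?c k) * qc k) 0 * ?h'"
    proof -
      have "?\<phi> * ?h = bs ((\<lambda>_. ?c k) * one_S * one_S) (u0 + u + d k)"
        by (simp add: D_fco_Some bs_mult algebra_simps)
      also have "\<dots> = bs ((\<lambda>_. ?c k) * one_S * one_S * me (gdot (d k))) (u0 + u)"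
        by (rule bs_shift_me[OF d_relation])
      also have "\<dots> = bs ((\<lambda>_. ?c k) * qc k * one_S) (0 + (u0 + u))"
        unfolding add_0_left by (rule bs_cong) (simp add: gdot_d me_axis pointwise_simps zero_outside_apply)
      finally show ?thesis by (simp only: bs_mult)
    qed
    also have "K \<dots> = (Cn (?c k) \<cdot> Mq (qc k)) \<odot>\<^bsub>NN\<^esub> K ?h'"
      using K_lift[OF const_mult_regular[OF regular_coord] h', of "?c k" k] by (simp only: Mq_const_mult[OF regular_coord])
    also have "Dq k \<odot>\<^bsub>NN\<^esub> \<dots> = (Dq k \<cdot> (Cn (?c k) \<cdot> Mq (qc k))) \<odot>\<^bsub>NN\<^esub> K ?h'"
      by (rule NN_module(5)[symmetric]) (intro cl Kh')+
    also have "Dq k \<cdot> (Cn (?c k) \<cdot> Mq (qc k)) = Cn (?c k) \<cdot> (Dq k \<cdot> Mq (qc k))"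
      by (simp only: o_assoc U.const_central[OF diff_op.partial])
    also have "Dq k \<cdot> Mq (qc k) = U.I + \<theta> k"
      by (simp add: Dq_Mq[OF regular_coord] partial_op_coord[OF open_S2] Mq_one \<theta>_Mq)
    finally show ?thesis .
  qed
  note clo = cl \<theta>_closed
  have "\<tau> \<odot>\<^bsub>NN\<^esub> K ?h = J (X.D i \<cdot> Fs + sum ?T UNIV) ?h"
    unfolding J_\<tau>[OF Fs_Tr h] split ..
  also have "\<dots> = J (X.D i \<cdot> Fs) ?h \<oplus>\<^bsub>NN\<^esub> J (sum ?T UNIV) ?h"
    by (rule J_add_left[OF DF F.transfer_sum[OF T] h])
  also have "J (sum ?T UNIV) ?h = (\<Sum>k\<in>UNIV. Cn (?c k) \<cdot> (U.I + \<theta> k)) \<odot>\<^bsub>NN\<^esub> K ?h'"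
    by (rule J_sum_left[OF _ _ T _ 2 h Kh']) (simp_all add: clo)
  also have "J (X.D i \<cdot> Fs) ?h \<oplus>\<^bsub>NN\<^esub> (\<Sum>k\<in>UNIV. Cn (?c k) \<cdot> (U.I + \<theta> k)) \<odot>\<^bsub>NN\<^esub> K ?h' =
      (Cn (- ?v) + (\<Sum>k\<in>UNIV. Cn (?c k) \<cdot> (U.I + \<theta> k))) \<odot>\<^bsub>NN\<^esub> K ?h'"
    unfolding 1[OF refl] by (rule NN_module(4)[symmetric]) (intro clo Kh')+
  \<comment> \<open>The constants from \<partial>_q q = 1 + q \<partial>_q cancel the part of - v
    that stems from \<open>u0\<close>, so only - u_i is left.\<close>
  also have "Cn (- ?v) + (\<Sum>k\<in>UNIV. Cn (?c k) \<cdot> (U.I + \<theta> k)) = Eu i - Cn (of_int (u $ i))"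
  proof -
    have "(\<Sum>k\<in>UNIV. Cn (?c k) \<cdot> (U.I + \<theta> k)) = Cn (of_int (\<Sum>k\<in>UNIV. d k $ i)) + Eu i"
      by (simp only: Eu_def Cn_sum U.comp_plus_right[OF U.const_diff_op one_diff_op \<theta>_closed] U.comp_I[OF U.const_diff_op] sum.distrib)
    moreover have "Cn (- ?v) + Cn (of_int (\<Sum>k\<in>UNIV. d k $ i)) + Cn (of_int (u $ i)) = 0"
      unfolding U.M_add_const[symmetric] by (simp add: Cn_0)
    ultimately show ?thesis by (simp add: algebra_simps)
  qed
  finally have *: "\<tau> \<odot>\<^bsub>NN\<^esub> K ?h = (Eu i - Cn (of_int (u $ i))) \<odot>\<^bsub>NN\<^esub> K ?h'" .
  have "K ?h = (\<zeta> \<cdot> \<tau>) \<odot>\<^bsub>NN\<^esub> K ?h" by (simp add: \<zeta>_\<tau> NN_module(7) K_closed h)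
  also have "\<dots> = \<zeta> \<odot>\<^bsub>NN\<^esub> (\<tau> \<odot>\<^bsub>NN\<^esub> K ?h)" by (rule NN_module(5)) (intro clo K_closed h)+
  also have "\<dots> = fac i (u $ i) \<odot>\<^bsub>NN\<^esub> K ?h'"
    unfolding * fac_def by (rule NN_module(5)[symmetric]) (intro clo Eu_closed Kh')+
  finally show ?thesis .
qed

end

section \<open>The generator and its annihilator\<close>

context lg_model
begin

definition gen :: "complex ^ 'm \<Rightarrow> complex" where
  "gen = bs one_S u0"

lemma gen_regular: "gen \<in> regular_fun S1"
  unfolding gen_def by (intro bs_regular regular_fun_const)

lemma K_gen_closed: "K gen \<in> carrier NN"
  by (rule K_closed[OF gen_regular])

lemma K_Bop:
  assumes u: "\<And>i. u $ i \<ge> 0" shows "K (bs one_S (u0 + u)) = Bop u \<odot>\<^bsub>NN\<^esub> K gen"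
  using u
proof (induction rule: nonneg_vec_induct)
  case zero
  then show ?case by (simp add: Bop_0 NN_module(7) K_gen_closed) (simp add: gen_def)
next
  case (step u i)
  then show ?case
    by (simp add: K_step[OF step.hyps] Bop_step NN_module(5) fac_closed Bop_closed K_gen_closed)
qed

lemma K_bs:
  assumes r: "r \<in> regular_fun S2" and u: "\<And>i. u $ i \<ge> 0"
  shows "K (bs r (u0 + u)) = (Mq r \<cdot> Bop u) \<odot>\<^bsub>NN\<^esub> K gen"
proof -
  have "bs r 0 * bs one_S (u0 + u) = bs r (u0 + u)" by (simp add: bs_mult one_S_mult r)
  then show ?thesis
    using K_lift[OF r bs_regular[OF regular_fun_const], of 1 "u0 + u"]
    by (simp add: K_Bop u NN_module(5) Mq_closed r Bop_closed K_gen_closed)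
qed

lemma smult_diff_zero:
  assumes "P \<in> diff_op V" "Q \<in> diff_op V" "m \<in> carrier NN" "P \<odot>\<^bsub>NN\<^esub> m = Q \<odot>\<^bsub>NN\<^esub> m"
  shows "(P - Q) \<odot>\<^bsub>NN\<^esub> m = \<zero>\<^bsub>NN\<^esub>"
proof -
  interpret abelian_group NN by (rule NN_module(2))
  have "(P - Q + Q) \<odot>\<^bsub>NN\<^esub> m = (P - Q) \<odot>\<^bsub>NN\<^esub> m \<oplus>\<^bsub>NN\<^esub> Q \<odot>\<^bsub>NN\<^esub> m"
    by (rule NN_module(4)) (simp_all add: assms U_closed)
  then have "Q \<odot>\<^bsub>NN\<^esub> m = (P - Q) \<odot>\<^bsub>NN\<^esub> m \<oplus>\<^bsub>NN\<^esub> Q \<odot>\<^bsub>NN\<^esub> m" using assms(4) by simp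
  then show ?thesis
    using add.r_cancel_one[of "(P - Q) \<odot>\<^bsub>NN\<^esub> m" "Q \<odot>\<^bsub>NN\<^esub> m"] assms by (simp add: NN_module(3) U_closed)
qed

text \<open>The monomials with exponents \<open>pos l\<close> and \<open>pos (- l)\<close> differ by
  the monomial q^(gdot l), so both halves of the box operator send the generator to the same
  class.\<close>

lemma box_annihilates:
  assumes l: "deg l = 0" shows "box_op S2 p d l \<odot>\<^bsub>NN\<^esub> K gen = \<zero>\<^bsub>NN\<^esub>"
proof -
  let ?g = "gdot l"
  have "bs (me (pos (- ?g))) (u0 + pos l) = bs (me (pos (- ?g))) (u0 + pos (- l) + l)"
    using pos_diff[of l] by (simp add: algebra_simps)
  also have "\<dots> = bs (me (pos (- ?g) + ?g)) (u0 + pos (- l))"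
    by (simp only: bs_shift_me[OF l] me_add)
  also have "pos (- ?g) + ?g = pos ?g" using pos_diff[of ?g] by (simp add: algebra_simps)
  finally have "K (bs (me (pos ?g)) (u0 + pos (- l))) = K (bs (me (pos (- ?g))) (u0 + pos l))" by simp
  moreover have "pos v $ i \<ge> 0" for v :: "int ^ 'm" and i by (simp add: pos_nth)
  ultimately show ?thesis unfolding box_op_eq[OF l]
    by (intro smult_diff_zero U_closed me_regular Bop_closed K_gen_closed) (simp only: K_bs[OF me_regular])
qed

text \<open>\<partial>_\<tau> acts as multiplication by W, and by \<open>K_step\<close> W times the
  generator is \<Sum>z E_i applied to it; multiplication by \<tau> removes z.\<close>

lemma euler_annihilates: "euler_op S2 A d \<odot>\<^bsub>NN\<^esub> K gen = \<zero>\<^bsub>NN\<^esub>"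
proof -
  note cl = U_closed Eu_closed fac_closed
  have "fco None * gen = (\<Sum>i\<in>UNIV. bs one_S (u0 + axis i 1))"
    by (simp add: fco_None gen_def sum_distrib_right bs_mult one_S_mult[OF regular_fun_const] add.commute)
  then have "Dt \<odot>\<^bsub>NN\<^esub> K gen = K (\<Sum>i\<in>UNIV. bs one_S (u0 + axis i 1))"
    by (simp add: K_Dt gen_regular)
  also have "\<dots> = (\<Sum>i\<in>UNIV. fac i 0) \<odot>\<^bsub>NN\<^esub> K gen"
  proof (rule J_sum_right)
    fix i
    have "K (bs one_S (u0 + (0 + axis i 1))) = fac i (0 $ i) \<odot>\<^bsub>NN\<^esub> K (bs one_S (u0 + 0))" by (rule K_step) simp
    then show "K (bs one_S (u0 + axis i 1)) = fac i 0 \<odot>\<^bsub>NN\<^esub> K gen" by (simp add: gen_def)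
  qed (simp_all add: cl bs_regular regular_fun_const Fs_Tr K_gen_closed)
  finally have "\<tau> \<odot>\<^bsub>NN\<^esub> (Dt \<odot>\<^bsub>NN\<^esub> K gen) = \<tau> \<odot>\<^bsub>NN\<^esub> ((\<Sum>i\<in>UNIV. fac i 0) \<odot>\<^bsub>NN\<^esub> K gen)" by simp
  then have "(\<tau> \<cdot> Dt) \<odot>\<^bsub>NN\<^esub> K gen = (\<tau> \<cdot> (\<Sum>i\<in>UNIV. fac i 0)) \<odot>\<^bsub>NN\<^esub> K gen"
    by (simp only: NN_module(5)[OF \<tau>_closed diff_op.partial K_gen_closed]
        NN_module(5)[OF \<tau>_closed U.diff_op_sum[OF fac_closed] K_gen_closed])
  moreover have "\<tau> \<cdot> (\<Sum>i\<in>UNIV. fac i 0) = (\<Sum>i\<in>UNIV. Eu i)"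
  proof -
    have "\<tau> \<cdot> fac i 0 = \<tau> \<cdot> \<zeta> \<cdot> Eu i" for i by (simp add: fac_def Cn_0 o_assoc)
    then show ?thesis by (simp add: U.comp_sum_right cl \<tau>_\<zeta>)
  qed
  ultimately show ?thesis
    unfolding euler_op_eq by (intro smult_diff_zero cl K_gen_closed) simp
qed

lemma Iq_annihilates: "P \<in> Iq \<Longrightarrow> P \<odot>\<^bsub>NN\<^esub> K gen = \<zero>\<^bsub>NN\<^esub>"
proof -
  have "Iq \<subseteq> {P \<in> carrier DV. P \<odot>\<^bsub>NN\<^esub> K gen = \<zero>\<^bsub>NN\<^esub>}"
    unfolding Iq_def quantum_ideal_def Dtau_eq
    by (rule generated_left_ideal_least[OF annihilator_left_ideal[OF left_module_NN K_gen_closed]])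
       (use quantum_generators in \<open>auto simp: relation_iff box_annihilates euler_annihilates\<close>)
  then show "P \<in> Iq \<Longrightarrow> P \<odot>\<^bsub>NN\<^esub> K gen = \<zero>\<^bsub>NN\<^esub>" by blast
qed

abbreviation "cyc \<equiv> (\<lambda>P. P \<odot>\<^bsub>NN\<^esub> K gen) ` diff_op V"

lemma cyc_add: "m \<in> cyc \<Longrightarrow> m' \<in> cyc \<Longrightarrow> m \<oplus>\<^bsub>NN\<^esub> m' \<in> cyc"
  by (auto simp: NN_module(4)[symmetric] K_gen_closed intro!: imageI diff_op_plus)

lemma cyc_smult: "P \<in> diff_op V \<Longrightarrow> m \<in> cyc \<Longrightarrow> P \<odot>\<^bsub>NN\<^esub> m \<in> cyc"
  by (auto simp: NN_module(5)[symmetric] K_gen_closed intro!: imageI diff_op.comp)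

text \<open>Functions are combinations of the monomials treated in \<open>K_bs\<close>, and appended
  derivatives act through \<tau> and - \<partial>_q; both stay in the cyclic submodule.\<close>

lemma J_cyc: "T \<in> Tr \<Longrightarrow> h \<in> regular_fun S1 \<Longrightarrow> J T h \<in> cyc"
proof (induction arbitrary: h rule: F.transfer_partial_induct)
  case (pull \<phi>)
  have "K h \<in> cyc" if "h \<in> regular_fun S1" for h
    using that
  proof (induction rule: regular_S1_induct[where s = u0])
    case (bs r u)
    then show ?case by (auto simp: K_bs intro!: imageI U_closed Bop_closed)
  next
    case (add f h)
    then show ?case by (simp only: J_add_right[OF Fs_Tr add(1,2)] cyc_add)
  qed
  then show ?case using pull by (simp add: K_pull regular_fun_mult)
next
  case (partial T j)
  show ?case
  proof (cases j)
    case None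
    then show ?thesis using cyc_smult[OF \<tau>_closed partial(2)[OF partial(3)]] by (simp only: J_\<tau>[OF partial(1,3)])
  next
    case (Some k)
    have D: "- Y.D (Some k) \<in> diff_op Y" by (intro Y.diff_op_uminus diff_op.partial)
    have TD: "T \<cdot> Y.D (Some k) \<in> Tr" by (intro F.transfer_comp_right partial diff_op.partial)
    have "J (T \<cdot> Y.D (Some k)) h = (- Dq k) \<odot>\<^bsub>NN\<^esub> J T h"
    proof -
      have "restrict_op Y V (- Y.D (Some k)) = - Dq k"
      proof -
        have "restrict_op Y V (- Y.D (Some k)) + restrict_op Y V (Y.D (Some k)) = restrict_op Y V 0"
          by (subst UY.restrict_add[symmetric]) (simp_all add: D diff_op.partial)
        moreover have "restrict_op Y V 0 = 0"
          using UY.restrict_add[OF zero_diff_op zero_diff_op] by simp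
        ultimately show ?thesis by (simp add: restrict_generators eq_neg_iff_add_eq_0)
      qed
      moreover have "FL_hom S2 (- Y.D (Some k)) = - Y.D (Some k)"
      proof -
        have "FL_hom S2 (- Y.D (Some k)) + FL_hom S2 (Y.D (Some k)) = FL_hom S2 0"
          by (subst FL_add[symmetric]) (simp_all add: D diff_op.partial)
        moreover have "FL_hom S2 0 = 0" using FL_add[OF zero_diff_op zero_diff_op] by simp
        ultimately show ?thesis by (simp add: FL_D_Some eq_neg_iff_add_eq_0)
      qed
      ultimately show ?thesis
        using J_smult[OF D partial(1,3)] by (simp add: Y.adjoint_uminus Y.adjoint_D diff_op.partial)
    qed
    then show ?thesis using cyc_smult[OF U.diff_op_uminus[OF diff_op.partial] partial(2)[OF partial(3)]] Some by simp
  qed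
next
  case (add S T)
  then show ?case by (simp only: J_add_left[OF add(1,2,5)] cyc_add)
qed

lemma NN_cyclic: assumes "m \<in> carrier NN" shows "m \<in> cyc"
  using assms[unfolded NN_eq]
proof (induction rule: T2.tensor_induct)
  case (tensor Q m)
  then have Q: "Q \<in> diff_op V" and m: "m \<in> carrier T1.T" by (simp_all add: N0_simps(1) M0_eq[symmetric])
  have M: "m \<in> carrier M0 \<and> T2.tensor_cls U.I m \<in> cyc"
    using m
  proof (induction rule: T1.tensor_induct)
    case (tensor T h)
    then have "J T h \<in> cyc \<and> T1.tensor_cls T h \<in> carrier M0"
      using J_cyc[of T h] tensor1_closed[of T h] by (simp add: TM_simps OM_simps N0_simps(1))
    then show ?case unfolding J_def[of T] by blast
  next
    case (add C C')
    have "C \<oplus>\<^bsub>M0\<^esub> C' \<in> carrier M0"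
      using left_moduleD(2)[OF T1.left_module_T] add(3,4) abelian_group.axioms(1) abelian_monoid.a_closed
      unfolding M0_eq by (metis (no_types, lifting))
    moreover have "T2.tensor_cls U.I (C \<oplus>\<^bsub>M0\<^esub> C') = T2.tensor_cls U.I C \<oplus>\<^bsub>NN\<^esub> T2.tensor_cls U.I C'"
      using T2.tensor_cls_add_right[of U.I C C', folded NN_eq] add(3,4) by (simp add: one_diff_op N0_simps(1,2))
    ultimately have "C \<oplus>\<^bsub>M0\<^esub> C' \<in> carrier M0 \<and> T2.tensor_cls U.I (C \<oplus>\<^bsub>M0\<^esub> C') \<in> cyc"
      using cyc_add[OF conjunct2[OF add(3)] conjunct2[OF add(4)]] by (simp only: simp_thms)
    then show ?case unfolding M0_eq .
  qed
  have "Q \<odot>\<^bsub>NN\<^esub> T2.tensor_cls U.I m \<in> cyc" by (rule cyc_smult[OF Q conjunct2[OF M]])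
  moreover have "Q \<odot>\<^bsub>NN\<^esub> T2.tensor_cls U.I m = T2.tensor_cls (Q \<odot>\<^bsub>LM\<^esub> U.I) m"
    by (rule T2.smult_tensor_cls[folded NN_eq]) (simp add: Q)
  moreover have "Q \<odot>\<^bsub>LM\<^esub> U.I = Q" by (simp add: Q)
  ultimately show ?case by (simp only:)
next
  case (add C C')
  then show ?case unfolding NN_eq[symmetric] by (intro cyc_add)
qed

text \<open>The inverse map is assembled in two stages, all modulo the ideal: \<open>Lam\<close>
  induces \<open>E1\<close> on the direct image, and Q \<otimes> m to Q E1(m) induces
  \<open>E2\<close> on the localization. It sends the generator to 1, so an operator that kills the
  generator lies in the ideal.\<close>

lemma annihilator_Iq:
  assumes P: "P \<in> diff_op V" and zero: "P \<odot>\<^bsub>NN\<^esub> K gen = \<zero>\<^bsub>NN\<^esub>"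
  shows "P \<in> Iq"
proof -
  have IV: "Iq \<subseteq> diff_op V" using Iq_closed by blast
  obtain E1 where E1: "\<And>C. C \<in> carrier M0 \<Longrightarrow> E1 C \<in> diff_op V"
    "\<And>T h. T \<in> Tr \<Longrightarrow> h \<in> regular_fun S1 \<Longrightarrow> E1 (T1.tensor_cls T h) - Lam h T \<in> Iq"
    "\<And>C C'. C \<in> carrier M0 \<Longrightarrow> C' \<in> carrier M0 \<Longrightarrow> E1 (C \<oplus>\<^bsub>M0\<^esub> C') - (E1 C + E1 C') \<in> Iq"
  proof (rule T1.tensor_eval[OF additive_set_Iq additive_set_diff_op IV, of "\<lambda>T h. Lam h T", folded M0_eq], goal_cases)
    case (1 T h)
    then show ?case by (simp add: TM_simps OM_simps Lam_closed)
  next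
    case (2 S T h)
    then show ?case by (simp add: TM_simps OM_simps Lam_add Iq_0)
  next
    case (3 T f h)
    then show ?case by (simp add: TM_simps OM_simps Lam_add_left Iq_0)
  next
    case (4 T P h)
    then show ?case using Lam_adjoint[of P h T] by (simp add: TM_simps OM_simps equ_def)
  next
    case (5 E)
    show ?case by (rule 5(1)[OF 5(2) 5(3) 5(4)]) (simp_all add: TM_simps OM_simps)
  qed
  have E1_equ: "E1 (T1.tensor_cls T h) \<doteq> Lam h T" if "T \<in> Tr" "h \<in> regular_fun S1" for T h
    using E1(1)[of "T1.tensor_cls T h"] E1(2)[OF that] Lam_closed[OF that(2,1)] tensor1_closed[OF that]
    by (simp add: equ_def N0_simps(1))
  have MM: "abelian_group M0" unfolding M0_eq by (rule left_moduleD(2)[OF T1.left_module_T])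
  have Msum: "C \<oplus>\<^bsub>M0\<^esub> C' \<in> carrier M0" if "C \<in> carrier M0" "C' \<in> carrier M0" for C C'
    using abelian_monoid.a_closed[OF abelian_group.axioms(1)[OF MM] that] .
  have E1_add: "E1 (C \<oplus>\<^bsub>M0\<^esub> C') \<doteq> E1 C + E1 C'" if "C \<in> carrier M0" "C' \<in> carrier M0" for C C'
    using E1(3)[OF that] E1(1)[OF that(1)] E1(1)[OF that(2)] E1(1)[OF Msum[OF that]] by (simp add: equ_def U_closed)
  \<comment> \<open>This is the balancing condition for the second tensor product.\<close>
  have E1_smult: "restrict_op Y V P \<cdot> E1 C \<doteq> E1 (P \<odot>\<^bsub>N0\<^esub> C)"
    if P: "P \<in> diff_op Y" and C: "C \<in> carrier M0" for P C
    using C unfolding M0_eq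
  proof (induction rule: T1.tensor_induct)
    case (tensor T h)
    then have T: "T \<in> Tr" and h: "h \<in> regular_fun S1" by (simp_all add: TM_simps OM_simps)
    have T': "T \<cdot> adjoint_op Y (FL_hom S2 P) \<in> Tr" by (intro F.transfer_comp_right T Y.adjoint_closed FL_closed P)
    have "restrict_op Y V P \<cdot> E1 (T1.tensor_cls T h) \<doteq> restrict_op Y V P \<cdot> Lam h T"
      by (rule equ_comp[OF UY.restrict_closed[OF P] E1_equ[OF T h]])
    also have "\<dots> \<doteq> Lam h (T \<cdot> adjoint_op Y (FL_hom S2 P))" by (rule equ_sym[OF Lam_FL[OF P h T]])
    also have "\<dots> \<doteq> E1 (T1.tensor_cls (T \<cdot> adjoint_op Y (FL_hom S2 P)) h)" by (rule equ_sym[OF E1_equ[OF T' h]])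
    also have "\<dots> = E1 (P \<odot>\<^bsub>N0\<^esub> T1.tensor_cls T h)" by (simp only: N0_smult[OF P])
    finally show ?case unfolding M0_eq .
  next
    case (add C C')
    then have C: "C \<in> carrier M0" "C' \<in> carrier M0"
      and IH: "restrict_op Y V P \<cdot> E1 C \<doteq> E1 (P \<odot>\<^bsub>N0\<^esub> C)" "restrict_op Y V P \<cdot> E1 C' \<doteq> E1 (P \<odot>\<^bsub>N0\<^esub> C')"
      by (simp_all only: M0_eq[symmetric])
    have PC: "P \<odot>\<^bsub>N0\<^esub> C \<in> carrier M0" "P \<odot>\<^bsub>N0\<^esub> C' \<in> carrier M0"
      using left_moduleD(3)[OF left_module_N0, of P] C P by (simp_all add: N0_simps(1))
    have "restrict_op Y V P \<cdot> E1 (C \<oplus>\<^bsub>M0\<^esub> C') \<doteq> restrict_op Y V P \<cdot> (E1 C + E1 C')"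
      by (rule equ_comp[OF UY.restrict_closed[OF P] E1_add[OF C]])
    also have "\<dots> = restrict_op Y V P \<cdot> E1 C + restrict_op Y V P \<cdot> E1 C'"
      by (rule U.comp_plus_right[OF UY.restrict_closed[OF P] E1(1)[OF C(1)] E1(1)[OF C(2)]])
    also have "\<dots> \<doteq> E1 (P \<odot>\<^bsub>N0\<^esub> C) + E1 (P \<odot>\<^bsub>N0\<^esub> C')" by (rule equ_add[OF IH])
    also have "\<dots> \<doteq> E1 (P \<odot>\<^bsub>N0\<^esub> C \<oplus>\<^bsub>M0\<^esub> P \<odot>\<^bsub>N0\<^esub> C')" by (rule equ_sym[OF E1_add[OF PC]])
    also have "P \<odot>\<^bsub>N0\<^esub> C \<oplus>\<^bsub>M0\<^esub> P \<odot>\<^bsub>N0\<^esub> C' = P \<odot>\<^bsub>N0\<^esub> (C \<oplus>\<^bsub>M0\<^esub> C')"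
      using left_moduleD(6)[OF left_module_N0, of P C C'] C P by (simp add: N0_simps(1,2))
    finally show ?case unfolding M0_eq .
  qed
  obtain E2 where E2: "\<And>Q m. Q \<in> diff_op V \<Longrightarrow> m \<in> carrier M0 \<Longrightarrow> E2 (T2.tensor_cls Q m) - Q \<cdot> E1 m \<in> Iq"
    "E2 \<zero>\<^bsub>NN\<^esub> \<in> Iq"
  proof (rule T2.tensor_eval[OF additive_set_Iq additive_set_diff_op IV, of "\<lambda>Q m. Q \<cdot> E1 m", folded NN_eq], goal_cases)
    case (1 Q m)
    then show ?case by (simp add: N0_simps(1) E1(1) diff_op.comp)
  next
    case (2 Q Q' m)
    then show ?case by (simp add: comp_plus_left Iq_0)
  next
    case (3 Q m m')
    then have "Q \<in> diff_op V" and m: "m \<in> carrier M0" "m' \<in> carrier M0" by (simp_all add: N0_simps(1))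
    then have "Q \<cdot> E1 (m \<oplus>\<^bsub>M0\<^esub> m') \<doteq> Q \<cdot> E1 m + Q \<cdot> E1 m'"
      using equ_comp[OF _ E1_add[OF m], of Q] by (simp add: U.comp_plus_right E1(1))
    then show ?case by (simp add: equ_def N0_simps(2) diff_diff_eq)
  next
    case (4 Q P m)
    then have "Q \<in> diff_op V" "P \<in> diff_op Y" "m \<in> carrier M0" by (simp_all add: N0_simps(1))
    then have "Q \<cdot> (restrict_op Y V P \<cdot> E1 m) \<doteq> Q \<cdot> E1 (P \<odot>\<^bsub>N0\<^esub> m)" by (intro equ_comp E1_smult)
    then show ?case by (simp add: equ_def o_assoc)
  next
    case (5 E)
    show ?case by (rule 5(1)[OF 5(3) 5(5)]) (simp_all add: N0_simps(1))
  qed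
  let ?m = "T1.tensor_cls Fs gen"
  have m: "?m \<in> carrier M0" using tensor1_closed[OF Fs_Tr gen_regular] by (simp add: N0_simps(1))
  have "P \<odot>\<^bsub>NN\<^esub> K gen = T2.tensor_cls P ?m"
    using T2.smult_tensor_cls[of P U.I ?m, folded NN_eq] P by (simp add: J_def)
  then have "P \<cdot> E1 ?m - E2 \<zero>\<^bsub>NN\<^esub> \<in> Iq" using Iq_uminus[OF E2(1)[OF P m]] zero by simp
  then have "P \<cdot> E1 ?m \<in> Iq" using Iq_add[OF _ E2(2)] by fastforce
  moreover have "E1 ?m \<doteq> U.I"
  proof -
    have "E1 ?m \<doteq> Lam gen Fs" by (rule E1_equ[OF Fs_Tr gen_regular])
    also have "\<dots> = psi0 (bs one_S (u0 + 0))"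
      using Lam_pull[OF gen_regular regular_fun_const] by (simp add: Fs_def one1_mult gen_regular) (simp add: gen_def)
    also have "\<dots> \<doteq> Mq one_S \<cdot> Bop 0" by (rule psi0_bs[OF regular_fun_const]) simp
    also have "\<dots> = U.I" by (simp add: Mq_one_S Bop_0 one_diff_op)
    finally show ?thesis .
  qed
  then have "P \<cdot> E1 ?m \<doteq> P \<cdot> U.I" by (rule equ_comp[OF P])
  ultimately show ?thesis using Iq_diff[of "P \<cdot> E1 ?m" "P \<cdot> E1 ?m - P"] by (simp add: equ_def P)
qed

lemma modules_isomorphic:
  "left_modules_isomorphic (D_ring Y) (as_D_module S2 (quantum_module S2 A p d)) (as_D_module S2 (localization Y V N0))"
  unfolding quantum_module_def Dtau_eq Iq_def[symmetric] NN_def[symmetric]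
proof (rule cyclic_module_isomorphic[OF left_module_NN K_gen_closed _ Iq_left_ideal _ Y.ring_D_ring UY.restrict_ring_hom])
  show "\<exists>P\<in>carrier DV. m = P \<odot>\<^bsub>NN\<^esub> K gen" if "m \<in> carrier NN" for m
    using NN_cyclic[OF that] by auto
  show "P \<odot>\<^bsub>NN\<^esub> K gen = \<zero>\<^bsub>NN\<^esub> \<longleftrightarrow> P \<in> Iq" if "P \<in> carrier DV" for P
    using that annihilator_Iq Iq_annihilates by auto
qed

end

theorem corollary3p3:
  fixes \<Sigma> :: "(real ^ 'n::finite) set set"
    and A :: "'m::finite \<Rightarrow> int ^ 'n"
    and p :: "'r::finite \<Rightarrow> int ^ 'm \<Rightarrow> int"
    and d :: "'r \<Rightarrow> int ^ 'm"
    and g :: "'r \<Rightarrow> int ^ 'm"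
  assumes "smooth_projective_toric \<Sigma> A"
    and "weak_Fano \<Sigma> A"
    and "dual_lattice_basis A p"
    and "\<And>k. nef_class \<Sigma> A (p k)"
    and "in_generated_cone A p (anticanonical_class A)"
    and "dual_basis_of A p d"
    and "\<And>k i. g k $ i \<ge> 0"
    and "\<And>j k. (\<Sum>i\<in>UNIV. g j $ i * d k $ i) = (if j = k then 1 else 0)"
    and "\<And>k. divisor_class A (g k) = p k"
  shows "let S1 = S1_nondeg A; S2 = S2_nondeg A g in
         left_modules_isomorphic (D_ring (line_times S2))
           (as_D_module S2 (quantum_module S2 A p d))
           (as_D_module S2
             (localization (line_times S2) (punctured_line_times S2)
               (fourier_laplace S2
                 (direct_image_H0 S1 (line_times S2) (LG_map d) (structure_module S1)))))"
proof -
  interpret lg_model \<Sigma> A p d g by unfold_locales (fact assms)+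
  show ?thesis unfolding Let_def by (rule modules_isomorphic)
qed

end
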